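(* Let $\mathcal{A}$ be a superadditive category over a field $K$ with a finite number of objects, let $\Lambda_{\mathcal{A}}=\bigoplus_{X,Y\in\mathcal{A}}\mathcal{A}(X,Y)$ be the corresponding superalgebra, and let $M$ be a $\mathbb{Z}_2$-graded $\Lambda_{\mathcal{A}}$-bimodule, viewed also as a graded $\mathcal{A}$-bimodule. Then, in every degree and as superspaces (where $=$ means canonically isomorphic): (1) $\mathrm{HH}^*(\mathcal{A},M)=\mathrm{HH}^*(\Lambda_{\mathcal{A}},M)$ and $\mathrm{HH}_*(\mathcal{A},M)=\mathrm{HH}_*(\Lambda_{\mathcal{A}},M)$, where the right-hand sides are the Hochschild cohomology and homology of the superalgebra $\Lambda_{\mathcal{A}}$ with coefficients in $M$; (2) $\mathrm{HC}^*(\mathcal{A})=\mathrm{HC}^*(\Lambda_{\mathcal{A}})$ and $\mathrm{HC}_*(\mathcal{A})=\mathrm{HC}_*(\Lambda_{\mathcal{A}})$, where the right-hand sides are the cyclic cohomology and homology of the superalgebra $\Lambda_{\mathcal{A}}$.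
   Context: $K$ is a field, $\otimes=\otimes_K$. A superspace is a $\mathbb{Z}_2$-graded $K$-vector space $V=V_0\oplus V_1$; $|v|\in\mathbb{Z}_2$ is the degree of a homogeneous $v$; a linear map is even if it preserves the grading. Formulas with signs are stated for homogeneous elements and extended linearly. $\mathrm{Hom}_K(V,W)$ is a superspace, $\mathrm{Hom}_K(V,W)_i$ being the maps with $f(V_j)\subseteq W_{i+j}$. Superadditive category. A small category $\mathcal{A}$ in which each $\mathcal{A}(X,Y)$ is a superspace and composition is $K$-bilinear with $\mathcal{A}(X,Y)_i\cdot\mathcal{A}(Y,Z)_j\subseteq\mathcal{A}(X,Z)_{i+j}$ (existence of direct sums is not required). $\alpha\beta$ means first $\alpha$, then $\beta$. Graded $\mathcal{A}$-bimodule $M$. A family of superspaces $M(X,Y)$ with even, unital, associative, commuting actions $\mathcal{A}(Z,X)\otimes M(X,Y)\to M(Z,Y)$ and $M(X,Y)\otimes\mathcal{A}(Y,Z)\to M(X,Z)$. The standard bimodule is $\mathcal{A}$ itself. Corresponding superalgebra. $\Lambda_{\mathcal{A}}$ has the matrix product induced by composition (products of non-composable morphisms are $0$) and unit $\sum_X 1_X$. A graded $\Lambda_{\mathcal{A}}$-bimodule $M$ is the graded $\mathcal{A}$-bimodule $M(X,Y)=1_XM1_Y$. Hochschild homology. $\mathrm{HH}_*(\mathcal{A},M)$ is the homology of $C_n(\mathcal{A},M)=\bigoplus_{(X_n,\dots,X_0)}M(X_0,X_n)\otimes\mathcal{A}(X_n,X_{n-1})\otimes\cdots\otimes\mathcal{A}(X_1,X_0)$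 with $\partial_n=\sum_{i=0}^n(-1)^id_n^i$, where $d_n^i(a_0\otimes\cdots\otimes a_n)=a_0\otimes\cdots\otimes a_ia_{i+1}\otimes\cdots\otimes a_n$ for $0\le i<n$ and $d_n^n(a_0\otimes\cdots\otimes a_n)=(-1)^{|a_n|(|a_0|+\cdots+|a_{n-1}|)}a_na_0\otimes a_1\otimes\cdots\otimes a_{n-1}$. Hochschild cohomology. $\mathrm{HH}^*(\mathcal{A},M)$ is the cohomology of $C^n(\mathcal{A},M)=\prod_{(X_n,\dots,X_0)}\mathrm{Hom}_K(\mathcal{A}(X_n,X_{n-1})\otimes\cdots\otimes\mathcal{A}(X_1,X_0),M(X_n,X_0))$ (product of superspaces; $C^0=\prod_XM(X,X)$) with $(\partial^n\phi)(a_1,\dots,a_{n+1})=(-1)^{|a_1||\phi|}a_1\phi(a_2,\dots,a_{n+1})+\sum_{i=1}^n(-1)^i\phi(a_1,\dots,a_ia_{i+1},\dots,a_{n+1})+(-1)^{n+1}\phi(a_1,\dots,a_n)a_{n+1}$. Cyclic (co)homology. Put $C_n(\mathcal{A})=C_n(\mathcal{A},\mathcal{A})$, $t_n(a_0,\dots,a_n)=(-1)^{n+|a_n|(|a_0|+\cdots+|a_{n-1}|)}(a_n,a_0,\dots,a_{n-1})$, $N_n=1+t_n+\cdots+t_n^n$, $\bar\partial_n=\sum_{i=0}^{n-1}(-1)^id_n^i$. The cyclic bicomplex $CC_{**}(\mathcal{A})$ has $CC_{pq}=C_q(\mathcal{A})$ for $p,q\ge0$; vertical differentials are $\partial_q$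 for $p$ even and $-\bar\partial_q$ for $p$ odd; horizontal differentials $CC_{pq}\to CC_{p-1,q}$ are $1-t_q$ for $p$ odd and $N_q$ for $p\geq 2$ even. $\mathrm{HC}_n(\mathcal{A})=H_n(\mathrm{Tot}\,CC_{**}(\mathcal{A}))$, and $\mathrm{HC}^n(\mathcal{A})=H^n(\mathrm{Tot}\,CC^{**}(\mathcal{A}))$, where $CC^{**}(\mathcal{A})$ is the $K$-linear dual bicomplex. For a unital superalgebra $\Lambda$, its Hochschild and cyclic (co)homology are those obtained from the same complexes by regarding $\Lambda$ as a superadditive category with one object. *)

theory Defs
  imports
    "HOL.Vector_Spaces"
    "HOL-Library.Z2"
    "HOL-Library.Poly_Mapping"
    "HOL-Library.Function_Algebras"
    "HOL-Library.Set_Algebras"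
begin

section \<open>Superspaces\<close>

text \<open>
  The ground field is an arbitrary type \<^typ>\<open>'k\<close> of class \<^class>\<open>field\<close>. Degrees live in
  \<^typ>\<open>bit\<close>, the integers modulo 2. The data of a category (morphism spaces, bimodules) are
  families \<open>V :: bit \<Rightarrow> 'v set\<close> of homogeneous components inside one ambient vector space. This is
  no restriction: a small family of vector spaces embeds in its direct sum. Members of a family may
  overlap in the ambient space; this carries no meaning.
\<close>

definition superspace :: "('k::field \<Rightarrow> 'v::ab_group_add \<Rightarrow> 'v) \<Rightarrow> (bit \<Rightarrow> 'v set) \<Rightarrow> bool" where
  "superspace s V \<longleftrightarrow> (\<forall>i. module.subspace s (V i)) \<and> V 0 \<inter> V 1 = {0}"

definition total :: "(bit \<Rightarrow> 'v::ab_group_add set) \<Rightarrow> 'v set" where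
  "total V = V 0 + V 1"

definition ksign :: "bit \<Rightarrow> 'k::field" where
  "ksign d = (if d = 0 then 1 else -1)"

definition bilinear_on ::
  "('k \<Rightarrow> 'u::ab_group_add \<Rightarrow> 'u) \<Rightarrow> ('k \<Rightarrow> 'v::ab_group_add \<Rightarrow> 'v) \<Rightarrow> ('k \<Rightarrow> 'w::ab_group_add \<Rightarrow> 'w)
    \<Rightarrow> 'u set \<Rightarrow> 'v set \<Rightarrow> ('u \<Rightarrow> 'v \<Rightarrow> 'w) \<Rightarrow> bool" where
  "bilinear_on s1 s2 s3 U V b \<longleftrightarrow>
     (\<forall>u\<in>U. \<forall>u'\<in>U. \<forall>v\<in>V. b (u + u') v = b u v + b u' v) \<and>
     (\<forall>u\<in>U. \<forall>v\<in>V. \<forall>v'\<in>V. b u (v + v') = b u v + b u v') \<and>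
     (\<forall>c. \<forall>u\<in>U. \<forall>v\<in>V. b (s1 c u) v = s3 c (b u v) \<and> b u (s2 c v) = s3 c (b u v))"

text \<open>
  Tensor products and (co)homology are quotients. A superspace given as a quotient \<open>num / den\<close> has
  the degree \<open>i\<close> component \<open>num i / den i\<close>, whose elements are the cosets in \<open>comp_cosets\<close>; addition
  of cosets is the sum of sets. An even isomorphism of superspaces is an isomorphism in each of the
  two degrees. \<open>induces_iso f V W\<close> says that \<open>v + den V i \<mapsto> f v + den W i\<close> is a well-defined even
  isomorphism: well-definedness is contained in \<open>bij_betw\<close>, because the values have to be
  single cosets.
\<close>

record ('k, 'v) sspace =
  scl :: "'k \<Rightarrow> 'v \<Rightarrow> 'v"
  num :: "bit \<Rightarrow> 'v set"
  den :: "bit \<Rightarrow> 'v set"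

definition comp_cosets :: "('k, 'v::ab_group_add) sspace \<Rightarrow> bit \<Rightarrow> 'v set set" where
  "comp_cosets V i = (\<lambda>v. v +o den V i) ` num V i"

definition coset_scl :: "('k, 'v::ab_group_add) sspace \<Rightarrow> bit \<Rightarrow> 'k \<Rightarrow> 'v set \<Rightarrow> 'v set" where
  "coset_scl V i c C = scl V c ` C + den V i"

definition coset_map ::
  "('v \<Rightarrow> 'w) \<Rightarrow> ('k, 'w::ab_group_add) sspace \<Rightarrow> bit \<Rightarrow> 'v set \<Rightarrow> 'w set" where
  "coset_map f W i C = f ` C + den W i"

definition induces_iso ::
  "('v::ab_group_add \<Rightarrow> 'w::ab_group_add) \<Rightarrow> ('k, 'v) sspace \<Rightarrow> ('k, 'w) sspace \<Rightarrow> bool" where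
  "induces_iso f V W \<longleftrightarrow> (\<forall>i.
     bij_betw (coset_map f W i) (comp_cosets V i) (comp_cosets W i) \<and>
     (\<forall>C\<in>comp_cosets V i. \<forall>D\<in>comp_cosets V i.
        coset_map f W i (C + D) = coset_map f W i C + coset_map f W i D) \<and>
     (\<forall>c. \<forall>C\<in>comp_cosets V i.
        coset_map f W i (coset_scl V i c C) = coset_scl W i c (coset_map f W i C)))"

text \<open>Products of superspaces. For finite \<open>I\<close> this is also the direct sum.\<close>

definition prod_sspace ::
  "('k \<Rightarrow> 'v::ab_group_add \<Rightarrow> 'v) \<Rightarrow> 'i set \<Rightarrow> ('i \<Rightarrow> ('k, 'v) sspace) \<Rightarrow> ('k, 'i \<Rightarrow> 'v) sspace" where
  "prod_sspace s I V =
     \<lparr> scl = (\<lambda>c x p. s c (x p)),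
       num = (\<lambda>i. {x. (\<forall>p\<in>I. x p \<in> num (V p) i) \<and> (\<forall>p. p \<notin> I \<longrightarrow> x p = 0)}),
       den = (\<lambda>i. {x. (\<forall>p\<in>I. x p \<in> den (V p) i) \<and> (\<forall>p. p \<notin> I \<longrightarrow> x p = 0)}) \<rparr>"

text \<open>
  \<open>Hom_K(T, W)\<close> for a quotient \<open>T\<close>: linear maps that vanish on \<open>den T\<close>. Maps are
  defined on the whole ambient space of \<open>T\<close>, so those vanishing on \<open>num T\<close> are divided out.
\<close>

definition hom_sspace ::
  "('k::field, 'v::ab_group_add) sspace \<Rightarrow> ('k \<Rightarrow> 'w::ab_group_add \<Rightarrow> 'w) \<Rightarrow> (bit \<Rightarrow> 'w set)
    \<Rightarrow> ('k, 'v \<Rightarrow> 'w) sspace" where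
  "hom_sspace T s W =
     \<lparr> scl = (\<lambda>c f x. s c (f x)),
       num = (\<lambda>i. {f. Vector_Spaces.linear (scl T) s f \<and>
                      (\<forall>j. f ` num T j \<subseteq> W (i + j)) \<and> (\<forall>j. f ` den T j \<subseteq> {0})}),
       den = (\<lambda>i. {f. Vector_Spaces.linear (scl T) s f \<and> (\<forall>j. f ` num T j \<subseteq> {0})}) \<rparr>"

text \<open>The ground field, concentrated in degree 0.\<close>

definition ground :: "bit \<Rightarrow> 'k::field set" where
  "ground i = (if i = 0 then UNIV else {0})"

text \<open>
  (Co)homology of a complex \<open>C\<close>, zero in negative degrees. The differentials are given on
  representatives, so \<open>d z\<close> is zero in the quotient iff it lies in \<open>den\<close>. The cochain differential
  may depend on the superdegree of its argument.
\<close>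

definition homology ::
  "(nat \<Rightarrow> ('k, 'v::ab_group_add) sspace) \<Rightarrow> (nat \<Rightarrow> 'v \<Rightarrow> 'v) \<Rightarrow> nat \<Rightarrow> ('k, 'v) sspace" where
  "homology C d n =
     \<lparr> scl = scl (C n),
       num = (\<lambda>i. {z \<in> num (C n) i. n = 0 \<or> d n z \<in> den (C (n - 1)) i}),
       den = (\<lambda>i. d (Suc n) ` num (C (Suc n)) i + den (C n) i) \<rparr>"

definition cohomology ::
  "(nat \<Rightarrow> ('k, 'v::ab_group_add) sspace) \<Rightarrow> (nat \<Rightarrow> bit \<Rightarrow> 'v \<Rightarrow> 'v) \<Rightarrow> nat \<Rightarrow> ('k, 'v) sspace" where
  "cohomology C d n =
     \<lparr> scl = scl (C n),
       num = (\<lambda>i. {z \<in> num (C n) i. d n i z \<in> den (C (Suc n)) i}),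
       den = (\<lambda>i. (if n = 0 then {0} else d (n - 1) i ` num (C (n - 1)) i) + den (C n) i) \<rparr>"

section \<open>Free spaces and multilinearity relations\<close>

text \<open>The free vector space on a type \<^typ>\<open>'g\<close> is \<^typ>\<open>'g \<Rightarrow>\<^sub>0 'k\<close>.\<close>

definition pscale :: "'k::field \<Rightarrow> ('g \<Rightarrow>\<^sub>0 'k) \<Rightarrow> ('g \<Rightarrow>\<^sub>0 'k)" where
  "pscale c x = Poly_Mapping.map ((*) c) x"

abbreviation basis :: "'g \<Rightarrow> ('g \<Rightarrow>\<^sub>0 'k::field)" where
  "basis g \<equiv> Poly_Mapping.single g 1"

text \<open>Linear extension of a map given on the basis.\<close>

definition lext :: "('k::field \<Rightarrow> 'w::ab_group_add \<Rightarrow> 'w) \<Rightarrow> ('g \<Rightarrow> 'w) \<Rightarrow> ('g \<Rightarrow>\<^sub>0 'k) \<Rightarrow> 'w" where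
  "lext s h x = (\<Sum>g\<in>Poly_Mapping.keys x. s (Poly_Mapping.lookup x g) (h g))"

text \<open>
  Relations expressing linearity in one tensor factor \<open>V\<close>; \<open>ins v\<close> is the generator with \<open>v\<close>
  inserted in that slot.
\<close>

definition slot_relators ::
  "('k::field \<Rightarrow> 'v::ab_group_add \<Rightarrow> 'v) \<Rightarrow> 'v set \<Rightarrow> ('v \<Rightarrow> 'g) \<Rightarrow> ('g \<Rightarrow>\<^sub>0 'k) set" where
  "slot_relators s V ins =
     {basis (ins (u + v)) - basis (ins u) - basis (ins v) | u v. u \<in> V \<and> v \<in> V} \<union>
     {basis (ins (s c v)) - pscale c (basis (ins v)) | c v. v \<in> V}"

section \<open>Superadditive categories and graded bimodules\<close>

text \<open>
  \<open>Comp X Y Z a b\<close> is the composite of \<open>a : X \<rightarrow> Y\<close> followed by \<open>b : Y \<rightarrow> Z\<close>. It takes the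
  objects as arguments because the morphism spaces are allowed to overlap.
\<close>

record ('k, 'o, 'a) scat =
  Scale :: "'k \<Rightarrow> 'a \<Rightarrow> 'a"
  Obj :: "'o set"
  Mor :: "'o \<Rightarrow> 'o \<Rightarrow> bit \<Rightarrow> 'a set"
  Comp :: "'o \<Rightarrow> 'o \<Rightarrow> 'o \<Rightarrow> 'a \<Rightarrow> 'a \<Rightarrow> 'a"
  Idn :: "'o \<Rightarrow> 'a"

locale superadditive_category =
  fixes A :: "('k::field, 'o, 'a::ab_group_add) scat"
  assumes vector_space: "vector_space (Scale A)"
    and superspace_Mor: "\<lbrakk>X \<in> Obj A; Y \<in> Obj A\<rbrakk> \<Longrightarrow> superspace (Scale A) (Mor A X Y)"
    and Comp_degree: "\<lbrakk>X \<in> Obj A; Y \<in> Obj A; Z \<in> Obj A; a \<in> Mor A X Y i; b \<in> Mor A Y Z j\<rbrakk>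
      \<Longrightarrow> Comp A X Y Z a b \<in> Mor A X Z (i + j)"
    and Comp_bilinear: "\<lbrakk>X \<in> Obj A; Y \<in> Obj A; Z \<in> Obj A\<rbrakk>
      \<Longrightarrow> bilinear_on (Scale A) (Scale A) (Scale A)
            (total (Mor A X Y)) (total (Mor A Y Z)) (Comp A X Y Z)"
    and Comp_assoc: "\<lbrakk>W \<in> Obj A; X \<in> Obj A; Y \<in> Obj A; Z \<in> Obj A;
        a \<in> total (Mor A W X); b \<in> total (Mor A X Y); c \<in> total (Mor A Y Z)\<rbrakk>
      \<Longrightarrow> Comp A W Y Z (Comp A W X Y a b) c = Comp A W X Z a (Comp A X Y Z b c)"
    and Idn_Mor: "X \<in> Obj A \<Longrightarrow> Idn A X \<in> total (Mor A X X)"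
    and Idn_left: "\<lbrakk>X \<in> Obj A; Y \<in> Obj A; a \<in> total (Mor A X Y)\<rbrakk>
      \<Longrightarrow> Comp A X X Y (Idn A X) a = a"
    and Idn_right: "\<lbrakk>X \<in> Obj A; Y \<in> Obj A; a \<in> total (Mor A X Y)\<rbrakk>
      \<Longrightarrow> Comp A X Y Y a (Idn A Y) = a"

text \<open>
  \<open>LAct Z X Y\<close> is the action \<open>A(Z,X) \<otimes> M(X,Y) \<rightarrow> M(Z,Y)\<close> and \<open>RAct X Y Z\<close> the action
  \<open>M(X,Y) \<otimes> A(Y,Z) \<rightarrow> M(X,Z)\<close>.
\<close>

record ('k, 'o, 'a, 'm) sbimod =
  MScale :: "'k \<Rightarrow> 'm \<Rightarrow> 'm"
  Bim :: "'o \<Rightarrow> 'o \<Rightarrow> bit \<Rightarrow> 'm set"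
  LAct :: "'o \<Rightarrow> 'o \<Rightarrow> 'o \<Rightarrow> 'a \<Rightarrow> 'm \<Rightarrow> 'm"
  RAct :: "'o \<Rightarrow> 'o \<Rightarrow> 'o \<Rightarrow> 'm \<Rightarrow> 'a \<Rightarrow> 'm"

locale graded_bimodule =
  fixes A :: "('k::field, 'o, 'a::ab_group_add) scat"
    and M :: "('k, 'o, 'a, 'm::ab_group_add) sbimod"
  assumes vector_space: "vector_space (MScale M)"
    and superspace_Bim: "\<lbrakk>X \<in> Obj A; Y \<in> Obj A\<rbrakk> \<Longrightarrow> superspace (MScale M) (Bim M X Y)"
    and LAct_degree: "\<lbrakk>X \<in> Obj A; Y \<in> Obj A; Z \<in> Obj A; a \<in> Mor A Z X i; m \<in> Bim M X Y j\<rbrakk>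
      \<Longrightarrow> LAct M Z X Y a m \<in> Bim M Z Y (i + j)"
    and RAct_degree: "\<lbrakk>X \<in> Obj A; Y \<in> Obj A; Z \<in> Obj A; m \<in> Bim M X Y i; a \<in> Mor A Y Z j\<rbrakk>
      \<Longrightarrow> RAct M X Y Z m a \<in> Bim M X Z (i + j)"
    and LAct_bilinear: "\<lbrakk>X \<in> Obj A; Y \<in> Obj A; Z \<in> Obj A\<rbrakk>
      \<Longrightarrow> bilinear_on (Scale A) (MScale M) (MScale M)
            (total (Mor A Z X)) (total (Bim M X Y)) (LAct M Z X Y)"
    and RAct_bilinear: "\<lbrakk>X \<in> Obj A; Y \<in> Obj A; Z \<in> Obj A\<rbrakk>
      \<Longrightarrow> bilinear_on (MScale M) (Scale A) (MScale M)
            (total (Bim M X Y)) (total (Mor A Y Z)) (RAct M X Y Z)"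
    and LAct_unit: "\<lbrakk>X \<in> Obj A; Y \<in> Obj A; m \<in> total (Bim M X Y)\<rbrakk>
      \<Longrightarrow> LAct M X X Y (Idn A X) m = m"
    and RAct_unit: "\<lbrakk>X \<in> Obj A; Y \<in> Obj A; m \<in> total (Bim M X Y)\<rbrakk>
      \<Longrightarrow> RAct M X Y Y m (Idn A Y) = m"
    and LAct_assoc: "\<lbrakk>W \<in> Obj A; Z \<in> Obj A; X \<in> Obj A; Y \<in> Obj A;
        a \<in> total (Mor A W Z); b \<in> total (Mor A Z X); m \<in> total (Bim M X Y)\<rbrakk>
      \<Longrightarrow> LAct M W X Y (Comp A W Z X a b) m = LAct M W Z Y a (LAct M Z X Y b m)"
    and RAct_assoc: "\<lbrakk>X \<in> Obj A; Y \<in> Obj A; Z \<in> Obj A; W \<in> Obj A;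
        m \<in> total (Bim M X Y); a \<in> total (Mor A Y Z); b \<in> total (Mor A Z W)\<rbrakk>
      \<Longrightarrow> RAct M X Z W (RAct M X Y Z m a) b = RAct M X Y W m (Comp A Y Z W a b)"
    and acts_commute: "\<lbrakk>Z \<in> Obj A; X \<in> Obj A; Y \<in> Obj A; W \<in> Obj A;
        a \<in> total (Mor A Z X); m \<in> total (Bim M X Y); b \<in> total (Mor A Y W)\<rbrakk>
      \<Longrightarrow> RAct M Z Y W (LAct M Z X Y a m) b = LAct M Z X W a (RAct M X Y W m b)"

definition std_bimod :: "('k, 'o, 'a) scat \<Rightarrow> ('k, 'o, 'a, 'a) sbimod" where
  "std_bimod A = \<lparr> MScale = Scale A, Bim = Mor A, LAct = Comp A, RAct = Comp A \<rparr>"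

text \<open>
  The superalgebra of a category with finitely many objects, as a category with the single object
  \<^term>\<open>()\<close>. Its elements are matrices of morphisms.
\<close>

definition superalgebra ::
  "('k::field, 'o, 'a::ab_group_add) scat \<Rightarrow> ('k, unit, 'o \<Rightarrow> 'o \<Rightarrow> 'a) scat" where
  "superalgebra A =
     \<lparr> Scale = (\<lambda>c f X Y. Scale A c (f X Y)),
       Obj = {()},
       Mor = (\<lambda>_ _ i. {f. \<forall>X Y. if X \<in> Obj A \<and> Y \<in> Obj A then f X Y \<in> Mor A X Y i else f X Y = 0}),
       Comp = (\<lambda>_ _ _ f g X Z. if X \<in> Obj A \<and> Z \<in> Obj A
                 then \<Sum>Y\<in>Obj A. Comp A X Y Z (f X Y) (g Y Z) else 0),
       Idn = (\<lambda>_ X Y. if X \<in> Obj A \<and> X = Y then Idn A X else 0) \<rparr>"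

definition munit :: "'o \<Rightarrow> 'o \<Rightarrow> 'a::ab_group_add \<Rightarrow> 'o \<Rightarrow> 'o \<Rightarrow> 'a" where
  "munit X Y a = (\<lambda>X' Y'. if X' = X \<and> Y' = Y then a else 0)"

text \<open>The element \<open>1\<^sub>X m 1\<^sub>Y\<close> of a bimodule \<open>M\<close> over the superalgebra.\<close>

definition corner ::
  "('k::field, 'o, 'a::ab_group_add) scat \<Rightarrow> ('k, unit, 'o \<Rightarrow> 'o \<Rightarrow> 'a, 'm) sbimod
    \<Rightarrow> 'o \<Rightarrow> 'o \<Rightarrow> 'm \<Rightarrow> 'm" where
  "corner A M X Y m =
     LAct M () () () (munit X X (Idn A X)) (RAct M () () () m (munit Y Y (Idn A Y)))"

definition cat_bimod ::
  "('k::field, 'o, 'a::ab_group_add) scat \<Rightarrow> ('k, unit, 'o \<Rightarrow> 'o \<Rightarrow> 'a, 'm) sbimod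
    \<Rightarrow> ('k, 'o, 'a, 'm) sbimod" where
  "cat_bimod A M =
     \<lparr> MScale = MScale M,
       Bim = (\<lambda>X Y i. corner A M X Y ` Bim M () () i),
       LAct = (\<lambda>Z X Y a m. LAct M () () () (munit Z X a) m),
       RAct = (\<lambda>X Y Z m a. RAct M () () () m (munit Y Z a)) \<rparr>"

section \<open>Hochschild homology and cohomology\<close>

text \<open>
  An object tuple \<open>(X\<^sub>n, \<dots>, X\<^sub>0)\<close> is the list \<open>ys\<close> with \<open>ys ! k = X\<^sub>n\<^sub>-\<^sub>k\<close>. Elements
  \<open>a\<^sub>1, \<dots>, a\<^sub>n\<close> with \<open>a\<^sub>k\<close> in \<open>A(X\<^sub>n\<^sub>-\<^sub>k\<^sub>+\<^sub>1, X\<^sub>n\<^sub>-\<^sub>k)\<close> form the list \<open>xs\<close>, where \<open>a\<^sub>k\<close> is entry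
  \<open>k - 1\<close>. All entries are homogeneous and stored with their degree (the zero element has both
  degrees; generators with an entry 0 vanish in the quotient by the multilinearity relations). Since
  the degree \<open>i\<close> part of a tensor product of superspaces is the direct sum of the tensor products of
  homogeneous components of total degree \<open>i\<close>, the quotients below are the tensor products.
\<close>

definition obj_tuples :: "('k, 'o, 'a) scat \<Rightarrow> nat \<Rightarrow> 'o list set" where
  "obj_tuples A n = {ys. length ys = Suc n \<and> set ys \<subseteq> Obj A}"

definition arrow_tuples :: "('k, 'o, 'a) scat \<Rightarrow> 'o list \<Rightarrow> (bit \<times> 'a) list set" where
  "arrow_tuples A ys = {xs. Suc (length xs) = length ys \<and>
     (\<forall>k<length xs. snd (xs ! k) \<in> Mor A (ys ! k) (ys ! Suc k) (fst (xs ! k)))}"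

abbreviation degsum :: "(bit \<times> 'a) list \<Rightarrow> bit" where
  "degsum xs \<equiv> sum_list (map fst xs)"

text \<open>\<open>A(X\<^sub>n, X\<^sub>n\<^sub>-\<^sub>1) \<otimes> \<dots> \<otimes> A(X\<^sub>1, X\<^sub>0)\<close>; for \<open>n = 0\<close> this is the ground field, with basis \<open>[]\<close>.\<close>

definition arrow_tensor ::
  "('k::field, 'o, 'a::ab_group_add) scat \<Rightarrow> 'o list \<Rightarrow> ('k, (bit \<times> 'a) list \<Rightarrow>\<^sub>0 'k) sspace" where
  "arrow_tensor A ys =
     \<lparr> scl = pscale,
       num = (\<lambda>i. {x. Poly_Mapping.keys x \<subseteq> {xs \<in> arrow_tuples A ys. degsum xs = i}}),
       den = (\<lambda>i. module.span pscale
         (\<Union>xs\<in>{xs \<in> arrow_tuples A ys. degsum xs = i}. \<Union>k<length xs.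
            slot_relators (Scale A) (Mor A (ys ! k) (ys ! Suc k) (fst (xs ! k)))
              (\<lambda>a. xs[k := (fst (xs ! k), a)]))) \<rparr>"

text \<open>
  A generator \<open>(ys, (d, m), xs)\<close> of the Hochschild chains has \<open>a\<^sub>0 = m\<close> in \<open>M(X\<^sub>0, X\<^sub>n)\<close>. The direct
  sum over the object tuples is obtained by recording \<open>ys\<close> in the generators.
\<close>

type_synonym ('o, 'a, 'm) htuple = "'o list \<times> (bit \<times> 'm) \<times> (bit \<times> 'a) list"

definition hgens ::
  "('k, 'o, 'a) scat \<Rightarrow> ('k, 'o, 'a, 'm) sbimod \<Rightarrow> nat \<Rightarrow> bit \<Rightarrow> ('o, 'a, 'm) htuple set" where
  "hgens A M n i = {(ys, (d, m), xs) | ys d m xs.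
     ys \<in> obj_tuples A n \<and> m \<in> Bim M (last ys) (hd ys) d \<and> xs \<in> arrow_tuples A ys \<and>
     d + degsum xs = i}"

definition hchains ::
  "('k::field, 'o, 'a::ab_group_add) scat \<Rightarrow> ('k, 'o, 'a, 'm::ab_group_add) sbimod \<Rightarrow> nat
    \<Rightarrow> ('k, ('o, 'a, 'm) htuple \<Rightarrow>\<^sub>0 'k) sspace" where
  "hchains A M n =
     \<lparr> scl = pscale,
       num = (\<lambda>i. {x. Poly_Mapping.keys x \<subseteq> hgens A M n i}),
       den = (\<lambda>i. module.span pscale
         (\<Union>(ys, (d, m), xs)\<in>hgens A M n i.
            slot_relators (MScale M) (Bim M (last ys) (hd ys) d) (\<lambda>u. (ys, (d, u), xs)) \<union>
            (\<Union>k<length xs.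
               slot_relators (Scale A) (Mor A (ys ! k) (ys ! Suc k) (fst (xs ! k)))
                 (\<lambda>a. (ys, (d, m), xs[k := (fst (xs ! k), a)]))))) \<rparr>"

definition remove_nth :: "nat \<Rightarrow> 'b list \<Rightarrow> 'b list" where
  "remove_nth k ys = take k ys @ drop (Suc k) ys"

text \<open>Replaces \<open>a\<^sub>i, a\<^sub>i\<^sub>+\<^sub>1\<close> by \<open>a\<^sub>i a\<^sub>i\<^sub>+\<^sub>1\<close> (\<open>1 \<le> i < length xs\<close>); the object \<open>ys ! i\<close> between them disappears.\<close>

definition contract ::
  "('k, 'o, 'a) scat \<Rightarrow> 'o list \<Rightarrow> nat \<Rightarrow> (bit \<times> 'a) list \<Rightarrow> (bit \<times> 'a) list" where
  "contract A ys i xs = take (i - 1) xs @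
     (fst (xs ! (i - 1)) + fst (xs ! i),
      Comp A (ys ! (i - 1)) (ys ! i) (ys ! (i + 1)) (snd (xs ! (i - 1))) (snd (xs ! i)))
     # drop (i + 1) xs"

definition hface ::
  "('k::field, 'o, 'a) scat \<Rightarrow> ('k, 'o, 'a, 'm) sbimod \<Rightarrow> nat \<Rightarrow> nat
    \<Rightarrow> ('o, 'a, 'm) htuple \<Rightarrow> (('o, 'a, 'm) htuple \<Rightarrow>\<^sub>0 'k)" where
  "hface A M n i = (\<lambda>(ys, (d, m), xs).
     if i < n then
       (if i = 0 then
          basis (tl ys,
            (d + fst (hd xs), RAct M (last ys) (ys ! 0) (ys ! 1) m (snd (hd xs))),
            tl xs)
        else basis (remove_nth i ys, (d, m), contract A ys i xs))
     else
       pscale (ksign (fst (last xs) * (d + degsum (butlast xs))))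
         (basis (butlast ys,
            (fst (last xs) + d, LAct M (ys ! (n - 1)) (ys ! n) (ys ! 0) (snd (last xs)) m),
            butlast xs)))"

definition hboundary ::
  "('k::field, 'o, 'a) scat \<Rightarrow> ('k, 'o, 'a, 'm) sbimod \<Rightarrow> nat
    \<Rightarrow> (('o, 'a, 'm) htuple \<Rightarrow>\<^sub>0 'k) \<Rightarrow> (('o, 'a, 'm) htuple \<Rightarrow>\<^sub>0 'k)" where
  "hboundary A M n = lext pscale (\<lambda>g. \<Sum>i\<le>n. pscale ((-1) ^ i) (hface A M n i g))"

definition HH_hom ::
  "('k::field, 'o, 'a::ab_group_add) scat \<Rightarrow> ('k, 'o, 'a, 'm::ab_group_add) sbimod \<Rightarrow> nat
    \<Rightarrow> ('k, ('o, 'a, 'm) htuple \<Rightarrow>\<^sub>0 'k) sspace" where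
  "HH_hom A M = homology (hchains A M) (hboundary A M)"

text \<open>
  For \<open>n = 0\<close> the factor at \<open>[X]\<close> is \<open>Hom_K(K, M(X,X))\<close>, that is \<open>M(X,X)\<close>.
\<close>

definition hcochains ::
  "('k::field, 'o, 'a::ab_group_add) scat \<Rightarrow> ('k, 'o, 'a, 'm::ab_group_add) sbimod \<Rightarrow> nat
    \<Rightarrow> ('k, 'o list \<Rightarrow> ((bit \<times> 'a) list \<Rightarrow>\<^sub>0 'k) \<Rightarrow> 'm) sspace" where
  "hcochains A M n = prod_sspace (\<lambda>c f x. MScale M c (f x)) (obj_tuples A n)
     (\<lambda>ys. hom_sspace (arrow_tensor A ys) (MScale M) (Bim M (hd ys) (last ys)))"

text \<open>The differential on cochains of superdegree \<open>j\<close>.\<close>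

definition hcoboundary ::
  "('k::field, 'o, 'a::ab_group_add) scat \<Rightarrow> ('k, 'o, 'a, 'm::ab_group_add) sbimod \<Rightarrow> nat \<Rightarrow> bit
    \<Rightarrow> ('o list \<Rightarrow> ((bit \<times> 'a) list \<Rightarrow>\<^sub>0 'k) \<Rightarrow> 'm)
    \<Rightarrow> ('o list \<Rightarrow> ((bit \<times> 'a) list \<Rightarrow>\<^sub>0 'k) \<Rightarrow> 'm)" where
  "hcoboundary A M n j \<phi> = (\<lambda>ys. if ys \<in> obj_tuples A (Suc n) then
     lext (MScale M) (\<lambda>xs.
       MScale M (ksign (fst (hd xs) * j))
         (LAct M (ys ! 0) (ys ! 1) (last ys) (snd (hd xs)) (\<phi> (tl ys) (basis (tl xs)))) +
       (\<Sum>i=1..n. MScale M ((-1) ^ i) (\<phi> (remove_nth i ys) (basis (contract A ys i xs)))) +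
       MScale M ((-1) ^ Suc n)
         (RAct M (ys ! 0) (ys ! n) (ys ! Suc n) (\<phi> (butlast ys) (basis (butlast xs))) (snd (last xs))))
     else 0)"

definition HH_coh ::
  "('k::field, 'o, 'a::ab_group_add) scat \<Rightarrow> ('k, 'o, 'a, 'm::ab_group_add) sbimod \<Rightarrow> nat
    \<Rightarrow> ('k, 'o list \<Rightarrow> ((bit \<times> 'a) list \<Rightarrow>\<^sub>0 'k) \<Rightarrow> 'm) sspace" where
  "HH_coh A M = cohomology (hcochains A M) (hcoboundary A M)"

section \<open>Cyclic homology and cohomology\<close>

abbreviation cchains ::
  "('k::field, 'o, 'a::ab_group_add) scat \<Rightarrow> nat \<Rightarrow> ('k, ('o, 'a, 'a) htuple \<Rightarrow>\<^sub>0 'k) sspace" where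
  "cchains A \<equiv> hchains A (std_bimod A)"

definition bar_boundary ::
  "('k::field, 'o, 'a) scat \<Rightarrow> nat \<Rightarrow> (('o, 'a, 'a) htuple \<Rightarrow>\<^sub>0 'k) \<Rightarrow> (('o, 'a, 'a) htuple \<Rightarrow>\<^sub>0 'k)" where
  "bar_boundary A n = lext pscale (\<lambda>g. \<Sum>i<n. pscale ((-1) ^ i) (hface A (std_bimod A) n i g))"

definition cyc :: "nat \<Rightarrow> (('o, 'a, 'a) htuple \<Rightarrow>\<^sub>0 'k::field) \<Rightarrow> (('o, 'a, 'a) htuple \<Rightarrow>\<^sub>0 'k)" where
  "cyc n = lext pscale (\<lambda>(ys, a0, xs). let as = a0 # xs in
     pscale ((-1) ^ n * ksign (fst (last as) * degsum (butlast as)))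
       (basis (last ys # butlast ys, last as, butlast as)))"

definition cyc_norm :: "nat \<Rightarrow> (('o, 'a, 'a) htuple \<Rightarrow>\<^sub>0 'k::field) \<Rightarrow> (('o, 'a, 'a) htuple \<Rightarrow>\<^sub>0 'k)" where
  "cyc_norm n x = (\<Sum>k\<le>n. (cyc n ^^ k) x)"

text \<open>The differentials \<open>CC\<^sub>p\<^sub>,\<^sub>q \<rightarrow> CC\<^sub>p\<^sub>,\<^sub>q\<^sub>-\<^sub>1\<close> and \<open>CC\<^sub>p\<^sub>,\<^sub>q \<rightarrow> CC\<^sub>p\<^sub>-\<^sub>1\<^sub>,\<^sub>q\<close> of the cyclic bicomplex.\<close>

definition cc_vert ::
  "('k::field, 'o, 'a) scat \<Rightarrow> nat \<Rightarrow> nat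
    \<Rightarrow> (('o, 'a, 'a) htuple \<Rightarrow>\<^sub>0 'k) \<Rightarrow> (('o, 'a, 'a) htuple \<Rightarrow>\<^sub>0 'k)" where
  "cc_vert A p q x = (if even p then hboundary A (std_bimod A) q x else - bar_boundary A q x)"

definition cc_horiz ::
  "nat \<Rightarrow> nat \<Rightarrow> (('o, 'a, 'a) htuple \<Rightarrow>\<^sub>0 'k::field) \<Rightarrow> (('o, 'a, 'a) htuple \<Rightarrow>\<^sub>0 'k)" where
  "cc_horiz p q x = (if odd p then x - cyc q x else cyc_norm q x)"

text \<open>Total complex; the component \<open>p\<close> of an element of \<open>Tot\<^sub>n\<close> lies in \<open>CC\<^sub>p\<^sub>,\<^sub>n\<^sub>-\<^sub>p\<close>.\<close>

definition tot_chains ::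
  "('k::field, 'o, 'a::ab_group_add) scat \<Rightarrow> nat
    \<Rightarrow> ('k, nat \<Rightarrow> (('o, 'a, 'a) htuple \<Rightarrow>\<^sub>0 'k)) sspace" where
  "tot_chains A n = prod_sspace pscale {..n} (\<lambda>p. cchains A (n - p))"

definition tot_boundary ::
  "('k::field, 'o, 'a) scat \<Rightarrow> nat
    \<Rightarrow> (nat \<Rightarrow> (('o, 'a, 'a) htuple \<Rightarrow>\<^sub>0 'k)) \<Rightarrow> (nat \<Rightarrow> (('o, 'a, 'a) htuple \<Rightarrow>\<^sub>0 'k))" where
  "tot_boundary A n x = (\<lambda>p. if p < n
     then cc_vert A p (n - p) (x p) + cc_horiz (Suc p) (n - Suc p) (x (Suc p)) else 0)"

definition HC_hom ::
  "('k::field, 'o, 'a::ab_group_add) scat \<Rightarrow> nat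
    \<Rightarrow> ('k, nat \<Rightarrow> (('o, 'a, 'a) htuple \<Rightarrow>\<^sub>0 'k)) sspace" where
  "HC_hom A = homology (tot_chains A) (tot_boundary A)"

text \<open>The dual bicomplex has \<open>Hom_K(CC\<^sub>p\<^sub>,\<^sub>q, K)\<close> in position \<open>(p, q)\<close> and the transposed differentials.\<close>

definition tot_cochains ::
  "('k::field, 'o, 'a::ab_group_add) scat \<Rightarrow> nat
    \<Rightarrow> ('k, nat \<Rightarrow> (('o, 'a, 'a) htuple \<Rightarrow>\<^sub>0 'k) \<Rightarrow> 'k) sspace" where
  "tot_cochains A n = prod_sspace (\<lambda>c f x. c * f x) {..n}
     (\<lambda>p. hom_sspace (cchains A (n - p)) (*) ground)"

definition tot_coboundary ::
  "('k::field, 'o, 'a::ab_group_add) scat \<Rightarrow> nat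
    \<Rightarrow> (nat \<Rightarrow> (('o, 'a, 'a) htuple \<Rightarrow>\<^sub>0 'k) \<Rightarrow> 'k) \<Rightarrow> (nat \<Rightarrow> (('o, 'a, 'a) htuple \<Rightarrow>\<^sub>0 'k) \<Rightarrow> 'k)" where
  "tot_coboundary A n f = (\<lambda>p.
     (if p \<le> n then f p \<circ> cc_vert A p (Suc n - p) else 0) +
     (if 1 \<le> p \<and> p \<le> Suc n then f (p - 1) \<circ> cc_horiz p (Suc n - p) else 0))"

definition HC_coh ::
  "('k::field, 'o, 'a::ab_group_add) scat \<Rightarrow> nat
    \<Rightarrow> ('k, nat \<Rightarrow> (('o, 'a, 'a) htuple \<Rightarrow>\<^sub>0 'k) \<Rightarrow> 'k) sspace" where
  "HC_coh A = cohomology (tot_cochains A) (\<lambda>n _. tot_coboundary A n)"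

section \<open>The canonical maps\<close>

text \<open>
  Morphisms are regarded as elements of the superalgebra through the matrix units. On chains this
  gives the inclusion of the (cyclically) composable tensors into all tensors over the superalgebra;
  the cochain maps are the corresponding restrictions, for Hochschild cochains followed by the
  projections \<open>m \<mapsto> 1\<^sub>X m 1\<^sub>Y\<close> from \<open>M\<close> to \<open>M(X,Y)\<close>.
\<close>

definition unit_arrows ::
  "'o list \<Rightarrow> (bit \<times> 'a::ab_group_add) list \<Rightarrow> (bit \<times> ('o \<Rightarrow> 'o \<Rightarrow> 'a)) list" where
  "unit_arrows ys xs =
     map (\<lambda>k. (fst (xs ! k), munit (ys ! k) (ys ! Suc k) (snd (xs ! k)))) [0..<length xs]"

definition HH_incl ::
  "(('o, 'a::ab_group_add, 'm) htuple \<Rightarrow>\<^sub>0 'k::field)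
    \<Rightarrow> ((unit, 'o \<Rightarrow> 'o \<Rightarrow> 'a, 'm) htuple \<Rightarrow>\<^sub>0 'k)" where
  "HH_incl = lext pscale (\<lambda>(ys, (d, m), xs).
     basis (map (\<lambda>_. ()) ys, (d, m), unit_arrows ys xs))"

definition HH_restr ::
  "('k::field, 'o, 'a::ab_group_add) scat
    \<Rightarrow> ('k, unit, 'o \<Rightarrow> 'o \<Rightarrow> 'a, 'm::ab_group_add) sbimod \<Rightarrow> nat
    \<Rightarrow> (unit list \<Rightarrow> ((bit \<times> ('o \<Rightarrow> 'o \<Rightarrow> 'a)) list \<Rightarrow>\<^sub>0 'k) \<Rightarrow> 'm)
    \<Rightarrow> ('o list \<Rightarrow> ((bit \<times> 'a) list \<Rightarrow>\<^sub>0 'k) \<Rightarrow> 'm)" where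
  "HH_restr A M n \<phi> = (\<lambda>ys. if ys \<in> obj_tuples A n then
     lext (MScale M) (\<lambda>xs.
       corner A M (hd ys) (last ys) (\<phi> (map (\<lambda>_. ()) ys) (basis (unit_arrows ys xs))))
     else 0)"

definition cyc_incl ::
  "(('o, 'a::ab_group_add, 'a) htuple \<Rightarrow>\<^sub>0 'k::field)
    \<Rightarrow> ((unit, 'o \<Rightarrow> 'o \<Rightarrow> 'a, 'o \<Rightarrow> 'o \<Rightarrow> 'a) htuple \<Rightarrow>\<^sub>0 'k)" where
  "cyc_incl = lext pscale (\<lambda>(ys, (d, a), xs).
     basis (map (\<lambda>_. ()) ys, (d, munit (last ys) (hd ys) a), unit_arrows ys xs))"

definition HC_incl ::
  "(nat \<Rightarrow> (('o, 'a::ab_group_add, 'a) htuple \<Rightarrow>\<^sub>0 'k::field))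
    \<Rightarrow> (nat \<Rightarrow> ((unit, 'o \<Rightarrow> 'o \<Rightarrow> 'a, 'o \<Rightarrow> 'o \<Rightarrow> 'a) htuple \<Rightarrow>\<^sub>0 'k))" where
  "HC_incl x = (\<lambda>p. cyc_incl (x p))"

definition HC_restr ::
  "(nat \<Rightarrow> ((unit, 'o \<Rightarrow> 'o \<Rightarrow> 'a::ab_group_add, 'o \<Rightarrow> 'o \<Rightarrow> 'a) htuple \<Rightarrow>\<^sub>0 'k::field) \<Rightarrow> 'k)
    \<Rightarrow> (nat \<Rightarrow> (('o, 'a, 'a) htuple \<Rightarrow>\<^sub>0 'k) \<Rightarrow> 'k)" where
  "HC_restr f = (\<lambda>p. f p \<circ> cyc_incl)"

end

theory Submission
 imports Defs
begin

text \<open>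
 A tensor over the superalgebra is a sum of words of matrix units. A word is composable when consecutive
 arrows fit together, and the composable words span the complex of the category. On the other words,
 inserting an identity at the first joint that does not fit is a contracting homotopy; it does not involve
 the outer faces, so it serves the Hochschild differential \<open>b\<close> as well as \<open>b'\<close>. Hochschild cohomology is
 compared in this way. For homology the same argument is applied to linear functionals, and over a field a
 map that is bijective on functionals is an isomorphism. For the total complex of the cyclic bicomplex, a
 cocycle that vanishes on the composable words is killed one column at a time.
\<close>

section \<open>Linear algebra\<close>

text \<open>Chain spaces are quotients of free spaces by multilinearity relations. A homotopy on
  chains would have to split every generator into matrix units and be checked against these
  relations. A functional on the quotient is just a multilinear function, and such a function
  extends from words of matrix units by an explicit finite sum; this is why homology is reached
  through functionals. The homotopy works because a mismatched pair of arrows multiplies to zero: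
  the identity put at such a joint is absorbed on its left and annihilated on its right, so exactly
  one new face survives. That face is never the last one, the only face that b' lacks. Rotation does
  not commute with the insertion, since the first mismatch depends on where the cycle is cut open.
  In the bicomplex only the exactness of the columns away from the composable words is available,
  and each primitive must again vanish on the composable words so that the next column can be
  treated.\<close>

abbreviation "lin_map \<equiv> Vector_Spaces.linear"
abbreviation "linfun \<equiv> Vector_Spaces.linear pscale (*)"
abbreviation "linop \<equiv> Vector_Spaces.linear pscale pscale"
abbreviation "subspc \<equiv> module.subspace"
abbreviation "hnum A M n \<equiv> num (hchains A M n)"
abbreviation "cnum A n \<equiv> num (cchains A n)"

lemma lookup_pscale [simp]: "Poly_Mapping.lookup (pscale c x) g = c * Poly_Mapping.lookup x g"
 by (simp add: pscale_def Poly_Mapping.map.rep_eq when_def)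

lemma vs_pscale: "vector_space pscale"
 by unfold_locales (auto intro!: poly_mapping_eqI simp: lookup_add algebra_simps)

lemma vector_space_mult: "vector_space ((*) :: 'k::field => 'k => 'k)"
 by unfold_locales (auto simp: algebra_simps)

lemma vector_space_fun:
 assumes "vector_space s"
 shows "vector_space (%c f x. s c (f x))"
proof -
 interpret vector_space s by fact
 show ?thesis by unfold_locales (auto simp: fun_eq_iff scale_right_distrib scale_left_distrib)
qed

lemma linear_iff:
 assumes "vector_space s" "vector_space t"
 shows "lin_map s t f \<longleftrightarrow> (\<forall>x y. f (x + y) = f x + f y) & (\<forall>c x. f (s c x) = t c (f x))"
 using assms unfolding Vector_Spaces.linear_def module_hom_def module_hom_axioms_def
 by (auto simp: module_iff_vector_space)

lemma subspace_iff:
 assumes "vector_space s"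
 shows "subspc s S \<longleftrightarrow> 0 \<in> S & (\<forall>x\<in>S. \<forall>y\<in>S. x + y \<in> S) & (\<forall>c. \<forall>x\<in>S. s c x \<in> S)"
proof -
 interpret vector_space s by fact
 show ?thesis by (auto simp: subspace_def)
qed

lemma subspace_diff:
 assumes "vector_space s" "subspc s S" "x \<in> S" "y \<in> S"
 shows "x - y \<in> S"
proof -
 interpret vector_space s by fact
 show ?thesis using assms subspace_diff by blast
qed

lemma subspace_plus:
 assumes "vector_space s" "subspc s S" "subspc s T"
 shows "subspc s (S + T)"
proof -
 interpret vector_space s by fact
 have "S + T = {x + y |x y. x \<in> S & y \<in> T}"
  by (auto simp: set_plus_def)
 then show ?thesis using subspace_sums[OF assms(2,3)] by simp
qed

lemma subspace_linear_image:
 assumes "lin_map s t f" "subspc s S"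
 shows "subspc t (f ` S)"
 by (rule module_hom.subspace_image) (use assms linear_iff_module_hom in auto)

section \<open>Cosets and the maps they induce\<close>

lemma mem_elt_set_plus_iff: "x \<in> a +o B \<longleftrightarrow> x - a \<in> (B :: 'v::ab_group_add set)"
 by (auto simp: elt_set_plus_def algebra_simps) (metis add_diff_cancel_left' diff_add_cancel add.commute)

lemma elt_set_plus_eq_iff:
 assumes "vector_space s" "subspc s D"
 shows "u +o D = v +o D \<longleftrightarrow> u - v \<in> D"
proof -
 interpret vector_space s by fact
 note D = assms(2)
 show ?thesis
 proof
  assume "u +o D = v +o D"
  moreover have "u \<in> u +o D" using D by (simp add: mem_elt_set_plus_iff subspace_0)
  ultimately show "u - v \<in> D" by (simp add: mem_elt_set_plus_iff)
 next
  assume uv: "u - v \<in> D"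
  have "x - u \<in> D \<longleftrightarrow> x - v \<in> D" for x
   using subspace_add[OF D uv, of "x - u"] subspace_diff[OF D _ uv, of "x - v"] by auto
  then show "u +o D = v +o D" by (auto simp: mem_elt_set_plus_iff)
 qed
qed

text \<open>Additivity is asked only on a set \<open>S\<close> containing numerators and
  denominators, and only up to the target denominator. Restriction of cochains needs this: a cochain
  is a map on a whole ambient space, while the actions of a bimodule are bilinear only on its
  homogeneous parts.\<close>

lemma induces_isoI:
 fixes f :: "'v::ab_group_add => 'w::ab_group_add"
  and V :: "('k::field, 'v) sspace" and W :: "('k, 'w) sspace"
 assumes vsV: "vector_space (scl V)" and vsW: "vector_space (scl W)"
  and numV: "!!i. subspc (scl V) (num V i)"
  and denV: "!!i. subspc (scl V) (den V i)"
  and denW: "!!i. subspc (scl W) (den W i)"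
  and S: "!!i. num V i <= S i" "!!i. den V i <= S i"
  and add: "!!i x y. x \<in> S i ==> y \<in> S i ==> f (x + y) - (f x + f y) \<in> den W i"
  and scale: "!!i c x. x \<in> num V i ==> f (scl V c x) - scl W c (f x) \<in> den W i"
  and num: "!!i x. x \<in> num V i ==> f x \<in> num W i"
  and den: "!!i x. x \<in> den V i ==> f x \<in> den W i"
  and inj: "!!i x. x \<in> num V i ==> f x \<in> den W i ==> x \<in> den V i"
  and surj: "!!i w. w \<in> num W i ==> \<exists>v\<in>num V i. f v - w \<in> den W i"
 shows "induces_iso f V W"
proof -
 interpret V: vector_space "scl V" by fact
 interpret W: vector_space "scl W" by fact
 note numV' = numV[unfolded subspace_iff[OF vsV]] and denV' = denV[unfolded subspace_iff[OF vsV]]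
  and denW' = denW[unfolded subspace_iff[OF vsW]]
 have eqW: "u +o den W i = v +o den W i \<longleftrightarrow> u - v \<in> den W i" for u v i
  by (rule elt_set_plus_eq_iff[OF vsW denW])
 have eqV: "u +o den V i = v +o den V i \<longleftrightarrow> u - v \<in> den V i" for u v i
  by (rule elt_set_plus_eq_iff[OF vsV denV])
 \<comment> \<open>The additivity defect of \<open>f\<close> lies in \<open>den W i\<close>, so the
   image of a coset plus \<open>den W i\<close> is again a single coset.\<close>
 have cm: "coset_map f W i (x +o den V i) = f x +o den W i" if "x \<in> num V i" for x i
 proof (intro set_eqI iffI)
  fix z assume "z \<in> coset_map f W i (x +o den V i)"
  then obtain b e where be: "b \<in> den V i" "e \<in> den W i" "z = f (x + b) + e"
   by (auto simp: coset_map_def set_plus_def elt_set_plus_def)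
  have "z - f x = (f (x + b) - (f x + f b)) + f b + e" using be by simp
  moreover have "f (x + b) - (f x + f b) \<in> den W i" using add S that be by blast
  ultimately have "z - f x \<in> den W i" using be den denW' by metis
  then show "z \<in> f x +o den W i" by (simp add: mem_elt_set_plus_iff)
 next
  fix z assume "z \<in> f x +o den W i"
  then have "z - f x \<in> den W i" by (simp add: mem_elt_set_plus_iff)
  moreover have "x \<in> x +o den V i" using denV' by (simp add: mem_elt_set_plus_iff)
  moreover have "z = f x + (z - f x)" by simp
  ultimately show "z \<in> coset_map f W i (x +o den V i)"
   unfolding coset_map_def by (metis image_eqI set_plus_intro)
 qed
 have sum: "(x +o D) + (y +o D) = (x + y) +o D" if "0 \<in> D" "\<forall>a\<in>D. \<forall>b\<in>D. a + b \<in> D"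
  for x y :: "'b::ab_group_add" and D
 proof -
  have "D + D = D" using that by (auto simp: set_plus_def) (metis add_0)
  then show ?thesis by (simp add: set_plus_rearrange)
 qed
 have csV: "coset_scl V i c (x +o den V i) = scl V c x +o den V i" for i c x
 proof (intro set_eqI iffI)
  fix z assume "z \<in> coset_scl V i c (x +o den V i)"
  then obtain b e where be: "b \<in> den V i" "e \<in> den V i" "z = scl V c (x + b) + e"
   by (auto simp: coset_scl_def set_plus_def elt_set_plus_def)
  then show "z \<in> scl V c x +o den V i"
   using denV' by (simp add: mem_elt_set_plus_iff V.scale_right_distrib)
 next
  fix z assume "z \<in> scl V c x +o den V i"
  then have "z - scl V c x \<in> den V i" by (simp add: mem_elt_set_plus_iff)
  moreover have "x \<in> x +o den V i" using denV' by (simp add: mem_elt_set_plus_iff)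
  moreover have "z = scl V c x + (z - scl V c x)" by simp
  ultimately show "z \<in> coset_scl V i c (x +o den V i)"
   unfolding coset_scl_def by (metis image_eqI set_plus_intro)
 qed
 have csW: "coset_scl W i c (x +o den W i) = scl W c x +o den W i" for i c x
 proof (intro set_eqI iffI)
  fix z assume "z \<in> coset_scl W i c (x +o den W i)"
  then obtain b e where be: "b \<in> den W i" "e \<in> den W i" "z = scl W c (x + b) + e"
   by (auto simp: coset_scl_def set_plus_def elt_set_plus_def)
  then show "z \<in> scl W c x +o den W i"
   using denW' by (simp add: mem_elt_set_plus_iff W.scale_right_distrib)
 next
  fix z assume "z \<in> scl W c x +o den W i"
  then have "z - scl W c x \<in> den W i" by (simp add: mem_elt_set_plus_iff)
  moreover have "x \<in> x +o den W i" using denW' by (simp add: mem_elt_set_plus_iff)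
  moreover have "z = scl W c x + (z - scl W c x)" by simp
  ultimately show "z \<in> coset_scl W i c (x +o den W i)"
   unfolding coset_scl_def by (metis image_eqI set_plus_intro)
 qed
 show ?thesis
  unfolding induces_iso_def
 proof (intro allI conjI ballI)
  fix i
  show "bij_betw (coset_map f W i) (comp_cosets V i) (comp_cosets W i)"
   unfolding bij_betw_def
  proof
   show "inj_on (coset_map f W i) (comp_cosets V i)"
   proof (rule inj_onI)
    fix C D assume "C \<in> comp_cosets V i" "D \<in> comp_cosets V i"
     and eq: "coset_map f W i C = coset_map f W i D"
    then obtain x y where xy: "x \<in> num V i" "y \<in> num V i" "C = x +o den V i" "D = y +o den V i"
     by (auto simp: comp_cosets_def)
    have "f x - f y \<in> den W i" using eq xy by (simp add: cm eqW)
    moreover have d: "x - y \<in> num V i" using subspace_diff[OF vsV numV] xy by blast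
    moreover have "f ((x - y) + y) - (f (x - y) + f y) \<in> den W i"
     using add S d xy by blast
    ultimately have "f x - f y - (f x - (f (x - y) + f y)) \<in> den W i"
     using subspace_diff[OF vsW denW] by (metis diff_add_cancel)
    then have "f (x - y) \<in> den W i" by (simp add: algebra_simps)
    then show "C = D" using inj d xy eqV by blast
   qed
   show "coset_map f W i ` comp_cosets V i = comp_cosets W i"
   proof (intro set_eqI iffI)
    fix C assume "C \<in> coset_map f W i ` comp_cosets V i"
    then show "C \<in> comp_cosets W i" using cm num by (auto simp: comp_cosets_def)
   next
    fix C assume "C \<in> comp_cosets W i"
    then obtain w where w: "w \<in> num W i" "C = w +o den W i" by (auto simp: comp_cosets_def)
    then obtain v where v: "v \<in> num V i" "f v - w \<in> den W i" using surj by blast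
    then have "C = coset_map f W i (v +o den V i)" using w cm eqW by metis
    then show "C \<in> coset_map f W i ` comp_cosets V i" using v by (auto simp: comp_cosets_def)
   qed
  qed
  fix C assume "C \<in> comp_cosets V i"
  then obtain x where x: "x \<in> num V i" "C = x +o den V i" by (auto simp: comp_cosets_def)
  show "coset_map f W i (coset_scl V i c C) = coset_scl W i c (coset_map f W i C)" for c
   using x scale numV' by (simp add: csV csW cm eqW)
  fix D assume "D \<in> comp_cosets V i"
  then obtain y where y: "y \<in> num V i" "D = y +o den V i" by (auto simp: comp_cosets_def)
  have "f (x + y) - (f x + f y) \<in> den W i" using add S x y by blast
  then show "coset_map f W i (C + D) = coset_map f W i C + coset_map f W i D"
   using x y numV' denV' denW' by (simp add: sum cm eqW)
 qed
qed

text \<open>On \<open>S\<close> the value of \<open>\<phi>\<close> depends only on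
  \<open>T x\<close> modulo \<open>D\<close>. It therefore descends to the image of \<open>S\<close>
  in the quotient by \<open>D\<close>, and over a field it extends from there to the whole
  space.\<close>

lemma functional_factor:
 fixes s :: "'k::field => 'v::ab_group_add => 'v" and t :: "'k => 'u::ab_group_add => 'u"
 assumes s: "vector_space s" and t: "vector_space t" and T: "lin_map s t T"
  and S: "subspc s S" and D: "subspc t D"
  and phi: "lin_map s (*) \<phi>" and 0: "!!x. x \<in> S ==> T x \<in> D ==> \<phi> x = 0"
 obtains g where "lin_map t (*) g" "!!y. y \<in> D ==> g y = (0::'k)" "!!x. x \<in> S ==> g (T x) = \<phi> x"
proof -
 interpret tt: vector_space_pair t t using t by (simp add: vector_space_pair_def)
 interpret st: vector_space_pair s t using s t by (simp add: vector_space_pair_def)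
 have "lin_map t t id" by (simp add: linear_iff[OF t t])
 from tt.linear_exists_left_inverse_on[OF this D]
 obtain q where q: "range q <= D" "lin_map t t q" "!!v. v \<in> D ==> q v = v"
  by auto
 \<comment> \<open>\<open>q\<close> projects onto \<open>D\<close>, so \<open>r\<close> has kernel
   exactly \<open>D\<close> and stands in for the quotient map.\<close>
 define r where "r = (%x. x - q x)"
 have r: "lin_map t t r"
  using q(2) unfolding linear_iff[OF t t] r_def by (simp add: tt.vs1.scale_right_diff_distrib)
 have rD: "r x = 0 \<longleftrightarrow> x \<in> D" for x
  using q by (auto simp: r_def)
 have rT: "lin_map s t (%x. r (T x))"
  using r T unfolding linear_iff[OF t t] linear_iff[OF s t] by simp
 \<comment> \<open>A linear choice of preimages in \<open>S\<close>. Two preimages of one value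
   differ by an element that \<open>T\<close> sends into \<open>D\<close>, where
   \<open>\<phi>\<close> vanishes.\<close>
 from st.linear_exists_right_inverse_on[OF rT S]
 obtain h where h: "range h <= S" "lin_map t s h"
  "!!v. v \<in> (%x. r (T x)) ` S ==> r (T (h v)) = v" by auto
 define g where "g = (%y. \<phi> (h (r y)))"
 have "lin_map t (*) g"
  using r h(2) phi unfolding linear_iff[OF t t] linear_iff[OF t s]
   linear_iff[OF s vector_space_mult] linear_iff[OF t vector_space_mult] g_def by simp
 moreover have "g y = 0" if "y \<in> D" for y
  using that rD h(2) phi unfolding g_def linear_iff[OF t s] linear_iff[OF s vector_space_mult]
  by (metis add_cancel_right_left)
 moreover have "g (T x) = \<phi> x" if x: "x \<in> S" for x
 proof -
  let ?y = "h (r (T x))"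
  have y: "?y \<in> S" "r (T ?y) = r (T x)" using h x by auto
  have "T (?y - x) = T ?y - T x"
   using T unfolding linear_iff[OF s t] by (metis diff_add_cancel add_diff_cancel)
  then have "r (T (?y - x)) = 0"
   using y r unfolding linear_iff[OF t t] by (metis diff_add_cancel add_diff_cancel diff_self)
  then have "\<phi> (?y - x) = 0" using rD 0 subspace_diff[OF s S y(1) x] by blast
  then show ?thesis
   using phi unfolding g_def linear_iff[OF s vector_space_mult]
   by (metis add_0 diff_add_cancel)
 qed
 ultimately show thesis by (rule that)
qed

text \<open>\<open>functional_factor\<close> for the line through \<open>z\<close>: no nonzero
  multiple of \<open>z\<close> lies in \<open>D\<close>, so the coefficient is a well-defined
  functional on the line modulo \<open>D\<close>.\<close>

lemma functional_separation:
 fixes t :: "'k::field => 'u::ab_group_add => 'u"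
 assumes t: "vector_space t" and D: "subspc t D" and z: "z \<notin> D"
 obtains g where "lin_map t (*) g" "!!y. y \<in> D ==> g y = (0::'k)" "g z ~= 0"
proof -
 interpret vector_space t by fact
 have m: "vector_space ((*) :: 'k => 'k => 'k)" by (rule vector_space_mult)
 have T: "lin_map (*) t (%c. t c z)"
  by (simp add: linear_iff[OF m t] scale_left_distrib)
 have S: "subspc ((*) :: 'k => 'k => 'k) UNIV" by (simp add: subspace_iff[OF m])
 have phi: "lin_map (*) (*) (%c::'k. c)" by (simp add: linear_iff[OF m m])
 have 0: "c = 0" if "t c z \<in> D" for c
 proof (rule ccontr)
  assume "c ~= 0"
  moreover have "t (inverse c) (t c z) \<in> D" using subspace_scale[OF D that] .
  ultimately show False using z by simp
 qed
 obtain g where "lin_map t (*) g" "!!y. y \<in> D ==> g y = (0::'k)" "!!c. g (t c z) = c"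
  using functional_factor[OF m t T S D phi] 0 by (metis UNIV_I)
 then show thesis using that by (metis scale_one one_neq_zero)
qed

text \<open>Duality over a field. If every functional on the source quotient extends along the map
  (\<open>lift\<close>), no nonzero class is killed; if a functional on the target that vanishes on
  the image is zero (\<open>van\<close>), the image is everything.\<close>

lemma induces_iso_dual:
 fixes \<iota> :: "'v::ab_group_add => 'w::ab_group_add"
  and V :: "('k::field, 'v) sspace" and W :: "('k, 'w) sspace"
 assumes vsV: "vector_space (scl V)" and vsW: "vector_space (scl W)"
  and lin: "lin_map (scl V) (scl W) \<iota>"
  and numV: "!!i. subspc (scl V) (num V i)"
  and denV: "!!i. subspc (scl V) (den V i)"
  and denW: "!!i. subspc (scl W) (den W i)"
  and num: "!!i x. x \<in> num V i ==> \<iota> x \<in> num W i"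
  and den: "!!i x. x \<in> den V i ==> \<iota> x \<in> den W i"
  and lift: "!!i f. lin_map (scl V) (*) f ==> \<forall>x\<in>den V i. f x = (0::'k) ==>
   \<exists>f'. lin_map (scl W) (*) f' & (\<forall>x\<in>den W i. f' x = 0) & (\<forall>x\<in>num V i. f' (\<iota> x) = f x)"
  and van: "!!i f x. lin_map (scl W) (*) f ==> \<forall>x\<in>den W i. f x = (0::'k) ==>
   \<forall>x\<in>num V i. f (\<iota> x) = 0 ==> x \<in> num W i ==> f x = 0"
 shows "induces_iso \<iota> V W"
proof (rule induces_isoI[OF vsV vsW numV denV denW, where S = "%_. UNIV"])
 note L = lin[unfolded linear_iff[OF vsV vsW]]
 have 0: "0 \<in> den W i" for i using denW[unfolded subspace_iff[OF vsW]] by blast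
 show "\<iota> (x + y) - (\<iota> x + \<iota> y) \<in> den W i" for i x y using L 0 by simp
 show "\<iota> (scl V c x) - scl W c (\<iota> x) \<in> den W i" for i x c using L 0 by simp
 show "x \<in> den V i" if x: "x \<in> num V i" "\<iota> x \<in> den W i" for i x
 proof (rule ccontr)
  assume "x \<notin> den V i"
  from functional_separation[OF vsV denV this] obtain f where f: "lin_map (scl V) (*) f"
   "!!y. y \<in> den V i ==> f y = (0::'k)" "f x ~= 0" by blast
  then obtain f' where "\<forall>x\<in>den W i. f' x = 0" "\<forall>x\<in>num V i. f' (\<iota> x) = f x" using lift by metis
  then show False using x f by metis
 qed
 show "\<exists>v\<in>num V i. \<iota> v - w \<in> den W i" if w: "w \<in> num W i" for i w
 proof -
  \<comment> \<open>A \<open>w\<close> outside this subspace would be separated from it by a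
    functional, contradicting \<open>van\<close>.\<close>
  let ?D = "\<iota> ` num V i + den W i"
  have sub: "subspc (scl W) ?D"
   by (intro subspace_plus[OF vsW] denW subspace_linear_image[OF lin numV])
  have 0: "0 \<in> num V i" "0 \<in> den W i" using numV[unfolded subspace_iff[OF vsV]] 0 by auto
  have "w \<in> ?D"
  proof (rule ccontr)
   assume "w \<notin> ?D"
   from functional_separation[OF vsW sub this] obtain f where
    f: "lin_map (scl W) (*) f" "!!y. y \<in> ?D ==> f y = (0::'k)" "f w ~= 0" by blast
   have "f y = 0" if "y \<in> den W i" for y
   proof -
    have "\<iota> 0 = 0" using L by (metis add_cancel_right_left add_0)
    then show ?thesis using f(2) 0(1) that by (metis add_0 image_eqI set_plus_intro)
   qed
   moreover have "f (\<iota> x) = 0" if "x \<in> num V i" for x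
    using f(2) 0(2) that by (metis add.right_neutral image_eqI set_plus_intro)
   ultimately show False using van[OF f(1)] w f(3) by blast
  qed
  then obtain v e where "v \<in> num V i" "e \<in> den W i" "w = \<iota> v + e"
   by (auto simp: set_plus_def)
  then show ?thesis using subspace_diff[OF vsW denW 0(2)] by force
 qed
qed (use num den in auto)

section \<open>Linear extension from generators\<close>

lemma linear_lext:
 fixes s :: "'k::field => 'w::ab_group_add => 'w"
 assumes "vector_space s"
 shows "lin_map pscale s (lext s h)"
proof -
 interpret vector_space s by fact
 have *: "lext s h x = (\<Sum>g\<in>K. s (Poly_Mapping.lookup x g) (h g))"
  if "finite K" "Poly_Mapping.keys x <= K" for x K
  unfolding lext_def by (rule sum.mono_neutral_left) (use that in \<open>auto simp: in_keys_iff\<close>)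
 show ?thesis
  unfolding linear_iff[OF vs_pscale assms]
 proof safe
  fix x y :: "'a \<Rightarrow>\<^sub>0 'k"
  let ?K = "Poly_Mapping.keys x \<union> Poly_Mapping.keys y"
  have "Poly_Mapping.keys (x + y) <= ?K" by (rule Poly_Mapping.keys_add)
  then show "lext s h (x + y) = lext s h x + lext s h y"
   by (subst (1 2 3) *[of ?K]) (auto simp: lookup_add scale_left_distrib sum.distrib)
 next
  fix c and x :: "'a \<Rightarrow>\<^sub>0 'k"
  have "Poly_Mapping.keys (pscale c x) <= Poly_Mapping.keys x" by (auto simp: in_keys_iff)
  then show "lext s h (pscale c x) = s c (lext s h x)"
   by (subst (1 2) *[of "Poly_Mapping.keys x"]) (auto simp: scale_sum_right)
 qed
qed

lemma lext_basis:
 assumes "vector_space s"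
 shows "lext s h (basis g) = h g"
proof -
 interpret vector_space s by fact
 show ?thesis by (simp add: lext_def)
qed

lemma linear_eq_lext:
 fixes s :: "'k::field => 'w::ab_group_add => 'w"
 assumes s: "vector_space s" and f: "lin_map pscale s f"
 shows "f x = lext s (%g. f (basis g)) x"
proof -
 interpret f: Vector_Spaces.linear pscale s f by fact
 have "x = (\<Sum>g\<in>Poly_Mapping.keys x. pscale (Poly_Mapping.lookup x g) (basis g))"
  by (rule poly_mapping_eqI)
   (simp add: lookup_sum lookup_single when_def in_keys_iff mult.commute[of _ "if _ then _ else _"] if_distrib[of "%z. z * _"] cong: if_cong)
 then have "f x = f (\<Sum>g\<in>Poly_Mapping.keys x. pscale (Poly_Mapping.lookup x g) (basis g))"
  by (rule arg_cong)
 then show ?thesis by (simp add: f.sum f.scale lext_def)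
qed

lemma lext_cong:
 assumes "!!g. g \<in> Poly_Mapping.keys x ==> h g = h' g"
 shows "lext s h x = lext s h' x"
 unfolding lext_def by (rule sum.cong) (use assms in auto)

lemma linear_eq_on_keys:
 assumes s: "vector_space s" and f: "lin_map pscale s f" "lin_map pscale s f'"
  and eq: "!!g. g \<in> Poly_Mapping.keys x ==> f (basis g) = f' (basis g)"
 shows "f x = f' x"
 using linear_eq_lext[OF s f(1), of x] linear_eq_lext[OF s f(2), of x] lext_cong[OF eq, of x] by simp

lemma linear_zero_on_keys:
 assumes s: "vector_space s" and f: "lin_map pscale s f"
  and 0: "!!g. g \<in> Poly_Mapping.keys x ==> f (basis g) = 0"
 shows "f x = 0"
proof -
 interpret vector_space s by fact
 have "lin_map pscale s (%_. 0)" by (simp add: linear_iff[OF vs_pscale s])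
 then show ?thesis using linear_eq_on_keys[OF s f] 0 by blast
qed

lemma linear_compose:
 assumes "vector_space s" "vector_space t" "vector_space u"
  "lin_map s t f" "lin_map t u g"
 shows "lin_map s u (%x. g (f x))"
 using assms by (simp add: linear_iff)

lemmas linear_iff_pscale = linear_iff[OF vs_pscale vs_pscale]
lemmas linear_compose_pscale = linear_compose[OF vs_pscale vs_pscale vs_pscale]

lemma linear_zero_on_span:
 assumes "vector_space s" "vector_space t" "lin_map s t f" "!!x. x \<in> B ==> f x = 0"
  "x \<in> module.span s B"
 shows "f x = 0"
proof -
 interpret vector_space_pair s t using assms by (simp add: vector_space_pair_def)
 show ?thesis using linear_eq_0_on_span assms(3-5) by blast
qed

section \<open>Words of arrows and the contracting homotopy\<close>

context superadditive_category
begin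

section \<open>Composition of homogeneous morphisms\<close>

lemma Mor_subspace: "X \<in> Obj A ==> Y \<in> Obj A ==> subspc (Scale A) (Mor A X Y i)"
 using superspace_Mor by (auto simp: superspace_def)

lemmas Mor_closed = Mor_subspace[unfolded subspace_iff[OF vector_space]]

lemma Mor_0: "X \<in> Obj A ==> Y \<in> Obj A ==> 0 \<in> Mor A X Y i"
 using Mor_closed by blast

lemma Mor_total:
 assumes "X \<in> Obj A" "Y \<in> Obj A" "a \<in> Mor A X Y i"
 shows "a \<in> total (Mor A X Y)"
proof -
 have "a \<in> Mor A X Y 0 | a \<in> Mor A X Y 1" using assms(3) by (cases i) auto
 then show ?thesis
  using Mor_0[OF assms(1,2)] set_plus_intro[of a _ 0] set_plus_intro[of 0 _ a]
  by (auto simp: total_def)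
qed

lemma Comp_add_left:
 "[|X \<in> Obj A; Y \<in> Obj A; Z \<in> Obj A; a \<in> Mor A X Y i; a' \<in> Mor A X Y i; b \<in> Mor A Y Z j|]
  ==> Comp A X Y Z (a + a') b = Comp A X Y Z a b + Comp A X Y Z a' b"
 using Comp_bilinear[of X Y Z] Mor_total by (simp add: bilinear_on_def)

lemma Comp_add_right:
 "[|X \<in> Obj A; Y \<in> Obj A; Z \<in> Obj A; a \<in> Mor A X Y i; b \<in> Mor A Y Z j; b' \<in> Mor A Y Z j|]
  ==> Comp A X Y Z a (b + b') = Comp A X Y Z a b + Comp A X Y Z a b'"
 using Comp_bilinear[of X Y Z] Mor_total by (simp add: bilinear_on_def)

lemma Comp_scale:
 "[|X \<in> Obj A; Y \<in> Obj A; Z \<in> Obj A; a \<in> Mor A X Y i; b \<in> Mor A Y Z j|]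
  ==> Comp A X Y Z (Scale A c a) b = Scale A c (Comp A X Y Z a b) &
    Comp A X Y Z a (Scale A c b) = Scale A c (Comp A X Y Z a b)"
 using Comp_bilinear[of X Y Z] Mor_total by (simp add: bilinear_on_def)

lemma Comp_0_left:
 assumes "X \<in> Obj A" "Y \<in> Obj A" "Z \<in> Obj A" "b \<in> Mor A Y Z j"
 shows "Comp A X Y Z 0 b = 0"
 using Comp_add_left[OF assms(1-3) Mor_0[OF assms(1,2)] Mor_0[OF assms(1,2)] assms(4)] by simp

lemma Comp_0_right:
 assumes "X \<in> Obj A" "Y \<in> Obj A" "Z \<in> Obj A" "a \<in> Mor A X Y i"
 shows "Comp A X Y Z a 0 = 0"
 using Comp_add_right[OF assms Mor_0[OF assms(2,3)] Mor_0[OF assms(2,3)]] by simp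

text \<open>
 The odd part \<open>e\<close> of an identity annihilates homogeneous elements for degree reasons, hence also
 the identity itself, so \<open>e = 0\<close>.
\<close>

lemma Idn_degree:
 assumes X: "X \<in> Obj A"
 shows "Idn A X \<in> Mor A X X 0"
proof -
 interpret vector_space "Scale A" by (rule vector_space)
 obtain d e where de: "d \<in> Mor A X X 0" "e \<in> Mor A X X 1" "Idn A X = d + e"
  using Idn_Mor[OF X] by (auto simp: total_def set_plus_def)
 have t: "d \<in> total (Mor A X X)" "e \<in> total (Mor A X X)" using de Mor_total[OF X X] by auto
 have bil: "bilinear_on (Scale A) (Scale A) (Scale A) (total (Mor A X X)) (total (Mor A X X)) (Comp A X X X)"
  by (rule Comp_bilinear[OF X X X])
 have ann: "Comp A X X X e a = 0" if a: "a \<in> Mor A X X i" for a i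
 proof -
  have "Comp A X X X d a + Comp A X X X e a = a"
   using Idn_left[OF X X Mor_total[OF X X a]] bil t Mor_total[OF X X a] de(3)
   by (simp add: bilinear_on_def)
  moreover have "Comp A X X X d a \<in> Mor A X X i" by (metis Comp_degree[OF X X X de(1) a] add_0)
  ultimately have "Comp A X X X e a \<in> Mor A X X i"
   using subspace_diff[OF Mor_subspace[OF X X] a] by (metis add_diff_cancel_left')
  moreover have "Comp A X X X e a \<in> Mor A X X (1 + i)" by (rule Comp_degree[OF X X X de(2) a])
  moreover have "Mor A X X i \<inter> Mor A X X (1 + i) = {0}"
   using superspace_Mor[OF X X] by (cases i) (auto simp: superspace_def)
  ultimately show ?thesis by blast
 qed
 have "e = Comp A X X X e (d + e)" using Idn_right[OF X X t(2)] de(3) by simp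
 also have "... = Comp A X X X e d + Comp A X X X e e" using bil t by (simp add: bilinear_on_def)
 finally have "e = 0" using ann de by simp
 then show ?thesis using de by simp
qed

end

lemma sum_split_at:
 fixes g :: "nat => 'w::comm_monoid_add"
 assumes "i <= n"
 shows "(\<Sum>k\<le>n. g k) = (\<Sum>k<i. g k) + g i + (\<Sum>k=Suc i..n. g k)"
proof -
 have "{..n} = {..<i} \<union> {i..n}" using assms by auto
 then have "(\<Sum>k\<le>n. g k) = (\<Sum>k<i. g k) + (\<Sum>k=i..n. g k)"
  by (simp add: sum.union_disjoint ivl_disj_int_one)
 then show ?thesis using assms by (simp add: sum.atLeast_Suc_atMost add.assoc)
qed

text \<open>
 An arrow \<open>a : X \<rightarrow> Y\<close> of degree \<open>d\<close> is stored as \<open>((X, Y), (d, a))\<close>; consecutive arrows of a word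
 need not be composable. A word of length \<open>n\<close> placed between two outer objects \<open>X\<close> and \<open>Z\<close> has the
 joints \<open>0, \<dots>, n\<close>; joint \<open>k\<close> compares the target to its left with the source to its right.
\<close>

type_synonym ('o, 'a) arrow = "('o \<times> 'o) \<times> (bit * 'a)"

abbreviation src :: "('o, 'a) arrow => 'o" where "src x \<equiv> fst (fst x)"
abbreviation tgt :: "('o, 'a) arrow => 'o" where "tgt x \<equiv> snd (fst x)"
abbreviation deg :: "('o, 'a) arrow => bit" where "deg x \<equiv> fst (snd x)"
abbreviation mor :: "('o, 'a) arrow => 'a" where "mor x \<equiv> snd (snd x)"

definition arrows :: "('k, 'o, 'a) scat => ('o, 'a) arrow set" where
 "arrows A = {x. src x \<in> Obj A & tgt x \<in> Obj A & mor x \<in> Mor A (src x) (tgt x) (deg x)}"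

definition lo :: "'o => ('o, 'a) arrow list => nat => 'o" where
 "lo X w k = (if k = 0 then X else tgt (w ! (k - 1)))"

definition ro :: "('o, 'a) arrow list => 'o => nat => 'o" where
 "ro w Z k = (if k = length w then Z else src (w ! k))"

definition matched :: "'o => ('o, 'a) arrow list => 'o => nat => bool" where
 "matched X w Z k \<longleftrightarrow> lo X w k = ro w Z k"

definition composable :: "'o => ('o, 'a) arrow list => 'o => bool" where
 "composable X w Z \<longleftrightarrow> (\<forall>k\<le>length w. matched X w Z k)"

text \<open>Meaningful at a matched joint; the middle object is read off from the left
  factor.\<close>

definition mul :: "('k, 'o, 'a) scat => ('o, 'a) arrow => ('o, 'a) arrow => ('o, 'a) arrow" where
 "mul A x y = ((src x, tgt y), (deg x + deg y, Comp A (src x) (tgt x) (tgt y) (mor x) (mor y)))"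

definition wcontract :: "('k, 'o, 'a) scat => nat => ('o, 'a) arrow list => ('o, 'a) arrow list" where
 "wcontract A i w = take (i - 1) w @ mul A (w ! (i - 1)) (w ! i) # drop (Suc i) w"

text \<open>The face at joint \<open>i\<close> removes this joint; for \<open>i = 0\<close> and \<open>i = n\<close> the outer object changes.\<close>

definition fword :: "('k, 'o, 'a) scat => nat => ('o, 'a) arrow list => ('o, 'a) arrow list" where
 "fword A i w = (if i = 0 then tl w else if i < length w then wcontract A i w else butlast w)"

definition fleft :: "nat => 'o => ('o, 'a) arrow list => 'o" where
 "fleft i X w = (if i = 0 then tgt (hd w) else X)"

definition fright :: "nat => ('o, 'a) arrow list => 'o => 'o" where
 "fright i w Z = (if i = length w then src (last w) else Z)"

definition idw :: "('k, 'o, 'a) scat => 'o => ('o, 'a) arrow" where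
 "idw A X = ((X, X), (0, Idn A X))"

text \<open>The identity sits at the object to the left of joint \<open>i\<close>. The new joint
  \<open>i\<close> is then matched, and joint \<open>Suc i\<close> compares the same two objects as
  joint \<open>i\<close> did before.\<close>

definition ins :: "('k, 'o, 'a) scat => nat => 'o => ('o, 'a) arrow list => ('o, 'a) arrow list" where
 "ins A i X w = take i w @ idw A (lo X w i) # drop i w"

text \<open>The sign (-1)^i as a negation, so that families may take values in any abelian
  group.\<close>

definition alt :: "nat => 'w::ab_group_add => 'w" where
 "alt i x = (if even i then x else - x)"

lemma alt_0 [simp]: "alt i 0 = 0" by (simp add: alt_def)
lemma alt_add: "alt i (x + y) = alt i x + alt i y" by (simp add: alt_def)
lemma alt_alt: "alt i (alt j x) = alt (i + j) x" by (simp add: alt_def)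
lemma alt_Suc: "alt (Suc i) x = - alt i x" by (simp add: alt_def)
lemma alt_sum: "alt i (\<Sum>k\<in>K. f k) = (\<Sum>k\<in>K. alt i (f k))" by (simp add: alt_def sum_negf)
lemma alt_scale:
 assumes "vector_space s"
 shows "alt i x = s ((-1) ^ i) x"
proof -
 interpret vector_space s by fact
 show ?thesis by (simp add: alt_def)
qed

type_synonym ('o, 'a, 'w) wfam = "'o => ('o, 'a) arrow list => 'o => 'w"

text \<open>
 A cochain on the superalgebra corresponds to a family of values on the words of matrix units.
 In these terms \<open>wdiff\<close> is the Hochschild differential: \<open>\<lambda>\<close> and \<open>\<rho>\<close> are the contributions of the
 outer factors, and the faces at mismatched joints vanish.
\<close>

definition outer :: "(('o, 'a) arrow => 'o => 'w => 'w) => ('o => ('o, 'a) arrow => 'w => 'w)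
  => nat => 'o => ('o, 'a) arrow list => 'o => 'w => 'w" where
 "outer l r i X w Z \<phi> =
   (if i = 0 then l (hd w) Z \<phi> else if i < length w then \<phi> else r X (last w) \<phi>)"

definition wface :: "('k, 'o, 'a) scat => (('o, 'a) arrow => 'o => 'w => 'w)
  => ('o => ('o, 'a) arrow => 'w => 'w) => nat => ('o, 'a, 'w) wfam => ('o, 'a, 'w) wfam" where
 "wface A l r i f X w Z = outer l r i X w Z (f (fleft i X w) (fword A i w) (fright i w Z))"

definition wdiff :: "('k, 'o, 'a) scat => (('o, 'a) arrow => 'o => 'w => 'w)
  => ('o => ('o, 'a) arrow => 'w => 'w) => ('o, 'a, 'w::ab_group_add) wfam => ('o, 'a, 'w) wfam" where
 "wdiff A l r f X w Z = (\<Sum>i\<le>length w. alt i (if matched X w Z i then wface A l r i f X w Z else 0))"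

text \<open>The homotopy inserts an identity at the first mismatched joint.\<close>

definition first_mismatch :: "'o => ('o, 'a) arrow list => 'o => nat => bool" where
 "first_mismatch X w Z i \<longleftrightarrow> i <= length w & ~ matched X w Z i & (\<forall>k<i. matched X w Z k)"

definition whtpy :: "('k, 'o, 'a) scat => ('o, 'a, 'w::ab_group_add) wfam => ('o, 'a, 'w) wfam" where
 "whtpy A f X w Z = (if composable X w Z then 0
   else let i = (THE i. first_mismatch X w Z i) in alt i (f X (ins A i X w) Z))"

section \<open>Joints under faces and insertions\<close>

lemma first_mismatch_unique: "first_mismatch X w Z i ==> first_mismatch X w Z j ==> i = j"
 unfolding first_mismatch_def by (meson linorder_neqE_nat)

lemma not_composable_iff: "~ composable X w Z \<longleftrightarrow> (\<exists>i. first_mismatch X w Z i)"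
proof
 assume "~ composable X w Z"
 then obtain k where "k <= length w" "~ matched X w Z k" by (auto simp: composable_def)
 then show "\<exists>i. first_mismatch X w Z i"
 proof (induction k rule: less_induct)
  case (less k)
  then show ?case unfolding first_mismatch_def by (meson le_trans less_imp_le)
 qed
qed (auto simp: composable_def first_mismatch_def)

lemma whtpy_eq: "first_mismatch X w Z i ==> whtpy A f X w Z = alt i (f X (ins A i X w) Z)"
 unfolding whtpy_def Let_def using first_mismatch_unique not_composable_iff
 by (metis the_equality)

lemma length_wcontract: "0 < i ==> i < length w ==> length (wcontract A i w) = length w - 1"
 by (simp add: wcontract_def)

lemma nth_wcontract: "0 < i ==> i < length w ==> k < length w - 1 ==>
 wcontract A i w ! k = (if Suc k < i then w ! k else if Suc k = i then mul A (w ! (i - 1)) (w ! i) else w ! Suc k)"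
 by (auto simp: wcontract_def nth_append nth_Cons' less_Suc_eq)

lemma length_ins [simp]: "i <= length w ==> length (ins A i X w) = Suc (length w)"
 by (simp add: ins_def)

lemma nth_ins: "i <= length w ==> k <= length w ==>
 ins A i X w ! k = (if k < i then w ! k else if k = i then idw A (lo X w i) else w ! (k - 1))"
 by (auto simp: ins_def nth_append nth_Cons')

lemma length_fword: "w ~= [] ==> i <= length w ==> length (fword A i w) = length w - 1"
 by (simp add: fword_def length_wcontract)

text \<open>Because \<open>fleft\<close> and \<open>fright\<close> adjust the outer objects, an
  outer face deletes a joint in the same way as an inner one: the other joints keep their objects
  and are renumbered.\<close>

lemma lo_face:
 assumes "w ~= []" "i <= length w" "k < length w"
 shows "lo (fleft i X w) (fword A i w) k = lo X w (if k < i then k else Suc k)"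
 using assms
 by (auto simp: lo_def fleft_def fword_def hd_conv_nth nth_tl nth_butlast nth_wcontract mul_def)

lemma ro_face:
 assumes "w ~= []" "i <= length w" "k < length w"
 shows "ro (fword A i w) (fright i w Z) k = ro w Z (if k < i then k else Suc k)"
 using assms length_fword[OF assms(1,2), of A]
 by (cases "Suc k = i") (auto simp: ro_def fright_def fword_def last_conv_nth nth_tl nth_butlast nth_wcontract mul_def)

lemma matched_face:
 assumes "w ~= []" "i <= length w" "k < length w"
 shows "matched (fleft i X w) (fword A i w) (fright i w Z) k = matched X w Z (if k < i then k else Suc k)"
 unfolding matched_def lo_face[OF assms] ro_face[OF assms] ..

text \<open>In particular a face at a matched joint neither creates nor destroys composability,
  which separates the composable words from the others in the complex.\<close>

lemma composable_face:
 assumes "w ~= []" "i <= length w"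
 shows "composable (fleft i X w) (fword A i w) (fright i w Z) \<longleftrightarrow> (\<forall>k\<le>length w. k ~= i --> matched X w Z k)"
proof -
 have "composable (fleft i X w) (fword A i w) (fright i w Z) \<longleftrightarrow>
  (\<forall>k<length w. matched X w Z (if k < i then k else Suc k))"
 proof -
  have "k <= length w - 1 \<longleftrightarrow> k < length w" for k using assms(1) by (cases w) auto
  then show ?thesis unfolding composable_def length_fword[OF assms] by (metis matched_face[OF assms])
 qed
 also have "... \<longleftrightarrow> (\<forall>k\<le>length w. k ~= i --> matched X w Z k)"
 proof safe
  fix k assume *: "\<forall>k<length w. matched X w Z (if k < i then k else Suc k)" "k <= length w" "k ~= i"
  show "matched X w Z k"
   using *(1)[rule_format, of k] *(1)[rule_format, of "k - 1"] *(2,3) assms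
   by (cases "k < i"; cases k) (auto split: if_splits)
 qed (use assms in auto)
 finally show ?thesis .
qed

lemma lo_ins: "i <= length w ==> k <= Suc (length w) ==> lo X (ins A i X w) k = lo X w (if k <= i then k else k - 1)"
 by (auto simp: lo_def nth_ins idw_def)

lemma ro_ins: "i <= length w ==> k <= Suc (length w) ==>
 ro (ins A i X w) Z k = (if k < i then ro w Z k else if k = i then lo X w i else ro w Z (k - 1))"
 by (auto simp: ro_def nth_ins idw_def)

lemma matched_ins:
 assumes "i <= length w" "k <= Suc (length w)"
 shows "matched X (ins A i X w) Z k \<longleftrightarrow> (if k < i then matched X w Z k else k = i | matched X w Z (k - 1))"
 unfolding matched_def lo_ins[OF assms] ro_ins[OF assms] by auto

text \<open>Simplicial identity for a face to the left of the insertion: the inserted identity moves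
  down by one joint, but its object stays the same.\<close>

lemma face_ins_before:
 assumes "k < i" "i <= length w"
 shows "fword A k (ins A i X w) = ins A (i - 1) (fleft k X w) (fword A k w)"
  and "fleft k X (ins A i X w) = fleft k X w"
  and "fright k (ins A i X w) Z = fright k w Z"
  and "outer l r k X (ins A i X w) Z = outer l r k X w Z"
proof -
 have w: "w ~= []" "k <= length w" using assms by auto
 have hd: "hd (ins A i X w) = hd w" using assms by (cases w; cases i) (auto simp: ins_def)
 show "fleft k X (ins A i X w) = fleft k X w" by (simp add: fleft_def hd)
 show "fright k (ins A i X w) Z = fright k w Z" using assms by (simp add: fright_def)
 show "outer l r k X (ins A i X w) Z = outer l r k X w Z"
  using assms by (auto simp: fun_eq_iff outer_def hd)
 have lo: "lo (fleft k X w) (fword A k w) (i - 1) = lo X w i"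
  using lo_face[OF w, of "i - 1" X A] assms by (cases i) auto
 have ki: "k < length w" using assms by simp
 have ne: "ins A i X w ~= []" by (simp add: ins_def)
 show "fword A k (ins A i X w) = ins A (i - 1) (fleft k X w) (fword A k w)"
 proof (rule nth_equalityI)
  show "length (fword A k (ins A i X w)) = length (ins A (i - 1) (fleft k X w) (fword A k w))"
   using assms w length_fword[OF w, of A] by (subst length_fword) (use ne in auto)
  fix m assume "m < length (fword A k (ins A i X w))"
  then have m: "m < length w" using assms w by (subst (asm) length_fword) (use ne in auto)
  have R: "ins A (i - 1) (fleft k X w) (fword A k w) ! m =
   (if m < i - 1 then fword A k w ! m else if m = i - 1 then idw A (lo X w i) else fword A k w ! (m - 1))"
   using m assms length_fword[OF w, of A] by (subst nth_ins) (auto simp: lo lo[simplified])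
  show "fword A k (ins A i X w) ! m = ins A (i - 1) (fleft k X w) (fword A k w) ! m"
  proof (cases "k = 0")
   case True
   then show ?thesis unfolding R using m assms by (auto simp: fword_def nth_tl nth_ins)
  next
   case False
   then show ?thesis unfolding R using m assms ki
    by (auto simp: fword_def nth_ins nth_wcontract)
  qed
 qed
qed

text \<open>Simplicial identity on the other side, including the last face
  \<open>k = length w\<close>. The face index is shifted because the inserted identity precedes
  joint \<open>k\<close>.\<close>

lemma face_ins_after:
 assumes "i < k" "k <= length w"
 shows "fword A (Suc k) (ins A i X w) = ins A i (fleft k X w) (fword A k w)"
  and "fleft (Suc k) X (ins A i X w) = fleft k X w"
  and "fright (Suc k) (ins A i X w) Z = fright k w Z"
  and "outer l r (Suc k) X (ins A i X w) Z = outer l r k X w Z"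
proof -
 have w: "w ~= []" "k <= length w" using assms by auto
 have last: "last (ins A i X w) = last w" using assms by (simp add: ins_def)
 show "fleft (Suc k) X (ins A i X w) = fleft k X w" using assms by (simp add: fleft_def)
 show "fright (Suc k) (ins A i X w) Z = fright k w Z" using assms by (simp add: fright_def last)
 show "outer l r (Suc k) X (ins A i X w) Z = outer l r k X w Z"
  using assms by (auto simp: fun_eq_iff outer_def last)
 have lo: "lo (fleft k X w) (fword A k w) i = lo X w i"
  using lo_face[OF w, of i X A] assms by simp
 have ne: "ins A i X w ~= []" by (simp add: ins_def)
 show "fword A (Suc k) (ins A i X w) = ins A i (fleft k X w) (fword A k w)"
 proof (rule nth_equalityI)
  show "length (fword A (Suc k) (ins A i X w)) = length (ins A i (fleft k X w) (fword A k w))"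
   using assms w length_fword[OF w, of A] by (subst length_fword) (use ne in auto)
  fix m assume "m < length (fword A (Suc k) (ins A i X w))"
  then have m: "m < length w" using assms w by (subst (asm) length_fword) (use ne in auto)
  have R: "ins A i (fleft k X w) (fword A k w) ! m =
   (if m < i then fword A k w ! m else if m = i then idw A (lo X w i) else fword A k w ! (m - 1))"
   using m assms length_fword[OF w, of A] by (subst nth_ins) (auto simp: lo)
  show "fword A (Suc k) (ins A i X w) ! m = ins A i (fleft k X w) (fword A k w) ! m"
  proof (cases "k < length w")
   case True
   then show ?thesis unfolding R using m assms
    by (auto simp: fword_def nth_ins nth_wcontract)
  next
   case False
   then show ?thesis unfolding R using m assms by (auto simp: fword_def nth_butlast nth_ins)
  qed
 qed
qed

lemma first_mismatch_face_before:
 assumes "first_mismatch X w Z i" "k < i"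
 shows "first_mismatch (fleft k X w) (fword A k w) (fright k w Z) (i - 1)"
proof -
 have w: "w ~= []" "k <= length w" using assms by (auto simp: first_mismatch_def)
 obtain j where j: "i = Suc j" using assms(2) by (cases i) auto
 show ?thesis using assms w unfolding first_mismatch_def length_fword[OF w] j
  by (auto simp: matched_face[OF w])
qed

lemma first_mismatch_face_after:
 assumes "first_mismatch X w Z i" "i < k" "k <= length w"
 shows "first_mismatch (fleft k X w) (fword A k w) (fright k w Z) i"
proof -
 have w: "w ~= []" "k <= length w" using assms by auto
 show ?thesis using assms w unfolding first_mismatch_def length_fword[OF w]
  by (auto simp: matched_face[OF w])
qed

lemma set_fword:
 assumes "x \<in> set (fword A i w)" "w ~= []" "i <= length w"
 shows "x \<in> set w | (0 < i & i < length w & x = mul A (w ! (i - 1)) (w ! i))"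
 using assms unfolding fword_def wcontract_def
 by (auto split: if_splits dest: in_set_takeD in_set_dropD in_set_butlastD list.set_sel(2))

context superadditive_category
begin

section \<open>The contracting homotopy on words\<close>

lemma mul_arrows: "x \<in> arrows A ==> y \<in> arrows A ==> tgt x = src y ==> mul A x y \<in> arrows A"
 using Comp_degree[of "src x" "tgt x" "tgt y" "mor x" "deg x" "mor y" "deg y"]
 by (simp add: arrows_def mul_def)

lemma idw_arrows: "X \<in> Obj A ==> idw A X \<in> arrows A"
 by (simp add: arrows_def idw_def Idn_degree)

lemma mul_idw: "x \<in> arrows A ==> mul A x (idw A (tgt x)) = x"
 by (auto simp: arrows_def mul_def idw_def Idn_right Mor_total prod_eq_iff)

lemma fword_arrows:
 assumes "set w <= arrows A" "w ~= []" "i <= length w" "matched X w Z i"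
 shows "set (fword A i w) <= arrows A"
proof
 fix x assume "x \<in> set (fword A i w)"
 from set_fword[OF this assms(2,3)] show "x \<in> arrows A"
 proof
  assume i: "0 < i & i < length w & x = mul A (w ! (i - 1)) (w ! i)"
  then have "w ! (i - 1) \<in> arrows A" "w ! i \<in> arrows A" using assms(1) by auto
  moreover have "tgt (w ! (i - 1)) = src (w ! i)" using assms(4) i by (simp add: matched_def lo_def ro_def)
  ultimately show ?thesis using i mul_arrows by simp
 qed (use assms in auto)
qed

lemma lo_Obj: "set w <= arrows A ==> X \<in> Obj A ==> i <= length w ==> lo X w i \<in> Obj A"
 using subsetD[of "set w" "arrows A" "w ! (i - 1)"] by (cases i) (auto simp: lo_def arrows_def)

lemma fleft_Obj: "set w <= arrows A ==> w ~= [] ==> X \<in> Obj A ==> fleft i X w \<in> Obj A"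
 by (cases w) (auto simp: fleft_def arrows_def)

lemma fright_Obj: "set w <= arrows A ==> w ~= [] ==> Z \<in> Obj A ==> fright i w Z \<in> Obj A"
 using subsetD[of "set w" "arrows A" "last w"] by (auto simp: fright_def arrows_def)

lemma ins_arrows: "set w <= arrows A ==> X \<in> Obj A ==> i <= length w ==> set (ins A i X w) <= arrows A"
 using idw_arrows lo_Obj by (auto simp: ins_def dest: in_set_takeD in_set_dropD)

text \<open>The identity is multiplied into its left neighbour. At \<open>i = 0\<close> there is
  none and the left outer action takes its place; at \<open>i = length w\<close> this is still an
  inner face of the longer word, so the last face never occurs here.\<close>

lemma face_ins_same:
 assumes w: "set w <= arrows A" and i: "i <= length w"
 shows "wface A l r i f X (ins A i X w) Z = (if i = 0 then l (idw A X) Z (f X w Z) else f X w Z)"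
proof (cases "i = 0")
 case True
 then show ?thesis by (simp add: wface_def outer_def fleft_def fword_def fright_def ins_def lo_def idw_def)
next
 case False
 then have a: "w ! (i - 1) \<in> arrows A" using w i by (auto intro!: nth_mem subsetD[OF w])
 have "wcontract A i (ins A i X w) = w"
 proof (rule nth_equalityI)
  show "length (wcontract A i (ins A i X w)) = length w"
   using False i by (subst length_wcontract) auto
  fix m assume "m < length (wcontract A i (ins A i X w))"
  then have "m < length w" using False i by (subst (asm) length_wcontract) auto
  then show "wcontract A i (ins A i X w) ! m = w ! m"
   using False i mul_idw[OF a] by (auto simp: nth_wcontract nth_ins lo_def)
 qed
 then show ?thesis using False i by (simp add: wface_def outer_def fleft_def fword_def fright_def)
qed

text \<open>Away from the new identity, faces and insertion commute with opposite signs and cancel.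
  Of the two faces next to the identity, the right one stays mismatched and drops out, and the left
  one returns the word. \<open>C\<close> collects values on which the outer actions respect
  signs.\<close>

theorem whtpy_homotopy:
 fixes f :: "('o, 'a, 'w::ab_group_add) wfam"
 assumes w: "set w <= arrows A" and X: "X \<in> Obj A" and Z: "Z \<in> Obj A"
  and i: "first_mismatch X w Z i"
  and l: "!!x Z \<phi>. x \<in> arrows A ==> Z \<in> Obj A ==> \<phi> \<in> C ==> l x Z (- \<phi>) = - l x Z \<phi>"
  and r: "!!x X \<phi>. x \<in> arrows A ==> X \<in> Obj A ==> \<phi> \<in> C ==> r X x (- \<phi>) = - r X x \<phi>"
  and C: "!!X w Z. X \<in> Obj A ==> Z \<in> Obj A ==> set w <= arrows A ==> f X w Z \<in> C"
 shows "wdiff A l r (whtpy A f) X w Z + whtpy A (wdiff A l r f) X w Z =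
  (if i = 0 then l (idw A X) Z (f X w Z) else f X w Z)"
proof -
 let ?n = "length w"
 let ?w' = "ins A i X w"
 have in': "i <= ?n" using i by (simp add: first_mismatch_def)
 define T where "T = (%k. if matched X ?w' Z k then wface A l r k f X ?w' Z else 0)"
 define S where "S = (%k. if matched X w Z k then wface A l r k (whtpy A f) X w Z else 0)"
 define U where "U = (%k. alt i (alt k (T k)))"
 have op: "outer l r k X w Z (alt j \<phi>) = alt j (outer l r k X w Z \<phi>)"
  if "\<phi> \<in> C" "w ~= []" for \<phi> j k
 proof -
  have "hd w \<in> arrows A" "last w \<in> arrows A" using w that by auto
  then show ?thesis using l r that X Z by (auto simp: outer_def alt_def)
 qed
 have h: "whtpy A (wdiff A l r f) X w Z = (\<Sum>k\<le>Suc ?n. U k)"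
  unfolding whtpy_eq[OF i] wdiff_def alt_sum U_def T_def using in' by simp
 have d: "wdiff A l r (whtpy A f) X w Z = (\<Sum>k\<le>?n. alt k (S k))"
  unfolding wdiff_def S_def by simp
 have Si: "S i = 0" using i by (simp add: S_def first_mismatch_def)
 \<comment> \<open>Joint \<open>Suc i\<close> of the longer word carries the old mismatch.\<close>
 have TSi: "T (Suc i) = 0"
  using i in' by (simp add: T_def matched_ins first_mismatch_def)
 have Ti: "T i = (if i = 0 then l (idw A X) Z (f X w Z) else f X w Z)"
  unfolding T_def by (simp only: face_ins_same[OF w in'] matched_ins[OF in' le_SucI[OF in']] if_True simp_thms less_irrefl if_False)
 \<comment> \<open>After a face at \<open>k < i\<close> the first mismatch is at
   \<open>i - 1\<close>; after one at \<open>k > i\<close> it stays at \<open>i\<close>, but the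
   face has index \<open>Suc k\<close> in the longer word. Either way there is exactly one change of
   sign.\<close>
 have before: "alt k (S k) = - U k" if k: "k < i" for k
 proof -
  have mk: "matched X w Z k" using i k by (simp add: first_mismatch_def)
  have ne: "w ~= []" "k <= ?n" using k in' by auto
  note fm = first_mismatch_face_before[OF i k, of A]
  let ?f = "f (fleft k X w) (ins A (i - 1) (fleft k X w) (fword A k w)) (fright k w Z)"
  have "set (ins A (i - 1) (fleft k X w) (fword A k w)) <= arrows A"
   using k in' length_fword[OF ne, of A] by (intro ins_arrows fword_arrows[OF w ne mk] fleft_Obj w X ne) auto
  then have fC: "?f \<in> C" using C fleft_Obj[OF w ne(1) X] fright_Obj[OF w ne(1) Z] by blast
  have "S k = outer l r k X w Z (alt (i - 1) ?f)"
   using mk by (simp add: S_def wface_def whtpy_eq[OF fm])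
  also have "... = alt (i - 1) (outer l r k X w Z ?f)" by (rule op[OF fC ne(1)])
  also have "outer l r k X w Z ?f = T k"
   using k in' mk by (simp add: T_def matched_ins wface_def face_ins_before)
  finally have "alt k (S k) = alt (k + (i - 1)) (T k)" by (simp add: alt_alt)
  moreover have "U k = alt (Suc (k + (i - 1))) (T k)" using k by (simp add: U_def alt_alt add.commute)
  ultimately show ?thesis by (simp add: alt_Suc)
 qed
 have after: "alt k (S k) = - U (Suc k)" if k: "i < k" "k <= ?n" for k
 proof (cases "matched X w Z k")
  case mk: True
  have ne: "w ~= []" "k <= ?n" using k by auto
  note fm = first_mismatch_face_after[OF i k, of A]
  let ?f = "f (fleft k X w) (ins A i (fleft k X w) (fword A k w)) (fright k w Z)"
  have "set (ins A i (fleft k X w) (fword A k w)) <= arrows A"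
   using k in' length_fword[OF ne, of A] by (intro ins_arrows fword_arrows[OF w ne mk] fleft_Obj w X ne) auto
  then have fC: "?f \<in> C" using C fleft_Obj[OF w ne(1) X] fright_Obj[OF w ne(1) Z] by blast
  have "S k = outer l r k X w Z (alt i ?f)"
   using mk by (simp add: S_def wface_def whtpy_eq[OF fm])
  also have "... = alt i (outer l r k X w Z ?f)" by (rule op[OF fC ne(1)])
  also have "outer l r k X w Z ?f = T (Suc k)"
   using k in' mk by (simp add: T_def matched_ins wface_def face_ins_after)
  finally have "alt k (S k) = alt (k + i) (T (Suc k))" by (simp add: alt_alt)
  then show ?thesis by (simp add: U_def alt_alt alt_Suc add.commute)
 next
  case False
  then show ?thesis using k in' by (simp add: S_def U_def T_def matched_ins)
 qed
 have "(\<Sum>k\<le>?n. alt k (S k)) = (\<Sum>k<i. alt k (S k)) + alt i (S i) + (\<Sum>k\<in>{Suc i..?n}. alt k (S k))"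
  by (rule sum_split_at[OF in'])
 also have "... = - (\<Sum>k<i. U k) - (\<Sum>k\<in>{Suc i..?n}. U (Suc k))"
  using Si by (simp add: before after sum_negf)
 finally have 1: "(\<Sum>k\<le>?n. alt k (S k)) = - (\<Sum>k<i. U k) - (\<Sum>k\<in>{Suc i..?n}. U (Suc k))" .
 have "(\<Sum>k\<le>Suc ?n. U k) = (\<Sum>k<i. U k) + U i + (U (Suc i) + (\<Sum>k\<in>{Suc (Suc i)..Suc ?n}. U k))"
  using sum_split_at[OF le_SucI[OF in'], of U] sum.atLeast_Suc_atMost[of "Suc i" "Suc ?n" U] in'
  by simp
 moreover have "(\<Sum>k\<in>{Suc (Suc i)..Suc ?n}. U k) = (\<Sum>k\<in>{Suc i..?n}. U (Suc k))"
  by (rule sum.shift_bounds_cl_Suc_ivl)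
 moreover have "U (Suc i) = 0" "U i = T i" by (auto simp: U_def TSi alt_alt) (simp add: alt_def)
 ultimately show ?thesis unfolding h d 1 Ti by simp
qed

text \<open>By \<open>composable_face\<close> every contributing face, being taken at a matched
  joint, is again a non-composable word.\<close>

lemma wdiff_not_composable:
 assumes f: "!!X w Z. ~ composable X w Z ==> f X w Z = 0" and nc: "~ composable X w Z"
  and w: "set w <= arrows A" and X: "X \<in> Obj A" and Z: "Z \<in> Obj A"
  and l: "!!x Z. x \<in> arrows A ==> Z \<in> Obj A ==> l x Z 0 = 0"
  and r: "!!x X. x \<in> arrows A ==> X \<in> Obj A ==> r X x 0 = 0"
 shows "wdiff A l r f X w Z = 0"
 unfolding wdiff_def
proof (rule sum.neutral, clarify)
 fix i assume "i <= length w"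
 show "alt i (if matched X w Z i then wface A l r i f X w Z else 0) = 0"
 proof (cases "matched X w Z i")
  case True
  have ne: "w ~= []" using True nc \<open>i <= length w\<close> by (auto simp: composable_def)
  have "~ composable (fleft i X w) (fword A i w) (fright i w Z)"
   unfolding composable_face[OF ne \<open>i <= length w\<close>] using True nc by (auto simp: composable_def)
  moreover have "hd w \<in> arrows A" "last w \<in> arrows A" using w ne by auto
  ultimately show ?thesis using f l r X Z by (simp add: wface_def outer_def)
 qed simp
qed

end

section \<open>Multilinear functions on matrices\<close>

definition tup :: "nat => (nat => bit => 'a set) => (bit * 'a) list set" where
 "tup n V = {xs. length xs = n & (\<forall>k<n. snd (xs ! k) \<in> V k (fst (xs ! k)))}"

text \<open>An update of slot \<open>k\<close> keeps its recorded degree, so linearity is asked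
  within each homogeneous component only.\<close>

definition mlin :: "('k => 'a::ab_group_add => 'a) => ('k => 'w::ab_group_add => 'w) => nat
  => (nat => bit => 'a set) => ((bit * 'a) list => 'w) => bool" where
 "mlin s t n V F \<longleftrightarrow> (\<forall>xs\<in>tup n V. \<forall>k<n.
   (\<forall>u\<in>V k (fst (xs ! k)). \<forall>v\<in>V k (fst (xs ! k)).
    F (xs[k := (fst (xs ! k), u + v)]) = F (xs[k := (fst (xs ! k), u)]) + F (xs[k := (fst (xs ! k), v)])) &
   (\<forall>c. \<forall>u\<in>V k (fst (xs ! k)).
    F (xs[k := (fst (xs ! k), s c u)]) = t c (F (xs[k := (fst (xs ! k), u)]))))"

definition lin_on :: "('k => 'a::ab_group_add => 'a) => ('k => 'w::ab_group_add => 'w) => 'a set => ('a => 'w) => bool" where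
 "lin_on s t U f \<longleftrightarrow> (\<forall>u\<in>U. \<forall>v\<in>U. f (u + v) = f u + f v) & (\<forall>c. \<forall>u\<in>U. f (s c u) = t c (f u))"

lemma mlin_iff: "mlin s t n V F \<longleftrightarrow>
 (\<forall>xs\<in>tup n V. \<forall>k<n. lin_on s t (V k (fst (xs ! k))) (%u. F (xs[k := (fst (xs ! k), u)])))"
 by (simp add: mlin_def lin_on_def)

lemma mlinI:
 assumes "!!xs k. xs \<in> tup n V ==> k < n ==> lin_on s t (V k (fst (xs ! k))) (%u. F (xs[k := (fst (xs ! k), u)]))"
 shows "mlin s t n V F"
 using assms by (simp add: mlin_iff)

lemma mlinD:
 assumes "mlin s t n V F" "xs \<in> tup n V" "k < n" "d = fst (xs ! k)"
 shows "lin_on s t (V k d) (%u. F (xs[k := (d, u)]))"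
 using assms by (simp add: mlin_iff)

lemma tup_update: "xs \<in> tup n V ==> u \<in> V k (fst (xs ! k)) ==> xs[k := (fst (xs ! k), u)] \<in> tup n V"
 by (cases "k < length xs") (auto simp: tup_def nth_list_update)

lemma lin_on_zero: "vector_space t ==> lin_on s t U (%_. 0)"
 by (simp add: lin_on_def module.scale_zero_right module_iff_vector_space)

lemma lin_on_add: "vector_space t ==> lin_on s t U f ==> lin_on s t U g ==> lin_on s t U (%u. f u + g u)"
 by (simp add: lin_on_def module.scale_right_distrib module_iff_vector_space)

lemma lin_on_scale:
 assumes "vector_space t" "lin_on s t U f"
 shows "lin_on s t U (%u. t c (f u))"
proof -
 interpret vector_space t by fact
 show ?thesis using assms(2) by (simp add: lin_on_def scale_right_distrib mult.commute)
qed

lemma lin_on_sum: "vector_space t ==> (!!i. i \<in> I ==> lin_on s t U (f i)) ==> lin_on s t U (%u. \<Sum>i\<in>I. f i u)"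
 by (induction I rule: infinite_finite_induct) (auto intro: lin_on_zero lin_on_add)

lemma lin_on_0:
 assumes "vector_space s" "vector_space t" "lin_on s t U f" "u \<in> U"
 shows "f 0 = 0"
proof -
 interpret s: vector_space s by fact
 interpret t: vector_space t by fact
 have "f (s 0 u) = t 0 (f u)" using assms(3,4) unfolding lin_on_def by blast
 then show ?thesis by simp
qed

lemma lin_on_finite_sum:
 assumes "vector_space s" "vector_space t" "lin_on s t U f" "subspc s U" "finite I"
  "!!i. i \<in> I ==> u i \<in> U"
 shows "f (\<Sum>i\<in>I. u i) = (\<Sum>i\<in>I. f (u i))"
proof -
 interpret vector_space s by fact
 show ?thesis using assms(5,6)
 proof (induction I rule: finite_induct)
  case empty
  then show ?case using lin_on_0[OF assms(1-3) subspace_0[OF assms(4)]] by simp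
 next
  case (insert i I)
  then show ?case using assms(3) subspace_sum[OF assms(4), of I u] by (simp add: lin_on_def)
 qed
qed

lemma mlin_zero: "vector_space t ==> mlin s t n V (%_. 0)"
 by (simp add: mlin_iff lin_on_zero)

lemma mlin_add: "vector_space t ==> mlin s t n V F ==> mlin s t n V G ==> mlin s t n V (%xs. F xs + G xs)"
 by (simp add: mlin_iff lin_on_add)

lemma mlin_scale: "vector_space t ==> mlin s t n V F ==> mlin s t n V (%xs. t c (F xs))"
 by (rule mlinI, rule lin_on_scale, assumption, rule mlinD) auto

lemma mlin_sum: "vector_space t ==> (!!i. i \<in> I ==> mlin s t n V (F i)) ==> mlin s t n V (%xs. \<Sum>i\<in>I. F i xs)"
 by (simp add: mlin_iff lin_on_sum)

lemma mlin_alt: "vector_space t ==> mlin s t n V F ==> mlin s t n V (%xs. alt i (F xs))"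
 using mlin_scale[of t s n V F "(-1) ^ i"] alt_scale[of t] by simp

lemma mlin_diff:
 assumes "vector_space t" "mlin s t n V F" "mlin s t n V G"
 shows "mlin s t n V (%xs. F xs - G xs)"
 using mlin_add[OF assms(1,2) mlin_alt[OF assms(1,3), of 1]] by (simp add: alt_def)

lemma mlin_zero_entry:
 assumes "vector_space s" "vector_space t" "mlin s t n V F" "xs \<in> tup n V" "k < n" "snd (xs ! k) = 0"
 shows "F xs = 0"
proof -
 have "lin_on s t (V k (fst (xs ! k))) (%u. F (xs[k := (fst (xs ! k), u)]))"
  using assms by (simp add: mlin_iff)
 moreover have "0 \<in> V k (fst (xs ! k))" using assms(4-6) by (auto simp: tup_def)
 ultimately have "F (xs[k := (fst (xs ! k), 0)]) = 0" using lin_on_0[OF assms(1,2)] by blast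
 then show ?thesis using assms(6) by (metis list_update_id prod.collapse)
qed

lemma mlin_Cons:
 assumes "mlin s t (Suc n) (%_. V) F" "snd x \<in> V (fst x)"
 shows "mlin s t n (%_. V) (%xs. F (x # xs))"
proof (rule mlinI)
 fix xs k assume "xs \<in> tup n (%_. V)" "k < n"
 then have "x # xs \<in> tup (Suc n) (%_. V)" "Suc k < Suc n"
  using assms(2) by (auto simp: tup_def nth_Cons')
 from mlinD[OF assms(1) this refl] show "lin_on s t (V (fst (xs ! k))) (%u. F (x # xs[k := (fst (xs ! k), u)]))"
  by simp
qed

lemma mlin_head:
 assumes "mlin s t (Suc n) (%_. V) F" "xs \<in> tup n (%_. V)" "x \<in> V d"
 shows "lin_on s t (V d) (%x. F ((d, x) # xs))"
proof -
 have "(d, x) # xs \<in> tup (Suc n) (%_. V)" using assms by (auto simp: tup_def nth_Cons')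
 from mlinD[OF assms(1) this, of 0 d] show ?thesis by simp
qed

text \<open>Serves the outer faces, where one entry leaves the list and acts on the value at the
  remaining ones.\<close>

lemma mlin_hd:
 assumes H: "!!x. snd x \<in> V (fst x) ==> mlin s t n (%_. V) (H x)"
  and lin: "!!d xs. xs \<in> tup n (%_. V) ==> lin_on s t (V d) (%x. H (d, x) xs)"
 shows "mlin s t (Suc n) (%_. V) (%xs. H (hd xs) (tl xs))"
proof (rule mlinI)
 fix xs k assume xs: "xs \<in> tup (Suc n) (%_. V)" and k: "k < Suc n"
 obtain y ys where e: "xs = y # ys" using xs by (cases xs) (auto simp: tup_def)
 have ys: "ys \<in> tup n (%_. V)" "snd y \<in> V (fst y)" using xs by (auto simp: tup_def e)
 show "lin_on s t (V (fst (xs ! k))) (%u. H (hd (xs[k := (fst (xs ! k), u)])) (tl (xs[k := (fst (xs ! k), u)])))"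
 proof (cases k)
  case 0
  then show ?thesis using lin[OF ys(1)] by (simp add: e)
 next
  case (Suc j)
  then show ?thesis using mlinD[OF H[OF ys(2)] ys(1), of j] k by (simp add: e)
 qed
qed

lemma mlin_last:
 assumes H: "!!x. snd x \<in> V (fst x) ==> mlin s t n (%_. V) (H x)"
  and lin: "!!d xs. xs \<in> tup n (%_. V) ==> lin_on s t (V d) (%x. H (d, x) xs)"
 shows "mlin s t (Suc n) (%_. V) (%xs. H (last xs) (butlast xs))"
proof (rule mlinI)
 fix xs k assume xs: "xs \<in> tup (Suc n) (%_. V)" and k: "k < Suc n"
 obtain y ys where e: "xs = ys @ [y]" using xs by (cases xs rule: rev_cases) (auto simp: tup_def)
 have ys: "ys \<in> tup n (%_. V)" "snd y \<in> V (fst y)"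
  using xs by (auto simp: tup_def e nth_append split: if_splits)
 have l: "length ys = n" using ys by (simp add: tup_def)
 show "lin_on s t (V (fst (xs ! k))) (%u. H (last (xs[k := (fst (xs ! k), u)])) (butlast (xs[k := (fst (xs ! k), u)])))"
 proof (cases "k = n")
  case True
  then show ?thesis using lin[OF ys(1)] by (simp add: e l[symmetric])
 next
  case False
  then show ?thesis using mlinD[OF H[OF ys(2)] ys(1), of k] k by (simp add: e l list_update_append nth_append)
 qed
qed

locale finite_superadditive_category = superadditive_category A
 for A :: "('k::field, 'o, 'a::ab_group_add) scat" +
 assumes finite_Obj: "finite (Obj A)"
begin

section \<open>Matrix units and multilinear functions on the superalgebra\<close>

abbreviation "L \<equiv> superalgebra A"
abbreviation LM :: "bit => ('o => 'o => 'a) set" where "LM d \<equiv> Mor L () () d"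
abbreviation LC :: "('o => 'o => 'a) => ('o => 'o => 'a) => ('o => 'o => 'a)" where "LC \<equiv> Comp L () () ()"

lemma Obj_L: "Obj L = {()}" by (simp add: superalgebra_def)
lemma Scale_L: "Scale L c f X Y = Scale A c (f X Y)" by (simp add: superalgebra_def)

lemma LM_iff: "f \<in> LM d \<longleftrightarrow> (\<forall>X Y. if X \<in> Obj A & Y \<in> Obj A then f X Y \<in> Mor A X Y d else f X Y = 0)"
 by (simp add: superalgebra_def)

lemma LC_apply: "LC f g X Z = (if X \<in> Obj A & Z \<in> Obj A then \<Sum>Y\<in>Obj A. Comp A X Y Z (f X Y) (g Y Z) else 0)"
 by (simp add: superalgebra_def)

lemma vector_space_L: "vector_space (Scale L)"
 using vector_space_fun[OF vector_space_fun[OF vector_space]] by (simp add: superalgebra_def)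

lemma LM_iff2: "f \<in> LM d \<longleftrightarrow> (\<forall>X\<in>Obj A. \<forall>Y\<in>Obj A. f X Y \<in> Mor A X Y d) &
  (\<forall>X Y. ~ (X \<in> Obj A & Y \<in> Obj A) --> f X Y = 0)"
 unfolding LM_iff by metis

lemma LM_subspace: "subspc (Scale L) (LM d)"
proof -
 interpret vector_space "Scale A" by (rule vector_space)
 show ?thesis
  unfolding subspace_iff[OF vector_space_L] Ball_def[of "LM d"] LM_iff2
  using Mor_closed[where i = d] by (simp add: Scale_L)
qed

lemmas LM_closed = LM_subspace[unfolded subspace_iff[OF vector_space_L]]

lemma LC_degree:
 assumes "f \<in> LM i" "g \<in> LM j"
 shows "LC f g \<in> LM (i + j)"
proof -
 have "LC f g X Z \<in> Mor A X Z (i + j)" if "X \<in> Obj A" "Z \<in> Obj A" for X Z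
 proof -
  have "(\<Sum>Y\<in>Obj A. Comp A X Y Z (f X Y) (g Y Z)) \<in> Mor A X Z (i + j)"
  proof (rule module.subspace_sum)
   show "module (Scale A)" by (simp add: module_iff_vector_space vector_space)
   show "subspc (Scale A) (Mor A X Z (i + j))" by (rule Mor_subspace[OF that])
   show "Comp A X Y Z (f X Y) (g Y Z) \<in> Mor A X Z (i + j)" if "Y \<in> Obj A" for Y
    using assms \<open>X \<in> Obj A\<close> \<open>Z \<in> Obj A\<close> that unfolding LM_iff by (intro Comp_degree) metis+
  qed
  then show ?thesis using that by (simp add: LC_apply)
 qed
 then show ?thesis unfolding LM_iff by (simp add: LC_apply)
qed

lemma LC_lin_left:
 assumes "g \<in> LM j"
 shows "lin_on (Scale L) (Scale L) (LM i) (%f. LC f g)"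
 unfolding lin_on_def
proof safe
 have g: "g X Y \<in> Mor A X Y j" if "X \<in> Obj A" "Y \<in> Obj A" for X Y
  using assms that unfolding LM_iff by metis
 fix f assume "f \<in> LM i"
 then have f: "f X Y \<in> Mor A X Y i" if "X \<in> Obj A" "Y \<in> Obj A" for X Y
  using that unfolding LM_iff by metis
 interpret vector_space "Scale A" by (rule vector_space)
 show "LC (Scale L c f) g = Scale L c (LC f g)" for c
  using f g by (auto simp: fun_eq_iff LC_apply Scale_L scale_sum_right intro!: sum.cong Comp_scale[THEN conjunct1])
 fix f' assume "f' \<in> LM i"
 then have f': "f' X Y \<in> Mor A X Y i" if "X \<in> Obj A" "Y \<in> Obj A" for X Y
  using that unfolding LM_iff by metis
 show "LC (f + f') g = LC f g + LC f' g"
  using f f' g by (auto simp: fun_eq_iff LC_apply sum.distrib[symmetric] intro!: sum.cong Comp_add_left)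
qed

lemma LC_lin_right:
 assumes "f \<in> LM i"
 shows "lin_on (Scale L) (Scale L) (LM j) (%g. LC f g)"
 unfolding lin_on_def
proof safe
 have f: "f X Y \<in> Mor A X Y i" if "X \<in> Obj A" "Y \<in> Obj A" for X Y
  using assms that unfolding LM_iff by metis
 fix g assume "g \<in> LM j"
 then have g: "g X Y \<in> Mor A X Y j" if "X \<in> Obj A" "Y \<in> Obj A" for X Y
  using that unfolding LM_iff by metis
 interpret vector_space "Scale A" by (rule vector_space)
 show "LC f (Scale L c g) = Scale L c (LC f g)" for c
  using f g by (auto simp: fun_eq_iff LC_apply Scale_L scale_sum_right intro!: sum.cong Comp_scale[THEN conjunct2])
 fix g' assume "g' \<in> LM j"
 then have g': "g' X Y \<in> Mor A X Y j" if "X \<in> Obj A" "Y \<in> Obj A" for X Y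
  using that unfolding LM_iff by metis
 show "LC f (g + g') = LC f g + LC f g'"
  using f g g' by (auto simp: fun_eq_iff LC_apply sum.distrib[symmetric] intro!: sum.cong Comp_add_right)
qed

abbreviation um :: "('o, 'a) arrow => 'o => 'o => 'a" where "um x \<equiv> munit (src x) (tgt x) (mor x)"

lemma munit_LM: "X \<in> Obj A ==> Y \<in> Obj A ==> a \<in> Mor A X Y d ==> munit X Y a \<in> LM d"
 using Mor_0 by (auto simp: LM_iff munit_def)

lemma munit_lin: "lin_on (Scale A) (Scale L) U (munit X Y)"
proof -
 interpret vector_space "Scale A" by (rule vector_space)
 show ?thesis by (auto simp: lin_on_def munit_def fun_eq_iff Scale_L)
qed

lemma munit_0 [simp]: "munit X Y 0 = 0" by (auto simp: munit_def fun_eq_iff)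

lemma um_LM: "x \<in> arrows A ==> um x \<in> LM (deg x)"
 by (simp add: arrows_def munit_LM)

lemma LC_munit:
 assumes "X \<in> Obj A" "Y \<in> Obj A" "Y' \<in> Obj A" "Z \<in> Obj A" "a \<in> Mor A X Y i" "b \<in> Mor A Y' Z j"
 shows "LC (munit X Y a) (munit Y' Z b) = (if Y = Y' then munit X Z (Comp A X Y Z a b) else 0)"
proof (intro ext)
 fix U W
 have "(\<Sum>V\<in>Obj A. Comp A U V W (munit X Y a U V) (munit Y' Z b V W)) =
  (if U = X & W = Z & Y = Y' then Comp A X Y Z a b else 0)" if "U \<in> Obj A" "W \<in> Obj A"
 proof -
  have "Comp A U V W (munit X Y a U V) (munit Y' Z b V W) =
   (if V = Y then if U = X & W = Z & Y = Y' then Comp A X Y Z a b else 0 else 0)" if "V \<in> Obj A" for V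
  proof -
   have "munit X Y a \<in> LM i" "munit Y' Z b \<in> LM j" using assms munit_LM by auto
   then have "munit X Y a U V \<in> Mor A U V i" "munit Y' Z b V W \<in> Mor A V W j"
    using \<open>U \<in> Obj A\<close> \<open>W \<in> Obj A\<close> that unfolding LM_iff by metis+
   then show ?thesis
    using Comp_0_left[OF \<open>U \<in> Obj A\<close> that \<open>W \<in> Obj A\<close>] Comp_0_right[OF \<open>U \<in> Obj A\<close> that \<open>W \<in> Obj A\<close>]
    by (auto simp: munit_def split: if_splits)
  qed
  then show ?thesis using assms finite_Obj by (simp add: sum.delta)
 qed
 then show "LC (munit X Y a) (munit Y' Z b) U W = (if Y = Y' then munit X Z (Comp A X Y Z a b) else 0) U W"
  using assms by (auto simp: LC_apply munit_def)
qed

lemma LC_um: "x \<in> arrows A ==> y \<in> arrows A ==> LC (um x) (um y) = (if tgt x = src y then um (mul A x y) else 0)"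
 using LC_munit[of "src x" "tgt x" "src y" "tgt y" "mor x" "deg x" "mor y" "deg y"]
 by (auto simp: arrows_def mul_def)

lemma munit_expansion:
 assumes "f \<in> LM d"
 shows "f = (\<Sum>p\<in>Obj A \<times> Obj A. munit (fst p) (snd p) (f (fst p) (snd p)))"
proof (intro ext)
 fix X Y
 have "(\<Sum>p\<in>Obj A \<times> Obj A. munit (fst p) (snd p) (f (fst p) (snd p))) X Y =
  (\<Sum>p\<in>Obj A \<times> Obj A. munit (fst p) (snd p) (f (fst p) (snd p)) X Y)"
  by (induction rule: infinite_finite_induct) auto
 also have "... = (\<Sum>p\<in>Obj A \<times> Obj A. if p = (X, Y) then f X Y else 0)"
  by (rule sum.cong) (auto simp: munit_def)
 also have "... = f X Y"
 proof (cases "X \<in> Obj A & Y \<in> Obj A")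
  case True
  then show ?thesis using finite_Obj by (simp add: sum.delta)
 next
  case False
  then have "f X Y = 0" using assms unfolding LM_iff by metis
  then show ?thesis by (auto intro!: sum.neutral)
 qed
 finally show "f X Y = (\<Sum>p\<in>Obj A \<times> Obj A. munit (fst p) (snd p) (f (fst p) (snd p))) X Y" by simp
qed

definition ul :: "('o, 'a) arrow list => (bit * ('o => 'o => 'a)) list" where
 "ul w = map (%x. (deg x, um x)) w"

abbreviation "Ltup n \<equiv> tup n (%_. Mor L () ())"
abbreviation "Lmlin t n \<equiv> mlin (Scale L) t n (%_. Mor L () ())"

lemma length_ul [simp]: "length (ul w) = length w" by (simp add: ul_def)

lemma ul_Ltup: "set w <= arrows A ==> ul w \<in> Ltup (length w)"
proof -
 assume "set w <= arrows A"
 then have "um (w ! k) \<in> LM (deg (w ! k))" if "k < length w" for k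
  using that by (intro um_LM) auto
 then show ?thesis by (simp add: tup_def ul_def)
qed

lemma degsum_ul: "degsum (ul w) = sum_list (map deg w)"
 by (simp add: ul_def comp_def)

text \<open>Each entry in turn is expanded into matrix units. All words occur in the expansion,
  including those with mismatched joints.\<close>

lemma Lmlin_eq_0:
 assumes t: "vector_space t" and "Lmlin t n F" and "!!w. set w <= arrows A ==> length w = n ==> F (ul w) = 0"
  and "xs \<in> Ltup n"
 shows "F xs = 0"
 using assms(2-4)
proof (induction n arbitrary: F xs)
 case 0
 then show ?case using 0(2)[of "[]"] by (simp add: tup_def ul_def)
next
 case (Suc n)
 obtain d x ys where e: "xs = (d, x) # ys" using Suc(4) by (cases xs) (auto simp: tup_def)
 have x: "x \<in> LM d" and ys: "ys \<in> Ltup n" using Suc(4) by (auto simp: tup_def e)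
 have in_LM: "munit (fst p) (snd p) (x (fst p) (snd p)) \<in> LM d"
  and ar: "(p, d, x (fst p) (snd p)) \<in> arrows A" if "p \<in> Obj A \<times> Obj A" for p
 proof -
  have "x (fst p) (snd p) \<in> Mor A (fst p) (snd p) d" using x that unfolding LM_iff by (auto split: if_splits)
  then show "munit (fst p) (snd p) (x (fst p) (snd p)) \<in> LM d" "(p, d, x (fst p) (snd p)) \<in> arrows A"
   using that by (auto simp: arrows_def intro!: munit_LM)
 qed
 have "F xs = F ((d, \<Sum>p\<in>Obj A \<times> Obj A. munit (fst p) (snd p) (x (fst p) (snd p))) # ys)"
  using munit_expansion[OF x] by (simp add: e)
 also have "... = (\<Sum>p\<in>Obj A \<times> Obj A. F ((d, munit (fst p) (snd p) (x (fst p) (snd p))) # ys))"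
  using finite_Obj in_LM
  by (intro lin_on_finite_sum[OF vector_space_L t mlin_head[OF Suc(2) ys x] LM_subspace]) auto
 also have "... = 0"
 proof (rule sum.neutral, rule ballI)
  fix p assume p: "p \<in> Obj A \<times> Obj A"
  let ?x = "(d, munit (fst p) (snd p) (x (fst p) (snd p)))"
  show "F (?x # ys) = 0"
  proof (rule Suc(1)[of "%l. F (?x # l)"])
   show "Lmlin t n (%l. F (?x # l))" using mlin_Cons[OF Suc(2)] in_LM[OF p] by simp
   fix w assume "set w <= arrows A" "length w = n"
   then show "F (?x # ul w) = 0"
    using Suc(3)[of "(p, d, x (fst p) (snd p)) # w"] ar[OF p] by (simp add: ul_def)
  qed (rule ys)
 qed
 finally show ?case .
qed

definition PL :: "nat => ('o \<times> 'o) list set" where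
 "PL n = {ps. set ps <= Obj A \<times> Obj A & length ps = n}"

lemma finite_PL: "finite (PL n)"
 unfolding PL_def by (intro finite_lists_length_eq finite_cartesian_product finite_Obj)

abbreviation slots :: "('o \<times> 'o) list => nat => bit => 'a set" where
 "slots ps k d \<equiv> Mor A (fst (ps ! k)) (snd (ps ! k)) d"

definition wmlin :: "('k => 'w::ab_group_add => 'w) => nat => (('o, 'a) arrow list => 'w) => bool" where
 "wmlin t n g \<longleftrightarrow> (\<forall>ps\<in>PL n. mlin (Scale A) t n (slots ps) (%al. g (zip ps al)))"

definition entries :: "('o \<times> 'o) list => (bit * ('o => 'o => 'a)) list => (bit * 'a) list" where
 "entries ps xs = map2 (%p x. (fst x, snd x (fst p) (snd p))) ps xs"

text \<open>Every matrix is expanded into its entries, which is forced for a multilinear function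
  with prescribed values on words. \<open>PL\<close> runs over all lists of positions, composable or
  not.\<close>

definition exw :: "(('o, 'a) arrow list => 'w::ab_group_add) => (bit * ('o => 'o => 'a)) list => 'w" where
 "exw g xs = (\<Sum>ps\<in>PL (length xs). g (zip ps (entries ps xs)))"

lemma PL_nth: "ps \<in> PL n ==> k < n ==> fst (ps ! k) \<in> Obj A & snd (ps ! k) \<in> Obj A"
proof -
 assume "ps \<in> PL n" "k < n"
 then have "ps ! k \<in> Obj A \<times> Obj A" using nth_mem[of k ps] by (auto simp: PL_def)
 then show ?thesis by (simp add: mem_Times_iff)
qed

lemma entries_tup:
 assumes "ps \<in> PL n" "xs \<in> Ltup n"
 shows "entries ps xs \<in> tup n (slots ps)"
proof -
 have "snd (xs ! k) (fst (ps ! k)) (snd (ps ! k)) \<in> slots ps k (fst (xs ! k))" if "k < n" for k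
 proof -
  have "snd (xs ! k) \<in> LM (fst (xs ! k))" using assms that by (simp add: tup_def)
  then show ?thesis using PL_nth[OF assms(1) that] unfolding LM_iff by metis
 qed
 then show ?thesis using assms by (auto simp: tup_def entries_def PL_def)
qed

lemma exw_mlin:
 assumes t: "vector_space t" and g: "wmlin t n g"
 shows "Lmlin t n (exw g)"
proof -
 have "Lmlin t n (%xs. \<Sum>ps\<in>PL n. g (zip ps (entries ps xs)))"
 proof (rule mlin_sum[OF t], rule mlinI)
  fix ps xs k assume ps: "ps \<in> PL n" and xs: "xs \<in> Ltup n" and k: "k < n"
  let ?d = "fst (xs ! k)"
  have l: "length ps = n" "length xs = n" using ps xs by (auto simp: PL_def tup_def)
  have upd: "entries ps (xs[k := (?d, u)]) = (entries ps xs)[k := (?d, u (fst (ps ! k)) (snd (ps ! k)))]" for u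
   using k l by (intro nth_equalityI) (auto simp: entries_def nth_list_update)
  have d: "?d = fst (entries ps xs ! k)" using k l by (simp add: entries_def)
  have lin: "lin_on (Scale A) t (slots ps k ?d) (%a. g (zip ps ((entries ps xs)[k := (?d, a)])))"
   by (rule mlinD[OF _ entries_tup[OF ps xs] k d]) (use g ps in \<open>simp add: wmlin_def\<close>)
  have "u (fst (ps ! k)) (snd (ps ! k)) \<in> slots ps k ?d" if "u \<in> LM ?d" for u
   using that PL_nth[OF ps k] unfolding LM_iff by metis
  then show "lin_on (Scale L) t (LM ?d) (%u. g (zip ps (entries ps (xs[k := (?d, u)]))))"
   using lin unfolding lin_on_def upd by (simp add: Scale_L)
 qed
 \<comment> \<open>\<open>exw\<close> sums over position lists as long as its argument; on
   \<open>tup n\<close> this length is \<open>n\<close>.\<close>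
 moreover have "tup n V = {xs \<in> tup n V. length xs = n}" for V :: "nat => bit => 'x set"
  by (auto simp: tup_def)
 ultimately show ?thesis unfolding mlin_def exw_def by (simp add: tup_def)
qed

lemma exw_ul:
 assumes t: "vector_space t" and g: "wmlin t n g" and w: "set w <= arrows A" "length w = n"
 shows "exw g (ul w) = g w"
proof -
 have "fst x \<in> Obj A \<times> Obj A" if "x \<in> arrows A" for x
  using that by (cases x) (auto simp: arrows_def)
 then have P: "map fst w \<in> PL n" using w by (auto simp: PL_def)
 have eq: "zip (map fst w) (entries (map fst w) (ul w)) = w"
  by (rule nth_equalityI) (auto simp: entries_def ul_def munit_def prod_eq_iff)
 \<comment> \<open>At any other list of positions some matrix unit has entry 0, and multilinearity
   makes the summand vanish.\<close>
 have "g (zip ps (entries ps (ul w))) = (if ps = map fst w then g w else 0)" if ps: "ps \<in> PL n" for ps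
 proof (cases "ps = map fst w")
  case False
  have l: "length ps = n" using ps by (simp add: PL_def)
  then obtain k where k: "k < n" "ps ! k ~= fst (w ! k)"
   using False w(2) by (metis length_map nth_equalityI nth_map)
  have "snd (entries ps (ul w) ! k) = 0"
   using k l w(2) by (auto simp: entries_def ul_def munit_def prod_eq_iff)
  then show ?thesis
   using False mlin_zero_entry[OF vector_space t _ entries_tup[OF ps] k(1)] g ps ul_Ltup w
   by (auto simp: wmlin_def)
 qed (simp add: eq)
 then show ?thesis using P finite_PL w by (simp add: exw_def sum.delta)
qed

section \<open>Contractions of tuples of matrices\<close>

lemma contract_L: "contract L us i xs = take (i - 1) xs @
  (fst (xs ! (i - 1)) + fst (xs ! i), LC (snd (xs ! (i - 1))) (snd (xs ! i))) # drop (Suc i) xs"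
 by (simp add: contract_def)

lemma contract_Ltup:
 assumes "xs \<in> Ltup (Suc n)" "0 < i" "i <= n"
 shows "contract L us i xs \<in> Ltup n"
proof -
 have x: "snd (xs ! k) \<in> LM (fst (xs ! k))" if "k <= n" for k using assms(1) that by (simp add: tup_def)
 have l: "length xs = Suc n" using assms by (simp add: tup_def)
 define e where "e = fst (xs ! (i - 1)) + fst (xs ! i)"
 have "LC (snd (xs ! (i - 1))) (snd (xs ! i)) \<in> LM e"
  unfolding e_def using assms by (intro LC_degree x) auto
 then show ?thesis unfolding contract_L e_def[symmetric] using assms(2,3) x l
  by (auto simp: tup_def nth_append nth_Cons' min_def)
qed

lemma contract_ul:
 assumes w: "set w <= arrows A" and i: "0 < i" "i < length w"
 shows "contract L us i (ul w) = (if tgt (w ! (i - 1)) = src (w ! i) then ul (wcontract A i w)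
  else take (i - 1) (ul w) @ (deg (w ! (i - 1)) + deg (w ! i), 0) # drop (Suc i) (ul w))"
proof -
 have "w ! (i - 1) \<in> arrows A" "w ! i \<in> arrows A" using w i by auto
 then show ?thesis using i LC_um
  by (auto simp: contract_L ul_def wcontract_def take_map drop_map mul_def)
qed

lemma contract_ul_zero:
 assumes t: "vector_space t" and F: "Lmlin t n F" and w: "set w <= arrows A" "length w = Suc n" and i: "0 < i" "i <= n"
  and ne: "tgt (w ! (i - 1)) ~= src (w ! i)"
 shows "F (contract L us i (ul w)) = 0"
proof -
 have c: "contract L us i (ul w) \<in> Ltup n"
  using contract_Ltup[OF _ i] ul_Ltup[OF w(1)] w(2) by simp
 have "contract L us i (ul w) ! (i - 1) = (deg (w ! (i - 1)) + deg (w ! i), 0)"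
  using i w ne by (simp add: contract_ul nth_append)
 then show ?thesis using mlin_zero_entry[OF vector_space_L t F c, of "i - 1"] i by simp
qed

text \<open>Slots \<open>i - 1\<close> and \<open>i\<close> both act through the product in slot
  \<open>i - 1\<close> of the contracted tuple; later slots move down by one.\<close>

lemma mlin_contract:
 assumes t: "vector_space t" and F: "Lmlin t n F" and i: "0 < i" "i <= n"
 shows "Lmlin t (Suc n) (%xs. F (contract L us i xs))"
proof (rule mlinI)
 fix xs k assume xs: "xs \<in> Ltup (Suc n)" and k: "k < Suc n"
 have l: "length xs = Suc n" using xs by (simp add: tup_def)
 let ?d = "fst (xs ! k)"
 let ?ys = "contract L us i xs"
 have ys: "?ys \<in> Ltup n" by (rule contract_Ltup[OF xs i])
 have x: "snd (xs ! j) \<in> LM (fst (xs ! j))" if "j <= n" for j using xs that by (simp add: tup_def)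
 have nth: "?ys ! j = (if j < i - 1 then xs ! j else if j = i - 1 then
   (fst (xs ! (i - 1)) + fst (xs ! i), LC (snd (xs ! (i - 1))) (snd (xs ! i))) else xs ! Suc j)" if "j < n" for j
  using that i l by (auto simp: contract_L nth_append nth_Cons')
 consider "k = i - 1" | "k = i" | "k < i - 1" | "i < k" by linarith
 then show "lin_on (Scale L) t (LM ?d) (%u. F (contract L us i (xs[k := (?d, u)])))"
 proof cases
  case 1
  have e: "contract L us i (xs[k := (?d, u)]) = ?ys[i - 1 := (fst (?ys ! (i - 1)), LC u (snd (xs ! i)))]" for u
   using i l 1 by (simp add: contract_L list_update_append nth_append)
  have "lin_on (Scale L) t (LM (fst (?ys ! (i - 1)))) (%u. F (?ys[i - 1 := (fst (?ys ! (i - 1)), u)]))"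
   using i by (intro mlinD[OF F ys]) auto
  moreover have "fst (?ys ! (i - 1)) = ?d + fst (xs ! i)" using nth[of "i - 1"] i 1 by simp
  ultimately show ?thesis unfolding e
   using LC_lin_left[OF x[OF i(2)], of ?d] LC_degree[OF _ x[OF i(2)], of _ ?d] by (simp add: lin_on_def)
 next
  case 2
  have i1: "i - 1 <= n" using i by simp
  have e: "contract L us i (xs[k := (?d, u)]) = ?ys[i - 1 := (fst (?ys ! (i - 1)), LC (snd (xs ! (i - 1))) u)]" for u
   using i l 2 by (simp add: contract_L list_update_append nth_append)
  have "lin_on (Scale L) t (LM (fst (?ys ! (i - 1)))) (%u. F (?ys[i - 1 := (fst (?ys ! (i - 1)), u)]))"
   using i by (intro mlinD[OF F ys]) auto
  moreover have "fst (?ys ! (i - 1)) = fst (xs ! (i - 1)) + ?d" using nth[of "i - 1"] i 2 by simp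
  ultimately show ?thesis unfolding e
   using LC_lin_right[OF x[OF i1], of ?d] LC_degree[OF x[OF i1], of _ ?d] by (simp add: lin_on_def)
 next
  case 3
  have e: "contract L us i (xs[k := (?d, u)]) = ?ys[k := (?d, u)]" for u
   using i l 3 by (simp add: contract_L list_update_append take_update_swap)
  show ?thesis unfolding e using 3 i nth[of k] by (intro mlinD[OF F ys]) auto
 next
  case 4
  then obtain k' where k': "k = Suc k'" by (cases k) auto
  have e: "contract L us i (xs[k := (?d, u)]) = ?ys[k' := (?d, u)]" for u
   using i l 4 k unfolding k'
   by (auto simp: contract_L list_update_append drop_update_swap Suc_diff_le split: nat.splits)
  show ?thesis unfolding e using 4 i k nth[of k'] unfolding k' by (intro mlinD[OF F ys]) auto
 qed
qed

end

lemma mlin_cong: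
 assumes "mlin s t n V F" "!!k. k < n ==> V k = V' k" "!!xs. length xs = n ==> F xs = G xs"
 shows "mlin s t n V' G"
proof -
 have "tup n V' = tup n V" using assms(2) by (auto simp: tup_def)
 then show ?thesis using assms unfolding mlin_def by (simp add: tup_def)
qed

lemma mlin_insert:
 assumes F: "mlin s t (Suc n) V' F" and i: "i <= n" and e: "snd e \<in> V' i (fst e)"
  and V: "!!k. k < n ==> V k = V' (if k < i then k else Suc k)"
 shows "mlin s t n V (%xs. F (take i xs @ e # drop i xs))"
proof (rule mlinI)
 fix xs k assume xs: "xs \<in> tup n V" and k: "k < n"
 let ?I = "%xs. take i xs @ e # drop i xs"
 let ?k = "if k < i then k else Suc k"
 have l: "length xs = n" using xs by (simp add: tup_def)
 have base: "snd (xs ! m) \<in> V m (fst (xs ! m))" if "m < n" for m using xs that by (simp add: tup_def)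
 have "snd (?I xs ! m) \<in> V' m (fst (?I xs ! m))" if "m < Suc n" for m
 proof -
  consider "m < i" | "m = i" | m' where "m = Suc m'" "i <= m'" by (cases m) (auto, linarith)
  then show ?thesis
  proof cases
   case 1
   then show ?thesis using base[of m] V[of m] i l by (auto simp: nth_append)
  next
   case 2
   then show ?thesis using e i l by (simp add: nth_append)
  next
   case 3
   then show ?thesis using base[of m'] V[of m'] i l that by (auto simp: nth_append nth_Cons' Suc_diff_le)
  qed
 qed
 then have Ixs: "?I xs \<in> tup (Suc n) V'" using l i by (simp add: tup_def)
 have upd: "?I (xs[k := (d, u)]) = (?I xs)[?k := (d, u)]" for d u
  using l i k by (auto simp: list_update_append take_update_swap drop_update_swap Suc_diff_le list_update_beyond)
 have fk: "fst (xs ! k) = fst (?I xs ! ?k)"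
  using l i k by (auto simp: nth_append Suc_diff_le)
 have "?k < Suc n" using k by simp
 from mlinD[OF F Ixs this fk]
 show "lin_on s t (V k (fst (xs ! k))) (%u. F (?I (xs[k := (fst (xs ! k), u)])))"
  unfolding upd V[OF k] .
qed

text \<open>Joints depend on the objects alone. For a fixed list of positions the case distinctions
  in \<open>comp_fam\<close> and \<open>whtpy\<close> are therefore constant in the morphisms, and
  these families stay multilinear.\<close>

lemma lo_cong: "map fst w = map fst w' ==> k <= length w ==> lo X w k = lo X w' k"
proof -
 assume m: "map fst w = map fst w'" "k <= length w"
 then have "length w = length w'" by (metis length_map)
 then have "fst (w ! j) = fst (w' ! j)" if "j < length w" for j using m that by (metis nth_map)
 then show ?thesis using m(2) by (auto simp: lo_def)
qed

lemma ro_cong: "map fst w = map fst w' ==> k <= length w ==> ro w Z k = ro w' Z k"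
proof -
 assume m: "map fst w = map fst w'" "k <= length w"
 then have l: "length w = length w'" by (metis length_map)
 then have "fst (w ! j) = fst (w' ! j)" if "j < length w" for j using m that by (metis nth_map)
 then show ?thesis using m(2) l by (auto simp: ro_def)
qed

lemma matched_cong: "map fst w = map fst w' ==> k <= length w ==> matched X w Z k = matched X w' Z k"
 unfolding matched_def by (metis lo_cong ro_cong)

lemma composable_cong: "map fst w = map fst w' ==> composable X w Z = composable X w' Z"
 unfolding composable_def using matched_cong by (metis length_map)

lemma first_mismatch_cong: "map fst w = map fst w' ==> first_mismatch X w Z i = first_mismatch X w' Z i"
 unfolding first_mismatch_def using matched_cong length_map by (metis le_trans less_imp_le)

section \<open>Paths of the category as composable words\<close>

definition wd :: "'o list => (bit * 'a) list => ('o, 'a) arrow list" where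
 "wd ys al = zip (zip (butlast ys) (tl ys)) al"

text \<open>Families supported on the composable words are the cochains on the category.\<close>

definition comp_fam :: "('o list => (bit * 'a) list => 'w::ab_group_add) => ('o, 'a, 'w) wfam" where
 "comp_fam G X w Z = (if composable X w Z then G (X # map tgt w) (map snd w) else 0)"

context
 fixes ys :: "'o list" and al :: "(bit * 'a) list" and n :: nat
 assumes l: "length ys = Suc n" "length al = n"
begin

lemma path_ne: "ys ~= []" using l by auto

lemma length_wd: "length (wd ys al) = n" using l by (simp add: wd_def)

lemma nth_wd: "k < n ==> wd ys al ! k = ((ys ! k, ys ! Suc k), al ! k)"
 using l by (simp add: wd_def nth_butlast nth_tl)

lemma map_snd_wd: "map snd (wd ys al) = al"
 using l by (simp add: wd_def)

lemma map_tgt_wd: "hd ys # map tgt (wd ys al) = ys"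
proof (rule nth_equalityI)
 fix k assume "k < length (hd ys # map tgt (wd ys al))"
 then show "(hd ys # map tgt (wd ys al)) ! k = ys ! k"
  using l by (cases k) (auto simp: length_wd nth_wd hd_conv_nth[OF path_ne])
qed (simp add: length_wd l)

lemma lo_wd: "k <= n ==> lo (hd ys) (wd ys al) k = ys ! k"
 using l by (cases k) (auto simp: lo_def nth_wd hd_conv_nth[OF path_ne])

lemma ro_wd: "k <= n ==> ro (wd ys al) (last ys) k = ys ! k"
 using l last_conv_nth[OF path_ne] by (auto simp: ro_def length_wd nth_wd)

lemma composable_wd: "composable (hd ys) (wd ys al) (last ys)"
 by (simp add: composable_def matched_def length_wd lo_wd ro_wd)

lemma comp_fam_wd: "comp_fam G (hd ys) (wd ys al) (last ys) = G ys al"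
 by (simp add: comp_fam_def composable_wd map_tgt_wd map_snd_wd)

end

lemma unit_arrows_wd:
 assumes "length ys = Suc n" "length al = n"
 shows "unit_arrows ys al = map (%x. (deg x, munit (src x) (tgt x) (mor x))) (wd ys al)"
 by (rule nth_equalityI) (auto simp: unit_arrows_def length_wd[OF assms] nth_wd[OF assms] assms)

text \<open>Matched joints make the sources redundant, so \<open>X\<close> and the targets determine
  the word up to its morphisms; this inverts \<open>wd\<close>.\<close>

lemma composable_path:
 assumes "composable X w Z"
 shows "wd (X # map tgt w) (map snd w) = w" "last (X # map tgt w) = Z" "hd (X # map tgt w) = X"
proof -
 have m: "lo X w k = ro w Z k" if "k <= length w" for k
  using assms that by (simp add: composable_def matched_def)
 have l: "length (X # map tgt w) = Suc (length w)" "length (map snd w) = length w" by auto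
 show "wd (X # map tgt w) (map snd w) = w"
 proof (rule nth_equalityI)
  fix k assume "k < length (wd (X # map tgt w) (map snd w))"
  then have k: "k < length w" by (simp only: length_wd[OF l])
  have "(X # map tgt w) ! k = src (w ! k)" using m[of k] k by (cases k) (auto simp: lo_def ro_def)
  then show "wd (X # map tgt w) (map snd w) ! k = w ! k"
   using k by (simp add: nth_wd[OF l] prod_eq_iff)
 qed (simp only: length_wd[OF l])
 show "last (X # map tgt w) = Z" using m[of "length w"] by (auto simp: lo_def ro_def last_conv_nth)
qed simp

definition path_face :: "('k, 'o, 'a) scat => nat => 'o list => (bit * 'a) list => (bit * 'a) list" where
 "path_face A i ys al = (if i = 0 then tl al else if i < length al then contract A ys i al else butlast al)"

lemma length_remove_nth: "i < length ys ==> length (remove_nth i ys) = length ys - 1"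
 by (simp add: remove_nth_def)

lemma nth_remove_nth: "i < length ys ==> k < length ys - 1 ==> remove_nth i ys ! k = ys ! (if k < i then k else Suc k)"
 by (auto simp: remove_nth_def nth_append min_def)

lemma remove_nth_0: "remove_nth 0 ys = tl ys"
 by (simp add: remove_nth_def drop_Suc)

lemma remove_nth_last: "length ys = Suc n ==> remove_nth n ys = butlast ys"
 by (simp add: remove_nth_def butlast_conv_take)

lemma nth_contract: "0 < i ==> i < length xs ==> k < length xs - 1 ==>
 contract A ys i xs ! k = (if Suc k < i then xs ! k else if Suc k = i then
  (fst (xs ! (i - 1)) + fst (xs ! i), Comp A (ys ! (i - 1)) (ys ! i) (ys ! (i + 1)) (snd (xs ! (i - 1))) (snd (xs ! i)))
  else xs ! Suc k)"
 by (auto simp: contract_def nth_append nth_Cons' less_Suc_eq)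

lemma length_path_face: "al ~= [] ==> i <= length al ==> length (path_face A i ys al) = length al - 1"
 by (simp add: path_face_def contract_def, arith)

lemma face_wd:
 assumes ys: "length ys = Suc (Suc n)" and al: "length al = Suc n" and i: "i <= Suc n"
 shows "fword A i (wd ys al) = wd (remove_nth i ys) (path_face A i ys al)"
  and "fleft i (hd ys) (wd ys al) = hd (remove_nth i ys)"
  and "fright i (wd ys al) (last ys) = last (remove_nth i ys)"
proof -
 note l = ys al
 have iy: "i < length ys" using i ys by simp
 have l': "length (remove_nth i ys) = Suc n" "length (path_face A i ys al) = n"
  using i l length_path_face[of al i A ys] by (auto simp: length_remove_nth simp flip: length_greater_0_conv)
 have ne: "wd ys al ~= []" using length_wd[OF l] by auto
 have i': "i <= length (wd ys al)" using i length_wd[OF l] by simp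
 show "fword A i (wd ys al) = wd (remove_nth i ys) (path_face A i ys al)"
 proof (rule nth_equalityI)
  show "length (fword A i (wd ys al)) = length (wd (remove_nth i ys) (path_face A i ys al))"
   by (simp add: length_fword[OF ne i'] length_wd[OF l] length_wd[OF l'])
  fix k assume "k < length (fword A i (wd ys al))"
  then have k: "k < n" by (simp add: length_fword[OF ne i'] length_wd[OF l])
  consider "i = 0" | "i = Suc n" | "0 < i" "i < Suc n" using i by linarith
  then show "fword A i (wd ys al) ! k = wd (remove_nth i ys) (path_face A i ys al) ! k"
  proof cases
   case 1
   then show ?thesis using k l
    unfolding nth_wd[OF l' k]
    by (simp add: nth_wd[OF l] nth_remove_nth fword_def path_face_def nth_tl length_wd[OF l])
  next
   case 2
   then show ?thesis using k l
    unfolding nth_wd[OF l' k]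
    by (simp add: nth_wd[OF l] nth_remove_nth fword_def path_face_def nth_butlast length_wd[OF l])
  next
   case 3
   then have lt: "i < length (wd ys al)" by (simp add: length_wd[OF l])
   have a: "wd ys al ! (i - 1) = ((ys ! (i - 1), ys ! i), al ! (i - 1))"
    using 3 nth_wd[OF l, of "i - 1"] by simp
   have b: "wd ys al ! i = ((ys ! i, ys ! Suc i), al ! i)"
    using 3 nth_wd[OF l, of i] by simp
   have c: "wd ys al ! k = ((ys ! k, ys ! Suc k), al ! k)" "wd ys al ! Suc k = ((ys ! Suc k, ys ! Suc (Suc k)), al ! Suc k)"
    using k nth_wd[OF l] by simp_all
   have "fword A i (wd ys al) ! k = (if Suc k < i then wd ys al ! k else if Suc k = i then
     mul A (wd ys al ! (i - 1)) (wd ys al ! i) else wd ys al ! Suc k)"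
    using 3 k lt length_wd[OF l] by (simp add: fword_def nth_wcontract)
   moreover have "path_face A i ys al ! k = (if Suc k < i then al ! k else if Suc k = i then
    (fst (al ! (i - 1)) + fst (al ! i), Comp A (ys ! (i - 1)) (ys ! i) (ys ! (i + 1)) (snd (al ! (i - 1))) (snd (al ! i)))
     else al ! Suc k)"
    using 3 k al by (simp add: path_face_def nth_contract)
   ultimately show ?thesis
    unfolding nth_wd[OF l' k] a b c using 3 k l iy
    by (cases "Suc k = i") (auto simp: nth_remove_nth mul_def)
  qed
 qed
 have nr: "remove_nth i ys ~= []" using l' by auto
 show "fleft i (hd ys) (wd ys al) = hd (remove_nth i ys)"
  using l iy hd_conv_nth[OF nr] hd_conv_nth[OF ne] hd_conv_nth[OF path_ne[OF l]]
  by (auto simp: fleft_def nth_wd[OF l] nth_remove_nth)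
 show "fright i (wd ys al) (last ys) = last (remove_nth i ys)"
  using l l' i last_conv_nth[OF nr] last_conv_nth[OF ne] last_conv_nth[OF path_ne[OF l]]
  by (auto simp: fright_def nth_wd[OF l] nth_remove_nth length_wd[OF l])
qed

lemma wdiff_comp_fam:
 assumes "length ys = Suc (Suc n)" "length al = Suc n"
 shows "wdiff A l r (comp_fam G) (hd ys) (wd ys al) (last ys) =
  (\<Sum>i\<le>Suc n. alt i (outer l r i (hd ys) (wd ys al) (last ys) (G (remove_nth i ys) (path_face A i ys al))))"
 unfolding wdiff_def length_wd[OF assms]
proof (rule sum.cong[OF refl])
 fix i assume "i \<in> {..Suc n}"
 then have i: "i <= Suc n" by simp
 have "matched (hd ys) (wd ys al) (last ys) i"
  using composable_wd[OF assms] i length_wd[OF assms] by (simp add: composable_def)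
 moreover have "al ~= []" using assms by auto
 then have l': "length (remove_nth i ys) = Suc n" "length (path_face A i ys al) = n"
  using i assms by (simp_all add: length_remove_nth length_path_face)
 ultimately show "alt i (if matched (hd ys) (wd ys al) (last ys) i
   then wface A l r i (comp_fam G) (hd ys) (wd ys al) (last ys) else 0) =
  alt i (outer l r i (hd ys) (wd ys al) (last ys) (G (remove_nth i ys) (path_face A i ys al)))"
  by (simp add: wface_def face_wd[OF assms i] comp_fam_wd[OF l'])
qed

lemma outer_wd:
 assumes "length ys = Suc (Suc n)" "length al = Suc n"
 shows "outer l r i (hd ys) (wd ys al) (last ys) \<phi> =
  (if i = 0 then l ((ys ! 0, ys ! 1), hd al) (last ys) \<phi> else if i < Suc n then \<phi>
   else r (hd ys) ((ys ! n, ys ! Suc n), last al) \<phi>)"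
proof -
 have "wd ys al ~= []" "al ~= []" using length_wd[OF assms] assms by auto
 then show ?thesis
  using assms by (simp add: outer_def hd_conv_nth last_conv_nth length_wd[OF assms] nth_wd[OF assms])
qed

context finite_superadditive_category
begin

abbreviation "Atup n ys \<equiv> tup n (%k. Mor A (ys ! k) (ys ! Suc k))"

lemma wd_arrows:
 assumes "ys \<in> obj_tuples A n" "al \<in> arrow_tuples A ys"
 shows "set (wd ys al) <= arrows A"
proof
 have l: "length ys = Suc n" "length al = n" using assms by (auto simp: obj_tuples_def arrow_tuples_def)
 fix x assume "x \<in> set (wd ys al)"
 then obtain k where "k < n" "x = ((ys ! k, ys ! Suc k), al ! k)"
  using nth_wd[OF l] length_wd[OF l] by (metis in_set_conv_nth)
 moreover have "set ys <= Obj A" using assms by (simp add: obj_tuples_def)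
 ultimately show "x \<in> arrows A" using assms l
  by (auto simp: arrows_def arrow_tuples_def)
qed

lemma composable_tuples:
 assumes "composable X w Z" "set w <= arrows A" "X \<in> Obj A"
 shows "X # map tgt w \<in> obj_tuples A (length w)" "map snd w \<in> arrow_tuples A (X # map tgt w)"
proof -
 show o: "X # map tgt w \<in> obj_tuples A (length w)" using assms by (auto simp: obj_tuples_def arrows_def)
 have l: "length (X # map tgt w) = Suc (length w)" "length (map snd w) = length w" by auto
 have "mor (w ! k) \<in> Mor A ((X # map tgt w) ! k) ((X # map tgt w) ! Suc k) (deg (w ! k))" if k: "k < length w" for k
 proof -
  have "w ! k \<in> arrows A" using assms(2) k by auto
  moreover have "w ! k = (((X # map tgt w) ! k, (X # map tgt w) ! Suc k), map snd w ! k)"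
   using nth_wd[OF l k] composable_path(1)[OF assms(1)] by simp
  ultimately show ?thesis by (metis (no_types, lifting) arrows_def fst_conv mem_Collect_eq snd_conv)
 qed
 then show "map snd w \<in> arrow_tuples A (X # map tgt w)"
  by (simp add: arrow_tuples_def)
qed

lemma obj_tuples_hd_last:
 assumes "ys \<in> obj_tuples A n"
 shows "hd ys \<in> Obj A" "last ys \<in> Obj A"
 using assms by (auto simp: obj_tuples_def neq_Nil_conv length_Suc_conv)

lemma wmlin_comp_fam:
 assumes t: "vector_space t" and X: "X \<in> Obj A"
  and G: "!!ys. ys \<in> obj_tuples A n ==> mlin (Scale A) t n (%k. Mor A (ys ! k) (ys ! Suc k)) (G ys)"
 shows "wmlin t n (%w. comp_fam G X w Z)"
 unfolding wmlin_def
proof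
 fix ps assume ps: "ps \<in> PL n"
 have lps: "length ps = n" using ps by (simp add: PL_def)
 \<comment> \<open>A dummy list of morphisms: composability depends on the objects only, so it can
   be decided here once for all lists of length \<open>n\<close>.\<close>
 let ?al = "replicate n undefined :: (bit * 'a) list"
 have mf: "map fst (zip ps al) = ps" if "length al = n" for al :: "(bit * 'a) list"
  using that lps by simp
 have c: "composable X (zip ps al) Z = composable X (zip ps ?al) Z" if "length al = n" for al :: "(bit * 'a) list"
  by (rule composable_cong) (simp add: lps that)
 show "mlin (Scale A) t n (slots ps) (%al. comp_fam G X (zip ps al) Z)"
 proof (cases "composable X (zip ps ?al) Z")
  case True
  have tg: "map tgt (zip ps al) = map snd ps" if "length al = n" for al :: "(bit * 'a) list"
   using that lps by (simp add: comp_def[of snd fst, symmetric] flip: map_map)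
  let ?ys = "X # map snd ps"
  have ys: "?ys \<in> obj_tuples A n" using X ps by (auto simp: obj_tuples_def PL_def)
  show ?thesis
  proof (rule mlin_cong[OF G[OF ys]])
   fix k assume k: "k < n"
   have "lo X (zip ps ?al) k = ro (zip ps ?al) Z k" using True k lps by (simp add: composable_def matched_def)
   then have "?ys ! k = fst (ps ! k)" using k lps by (cases k) (auto simp: lo_def ro_def)
   then show "Mor A (?ys ! k) (?ys ! Suc k) = slots ps k" using k lps by simp
  next
   fix al :: "(bit * 'a) list" assume al: "length al = n"
   then show "G ?ys al = comp_fam G X (zip ps al) Z"
    using True c[OF al] tg[OF al] lps by (simp add: comp_fam_def)
  qed
 next
  case False
  show ?thesis
  proof (rule mlin_cong[OF mlin_zero[OF t]])
   fix al :: "(bit * 'a) list" assume al: "length al = n"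
   show "0 = comp_fam G X (zip ps al) Z" using False c[OF al] by (simp add: comp_fam_def)
  qed simp
 qed
qed

lemma wmlin_whtpy:
 assumes t: "vector_space t" and X: "X \<in> Obj A" and f: "wmlin t (Suc n) (%w. f X w Z)"
 shows "wmlin t n (%w. whtpy A f X w Z)"
 unfolding wmlin_def
proof
 fix ps assume ps: "ps \<in> PL n"
 have lps: "length ps = n" using ps by (simp add: PL_def)
 let ?al = "replicate n undefined :: (bit * 'a) list"
 have mf: "map fst (zip ps al) = map fst (zip ps ?al)" if "length al = n" for al :: "(bit * 'a) list"
  using that lps by simp
 show "mlin (Scale A) t n (slots ps) (%al. whtpy A f X (zip ps al) Z)"
 proof (cases "composable X (zip ps ?al) Z")
  case True
  show ?thesis
  proof (rule mlin_cong[OF mlin_zero[OF t]])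
   fix al :: "(bit * 'a) list" assume al: "length al = n"
   show "0 = whtpy A f X (zip ps al) Z"
    using True composable_cong[OF mf[OF al], of X Z] by (simp add: whtpy_def)
  qed simp
 next
  case False
  then obtain i where i: "first_mismatch X (zip ps ?al) Z i" using False[unfolded not_composable_iff] by blast
  then have i': "i <= n" using lps by (simp add: first_mismatch_def)
  let ?Y = "lo X (zip ps ?al) i"
  have Y: "?Y \<in> Obj A" using X PL_nth[OF ps, of "i - 1"] i' lps by (cases i) (auto simp: lo_def)
  \<comment> \<open>Positions of the longer word. The identity occupies the diagonal position at its
    object; fixing the entry of that slot leaves a multilinear function of the others.\<close>
  let ?ps = "take i ps @ (?Y, ?Y) # drop i ps"
  have ps': "?ps \<in> PL (Suc n)" using ps Y i' by (auto simp: PL_def dest: in_set_takeD in_set_dropD)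
  have "mlin (Scale A) t (Suc n) (slots ?ps) (%al. f X (zip ?ps al) Z)"
   using f ps' by (simp add: wmlin_def)
  from mlin_insert[OF this i', of "(0, Idn A ?Y)" "slots ps"]
  have "mlin (Scale A) t n (slots ps) (%al. f X (zip ?ps (take i al @ (0, Idn A ?Y) # drop i al)) Z)"
   using Idn_degree[OF Y] i' lps by (simp add: nth_append Suc_diff_le)
  then show ?thesis
  proof (rule mlin_cong[OF mlin_alt[OF t, where i = i]])
   fix al :: "(bit * 'a) list" assume al: "length al = n"
   have fm: "first_mismatch X (zip ps al) Z i" using i first_mismatch_cong[OF mf[OF al]] by blast
   have "ins A i X (zip ps al) = zip ?ps (take i al @ (0, Idn A ?Y) # drop i al)"
    using lo_cong[OF mf[OF al], of i X] al lps i'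
    by (simp add: ins_def idw_def zip_append take_zip drop_zip)
   then show "alt i (f X (zip ?ps (take i al @ (0, Idn A ?Y) # drop i al)) Z) = whtpy A f X (zip ps al) Z"
    by (simp add: whtpy_eq[OF fm])
  qed auto
 qed
qed

end

section \<open>Complexes of multilinear functions\<close>

text \<open>Degrees are to be handled by the ring laws of the integers modulo 2.\<close>

declare add_bit_eq_xor [simp del] mult_bit_eq_and [simp del]

lemma degsum_contract:
 assumes "0 < i" "i < length xs"
 shows "degsum (contract B us i xs) = degsum xs"
proof -
 have "xs = take (i - 1) xs @ xs ! (i - 1) # xs ! i # drop (Suc i) xs"
  using assms by (metis Cons_nth_drop_Suc Suc_diff_1 Suc_lessD append_take_drop_id less_imp_diff_less)
 then have "degsum xs = degsum (take (i - 1) xs @ xs ! (i - 1) # xs ! i # drop (Suc i) xs)" by simp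
 then show ?thesis by (simp add: contract_def add.assoc)
qed

text \<open>Linearity of the differential is required only on numerators and up to denominators:
  cochains live on ambient spaces, and the actions are bilinear only on homogeneous parts.\<close>

lemma cohomology_subspaces:
 assumes s: "vector_space s" "!!n. scl (C n) = s"
  and num: "!!n i. subspc s (num (C n) i)" and den: "!!n i. subspc s (den (C n) i)"
  and add: "!!n i x y. x \<in> num (C n) i ==> y \<in> num (C n) i ==>
   d n i (x + y) - (d n i x + d n i y) \<in> den (C (Suc n)) i"
  and scale: "!!n i c x. x \<in> num (C n) i ==> d n i (s c x) - s c (d n i x) \<in> den (C (Suc n)) i"
  and d0: "!!n i. d n i 0 \<in> den (C (Suc n)) i"
 shows "subspc s (num (cohomology C d n) i)" "subspc s (den (cohomology C d n) i)"
proof -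
 interpret vector_space s by fact
 note N = num[unfolded subspace_iff[OF s(1)]] and D = den[unfolded subspace_iff[OF s(1)]]
 have D2: "x - y \<in> den (C n) i" if "x \<in> den (C n) i" "y \<in> den (C n) i" for x y n i
  using subspace_diff[OF den that] .
 show "subspc s (num (cohomology C d n) i)"
  unfolding subspace_iff[OF s(1)]
 proof (intro conjI ballI allI)
  show "0 \<in> num (cohomology C d n) i" using N d0 by (simp add: cohomology_def)
  fix x assume x: "x \<in> num (cohomology C d n) i"
  then have x': "x \<in> num (C n) i" "d n i x \<in> den (C (Suc n)) i" by (auto simp: cohomology_def)
  show "s c x \<in> num (cohomology C d n) i" for c
  proof -
   have "(d n i (s c x) - s c (d n i x)) + s c (d n i x) \<in> den (C (Suc n)) i"
    using scale[OF x'(1)] x'(2) D by blast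
   then show ?thesis using N x' by (simp add: cohomology_def)
  qed
  fix y assume y: "y \<in> num (cohomology C d n) i"
  then have y': "y \<in> num (C n) i" "d n i y \<in> den (C (Suc n)) i" by (auto simp: cohomology_def)
  have "(d n i (x + y) - (d n i x + d n i y)) + (d n i x + d n i y) \<in> den (C (Suc n)) i"
   using add[OF x'(1) y'(1)] x'(2) y'(2) D by blast
  then show "x + y \<in> num (cohomology C d n) i" using N x' y' by (simp add: cohomology_def)
 qed
 show "subspc s (den (cohomology C d n) i)"
 proof (cases n)
  case 0
  then show ?thesis using den by (simp add: cohomology_def)
 next
  case (Suc m)
  \<comment> \<open>Membership rewritten as a congruence to a coboundary, in which the linearity
    defects of \<open>d\<close> can be absorbed into the denominator.\<close>
  have E: "x \<in> den (cohomology C d n) i \<longleftrightarrow> (\<exists>g\<in>num (C m) i. x - d m i g \<in> den (C n) i)" for x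
  proof
   assume "x \<in> den (cohomology C d n) i"
   then obtain g e where "g \<in> num (C m) i" "e \<in> den (C n) i" "x = d m i g + e"
    by (auto simp: cohomology_def Suc set_plus_def)
   then show "\<exists>g\<in>num (C m) i. x - d m i g \<in> den (C n) i" by (metis add_diff_cancel_left')
  next
   assume "\<exists>g\<in>num (C m) i. x - d m i g \<in> den (C n) i"
   then obtain g where "g \<in> num (C m) i" "x - d m i g \<in> den (C n) i" by blast
   then have "d m i g + (x - d m i g) \<in> d m i ` num (C m) i + den (C n) i" by (blast intro: set_plus_intro)
   then show "x \<in> den (cohomology C d n) i" by (simp add: cohomology_def Suc)
  qed
  show ?thesis unfolding subspace_iff[OF s(1)]
  proof (intro conjI ballI allI)
   show "0 \<in> den (cohomology C d n) i"
    unfolding E using N D2[OF _ d0, of 0 m i] D Suc by (metis diff_0)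
   fix x assume x: "x \<in> den (cohomology C d n) i"
   then obtain g where g: "g \<in> num (C m) i" "x - d m i g \<in> den (C n) i" unfolding E by blast
   show "s c x \<in> den (cohomology C d n) i" for c
   proof -
    have "s c (x - d m i g) - (d m i (s c g) - s c (d m i g)) \<in> den (C n) i"
     using scale[OF g(1)] g(2) D D2 Suc by metis
    then have "s c x - d m i (s c g) \<in> den (C n) i" by (simp add: scale_right_diff_distrib algebra_simps)
    then show ?thesis unfolding E using N g by blast
   qed
   fix y assume y: "y \<in> den (cohomology C d n) i"
   then obtain h where h: "h \<in> num (C m) i" "y - d m i h \<in> den (C n) i" unfolding E by blast
   have "((x - d m i g) + (y - d m i h)) - (d m i (g + h) - (d m i g + d m i h)) \<in> den (C n) i"
    using add[OF g(1) h(1)] g(2) h(2) D D2 Suc by metis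
   then have "x + y - d m i (g + h) \<in> den (C n) i" by (simp add: algebra_simps)
   then show "x + y \<in> den (cohomology C d n) i" unfolding E using N g h by blast
  qed
 qed
qed

lemma prod_subspaces:
 assumes s: "vector_space s"
  and num: "!!p. p \<in> I ==> subspc s (num (V p) i)"
  and den: "!!p. p \<in> I ==> subspc s (den (V p) i)"
 shows "subspc (%c x p. s c (x p)) (num (prod_sspace s I V) i)"
  "subspc (%c x p. s c (x p)) (den (prod_sspace s I V) i)"
proof -
 interpret vector_space s by fact
 show "subspc (%c x p. s c (x p)) (num (prod_sspace s I V) i)"
  "subspc (%c x p. s c (x p)) (den (prod_sspace s I V) i)"
  using num den unfolding subspace_iff[OF vector_space_fun[OF s]] subspace_iff[OF s]
  by (auto simp: prod_sspace_def)
qed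

lemma hom_subspaces:
 assumes t: "vector_space (scl T)" and s: "vector_space s" and W: "!!i. subspc s (W i)"
 shows "subspc (%c f x. s c (f x)) (num (hom_sspace T s W) i)"
  "subspc (%c f x. s c (f x)) (den (hom_sspace T s W) i)"
proof -
 interpret vector_space s by fact
 note W' = W[unfolded subspace_iff[OF s]]
 show "subspc (%c f x. s c (f x)) (num (hom_sspace T s W) i)"
  "subspc (%c f x. s c (f x)) (den (hom_sspace T s W) i)"
  using W' unfolding subspace_iff[OF vector_space_fun[OF s]]
  by (auto simp: hom_sspace_def linear_iff[OF t s] image_subset_iff algebra_simps scale_right_distrib)
qed

lemma tup_iff_arrow_tuples: "length ys = Suc n ==> arrow_tuples A ys = tup n (%k. Mor A (ys ! k) (ys ! Suc k))"
 by (auto simp: arrow_tuples_def tup_def)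

lemma degsum_update: "k < length xs ==> degsum (xs[k := (fst (xs ! k), u)]) = degsum xs"
 by (metis (no_types, lifting) fst_conv list_update_id map_update nth_map)

text \<open>Universal property of the tensor product: a linear map on the free space kills the
  relators exactly when its values on the generators are multilinear. The condition on degrees
  likewise needs checking on generators only.\<close>

lemma hom_arrow_tensor_num_iff:
 fixes s :: "'k::field => 'w::ab_group_add => 'w"
 assumes ys: "length ys = Suc n" and s: "vector_space s" and W: "!!i. subspc s (W i)"
 shows "f \<in> num (hom_sspace (arrow_tensor A ys) s W) j \<longleftrightarrow>
  lin_map pscale s f & mlin (Scale A) s n (%k. Mor A (ys ! k) (ys ! Suc k)) (%xs. f (basis xs)) &
  (\<forall>xs\<in>arrow_tuples A ys. f (basis xs) \<in> W (j + degsum xs))" (is "?l \<longleftrightarrow> ?r")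
proof -
 interpret vector_space s by fact
 let ?V = "%k. Mor A (ys ! k) (ys ! Suc k)"
 note P = vs_pscale
 have at: "arrow_tuples A ys = tup n ?V" by (rule tup_iff_arrow_tuples[OF ys])
 let ?R = "%i. \<Union>xs\<in>{xs \<in> arrow_tuples A ys. degsum xs = i}. \<Union>k<length xs.
      slot_relators (Scale A) (?V k (fst (xs ! k))) (%a. xs[k := (fst (xs ! k), a)])"
 show ?thesis
 proof
  assume f: ?l
  then have lin: "lin_map pscale s f" by (simp add: hom_sspace_def arrow_tensor_def)
  have R: "f x = 0" if "x \<in> ?R i" for x i
  proof -
   have "x \<in> module.span pscale (?R i)" using that by (rule module.span_base[OF P[unfolded module_iff_vector_space[symmetric]]])
   moreover have "f ` den (arrow_tensor A ys) i <= {0}" using f by (simp add: hom_sspace_def)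
   ultimately show ?thesis by (auto simp: arrow_tensor_def)
  qed
  have "mlin (Scale A) s n ?V (%xs. f (basis xs))"
   unfolding mlin_def
  proof (intro ballI allI impI conjI)
   fix xs k assume xs: "xs \<in> tup n ?V" and k: "k < n"
   let ?b = "%u. basis (xs[k := (fst (xs ! k), u)]) :: _ \<Rightarrow>\<^sub>0 'k"
   have kl: "k < length xs" using xs k by (simp add: tup_def)
   have "x \<in> ?R (degsum xs)" if "x \<in> slot_relators (Scale A) (?V k (fst (xs ! k))) (%a. xs[k := (fst (xs ! k), a)])" for x
    using that kl xs at by blast
   note R' = R[OF this]
   show "f (?b (u + v)) = f (?b u) + f (?b v)" if "u \<in> ?V k (fst (xs ! k))" "v \<in> ?V k (fst (xs ! k))" for u v
   proof -
    have "f (?b (u + v) - ?b u - ?b v) = 0" using that by (intro R') (auto simp: slot_relators_def)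
    moreover have "f (?b (u + v)) = f ((?b (u + v) - ?b u - ?b v) + ?b u + ?b v)" by simp
    ultimately show ?thesis using lin unfolding linear_iff[OF P s] by (metis add_0)
   qed
   show "f (?b (Scale A c u)) = s c (f (?b u))" if "u \<in> ?V k (fst (xs ! k))" for c u
   proof -
    have "f (?b (Scale A c u) - pscale c (?b u)) = 0" using that by (intro R') (auto simp: slot_relators_def)
    moreover have "f (?b (Scale A c u)) = f ((?b (Scale A c u) - pscale c (?b u)) + pscale c (?b u))" by simp
    ultimately show ?thesis using lin unfolding linear_iff[OF P s] by (metis add_0)
   qed
  qed
  moreover have "f (basis xs) \<in> W (j + degsum xs)" if "xs \<in> arrow_tuples A ys" for xs
  proof -
   have "basis xs \<in> num (arrow_tensor A ys) (degsum xs)" using that by (simp add: arrow_tensor_def)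
   then show ?thesis using f by (auto simp: hom_sspace_def)
  qed
  ultimately show ?r using lin by blast
 next
  assume r: ?r
  then have lin: "lin_map pscale s f" and ml: "mlin (Scale A) s n ?V (%xs. f (basis xs))" by auto
  have "f x \<in> W (j + i)" if x: "x \<in> num (arrow_tensor A ys) i" for x i
  proof -
   have "f x = lext s (%g. f (basis g)) x" by (rule linear_eq_lext[OF s lin])
   also have "... \<in> W (j + i)"
    unfolding lext_def using x r
    by (intro subspace_sum[OF W] subspace_scale[OF W]) (auto simp: arrow_tensor_def)
   finally show ?thesis .
  qed
  moreover have "f x = 0" if x: "x \<in> den (arrow_tensor A ys) i" for x i
  proof -
   have "x \<in> module.span pscale (?R i)" using x by (simp add: arrow_tensor_def)
   moreover have "f y = 0" if y: "y \<in> ?R i" for y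
   proof -
    obtain xs k where xs: "xs \<in> tup n ?V" and k: "k < n"
     and y: "y \<in> slot_relators (Scale A) (?V k (fst (xs ! k))) (%a. xs[k := (fst (xs ! k), a)])"
     using y at by (auto simp: tup_def)
    note m = mlinD[OF ml xs k refl, unfolded lin_on_def]
    have dif: "f (a - b) = f a - f b" for a b
     using lin unfolding linear_iff[OF P s] by (metis add_diff_cancel diff_add_cancel)
    show ?thesis using y m lin unfolding linear_iff[OF P s] slot_relators_def
     by (auto simp: dif)
   qed
   ultimately show ?thesis using linear_zero_on_span[OF P s lin] by blast
  qed
  ultimately show ?l using lin by (auto simp: hom_sspace_def arrow_tensor_def)
 qed
qed

lemma hom_arrow_tensor_den_iff:
 assumes s: "vector_space s"
 shows "f \<in> den (hom_sspace (arrow_tensor A ys) s W) j \<longleftrightarrow>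
  lin_map pscale s f & (\<forall>xs\<in>arrow_tuples A ys. f (basis xs) = 0)" (is "?l \<longleftrightarrow> ?r")
proof
 assume l: ?l
 have "f (basis xs) = 0" if "xs \<in> arrow_tuples A ys" for xs
 proof -
  have "basis xs \<in> num (arrow_tensor A ys) (degsum xs)" using that by (simp add: arrow_tensor_def)
  then show ?thesis using l by (auto simp: hom_sspace_def)
 qed
 then show ?r using l by (simp add: hom_sspace_def arrow_tensor_def)
next
 assume r: ?r
 then have "f x = 0" if "x \<in> num (arrow_tensor A ys) i" for x i
  using that by (elim conjE) (rule linear_zero_on_keys[OF s], auto simp: arrow_tensor_def)
 then show ?l using r by (auto simp: hom_sspace_def arrow_tensor_def)
qed

text \<open>The domain \<open>U\<close> of \<open>h\<close> may vary with the degrees of the tuple: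
  a cochain takes its values in a component determined by those degrees, and an action is linear on
  that component.\<close>

lemma mlin_comp:
 assumes F: "mlin s t n V F" and h: "!!xs. xs \<in> tup n V ==> lin_on t t' (U (map fst xs)) h"
  and U: "!!xs. xs \<in> tup n V ==> F xs \<in> U (map fst xs)"
 shows "mlin s t' n V (%xs. h (F xs))"
proof (rule mlinI)
 fix xs k assume xs: "xs \<in> tup n V" and k: "k < n"
 have "k < length xs" using xs k by (simp add: tup_def)
 then have m: "map fst (xs[k := (fst (xs ! k), u)]) = map fst xs" for u
  by (metis fst_conv list_update_id map_update nth_map)
 have FU: "F (xs[k := (fst (xs ! k), u)]) \<in> U (map fst xs)" if "u \<in> V k (fst (xs ! k))" for u
  using U[OF tup_update[OF xs that]] unfolding m .
 show "lin_on s t' (V k (fst (xs ! k))) (%u. h (F (xs[k := (fst (xs ! k), u)])))"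
  using mlinD[OF F xs k refl] FU h[OF xs] by (simp add: lin_on_def)
qed

lemma (in finite_superadditive_category) wmlin_ul:
 assumes F: "Lmlin t n F"
 shows "wmlin t n (%w. F (ul w))"
 unfolding wmlin_def
proof (rule ballI, rule mlinI)
 fix ps xs k assume ps: "ps \<in> PL n" and xs: "xs \<in> tup n (slots ps)" and k: "k < n"
 have l: "length ps = n" "length xs = n" using ps xs by (auto simp: PL_def tup_def)
 have ar: "set (zip ps xs) <= arrows A"
 proof
  fix x assume "x \<in> set (zip ps xs)"
  then obtain m where "m < n" "x = (ps ! m, xs ! m)" using l by (auto simp: set_zip)
  then show "x \<in> arrows A" using PL_nth[OF ps, of m] xs by (simp add: arrows_def tup_def)
 qed
 have t: "ul (zip ps xs) \<in> Ltup n" using ul_Ltup[OF ar] l by simp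
 let ?m = "munit (fst (ps ! k)) (snd (ps ! k))"
 have upd: "ul (zip ps (xs[k := (fst (xs ! k), u)])) = (ul (zip ps xs))[k := (fst (xs ! k), ?m u)]" for u
  using l k by (intro nth_equalityI) (auto simp: ul_def nth_list_update)
 have fk: "fst (xs ! k) = fst (ul (zip ps xs) ! k)" using l k by (simp add: ul_def)
 have "lin_on (Scale L) t (LM (fst (xs ! k))) (%u. F ((ul (zip ps xs))[k := (fst (xs ! k), u)]))"
  by (rule mlinD[OF F t k fk])
 moreover have "?m u \<in> LM (fst (xs ! k))" if "u \<in> slots ps k (fst (xs ! k))" for u
  using munit_LM PL_nth[OF ps k] that by blast
 ultimately show "lin_on (Scale A) t (slots ps k (fst (xs ! k))) (%u. F (ul (zip ps (xs[k := (fst (xs ! k), u)]))))"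
  unfolding upd using munit_lin[of UNIV "fst (ps ! k)" "snd (ps ! k)"] by (simp add: lin_on_def)
qed

lemma total_homogeneous: "0 \<in> V 0 ==> 0 \<in> V 1 ==> a \<in> V i ==> a \<in> total V"
 using set_plus_intro[of a "V 0" 0 "V 1"] set_plus_intro[of 0 "V 0" a "V 1"]
 by (cases i) (auto simp: total_def)

context finite_superadditive_category
begin

lemma Ltup_tl: "xs \<in> Ltup (Suc n) ==> tl xs \<in> Ltup n & snd (hd xs) \<in> LM (fst (hd xs)) & degsum xs = fst (hd xs) + degsum (tl xs)"
 by (cases xs) (auto simp: tup_def)

lemma Ltup_butlast: "xs \<in> Ltup (Suc n) ==> butlast xs \<in> Ltup n & snd (last xs) \<in> LM (fst (last xs)) & degsum xs = degsum (butlast xs) + fst (last xs)"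
proof (cases xs rule: rev_cases)
 case (snoc ys y)
 assume xs: "xs \<in> Ltup (Suc n)"
 then have k: "snd ((ys @ [y]) ! k) \<in> LM (fst ((ys @ [y]) ! k))" if "k < Suc n" for k
  using that snoc by (simp add: tup_def)
 have l: "length ys = n" using xs snoc by (simp add: tup_def)
 have "snd (ys ! k) \<in> LM (fst (ys ! k))" if "k < n" for k using k[of k] that l by (simp add: nth_append)
 moreover have "snd y \<in> LM (fst y)" using k[of n] l by (simp add: nth_append)
 ultimately show ?thesis using l snoc by (simp add: tup_def)
qed (simp add: tup_def)

lemma zip_entries:
 assumes "ps \<in> PL n" "xs \<in> Ltup n"
 shows "set (zip ps (entries ps xs)) <= arrows A" "length (zip ps (entries ps xs)) = n"
  "map deg (zip ps (entries ps xs)) = map fst xs"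
proof -
 have l: "length ps = n" "length xs = n" using assms by (auto simp: PL_def tup_def)
 note et = entries_tup[OF assms]
 show "set (zip ps (entries ps xs)) <= arrows A"
 proof
  fix x assume "x \<in> set (zip ps (entries ps xs))"
  then obtain k where "k < n" "x = (ps ! k, entries ps xs ! k)" using l by (auto simp: set_zip)
  then show "x \<in> arrows A" using et PL_nth[OF assms(1), of k] by (auto simp: arrows_def tup_def)
 qed
 show "length (zip ps (entries ps xs)) = n" using l by (simp add: entries_def)
 show "map deg (zip ps (entries ps xs)) = map fst xs"
  using l by (intro nth_equalityI) (auto simp: entries_def)
qed

lemma sum_deg_ins: "i <= length w ==> sum_list (map deg (ins A i X w)) = sum_list (map deg w)"
proof -
 have "sum_list (map deg w) = sum_list (map deg (take i w @ drop i w))" by simp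
 also have "... = sum_list (map deg (take i w)) + sum_list (map deg (drop i w))"
  by (simp only: map_append sum_list_append)
 finally show ?thesis by (simp add: ins_def idw_def)
qed

end

section \<open>Hochschild cohomology\<close>

lemma alt_sums_split:
 fixes g :: "nat => 'w::ab_group_add"
 shows "(\<Sum>i\<le>Suc n. alt i (g i)) = g 0 + (\<Sum>i=1..n. alt i (g i)) + alt (Suc n) (g (Suc n))"
 using sum_split_at[of 0 "Suc n" "%i. alt i (g i)"] by (simp add: alt_def add.assoc)

locale superalgebra_bimodule = finite_superadditive_category A + bim: graded_bimodule "superalgebra A" M
 for A :: "('k::field, 'o, 'a::ab_group_add) scat"
  and M :: "('k, unit, 'o => 'o => 'a, 'm::ab_group_add) sbimod"
begin

section \<open>The bimodule and its Peirce decomposition\<close>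

abbreviation "sM \<equiv> MScale M"
abbreviation "BM \<equiv> Bim M () ()"
abbreviation "LA \<equiv> LAct M () () ()"
abbreviation "RA \<equiv> RAct M () () ()"
abbreviation "e X \<equiv> munit X X (Idn A X)"

lemma BM_subspace: "subspc sM (BM d)"
 using bim.superspace_Bim by (auto simp: superspace_def Obj_L)

lemmas BM_closed = BM_subspace[unfolded subspace_iff[OF bim.vector_space]]

lemma BM_total: "m \<in> BM d ==> m \<in> total BM"
 using total_homogeneous[of BM] BM_closed by blast

lemma LM_total: "x \<in> LM d ==> x \<in> total (Mor L () ())"
 using total_homogeneous[of "Mor L () ()"] LM_closed by blast

lemma LA_degree: "x \<in> LM i ==> m \<in> BM j ==> LA x m \<in> BM (i + j)"
 using bim.LAct_degree[of "()" "()" "()"] by (simp add: Obj_L)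

lemma RA_degree: "m \<in> BM i ==> x \<in> LM j ==> RA m x \<in> BM (i + j)"
 using bim.RAct_degree[of "()" "()" "()"] by (simp add: Obj_L)

lemma LA_lin_left: "m \<in> BM j ==> lin_on (Scale L) sM (LM i) (%x. LA x m)"
 using bim.LAct_bilinear[of "()" "()" "()"] LM_total BM_total by (simp add: Obj_L bilinear_on_def lin_on_def)

lemma LA_lin_right: "x \<in> LM i ==> lin_on sM sM (BM j) (%m. LA x m)"
 using bim.LAct_bilinear[of "()" "()" "()"] LM_total BM_total by (simp add: Obj_L bilinear_on_def lin_on_def)

lemma RA_lin_left: "x \<in> LM i ==> lin_on sM sM (BM j) (%m. RA m x)"
 using bim.RAct_bilinear[of "()" "()" "()"] LM_total BM_total by (simp add: Obj_L bilinear_on_def lin_on_def)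

lemma RA_lin_right: "m \<in> BM j ==> lin_on (Scale L) sM (LM i) (%x. RA m x)"
 using bim.RAct_bilinear[of "()" "()" "()"] LM_total BM_total by (simp add: Obj_L bilinear_on_def lin_on_def)

lemma LA_LA: "x \<in> LM i ==> y \<in> LM j ==> m \<in> BM d ==> LA x (LA y m) = LA (LC x y) m"
 using bim.LAct_assoc[of "()" "()" "()" "()"] LM_total BM_total by (simp add: Obj_L)

lemma RA_RA: "x \<in> LM i ==> y \<in> LM j ==> m \<in> BM d ==> RA (RA m x) y = RA m (LC x y)"
 using bim.RAct_assoc[of "()" "()" "()" "()"] LM_total BM_total by (simp add: Obj_L)

lemma RA_LA: "x \<in> LM i ==> y \<in> LM j ==> m \<in> BM d ==> RA (LA x m) y = LA x (RA m y)"
 using bim.acts_commute[of "()" "()" "()" "()"] LM_total BM_total by (simp add: Obj_L)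

lemma LA_0: "m \<in> BM j ==> LA 0 m = 0"
 using lin_on_0[OF vector_space_L bim.vector_space LA_lin_left] LM_closed by blast

lemma RA_0: "m \<in> BM j ==> RA m 0 = 0"
 using lin_on_0[OF vector_space_L bim.vector_space RA_lin_right] LM_closed by blast

lemma e_LM: "X \<in> Obj A ==> e X \<in> LM 0"
 using munit_LM Idn_degree by blast

lemma e_LC: "X \<in> Obj A ==> Y \<in> Obj A ==> LC (e X) (e Y) = (if X = Y then e X else 0)"
 using LC_um[OF idw_arrows idw_arrows, of X Y] mul_idw[OF idw_arrows[of X]] by (auto simp: idw_def)

lemma e_um: "X \<in> Obj A ==> x \<in> arrows A ==> LC (e X) (um x) = (if X = src x then um x else 0)"
 using LC_um[OF idw_arrows, of X x]
 by (auto simp: idw_def mul_def arrows_def Idn_left Mor_total)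

lemma um_e: "X \<in> Obj A ==> x \<in> arrows A ==> LC (um x) (e X) = (if tgt x = X then um x else 0)"
 using LC_um[OF _ idw_arrows, of x X] mul_idw[of x] by (auto simp: idw_def)

lemma Idn_L: "Idn L () = (\<Sum>X\<in>Obj A. e X)"
proof (intro ext)
 fix U V
 have "(\<Sum>X\<in>Obj A. e X) U V = (\<Sum>X\<in>Obj A. e X U V)"
  by (induction rule: infinite_finite_induct) auto
 also have "... = (\<Sum>X\<in>Obj A. if X = U then if U = V then Idn A U else 0 else 0)"
  by (rule sum.cong) (auto simp: munit_def)
 finally show "Idn L () U V = (\<Sum>X\<in>Obj A. e X) U V"
  using finite_Obj by (simp add: superalgebra_def sum.delta)
qed

lemma corner_eq: "corner A M X Y m = LA (e X) (RA m (e Y))"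
 by (simp add: corner_def)

lemma LA0_degree: "x \<in> LM 0 ==> m \<in> BM d ==> LA x m \<in> BM d" using LA_degree[of x 0 m d] by simp
lemma RA0_degree: "x \<in> LM 0 ==> m \<in> BM d ==> RA m x \<in> BM d" using RA_degree[of m d x 0] by simp

lemma corner_degree: "X \<in> Obj A ==> Y \<in> Obj A ==> m \<in> BM d ==> corner A M X Y m \<in> BM d"
 by (simp add: corner_eq LA0_degree RA0_degree e_LM)

lemma corner_lin: "X \<in> Obj A ==> Y \<in> Obj A ==> lin_on sM sM (BM d) (corner A M X Y)"
 using LA_lin_right[OF e_LM, of X d] RA_lin_left[OF e_LM, of Y d] RA0_degree[OF e_LM, of Y]
 by (simp add: lin_on_def corner_eq)

lemma corner_0: "X \<in> Obj A ==> Y \<in> Obj A ==> corner A M X Y 0 = 0"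
 using lin_on_0[OF bim.vector_space bim.vector_space corner_lin, of X Y 0 0] BM_closed by blast

text \<open>The \<open>e X\<close> are orthogonal idempotents of the superalgebra, so the corner
  projections are orthogonal idempotents on \<open>M\<close>.\<close>

lemma corner_corner:
 assumes "X \<in> Obj A" "Y \<in> Obj A" "X' \<in> Obj A" "Y' \<in> Obj A" "m \<in> BM d"
 shows "corner A M X Y (corner A M X' Y' m) = (if X = X' & Y = Y' then corner A M X Y m else 0)"
proof -
 have R: "RA m (e Y') \<in> BM d" using assms by (simp add: RA0_degree e_LM)
 have "corner A M X Y (corner A M X' Y' m) = LA (e X) (LA (e X') (RA (RA m (e Y')) (e Y)))"
  unfolding corner_eq using RA_LA[OF e_LM e_LM R] assms by simp
 also have "... = LA (LC (e X) (e X')) (RA m (LC (e Y') (e Y)))"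
 proof -
  have "RA m (LC (e Y') (e Y)) \<in> BM d"
   using assms RA0_degree[OF e_LM assms(5)] RA_0[OF assms(5)] BM_closed by (simp add: e_LC)
  then show ?thesis
   using assms RA_RA[OF e_LM e_LM assms(5)] LA_LA[OF e_LM e_LM] by simp
 qed
 also have "... = (if X = X' & Y = Y' then corner A M X Y m else 0)"
  using assms R LA_0[OF RA0_degree[OF e_LM]] RA_0
   lin_on_0[OF bim.vector_space bim.vector_space LA_lin_right[OF e_LM], of X] BM_closed
  by (auto simp: e_LC corner_eq intro: LA_0)
 finally show ?thesis .
qed

text \<open>Peirce decomposition: both actions are unital and the unit is the sum of the
  \<open>e X\<close>.\<close>

lemma corner_sum:
 assumes m: "m \<in> BM d"
 shows "m = (\<Sum>X\<in>Obj A. \<Sum>Y\<in>Obj A. corner A M X Y m)"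
proof -
 note vM = bim.vector_space
 have r: "(\<Sum>Y\<in>Obj A. RA m (e Y)) = m"
  using bim.RAct_unit[of "()" "()" m] BM_total[OF m]
   lin_on_finite_sum[OF vector_space_L vM RA_lin_right[OF m] LM_subspace finite_Obj, of e 0] e_LM
  by (simp add: Obj_L Idn_L)
 have "m = LA (\<Sum>X\<in>Obj A. e X) m"
  using bim.LAct_unit[of "()" "()" m] BM_total[OF m] by (simp add: Obj_L Idn_L)
 also have "... = (\<Sum>X\<in>Obj A. LA (e X) m)"
  by (rule lin_on_finite_sum[OF vector_space_L vM LA_lin_left[OF m] LM_subspace finite_Obj]) (rule e_LM)
 also have "... = (\<Sum>X\<in>Obj A. \<Sum>Y\<in>Obj A. corner A M X Y m)"
 proof (rule sum.cong[OF refl])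
  fix X assume X: "X \<in> Obj A"
  have "LA (e X) (\<Sum>Y\<in>Obj A. RA m (e Y)) = (\<Sum>Y\<in>Obj A. LA (e X) (RA m (e Y)))"
   by (rule lin_on_finite_sum[OF vM vM LA_lin_right[OF e_LM[OF X]] BM_subspace finite_Obj])
    (rule RA0_degree[OF e_LM m])
  then show "LA (e X) m = (\<Sum>Y\<in>Obj A. corner A M X Y m)" unfolding r corner_eq .
 qed
 finally show ?thesis .
qed

lemma corner_LA:
 assumes "X \<in> Obj A" "Z \<in> Obj A" "x \<in> arrows A" "m \<in> BM d"
 shows "corner A M X Z (LA (um x) m) = (if X = src x then LA (um x) (corner A M (tgt x) Z m) else 0)"
proof -
 have u: "um x \<in> LM (deg x)" "tgt x \<in> Obj A" using assms um_LM by (auto simp: arrows_def)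
 have R: "RA m (e Z) \<in> BM d" using assms by (simp add: RA0_degree e_LM)
 have "corner A M X Z (LA (um x) m) = LA (LC (e X) (um x)) (RA m (e Z))"
  unfolding corner_eq RA_LA[OF u(1) e_LM[OF assms(2)] assms(4)] by (rule LA_LA[OF e_LM[OF assms(1)] u(1) R])
 moreover have "LA (um x) (corner A M (tgt x) Z m) = LA (LC (um x) (e (tgt x))) (RA m (e Z))"
  unfolding corner_eq by (rule LA_LA[OF u(1) e_LM[OF u(2)] R])
 ultimately show ?thesis using assms u by (simp add: e_um um_e LA_0[OF R])
qed

lemma corner_RA:
 assumes "X \<in> Obj A" "Z \<in> Obj A" "x \<in> arrows A" "m \<in> BM d"
 shows "corner A M X Z (RA m (um x)) = (if tgt x = Z then RA (corner A M X (src x) m) (um x) else 0)"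
proof -
 have u: "um x \<in> LM (deg x)" "src x \<in> Obj A" using assms um_LM by (auto simp: arrows_def)
 have l: "corner A M X Z (RA m (um x)) = LA (e X) (RA m (LC (um x) (e Z)))"
  unfolding corner_eq RA_RA[OF u(1) e_LM[OF assms(2)] assms(4)] ..
 have "RA (corner A M X (src x) m) (um x) = LA (e X) (RA (RA m (e (src x))) (um x))"
  unfolding corner_eq using assms u by (intro RA_LA[OF e_LM _ RA0_degree[OF e_LM]])
 also have "RA (RA m (e (src x))) (um x) = RA m (LC (e (src x)) (um x))"
  by (rule RA_RA[OF e_LM[OF u(2)] u(1) assms(4)])
 finally have r: "RA (corner A M X (src x) m) (um x) = LA (e X) (RA m (LC (e (src x)) (um x)))" .
 have "LA (e X) 0 = 0"
  using lin_on_0[OF bim.vector_space bim.vector_space LA_lin_right[OF e_LM[OF assms(1)]], of 0 0] BM_closed by blast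
 moreover have "LC (e (src x)) (um x) = um x" "LC (um x) (e Z) = (if tgt x = Z then um x else 0)"
  using assms u by (simp_all add: e_um um_e)
 ultimately show ?thesis unfolding l r using RA_0[OF assms(4)] by (cases "tgt x = Z") simp_all
qed

lemma LA_e_corner: "X \<in> Obj A ==> Z \<in> Obj A ==> m \<in> BM d ==> LA (e X) (corner A M X Z m) = corner A M X Z m"
 using LA_LA[OF e_LM e_LM RA0_degree[OF e_LM], of X X Z m d] by (simp add: corner_eq e_LC)

lemma RA_e_corner: "X \<in> Obj A ==> Z \<in> Obj A ==> m \<in> BM d ==> RA (corner A M X Z m) (e Z) = corner A M X Z m"
 using RA_LA[OF e_LM e_LM RA0_degree[OF e_LM], of X Z Z m d] RA_RA[OF e_LM e_LM, of Z Z m d]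
 by (simp add: corner_eq e_LC)

section \<open>Cochains on the superalgebra as families on words\<close>

definition lcoch :: "nat => bit => ((bit * ('o => 'o => 'a)) list => 'm) => bool" where
 "lcoch n j F \<longleftrightarrow> Lmlin sM n F & (\<forall>xs\<in>Ltup n. F xs \<in> BM (j + degsum xs))"

definition dL :: "nat => bit => ((bit * ('o => 'o => 'a)) list => 'm) => (bit * ('o => 'o => 'a)) list => 'm" where
 "dL n j F xs = sM (ksign (fst (hd xs) * j)) (LA (snd (hd xs)) (F (tl xs))) +
   (\<Sum>i=1..n. sM ((-1) ^ i) (F (contract L [] i xs))) +
   sM ((-1) ^ Suc n) (RA (F (butlast xs)) (snd (last xs)))"

text \<open>Carries the Koszul sign for moving a cochain of superdegree \<open>j\<close> past the
  first argument; the right action has no sign.\<close>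

definition lact :: "bit => ('o, 'a) arrow => 'o => 'm => 'm" where
 "lact j x Z \<phi> = sM (ksign (deg x * j)) (LA (um x) \<phi>)"

definition ract :: "'o => ('o, 'a) arrow => 'm => 'm" where
 "ract X x \<phi> = RA \<phi> (um x)"

text \<open>The Peirce components of a cochain. The outer objects of the word are those of the
  corner, so a mismatch at an end compares the corner with the first or last arrow.\<close>

definition fam :: "((bit * ('o => 'o => 'a)) list => 'm) => ('o, 'a, 'm) wfam" where
 "fam F X w Z = corner A M X Z (F (ul w))"

lemma dL_terms:
 assumes F: "lcoch n j F" and xs: "xs \<in> Ltup (Suc n)"
 shows "sM c (LA (snd (hd xs)) (F (tl xs))) \<in> BM (j + degsum xs)"
  "0 < i ==> i <= n ==> F (contract L [] i xs) \<in> BM (j + degsum xs)"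
  "RA (F (butlast xs)) (snd (last xs)) \<in> BM (j + degsum xs)"
proof -
 have l: "length xs = Suc n" using xs by (simp add: tup_def)
 have "LA (snd (hd xs)) (F (tl xs)) \<in> BM (fst (hd xs) + (j + degsum (tl xs)))"
  using Ltup_tl[OF xs] F by (intro LA_degree) (auto simp: lcoch_def)
 then show "sM c (LA (snd (hd xs)) (F (tl xs))) \<in> BM (j + degsum xs)"
  using Ltup_tl[OF xs] BM_closed by (simp add: ac_simps)
 have "RA (F (butlast xs)) (snd (last xs)) \<in> BM ((j + degsum (butlast xs)) + fst (last xs))"
  using Ltup_butlast[OF xs] F by (intro RA_degree) (auto simp: lcoch_def)
 then show "RA (F (butlast xs)) (snd (last xs)) \<in> BM (j + degsum xs)"
  using Ltup_butlast[OF xs] by (simp add: ac_simps)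
 show "F (contract L [] i xs) \<in> BM (j + degsum xs)" if i: "0 < i" "i <= n"
 proof -
  have "degsum (contract L [] i xs) = degsum xs" using i l by (intro degsum_contract) auto
  then show ?thesis using F contract_Ltup[OF xs i, of "[]"] unfolding lcoch_def by metis
 qed
qed

lemma dL_degree:
 assumes F: "lcoch n j F" and xs: "xs \<in> Ltup (Suc n)"
 shows "dL n j F xs \<in> BM (j + degsum xs)"
proof -
 interpret vector_space sM by (rule bim.vector_space)
 have "(\<Sum>i=1..n. sM ((-1) ^ i) (F (contract L [] i xs))) \<in> BM (j + degsum xs)"
  using dL_terms(2)[OF F xs] by (intro subspace_sum[OF BM_subspace] subspace_scale[OF BM_subspace]) auto
 then show ?thesis
  unfolding dL_def using dL_terms(1,3)[OF F xs] BM_closed by blast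
qed

lemma dL_lcoch:
 assumes F: "lcoch n j F"
 shows "lcoch (Suc n) j (dL n j F)"
proof -
 note vM = bim.vector_space
 have Fm: "Lmlin sM n F" and Fd: "!!xs. xs \<in> Ltup n ==> F xs \<in> BM (j + degsum xs)"
  using F by (auto simp: lcoch_def)
 have "Lmlin sM (Suc n) (%xs. (%x xs. sM (ksign (fst x * j)) (LA (snd x) (F xs))) (hd xs) (tl xs))"
 proof (rule mlin_hd)
  fix x :: "bit * ('o => 'o => 'a)" assume x: "snd x \<in> LM (fst x)"
  show "Lmlin sM n (%xs. sM (ksign (fst x * j)) (LA (snd x) (F xs)))"
   by (intro mlin_scale[OF vM] mlin_comp[OF Fm, where U = "%ds. BM (j + sum_list ds)"] LA_lin_right[OF x] Fd)
 next
  fix d and xs :: "(bit * ('o => 'o => 'a)) list" assume "xs \<in> Ltup n"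
  then show "lin_on (Scale L) sM (LM d) (%x. sM (ksign (fst (d, x) * j)) (LA (snd (d, x)) (F xs)))"
   unfolding fst_conv snd_conv by (intro lin_on_scale[OF vM] LA_lin_left[OF Fd])
 qed
 moreover have "Lmlin sM (Suc n) (%xs. (%x xs. sM ((-1) ^ Suc n) (RA (F xs) (snd x))) (last xs) (butlast xs))"
 proof (rule mlin_last)
  fix x :: "bit * ('o => 'o => 'a)" assume x: "snd x \<in> LM (fst x)"
  show "Lmlin sM n (%xs. sM ((-1) ^ Suc n) (RA (F xs) (snd x)))"
   by (intro mlin_scale[OF vM] mlin_comp[OF Fm, where U = "%ds. BM (j + sum_list ds)" and h = "%m. RA m (snd x)"] RA_lin_left[OF x] Fd)
 next
  fix d and xs :: "(bit * ('o => 'o => 'a)) list" assume "xs \<in> Ltup n"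
  then show "lin_on (Scale L) sM (LM d) (%x. sM ((-1) ^ Suc n) (RA (F xs) (snd (d, x))))"
   unfolding fst_conv snd_conv by (intro lin_on_scale[OF vM] RA_lin_right[OF Fd])
 qed
 moreover have "Lmlin sM (Suc n) (%xs. \<Sum>i=1..n. sM ((-1) ^ i) (F (contract L [] i xs)))"
  by (intro mlin_sum[OF vM] mlin_scale[OF vM] mlin_contract[OF vM Fm]) auto
 ultimately have "Lmlin sM (Suc n) (dL n j F)"
  unfolding dL_def[abs_def] by (intro mlin_add[OF vM]) auto
 then show ?thesis using dL_degree[OF F] by (simp add: lcoch_def)
qed

text \<open>Projection to a corner kills an outer face unless the acting arrow starts or ends at the
  corner's object, and an inner face vanishes unless the two matrix units compose. What remains are
  the faces at matched joints.\<close>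

lemma fam_dL:
 assumes F: "lcoch n j F" and w: "set w <= arrows A" "length w = Suc n" and X: "X \<in> Obj A" and Z: "Z \<in> Obj A"
 shows "fam (dL n j F) X w Z = wdiff A (lact j) ract (fam F) X w Z"
proof -
 note vM = bim.vector_space
 interpret vector_space sM by (rule bim.vector_space)
 have ne: "w ~= []" using w by auto
 have xs: "ul w \<in> Ltup (Suc n)" using ul_Ltup[OF w(1)] w(2) by simp
 let ?B = "BM (j + degsum (ul w))"
 note T = dL_terms[OF F xs]
 have lin: "lin_on sM sM ?B (corner A M X Z)" by (rule corner_lin[OF X Z])
 have hl: "hd w \<in> arrows A" "last w \<in> arrows A" using w ne by auto
 have hd: "hd (ul w) = (deg (hd w), um (hd w))" and tl: "tl (ul w) = ul (tl w)"
  using ne by (auto simp: ul_def hd_map map_tl)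
 have la: "last (ul w) = (deg (last w), um (last w))" and bu: "butlast (ul w) = ul (butlast w)"
  using ne by (auto simp: ul_def last_map map_butlast)
 have tlt: "ul (tl w) \<in> Ltup n" "ul (butlast w) \<in> Ltup n"
  using Ltup_tl[OF xs] Ltup_butlast[OF xs] tl bu by auto
 have F1: "F (ul (tl w)) \<in> BM (j + degsum (ul (tl w)))" "F (ul (butlast w)) \<in> BM (j + degsum (ul (butlast w)))"
  using F tlt by (auto simp: lcoch_def)
 define g where "g = (%i. if matched X w Z i then wface A (lact j) ract i (fam F) X w Z else 0)"
 have S: "(\<Sum>i=1..n. sM ((-1) ^ i) (F (contract L [] i (ul w)))) \<in> ?B"
  using T(2) by (intro subspace_sum[OF BM_subspace] subspace_scale[OF BM_subspace]) auto
 have g0: "corner A M X Z (sM (ksign (fst (hd (ul w)) * j)) (LA (snd (hd (ul w))) (F (tl (ul w))))) = g 0"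
 proof -
  have "corner A M X Z (sM (ksign (fst (hd (ul w)) * j)) (LA (snd (hd (ul w))) (F (tl (ul w))))) =
   sM (ksign (deg (hd w) * j)) (corner A M X Z (LA (um (hd w)) (F (ul (tl w)))))"
   using lin T(1)[of 1] unfolding lin_on_def hd tl by simp
  then show ?thesis using ne unfolding corner_LA[OF X Z hl(1) F1(1)]
   by (auto simp: g_def matched_def lo_def ro_def hd_conv_nth wface_def outer_def lact_def fam_def fleft_def fword_def fright_def w)
 qed
 have gi: "corner A M X Z (sM ((-1) ^ i) (F (contract L [] i (ul w)))) = alt i (g i)" if i: "i \<in> {1..n}" for i
 proof -
  have i': "0 < i" "i <= n" using i by auto
  have "corner A M X Z (F (contract L [] i (ul w))) = g i"
  proof (cases "tgt (w ! (i - 1)) = src (w ! i)")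
   case True
   then have "contract L [] i (ul w) = ul (wcontract A i w)" using contract_ul[OF w(1)] i' w by simp
   then show ?thesis using True i' w
    by (simp add: g_def matched_def lo_def ro_def wface_def outer_def fleft_def fword_def fright_def fam_def)
  next
   case False
   then have "F (contract L [] i (ul w)) = 0"
    using contract_ul_zero[OF vM _ w i'] F by (simp add: lcoch_def)
   then show ?thesis using False i' w by (simp add: g_def matched_def lo_def ro_def corner_0 X Z)
  qed
  moreover have "corner A M X Z (sM ((-1) ^ i) (F (contract L [] i (ul w)))) =
   sM ((-1) ^ i) (corner A M X Z (F (contract L [] i (ul w))))"
   using lin T(2)[OF i'] unfolding lin_on_def by blast
  ultimately show ?thesis by (simp add: alt_scale[OF vM, of i "g i"])
 qed
 have gn: "corner A M X Z (sM ((-1) ^ Suc n) (RA (F (butlast (ul w))) (snd (last (ul w))))) = alt (Suc n) (g (Suc n))"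
 proof -
  have "corner A M X Z (RA (F (butlast (ul w))) (snd (last (ul w)))) = g (Suc n)"
   unfolding la bu snd_conv corner_RA[OF X Z hl(2) F1(2)] using ne w
   by (auto simp: g_def matched_def lo_def ro_def last_conv_nth wface_def outer_def ract_def fam_def fleft_def fword_def fright_def)
  moreover have "corner A M X Z (sM ((-1) ^ Suc n) (RA (F (butlast (ul w))) (snd (last (ul w))))) =
   sM ((-1) ^ Suc n) (corner A M X Z (RA (F (butlast (ul w))) (snd (last (ul w)))))"
   using lin T(3) unfolding lin_on_def by blast
  ultimately show ?thesis using alt_scale[OF vM, of "Suc n" "g (Suc n)"] by simp
 qed
 have "corner A M X Z (dL n j F (ul w)) = g 0 + (\<Sum>i=1..n. alt i (g i)) + alt (Suc n) (g (Suc n))"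
 proof -
  have sum: "corner A M X Z (\<Sum>i=1..n. sM ((-1) ^ i) (F (contract L [] i (ul w)))) = (\<Sum>i=1..n. alt i (g i))"
   using lin_on_finite_sum[OF vM vM lin BM_subspace, of "{1..n}" "%i. sM ((-1) ^ i) (F (contract L [] i (ul w)))"]
    T(2) gi subspace_scale[OF BM_subspace] by simp
  show ?thesis
   using lin T(1) T(3) S BM_closed unfolding dL_def g0[symmetric] sum[symmetric] gn[symmetric] lin_on_def
   by (metis (no_types, lifting))
 qed
 then show ?thesis unfolding fam_def[of "dL n j F"] wdiff_def w(2) g_def[symmetric]
  using alt_sums_split[of g n] by (simp add: g_def)
qed

end

context superalgebra_bimodule
begin

definition gfam :: "nat => bit => ('o, 'a, 'm) wfam => bool" where
 "gfam n j f \<longleftrightarrow> (\<forall>X\<in>Obj A. \<forall>Z\<in>Obj A. wmlin sM n (%w. f X w Z) &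
   (\<forall>w. set w <= arrows A --> length w = n -->
    f X w Z \<in> corner A M X Z ` BM (j + sum_list (map deg w))))"

text \<open>Reassembles a cochain from its values on words in all corners; on the families described
  by \<open>gfam\<close> this inverts \<open>fam\<close>.\<close>

definition exF :: "('o, 'a, 'm) wfam => (bit * ('o => 'o => 'a)) list => 'm" where
 "exF f xs = (\<Sum>X\<in>Obj A. \<Sum>Z\<in>Obj A. exw (%w. f X w Z) xs)"

lemma corner_image_BM: "X \<in> Obj A ==> Z \<in> Obj A ==> m \<in> corner A M X Z ` BM d ==> m \<in> BM d"
 using corner_degree by auto

lemma corner_image_subspace: "X \<in> Obj A ==> Z \<in> Obj A ==> subspc sM (corner A M X Z ` BM d)"
 unfolding subspace_iff[OF bim.vector_space]
proof (intro conjI ballI allI)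
 assume XZ: "X \<in> Obj A" "Z \<in> Obj A"
 note lin = corner_lin[OF XZ, of d, unfolded lin_on_def]
 show "0 \<in> corner A M X Z ` BM d" using corner_0[OF XZ] BM_closed by (metis image_eqI)
 fix x assume "x \<in> corner A M X Z ` BM d"
 then obtain u where u: "u \<in> BM d" "x = corner A M X Z u" by auto
 show "sM c x \<in> corner A M X Z ` BM d" for c using u lin BM_closed by (metis image_eqI)
 fix y assume "y \<in> corner A M X Z ` BM d"
 then obtain v where v: "v \<in> BM d" "y = corner A M X Z v" by auto
 show "x + y \<in> corner A M X Z ` BM d" using u v lin BM_closed by (metis image_eqI)
qed

lemmas corner_image_closed = corner_image_subspace[unfolded subspace_iff[OF bim.vector_space]]

lemma exF_lcoch:
 assumes f: "gfam n j f"
 shows "lcoch n j (exF f)"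
proof -
 interpret vector_space sM by (rule bim.vector_space)
 have "Lmlin sM n (exF f)"
  unfolding exF_def[abs_def] using f
  by (intro mlin_sum[OF bim.vector_space] exw_mlin[OF bim.vector_space]) (auto simp: gfam_def)
 moreover have "exF f xs \<in> BM (j + degsum xs)" if xs: "xs \<in> Ltup n" for xs
  unfolding exF_def exw_def
 proof (intro subspace_sum[OF BM_subspace])
  fix X Z ps assume XZ: "X \<in> Obj A" "Z \<in> Obj A" and "ps \<in> PL (length xs)"
  then have ps: "ps \<in> PL n" using xs by (simp add: tup_def)
  have "f X (zip ps (entries ps xs)) Z \<in> corner A M X Z ` BM (j + sum_list (map deg (zip ps (entries ps xs))))"
   using f XZ zip_entries(1,2)[OF ps xs] unfolding gfam_def by blast
  then show "f X (zip ps (entries ps xs)) Z \<in> BM (j + degsum xs)"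
   unfolding zip_entries(3)[OF ps xs] by (rule corner_image_BM[OF XZ])
 qed
 ultimately show ?thesis by (simp add: lcoch_def)
qed

lemma fam_exF:
 assumes f: "gfam n j f" and w: "set w <= arrows A" "length w = n" and X: "X \<in> Obj A" and Z: "Z \<in> Obj A"
 shows "fam (exF f) X w Z = f X w Z"
proof -
 note vM = bim.vector_space
 let ?d = "j + sum_list (map deg w)"
 have ex: "exF f (ul w) = (\<Sum>X\<in>Obj A. \<Sum>Z\<in>Obj A. f X w Z)"
  unfolding exF_def using f w by (intro sum.cong refl exw_ul[OF vM]) (auto simp: gfam_def)
 have im: "f X' w Z' \<in> corner A M X' Z' ` BM ?d" if "X' \<in> Obj A" "Z' \<in> Obj A" for X' Z'
  using f w that unfolding gfam_def by blast
 have B: "f X' w Z' \<in> BM ?d" if "X' \<in> Obj A" "Z' \<in> Obj A" for X' Z'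
  using corner_image_BM[OF that im[OF that]] .
 have c: "corner A M X Z (f X' w Z') = (if X' = X & Z' = Z then f X w Z else 0)"
  if XZ: "X' \<in> Obj A" "Z' \<in> Obj A" for X' Z'
 proof -
  obtain m where m: "m \<in> BM ?d" "f X' w Z' = corner A M X' Z' m" using im[OF XZ] by auto
  show ?thesis using corner_corner[OF X Z XZ m(1)] m(2) by auto
 qed
 interpret vector_space sM by (rule vM)
 note fs = lin_on_finite_sum[OF vM vM corner_lin[OF X Z, of ?d] BM_subspace finite_Obj]
 have "corner A M X Z (exF f (ul w)) = (\<Sum>X'\<in>Obj A. corner A M X Z (\<Sum>Z'\<in>Obj A. f X' w Z'))"
  unfolding ex by (rule fs) (rule subspace_sum[OF BM_subspace], rule B)
 also have "... = (\<Sum>X'\<in>Obj A. \<Sum>Z'\<in>Obj A. corner A M X Z (f X' w Z'))"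
  by (intro sum.cong refl fs B)
 also have "... = (\<Sum>X'\<in>Obj A. \<Sum>Z'\<in>Obj A. if X' = X then if Z' = Z then f X w Z else 0 else 0)"
  by (intro sum.cong refl) (auto simp: c)
 also have "... = (\<Sum>X'\<in>Obj A. if X' = X then f X w Z else 0)"
  using finite_Obj Z by (intro sum.cong refl) (simp add: sum.delta)
 also have "... = f X w Z" using finite_Obj X by (simp add: sum.delta)
 finally show ?thesis by (simp add: fam_def)
qed

lemma gfam_fam:
 assumes F: "lcoch n j F"
 shows "gfam n j (fam F)"
 unfolding gfam_def
proof (intro ballI conjI allI impI)
 fix X Z assume XZ: "X \<in> Obj A" "Z \<in> Obj A"
 have Fm: "Lmlin sM n F" and Fd: "!!xs. xs \<in> Ltup n ==> F xs \<in> BM (j + sum_list (map fst xs))"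
  using F by (auto simp: lcoch_def)
 have "Lmlin sM n (%xs. corner A M X Z (F xs))"
  by (rule mlin_comp[OF Fm corner_lin[OF XZ] Fd])
 then show "wmlin sM n (%w. fam F X w Z)" unfolding fam_def by (rule wmlin_ul)
 fix w assume "set w <= arrows A" "length w = n"
 then show "fam F X w Z \<in> corner A M X Z ` BM (j + sum_list (map deg w))"
  unfolding fam_def using Fd[of "ul w"] ul_Ltup[of w] by (auto simp: degsum_ul)
qed

lemma gfam_add:
 assumes "gfam n j f" "gfam n j g"
 shows "gfam n j (%X w Z. f X w Z + g X w Z)"
 unfolding gfam_def
proof (intro ballI conjI allI impI)
 fix X Z assume XZ: "X \<in> Obj A" "Z \<in> Obj A"
 show "wmlin sM n (%w. f X w Z + g X w Z)"
  using assms XZ unfolding wmlin_def by (intro ballI mlin_add[OF bim.vector_space]) (auto simp: gfam_def wmlin_def)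
 fix w assume "set w <= arrows A" "length w = n"
 then show "f X w Z + g X w Z \<in> corner A M X Z ` BM (j + sum_list (map deg w))"
  using assms XZ corner_image_closed[OF XZ] unfolding gfam_def by blast
qed

text \<open>The inserted identity has degree 0 and the outer objects stay, so neither the total
  degree nor the corner changes.\<close>

lemma gfam_whtpy:
 assumes f: "gfam (Suc n) j f"
 shows "gfam n j (whtpy A f)"
 unfolding gfam_def
proof (intro ballI conjI allI impI)
 fix X Z assume XZ: "X \<in> Obj A" "Z \<in> Obj A"
 show "wmlin sM n (%w. whtpy A f X w Z)"
  using f XZ by (intro wmlin_whtpy[OF bim.vector_space]) (auto simp: gfam_def)
 fix w assume w: "set w <= arrows A" "length w = n"
 show "whtpy A f X w Z \<in> corner A M X Z ` BM (j + sum_list (map deg w))"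
 proof (cases "composable X w Z")
  case True
  then show ?thesis using corner_image_closed[OF XZ] by (simp add: whtpy_def)
 next
  case False
  then obtain i where i: "first_mismatch X w Z i" using not_composable_iff[of X w Z] by blast
  then have i': "i <= length w" by (simp add: first_mismatch_def)
  have "f X (ins A i X w) Z \<in> corner A M X Z ` BM (j + sum_list (map deg (ins A i X w)))"
   using f XZ ins_arrows[OF w(1) XZ(1) i'] i' w unfolding gfam_def by simp
  then show ?thesis
   unfolding whtpy_eq[OF i] alt_scale[OF bim.vector_space] sum_deg_ins[OF i']
   using corner_image_closed[OF XZ] by blast
 qed
qed

lemma lact_add: "x \<in> arrows A ==> \<phi> \<in> BM d ==> \<psi> \<in> BM d ==> lact j x Z (\<phi> + \<psi>) = lact j x Z \<phi> + lact j x Z \<psi>"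
 and ract_add: "x \<in> arrows A ==> \<phi> \<in> BM d ==> \<psi> \<in> BM d ==> ract X x (\<phi> + \<psi>) = ract X x \<phi> + ract X x \<psi>"
 using LA_lin_right[OF um_LM, of x d] RA_lin_left[OF um_LM, of x d]
  lin_on_scale[OF bim.vector_space LA_lin_right[OF um_LM], of x d]
 by (simp_all add: lin_on_def lact_def ract_def)

lemma lact_0: "x \<in> arrows A ==> lact j x Z 0 = 0" and ract_0: "x \<in> arrows A ==> ract X x 0 = 0"
 using lact_add[of x 0 0 0 j Z] ract_add[of x 0 0 0 X] BM_closed by auto

lemma lact_minus: "x \<in> arrows A ==> \<phi> \<in> (\<Union>d. BM d) ==> lact j x Z (- \<phi>) = - lact j x Z \<phi>"
 and ract_minus: "x \<in> arrows A ==> \<phi> \<in> (\<Union>d. BM d) ==> ract X x (- \<phi>) = - ract X x \<phi>"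
proof -
 interpret vector_space sM by (rule bim.vector_space)
 assume x: "x \<in> arrows A" and "\<phi> \<in> (\<Union>d. BM d)"
 then obtain d where d: "\<phi> \<in> BM d" "- \<phi> \<in> BM d" using subspace_neg[OF BM_subspace] by auto
 show "lact j x Z (- \<phi>) = - lact j x Z \<phi>" "ract X x (- \<phi>) = - ract X x \<phi>"
  using lact_add[OF x d, of j Z] ract_add[OF x d, of X] lact_0[OF x, of j Z] ract_0[OF x, of X]
  by (auto simp: eq_neg_iff_add_eq_0 add.commute)
qed

lemma wdiff_add:
 assumes f: "gfam n j f" and g: "gfam n j g" and w: "set w <= arrows A" "length w = Suc n"
  and X: "X \<in> Obj A" and Z: "Z \<in> Obj A"
 shows "wdiff A (lact j') ract (%X w Z. f X w Z + g X w Z) X w Z =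
  wdiff A (lact j') ract f X w Z + wdiff A (lact j') ract g X w Z"
 unfolding wdiff_def sum.distrib[symmetric]
proof (rule sum.cong[OF refl])
 fix i assume "i \<in> {..length w}"
 then have i: "i <= length w" by simp
 have ne: "w ~= []" using w by auto
 show "alt i (if matched X w Z i then wface A (lact j') ract i (%X w Z. f X w Z + g X w Z) X w Z else 0) =
  alt i (if matched X w Z i then wface A (lact j') ract i f X w Z else 0) +
  alt i (if matched X w Z i then wface A (lact j') ract i g X w Z else 0)"
 proof (cases "matched X w Z i")
  case True
  note o = fleft_Obj[OF w(1) ne X] fright_Obj[OF w(1) ne Z]
  have wd: "set (fword A i w) <= arrows A" "length (fword A i w) = n"
   using fword_arrows[OF w(1) ne i True] length_fword[OF ne i, of A] w by auto
  let ?d = "j + sum_list (map deg (fword A i w))"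
  have B: "f (fleft i X w) (fword A i w) (fright i w Z) \<in> BM ?d"
   "g (fleft i X w) (fword A i w) (fright i w Z) \<in> BM ?d"
   using f g o wd corner_image_BM[OF o] unfolding gfam_def by blast+
  have "hd w \<in> arrows A" "last w \<in> arrows A" using w ne by auto
  then have "outer (lact j') ract i X w Z (f (fleft i X w) (fword A i w) (fright i w Z) + g (fleft i X w) (fword A i w) (fright i w Z)) =
   outer (lact j') ract i X w Z (f (fleft i X w) (fword A i w) (fright i w Z)) +
   outer (lact j') ract i X w Z (g (fleft i X w) (fword A i w) (fright i w Z))"
   unfolding outer_def using lact_add[OF _ B] ract_add[OF _ B] by (cases "i = 0") simp_all
  then show ?thesis unfolding wface_def by (simp add: True alt_add)
 qed simp
qed

text \<open>\<open>corner_sum\<close> recovers a value from its corners, and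
  \<open>Lmlin_eq_0\<close> passes from words to arbitrary tuples.\<close>

lemma lcoch_eqI:
 assumes F: "lcoch n j F" and G: "lcoch n j G"
  and eq: "!!X Z w. X \<in> Obj A ==> Z \<in> Obj A ==> set w <= arrows A ==> length w = n ==> fam F X w Z = fam G X w Z"
  and xs: "xs \<in> Ltup n"
 shows "F xs = G xs"
proof -
 have "(%xs. F xs - G xs) xs = 0"
 proof (rule Lmlin_eq_0[OF bim.vector_space _ _ xs])
  show "Lmlin sM n (%xs. F xs - G xs)"
   using F G by (intro mlin_diff[OF bim.vector_space]) (auto simp: lcoch_def)
  fix w assume w: "set w <= arrows A" "length w = n"
  then have u: "ul w \<in> Ltup n" using ul_Ltup by blast
  have "F (ul w) = G (ul w)"
   using corner_sum[of "F (ul w)"] corner_sum[of "G (ul w)"] F G u eq[OF _ _ w]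
   unfolding lcoch_def fam_def by (metis (no_types, lifting) sum.cong)
  then show "F (ul w) - G (ul w) = 0" by simp
 qed
 then show ?thesis by simp
qed

section \<open>Cochains on the category and their extension\<close>

definition acoch :: "nat => bit => ('o list => (bit * 'a) list => 'm) => bool" where
 "acoch n j G \<longleftrightarrow> (\<forall>ys\<in>obj_tuples A n. mlin (Scale A) sM n (%k. Mor A (ys ! k) (ys ! Suc k)) (G ys) &
   (\<forall>al\<in>arrow_tuples A ys. G ys al \<in> corner A M (hd ys) (last ys) ` BM (j + degsum al)))"

lemma gfam_comp_fam:
 assumes G: "acoch n j G"
 shows "gfam n j (comp_fam G)"
 unfolding gfam_def
proof (intro ballI conjI allI impI)
 fix X Z assume XZ: "X \<in> Obj A" "Z \<in> Obj A"
 show "wmlin sM n (%w. comp_fam G X w Z)"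
  using G XZ by (intro wmlin_comp_fam[OF bim.vector_space]) (auto simp: acoch_def)
 fix w assume w: "set w <= arrows A" "length w = n"
 show "comp_fam G X w Z \<in> corner A M X Z ` BM (j + sum_list (map deg w))"
 proof (cases "composable X w Z")
  case True
  note t = composable_tuples[OF True w(1) XZ(1)]
  have "G (X # map tgt w) (map snd w) \<in>
   corner A M (hd (X # map tgt w)) (last (X # map tgt w)) ` BM (j + degsum (map snd w))"
   using G t w unfolding acoch_def by blast
  then show ?thesis unfolding composable_path(2,3)[OF True] using True by (simp add: comp_fam_def comp_def)
 next
  case False
  then show ?thesis using corner_image_closed[OF XZ] by (simp add: comp_fam_def)
 qed
qed

definition dA :: "nat => bit => ('o list => (bit * 'a) list => 'm) => 'o list => (bit * 'a) list => 'm" where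
 "dA n j G ys xs =
   sM (ksign (fst (hd xs) * j)) (LA (munit (ys ! 0) (ys ! 1) (snd (hd xs))) (G (tl ys) (tl xs))) +
   (\<Sum>i=1..n. sM ((-1) ^ i) (G (remove_nth i ys) (contract A ys i xs))) +
   sM ((-1) ^ Suc n) (RA (G (butlast ys) (butlast xs)) (munit (ys ! n) (ys ! Suc n) (snd (last xs))))"

lemma dA_wdiff:
 assumes l: "length ys = Suc (Suc n)" "length al = Suc n"
 shows "dA n j G ys al = wdiff A (lact j) ract (comp_fam G) (hd ys) (wd ys al) (last ys)"
proof -
 note s = alt_scale[OF bim.vector_space, symmetric]
 have al: "al ~= []" using l by auto
 show ?thesis
  unfolding wdiff_comp_fam[OF l] alt_sums_split outer_wd[OF l] dA_def s using al l
  by (auto simp: lact_def ract_def path_face_def remove_nth_0 remove_nth_last[OF l(1)]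
    intro!: arg_cong2[where f = "(+)"] sum.cong)
qed

lemma fam_wd:
 assumes "ys \<in> obj_tuples A n" "al \<in> arrow_tuples A ys"
 shows "corner A M (hd ys) (last ys) (F (unit_arrows ys al)) = fam F (hd ys) (wd ys al) (last ys)"
proof -
 have l: "length ys = Suc n" "length al = n" using assms by (auto simp: obj_tuples_def arrow_tuples_def)
 show ?thesis by (simp add: fam_def ul_def unit_arrows_wd[OF l])
qed

lemma fam_composable:
 assumes "composable X w Z" "set w <= arrows A" "X \<in> Obj A"
  and eq: "!!ys al. ys \<in> obj_tuples A (length w) ==> al \<in> arrow_tuples A ys ==>
   corner A M (hd ys) (last ys) (F (unit_arrows ys al)) = H ys al"
 shows "fam F X w Z = H (X # map tgt w) (map snd w)"
 using eq[OF composable_tuples[OF assms(1-3)]] fam_wd[OF composable_tuples[OF assms(1-3)], of F]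
 unfolding composable_path[OF assms(1)] by simp

lemma wdiff_comp_fam_composable:
 assumes "composable X w Z" "set w <= arrows A" "X \<in> Obj A" "length w = Suc n"
 shows "wdiff A (lact j) ract (comp_fam G) X w Z = dA n j G (X # map tgt w) (map snd w)"
 using dA_wdiff[of "X # map tgt w" n "map snd w" j G] assms(4) unfolding composable_path[OF assms(1)] by simp

lemma wdiff_comp_fam_not_composable:
 assumes "~ composable X w Z" "set w <= arrows A" "X \<in> Obj A" "Z \<in> Obj A"
 shows "wdiff A (lact j) ract (comp_fam G) X w Z = 0"
 by (rule wdiff_not_composable[OF _ assms]) (auto simp: comp_fam_def lact_0 ract_0)

text \<open>Surjectivity in cohomology: extension by zero to the non-composable words. The extension
  is a cocycle because faces at matched joints never lead from a non-composable word to a composable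
  one.\<close>

lemma cochain_lift:
 assumes G: "acoch n j G"
  and dG: "!!ys al. ys \<in> obj_tuples A (Suc n) ==> al \<in> arrow_tuples A ys ==> dA n j G ys al = 0"
 obtains F where "lcoch n j F" "!!xs. xs \<in> Ltup (Suc n) ==> dL n j F xs = 0"
  "!!ys al. ys \<in> obj_tuples A n ==> al \<in> arrow_tuples A ys ==>
   corner A M (hd ys) (last ys) (F (unit_arrows ys al)) = G ys al"
proof
 let ?F = "exF (comp_fam G)"
 have g: "gfam n j (comp_fam G)" by (rule gfam_comp_fam[OF G])
 show F: "lcoch n j ?F" by (rule exF_lcoch[OF g])
 note vM = bim.vector_space
 have 0: "lcoch (Suc n) j (%_. 0)" using BM_closed by (simp add: lcoch_def mlin_zero[OF vM])
 show "dL n j ?F xs = 0" if xs: "xs \<in> Ltup (Suc n)" for xs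
 proof (rule lcoch_eqI[OF dL_lcoch[OF F] 0 _ xs])
  fix X Z w assume XZ: "X \<in> Obj A" "Z \<in> Obj A" and w: "set w <= arrows A" "length w = Suc n"
  have ne: "w ~= []" using w by auto
  have "fam (dL n j ?F) X w Z = wdiff A (lact j) ract (fam ?F) X w Z" by (rule fam_dL[OF F w XZ])
  also have "... = wdiff A (lact j) ract (comp_fam G) X w Z"
  proof (unfold wdiff_def, rule sum.cong[OF refl])
   fix i assume "i \<in> {..length w}"
   then have i: "i <= length w" by simp
   have "fam ?F (fleft i X w) (fword A i w) (fright i w Z) = comp_fam G (fleft i X w) (fword A i w) (fright i w Z)"
    if m: "matched X w Z i"
    using fam_exF[OF g fword_arrows[OF w(1) ne i m] _ fleft_Obj[OF w(1) ne XZ(1)] fright_Obj[OF w(1) ne XZ(2)]]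
     length_fword[OF ne i, of A] w(2) by simp
   then show "alt i (if matched X w Z i then wface A (lact j) ract i (fam ?F) X w Z else 0) =
    alt i (if matched X w Z i then wface A (lact j) ract i (comp_fam G) X w Z else 0)"
    by (simp add: wface_def)
  qed
  also have "... = 0"
  proof (cases "composable X w Z")
   case True
   then show ?thesis
    using dG composable_tuples[OF True w(1) XZ(1)] w
    by (simp add: wdiff_comp_fam_composable[OF True w(1) XZ(1) w(2)])
  next
   case False
   then show ?thesis by (rule wdiff_comp_fam_not_composable[OF _ w(1) XZ])
  qed
  finally show "fam (dL n j ?F) X w Z = fam (%_. 0) X w Z" using XZ by (simp add: fam_def corner_0)
 qed
 show "corner A M (hd ys) (last ys) (?F (unit_arrows ys al)) = G ys al"
  if ys: "ys \<in> obj_tuples A n" and al: "al \<in> arrow_tuples A ys" for ys al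
 proof -
  have l: "length ys = Suc n" "length al = n" using ys al by (auto simp: obj_tuples_def arrow_tuples_def)
  show ?thesis
   unfolding fam_wd[OF ys al]
   using fam_exF[OF g wd_arrows[OF ys al] length_wd[OF l] obj_tuples_hd_last[OF ys]] comp_fam_wd[OF l] by simp
 qed
qed

text \<open>For a cocycle the term of the homotopy identity containing the differential of
  \<open>F\<close> vanishes, so the inserted family is a primitive on the non-composable
  words.\<close>

lemma cochain_homotopy:
 assumes F: "lcoch n j F" and dF: "!!xs. xs \<in> Ltup (Suc n) ==> dL n j F xs = 0"
  and w: "set w <= arrows A" "length w = n" and XZ: "X \<in> Obj A" "Z \<in> Obj A" and nc: "~ composable X w Z"
 shows "fam F X w Z = wdiff A (lact j) ract (whtpy A (fam F)) X w Z"
proof -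
 obtain i where i: "first_mismatch X w Z i" using nc not_composable_iff[of X w Z] by blast
 then have i': "i <= length w" by (simp add: first_mismatch_def)
 have g: "gfam n j (fam F)" by (rule gfam_fam[OF F])
 interpret vector_space sM by (rule bim.vector_space)
 have C: "fam F X w Z \<in> (\<Union>d. BM d)" if "X \<in> Obj A" "Z \<in> Obj A" "set w <= arrows A" "length w = n" for X w Z
  using g that corner_image_BM[OF that(1,2)] unfolding gfam_def by blast
 \<comment> \<open>Words of other lengths are cut off, since values there need not lie in the
   components of \<open>BM\<close> as the homotopy identity requires.\<close>
 let ?f = "%X w Z. if length w = n then fam F X w Z else 0"
 have C': "?f X w Z \<in> (\<Union>d. BM d)" if "X \<in> Obj A" "Z \<in> Obj A" "set w <= arrows A" for X w Z
  using C that BM_closed by auto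
 have "whtpy A (wdiff A (lact j) ract (fam F)) X w Z = alt i (wdiff A (lact j) ract (fam F) X (ins A i X w) Z)"
  by (rule whtpy_eq[OF i])
 also have "wdiff A (lact j) ract (fam F) X (ins A i X w) Z = fam (dL n j F) X (ins A i X w) Z"
  using fam_dL[OF F ins_arrows[OF w(1) XZ(1) i'] _ XZ] i' w by simp
 also have "... = 0"
  using dF[OF ul_Ltup[OF ins_arrows[OF w(1) XZ(1) i'], unfolded length_ins[OF i'] w(2)]] XZ
  by (simp add: fam_def corner_0)
 finally have h0: "whtpy A (wdiff A (lact j) ract (fam F)) X w Z = 0" by simp
 have wf: "whtpy A (wdiff A (lact j) ract ?f) X w Z = whtpy A (wdiff A (lact j) ract (fam F)) X w Z"
 proof -
  have ne: "ins A i X w ~= []" by (simp add: ins_def)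
  show ?thesis unfolding whtpy_eq[OF i] wdiff_def wface_def
   using length_fword[OF ne, of _ A] i' w(2) by (intro arg_cong[of _ _ "alt i"] sum.cong refl) simp
 qed
 have dw: "wdiff A (lact j) ract (whtpy A ?f) X w Z = wdiff A (lact j) ract (whtpy A (fam F)) X w Z"
 proof (cases "w = []")
  case True
  then show ?thesis using i by (auto simp: wdiff_def first_mismatch_def)
 next
  case False
  have "whtpy A ?f X' v Z' = whtpy A (fam F) X' v Z'" if "length v = n - 1" for X' v Z'
  proof (cases "composable X' v Z'")
   case c: False
   then obtain k where k: "first_mismatch X' v Z' k" using not_composable_iff[of X' v Z'] by blast
   then show ?thesis using that False w(2) by (auto simp: whtpy_eq[OF k] first_mismatch_def)
  qed (simp add: whtpy_def)
  then show ?thesis unfolding wdiff_def wface_def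
   using length_fword[OF False, of _ A] w(2) by (intro sum.cong refl) simp
 qed
 have "wdiff A (lact j) ract (whtpy A ?f) X w Z + whtpy A (wdiff A (lact j) ract ?f) X w Z =
  (if i = 0 then lact j (idw A X) Z (?f X w Z) else ?f X w Z)"
  by (rule whtpy_homotopy[OF w(1) XZ i, where f = ?f and l = "lact j" and r = ract and C = "\<Union>d. BM d"])
   (rule lact_minus ract_minus C'; assumption)+
 \<comment> \<open>Needed when the first joint is mismatched: an identity fixes the values in its
   corner, and its degree 0 makes the Koszul sign trivial.\<close>
 moreover have "lact j (idw A X) Z (fam F X w Z) = fam F X w Z"
 proof -
  obtain m d where "m \<in> BM d" "fam F X w Z = corner A M X Z m" using g XZ w unfolding gfam_def by blast
  then show ?thesis using LA_e_corner[OF XZ] by (simp add: lact_def idw_def ksign_def)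
 qed
 ultimately show ?thesis using w(2) unfolding wf dw h0 by simp
qed

text \<open>Injectivity in cohomology. The case distinction in \<open>FG\<close> reflects that in
  degree 0 only the zero cochain is a coboundary.\<close>

lemma cochain_exact:
 assumes F: "lcoch n j F" and dF: "!!xs. xs \<in> Ltup (Suc n) ==> dL n j F xs = 0"
  and G: "n = Suc m ==> acoch m j G"
  and FG: "!!ys al. ys \<in> obj_tuples A n ==> al \<in> arrow_tuples A ys ==>
   corner A M (hd ys) (last ys) (F (unit_arrows ys al)) = (case n of 0 => 0 | Suc m => dA m j G ys al)"
 shows "n = 0 ==> xs \<in> Ltup n ==> F xs = 0"
  "n = Suc m ==> \<exists>K. lcoch m j K & (\<forall>xs\<in>Ltup n. F xs = dL m j K xs)"
proof -
 note vM = bim.vector_space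
 show "F xs = 0" if n: "n = 0" and xs: "xs \<in> Ltup n"
 proof (rule lcoch_eqI[OF F _ _ xs])
  show "lcoch n j (%_. 0)" using BM_closed by (simp add: lcoch_def mlin_zero[OF vM])
  fix X Z w assume XZ: "X \<in> Obj A" "Z \<in> Obj A" and w: "set w <= arrows A" "length w = n"
  have "fam F X w Z = 0"
  proof (cases "composable X w Z")
   case True
   show ?thesis using fam_composable[OF True w(1) XZ(1) FG] w(2) n by simp
  next
   case False
   \<comment> \<open>The empty word has only this joint, so all terms of \<open>wdiff\<close>
     vanish.\<close>
   have "~ matched X w Z 0" using False w(2) n by (simp add: composable_def)
   then show ?thesis using cochain_homotopy[OF F dF w XZ False] w(2) n by (simp add: wdiff_def)
  qed
  then show "fam F X w Z = fam (%_. 0) X w Z" using XZ by (simp add: fam_def corner_0)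
 qed
 show "\<exists>K. lcoch m j K & (\<forall>xs\<in>Ltup n. F xs = dL m j K xs)" if n: "n = Suc m"
 proof -
  \<comment> \<open>\<open>?k1\<close> is the given primitive on the composable words and
    \<open>?k2\<close> the homotopy on the others. Composable and non-composable words decouple, so
    neither disturbs the other.\<close>
  let ?k1 = "comp_fam G" and ?k2 = "whtpy A (fam F)"
  let ?k = "%X w Z. ?k1 X w Z + ?k2 X w Z"
  have g1: "gfam m j ?k1" by (rule gfam_comp_fam[OF G[OF n]])
  have g2: "gfam m j ?k2" using gfam_fam[OF F] n by (intro gfam_whtpy) simp
  have g: "gfam m j ?k" by (rule gfam_add[OF g1 g2])
  have K: "lcoch m j (exF ?k)" by (rule exF_lcoch[OF g])
  have "F xs = dL m j (exF ?k) xs" if xs: "xs \<in> Ltup n" for xs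
  proof (rule lcoch_eqI[OF F _ _ xs])
   show "lcoch n j (dL m j (exF ?k))" using dL_lcoch[OF K] n by simp
   fix X Z w assume XZ: "X \<in> Obj A" "Z \<in> Obj A" and w: "set w <= arrows A" "length w = n"
   have w': "length w = Suc m" using w n by simp
   have ne: "w ~= []" using w' by auto
   have "fam (dL m j (exF ?k)) X w Z = wdiff A (lact j) ract (fam (exF ?k)) X w Z"
    by (rule fam_dL[OF K w(1) w' XZ])
   also have "... = wdiff A (lact j) ract ?k X w Z"
   proof (unfold wdiff_def, rule sum.cong[OF refl])
    fix i assume "i \<in> {..length w}"
    then have i: "i <= length w" by simp
    have "fam (exF ?k) (fleft i X w) (fword A i w) (fright i w Z) = ?k (fleft i X w) (fword A i w) (fright i w Z)"
     if mi: "matched X w Z i"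
     using fam_exF[OF g fword_arrows[OF w(1) ne i mi] _ fleft_Obj[OF w(1) ne XZ(1)] fright_Obj[OF w(1) ne XZ(2)]]
      length_fword[OF ne i, of A] w' by simp
    then show "alt i (if matched X w Z i then wface A (lact j) ract i (fam (exF ?k)) X w Z else 0) =
     alt i (if matched X w Z i then wface A (lact j) ract i ?k X w Z else 0)"
     by (simp add: wface_def)
   qed
   also have "... = wdiff A (lact j) ract ?k1 X w Z + wdiff A (lact j) ract ?k2 X w Z"
    by (rule wdiff_add[OF g1 g2 w(1) w' XZ])
   also have "... = fam F X w Z"
   proof (cases "composable X w Z")
    case True
    have "wdiff A (lact j) ract ?k2 X w Z = 0"
     unfolding wdiff_def
    proof (rule sum.neutral, clarify)
     fix i assume i: "i <= length w"
     have "composable (fleft i X w) (fword A i w) (fright i w Z)"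
      unfolding composable_face[OF ne i] using True by (simp add: composable_def)
     moreover have "hd w \<in> arrows A" "last w \<in> arrows A" using w ne by auto
     ultimately show "alt i (if matched X w Z i then wface A (lact j) ract i ?k2 X w Z else 0) = 0"
      by (simp add: wface_def whtpy_def outer_def lact_0 ract_0)
    qed
    moreover have "fam F X w Z = dA m j G (X # map tgt w) (map snd w)"
     using fam_composable[OF True w(1) XZ(1) FG] w n by simp
    ultimately show ?thesis using wdiff_comp_fam_composable[OF True w(1) XZ(1) w', of j G] by simp
   next
    case False
    then show ?thesis
     using wdiff_comp_fam_not_composable[OF False w(1) XZ, of j G] cochain_homotopy[OF F dF w XZ False] by simp
   qed
   finally show "fam F X w Z = fam (dL m j (exF ?k)) X w Z" by simp
  qed
  then show ?thesis using K by blast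
 qed
qed

end

section \<open>The defined cochain complexes in terms of multilinear functions\<close>

lemma unit_list_eq: "length us = length vs ==> us = (vs :: unit list)"
 by (rule nth_equalityI) auto

context superalgebra_bimodule
begin

abbreviation "uls n \<equiv> replicate (Suc n) ()"

lemma obj_tuples_L: "obj_tuples L n = {uls n}"
 using unit_list_eq by (auto simp: obj_tuples_def Obj_L)

lemma arrow_tuples_L: "arrow_tuples L (uls n) = Ltup n"
 by (simp add: tup_iff_arrow_tuples)

lemma dL_add:
 assumes "lcoch n j F" "lcoch n j G" "xs \<in> Ltup (Suc n)"
 shows "dL n j (%xs. F xs + G xs) xs = dL n j F xs + dL n j G xs"
proof -
 interpret vector_space sM by (rule bim.vector_space)
 have "LA (snd (hd xs)) (F (tl xs) + G (tl xs)) = LA (snd (hd xs)) (F (tl xs)) + LA (snd (hd xs)) (G (tl xs))"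
  "RA (F (butlast xs) + G (butlast xs)) (snd (last xs)) = RA (F (butlast xs)) (snd (last xs)) + RA (G (butlast xs)) (snd (last xs))"
  using assms Ltup_tl[OF assms(3)] Ltup_butlast[OF assms(3)]
   LA_lin_right[of "snd (hd xs)" "fst (hd xs)" "j + degsum (tl xs)"]
   RA_lin_left[of "snd (last xs)" "fst (last xs)" "j + degsum (butlast xs)"]
  unfolding lcoch_def lin_on_def by blast+
 then show ?thesis
  by (simp add: dL_def scale_right_distrib sum.distrib)
qed

lemma dL_scale:
 assumes "lcoch n j F" "xs \<in> Ltup (Suc n)"
 shows "dL n j (%xs. sM c (F xs)) xs = sM c (dL n j F xs)"
proof -
 interpret vector_space sM by (rule bim.vector_space)
 have "LA (snd (hd xs)) (sM c (F (tl xs))) = sM c (LA (snd (hd xs)) (F (tl xs)))"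
  "RA (sM c (F (butlast xs))) (snd (last xs)) = sM c (RA (F (butlast xs)) (snd (last xs)))"
  using assms Ltup_tl[OF assms(2)] Ltup_butlast[OF assms(2)]
   LA_lin_right[of "snd (hd xs)" "fst (hd xs)" "j + degsum (tl xs)"]
   RA_lin_left[of "snd (last xs)" "fst (last xs)" "j + degsum (butlast xs)"]
  unfolding lcoch_def lin_on_def by blast+
 then show ?thesis
  by (simp add: dL_def scale_right_distrib scale_right_diff_distrib scale_sum_right mult.commute)
qed

lemma acoch_BM:
 assumes "acoch n j G" "ys \<in> obj_tuples A n" "al \<in> arrow_tuples A ys"
 shows "G ys al \<in> BM (j + degsum al)"
 using assms corner_image_BM[OF obj_tuples_hd_last[OF assms(2)]] unfolding acoch_def by blast

lemma path_ends:
 assumes ys: "ys \<in> obj_tuples A (Suc n)" and al: "al \<in> arrow_tuples A ys"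
 shows "tl ys \<in> obj_tuples A n" "tl al \<in> arrow_tuples A (tl ys)"
  "butlast ys \<in> obj_tuples A n" "butlast al \<in> arrow_tuples A (butlast ys)"
  "munit (ys ! 0) (ys ! 1) (snd (hd al)) \<in> LM (fst (hd al))"
  "munit (ys ! n) (ys ! Suc n) (snd (last al)) \<in> LM (fst (last al))"
proof -
 have l: "length ys = Suc (Suc n)" "length al = Suc n" using ys al by (auto simp: obj_tuples_def arrow_tuples_def)
 have o: "ys ! k \<in> Obj A" if "k <= Suc n" for k using ys that by (auto simp: obj_tuples_def)
 have a: "snd (al ! k) \<in> Mor A (ys ! k) (ys ! Suc k) (fst (al ! k))" if "k <= n" for k
  using al l that by (simp add: arrow_tuples_def)
 have ne: "al ~= []" "ys ~= []" using l by auto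
 show "tl ys \<in> obj_tuples A n" "butlast ys \<in> obj_tuples A n"
  using ys l by (cases ys; auto simp: obj_tuples_def dest: in_set_butlastD split: if_splits)+
 show "tl al \<in> arrow_tuples A (tl ys)" "butlast al \<in> arrow_tuples A (butlast ys)"
  using l a by (auto simp: arrow_tuples_def nth_tl nth_butlast)
 show "munit (ys ! 0) (ys ! 1) (snd (hd al)) \<in> LM (fst (hd al))"
  using a[of 0] o ne by (intro munit_LM) (auto simp: hd_conv_nth)
 show "munit (ys ! n) (ys ! Suc n) (snd (last al)) \<in> LM (fst (last al))"
  using a[of n] o ne l by (intro munit_LM) (auto simp: last_conv_nth)
qed

lemma dA_add:
 assumes "acoch n j F" "acoch n j G" and ys: "ys \<in> obj_tuples A (Suc n)" and al: "al \<in> arrow_tuples A ys"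
 shows "dA n j (%ys xs. F ys xs + G ys xs) ys al = dA n j F ys al + dA n j G ys al"
proof -
 interpret vector_space sM by (rule bim.vector_space)
 note p = path_ends[OF ys al]
 have "LA (munit (ys ! 0) (ys ! 1) (snd (hd al))) (F (tl ys) (tl al) + G (tl ys) (tl al)) =
   LA (munit (ys ! 0) (ys ! 1) (snd (hd al))) (F (tl ys) (tl al)) + LA (munit (ys ! 0) (ys ! 1) (snd (hd al))) (G (tl ys) (tl al))"
  "RA (F (butlast ys) (butlast al) + G (butlast ys) (butlast al)) (munit (ys ! n) (ys ! Suc n) (snd (last al))) =
   RA (F (butlast ys) (butlast al)) (munit (ys ! n) (ys ! Suc n) (snd (last al))) +
   RA (G (butlast ys) (butlast al)) (munit (ys ! n) (ys ! Suc n) (snd (last al)))"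
  using LA_lin_right[OF p(5)] RA_lin_left[OF p(6)] acoch_BM[OF assms(1) p(1,2)] acoch_BM[OF assms(2) p(1,2)]
   acoch_BM[OF assms(1) p(3,4)] acoch_BM[OF assms(2) p(3,4)] unfolding lin_on_def by blast+
 then show ?thesis
  by (simp add: dA_def scale_right_distrib sum.distrib)
qed

lemma dA_scale:
 assumes "acoch n j F" and ys: "ys \<in> obj_tuples A (Suc n)" and al: "al \<in> arrow_tuples A ys"
 shows "dA n j (%ys xs. sM c (F ys xs)) ys al = sM c (dA n j F ys al)"
proof -
 interpret vector_space sM by (rule bim.vector_space)
 note p = path_ends[OF ys al]
 have "LA (munit (ys ! 0) (ys ! 1) (snd (hd al))) (sM c (F (tl ys) (tl al))) =
   sM c (LA (munit (ys ! 0) (ys ! 1) (snd (hd al))) (F (tl ys) (tl al)))"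
  "RA (sM c (F (butlast ys) (butlast al))) (munit (ys ! n) (ys ! Suc n) (snd (last al))) =
   sM c (RA (F (butlast ys) (butlast al)) (munit (ys ! n) (ys ! Suc n) (snd (last al))))"
  using LA_lin_right[OF p(5)] RA_lin_left[OF p(6)] acoch_BM[OF assms(1) p(1,2)]
   acoch_BM[OF assms(1) p(3,4)] unfolding lin_on_def by blast+
 then show ?thesis
  by (simp add: dA_def scale_right_distrib scale_right_diff_distrib scale_sum_right mult.commute)
qed

abbreviation "cM \<equiv> cat_bimod A M"
abbreviation "hs \<equiv> (%c \<phi> ys x. sM c (\<phi> ys x)) :: 'k => ('x => 'y => 'm) => 'x => 'y => 'm"

lemma num_hcochains_L: "\<phi> \<in> num (hcochains L M n) j \<longleftrightarrow> (\<forall>us. us ~= uls n --> \<phi> us = 0) &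
  lin_map pscale sM (\<phi> (uls n)) & lcoch n j (%xs. \<phi> (uls n) (basis xs))"
proof -
 have "\<phi> (uls n) \<in> num (hom_sspace (arrow_tensor L (uls n)) sM BM) j \<longleftrightarrow>
  lin_map pscale sM (\<phi> (uls n)) & lcoch n j (%xs. \<phi> (uls n) (basis xs))"
  using hom_arrow_tensor_num_iff[where W = BM and A = L and j = j and f = "\<phi> (uls n)", OF _ bim.vector_space BM_subspace, of "uls n" n] arrow_tuples_L[of n]
  by (simp add: lcoch_def del: replicate_Suc)
 then show ?thesis by (auto simp: hcochains_def prod_sspace_def obj_tuples_L simp del: replicate_Suc)
qed

lemma den_hcochains_L: "\<phi> \<in> den (hcochains L M n) j \<longleftrightarrow> (\<forall>us. us ~= uls n --> \<phi> us = 0) &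
  lin_map pscale sM (\<phi> (uls n)) & (\<forall>xs\<in>Ltup n. \<phi> (uls n) (basis xs) = 0)"
 using hom_arrow_tensor_den_iff[OF bim.vector_space, of "\<phi> (uls n)" L "uls n" BM j] arrow_tuples_L[of n]
 by (auto simp: hcochains_def prod_sspace_def obj_tuples_L simp del: replicate_Suc)

lemma num_hcochains_A: "\<psi> \<in> num (hcochains A cM n) j \<longleftrightarrow> (\<forall>ys. ys \<notin> obj_tuples A n --> \<psi> ys = 0) &
  (\<forall>ys\<in>obj_tuples A n. lin_map pscale sM (\<psi> ys)) & acoch n j (%ys al. \<psi> ys (basis al))"
proof -
 have "\<psi> ys \<in> num (hom_sspace (arrow_tensor A ys) sM (%i. corner A M (hd ys) (last ys) ` BM i)) j \<longleftrightarrow>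
  lin_map pscale sM (\<psi> ys) &
  mlin (Scale A) sM n (%k. Mor A (ys ! k) (ys ! Suc k)) (%al. \<psi> ys (basis al)) &
   (\<forall>al\<in>arrow_tuples A ys. \<psi> ys (basis al) \<in> corner A M (hd ys) (last ys) ` BM (j + degsum al))"
  if ys: "ys \<in> obj_tuples A n" for ys
  using ys corner_image_subspace[OF obj_tuples_hd_last[OF ys]]
  by (intro hom_arrow_tensor_num_iff bim.vector_space) (auto simp: obj_tuples_def)
 then show ?thesis by (auto simp: hcochains_def prod_sspace_def cat_bimod_def acoch_def)
qed

lemma den_hcochains_A: "\<psi> \<in> den (hcochains A cM n) j \<longleftrightarrow> (\<forall>ys. ys \<notin> obj_tuples A n --> \<psi> ys = 0) &
  (\<forall>ys\<in>obj_tuples A n. lin_map pscale sM (\<psi> ys) & (\<forall>al\<in>arrow_tuples A ys. \<psi> ys (basis al) = 0))"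
 by (auto simp: hcochains_def prod_sspace_def cat_bimod_def hom_arrow_tensor_den_iff[OF bim.vector_space])

lemma hcoboundary_L:
 "hcoboundary L M n j \<phi> (uls (Suc n)) (basis xs) = dL n j (%xs. \<phi> (uls n) (basis xs)) xs"
proof -
 have e: "tl (uls (Suc n)) = uls n" "butlast (uls (Suc n)) = uls n" "i <= Suc n ==> remove_nth i (uls (Suc n)) = uls n" for i
  by (rule unit_list_eq, simp add: length_remove_nth)+
 have c: "contract L (uls (Suc n)) i xs = contract L [] i xs" for i by (simp add: contract_L)
 have "(\<Sum>i=1..n. sM ((-1) ^ i) (\<phi> (remove_nth i (uls (Suc n))) (basis (contract L (uls (Suc n)) i xs)))) =
  (\<Sum>i=1..n. sM ((-1) ^ i) (\<phi> (uls n) (basis (contract L [] i xs))))"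
  unfolding c by (intro sum.cong refl) (simp add: e del: replicate_Suc)
 then show ?thesis
  unfolding hcoboundary_def dL_def
  by (simp add: obj_tuples_L lext_basis[OF bim.vector_space] e del: replicate_Suc)
qed

lemma hcoboundary_A:
 "ys \<in> obj_tuples A (Suc n) ==> hcoboundary A cM n j \<psi> ys (basis al) = dA n j (%ys al. \<psi> ys (basis al)) ys al"
 unfolding hcoboundary_def dA_def by (simp add: lext_basis[OF bim.vector_space] cat_bimod_def)

lemma hcoboundary_linear: "MScale M' = sM ==> ys \<in> obj_tuples B (Suc n) ==>
  lin_map pscale sM (hcoboundary B M' n j \<psi> ys)"
 using linear_lext[OF bim.vector_space] by (simp add: hcoboundary_def)

lemma hcoboundary_outside: "ys \<notin> obj_tuples B (Suc n) ==> hcoboundary B M' n j \<psi> ys = 0"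
 by (simp add: hcoboundary_def)

lemma HH_restr_basis: "ys \<in> obj_tuples A n ==>
  HH_restr A M n \<phi> ys (basis al) = corner A M (hd ys) (last ys) (\<phi> (uls n) (basis (unit_arrows ys al)))"
proof -
 assume ys: "ys \<in> obj_tuples A n"
 then have "map (%_. ()) ys = uls n" by (intro unit_list_eq) (simp add: obj_tuples_def)
 then show ?thesis using ys by (simp add: HH_restr_def lext_basis[OF bim.vector_space] del: replicate_Suc)
qed

lemma unit_arrows_Ltup:
 assumes "ys \<in> obj_tuples A n" "al \<in> arrow_tuples A ys"
 shows "unit_arrows ys al \<in> Ltup n" "degsum (unit_arrows ys al) = degsum al"
proof -
 have l: "length ys = Suc n" "length al = n" using assms by (auto simp: obj_tuples_def arrow_tuples_def)
 have u: "unit_arrows ys al = ul (wd ys al)" by (simp add: unit_arrows_wd[OF l] ul_def)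
 show "unit_arrows ys al \<in> Ltup n" unfolding u using ul_Ltup[OF wd_arrows[OF assms]] length_wd[OF l] by simp
 have "map fst (map snd (wd ys al)) = map fst al" unfolding map_snd_wd[OF l] ..
 then have "map deg (wd ys al) = map fst al" by (simp add: comp_def)
 then show "degsum (unit_arrows ys al) = degsum al" unfolding u degsum_ul by simp
qed

lemma linear_add_diff:
 assumes "lin_map pscale sM f" "lin_map pscale sM g" "lin_map pscale sM h"
 shows "lin_map pscale sM (f - (g + h))"
proof -
 interpret vector_space sM by (rule bim.vector_space)
 show ?thesis using assms unfolding linear_iff[OF vs_pscale bim.vector_space]
  by (simp add: scale_right_distrib scale_right_diff_distrib)
qed

lemma linear_scale_diff:
 assumes "lin_map pscale sM f" "lin_map pscale sM g"
 shows "lin_map pscale sM (f - (%x. sM c (g x)))"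
proof -
 interpret vector_space sM by (rule bim.vector_space)
 show ?thesis using assms unfolding linear_iff[OF vs_pscale bim.vector_space]
  by (simp add: scale_right_distrib scale_right_diff_distrib mult.commute)
qed

lemma linear_diff:
 assumes "lin_map pscale sM f" "lin_map pscale sM g"
 shows "lin_map pscale sM (f - g)"
 using linear_scale_diff[OF assms, of 1] bim.vector_space by (simp add: vector_space_def fun_diff_def)

lemma hcochains_subspaces_L:
 "subspc hs (num (HH_coh L M n) i)" "subspc hs (den (HH_coh L M n) i)"
proof -
 note vM = bim.vector_space
 have sub: "subspc hs (num (hcochains L M n) i)" "subspc hs (den (hcochains L M n) i)" for n i
  unfolding hcochains_def
  by (rule prod_subspaces[OF vector_space_fun[OF vM]]; rule hom_subspaces[OF _ vM];
    simp add: arrow_tensor_def vs_pscale BM_subspace)+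
 have z: "hcoboundary L M n i 0 \<in> den (hcochains L M (Suc n)) i" for n i
 proof -
  interpret vector_space sM by (rule vM)
  have "LA (snd (hd xs)) 0 = 0" "RA 0 (snd (last xs)) = 0" if "xs \<in> Ltup (Suc n)" for xs
   using Ltup_tl[OF that] Ltup_butlast[OF that] BM_closed
    lin_on_0[OF vM vM LA_lin_right, of "snd (hd xs)" "fst (hd xs)" 0 0] lin_on_0[OF vM vM RA_lin_left, of "snd (last xs)" "fst (last xs)" 0 0]
   by auto
  then show ?thesis
   unfolding den_hcochains_L hcoboundary_L
   by (auto simp: dL_def obj_tuples_L hcoboundary_outside hcoboundary_linear simp del: replicate_Suc)
 qed
 note * = cohomology_subspaces[OF vector_space_fun[OF vector_space_fun[OF vM]], of "hcochains L M" "hcoboundary L M", OF _ sub _ _ z]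
 have 1: "scl (hcochains L M n) = hs" for n by (simp add: hcochains_def prod_sspace_def)
 have 2: "hcoboundary L M n i (x + y) - (hcoboundary L M n i x + hcoboundary L M n i y) \<in> den (hcochains L M (Suc n)) i"
  if "x \<in> num (hcochains L M n) i" "y \<in> num (hcochains L M n) i" for n i x y
  using that dL_add unfolding num_hcochains_L den_hcochains_L fun_diff_def plus_fun_def hcoboundary_L
  by (auto simp: obj_tuples_L hcoboundary_outside intro!: linear_add_diff[unfolded fun_diff_def plus_fun_def] hcoboundary_linear simp del: replicate_Suc)
 have 3: "hcoboundary L M n i (hs c x) - hs c (hcoboundary L M n i x) \<in> den (hcochains L M (Suc n)) i"
  if "x \<in> num (hcochains L M n) i" for n i c x
  using that dL_scale vM unfolding num_hcochains_L den_hcochains_L fun_diff_def plus_fun_def hcoboundary_L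
  by (auto simp: obj_tuples_L hcoboundary_outside module.scale_zero_right module_iff_vector_space
   intro!: linear_scale_diff[unfolded fun_diff_def plus_fun_def] hcoboundary_linear simp del: replicate_Suc)
 show "subspc hs (num (HH_coh L M n) i)" "subspc hs (den (HH_coh L M n) i)"
  unfolding HH_coh_def by (rule *; fact 1 2 3)+
qed

lemma hcochains_subspaces_A:
 "subspc hs (den (HH_coh A cM n) i)"
proof -
 note vM = bim.vector_space
 have sM: "MScale cM = sM" by (simp add: cat_bimod_def)
 have sub: "subspc hs (num (hcochains A cM n) i)" "subspc hs (den (hcochains A cM n) i)" for n i
  unfolding hcochains_def sM
  by (rule prod_subspaces[OF vector_space_fun[OF vM]]; rule hom_subspaces[OF _ vM];
    simp add: arrow_tensor_def vs_pscale cat_bimod_def corner_image_subspace obj_tuples_hd_last)+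
 have z: "hcoboundary A cM n i 0 \<in> den (hcochains A cM (Suc n)) i" for n i
 proof -
  interpret vector_space sM by (rule vM)
  have "dA n i (%ys al. 0) ys al = 0" if ys: "ys \<in> obj_tuples A (Suc n)" "al \<in> arrow_tuples A ys" for ys al
  proof -
   note p = path_ends[OF ys]
   have "LA (munit (ys ! 0) (ys ! 1) (snd (hd al))) 0 = 0" "RA 0 (munit (ys ! n) (ys ! Suc n) (snd (last al))) = 0"
    using lin_on_0[OF vM vM LA_lin_right[OF p(5)], of 0 0] lin_on_0[OF vM vM RA_lin_left[OF p(6)], of 0 0] BM_closed by auto
   then show ?thesis by (simp add: dA_def)
  qed
  then show ?thesis
   unfolding den_hcochains_A by (auto simp: hcoboundary_outside hcoboundary_A hcoboundary_linear sM)
 qed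
 note * = cohomology_subspaces(2)[OF vector_space_fun[OF vector_space_fun[OF vM]], of "hcochains A cM" "hcoboundary A cM", OF _ sub _ _ z]
 have 1: "scl (hcochains A cM n) = hs" for n by (simp add: hcochains_def prod_sspace_def sM)
 have 2: "hcoboundary A cM n i (x + y) - (hcoboundary A cM n i x + hcoboundary A cM n i y) \<in> den (hcochains A cM (Suc n)) i"
  if "x \<in> num (hcochains A cM n) i" "y \<in> num (hcochains A cM n) i" for n i x y
  using that dA_add unfolding num_hcochains_A den_hcochains_A
  by (auto simp: hcoboundary_outside hcoboundary_A intro!: linear_add_diff hcoboundary_linear[OF sM])
 have 3: "hcoboundary A cM n i (hs c x) - hs c (hcoboundary A cM n i x) \<in> den (hcochains A cM (Suc n)) i"
  if "x \<in> num (hcochains A cM n) i" for n i c x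
  using that dA_scale vM unfolding num_hcochains_A den_hcochains_A
  by (auto simp: hcoboundary_outside hcoboundary_A module.scale_zero_right module_iff_vector_space fun_diff_def
   intro!: linear_scale_diff[unfolded fun_diff_def] hcoboundary_linear[OF sM])
 show "subspc hs (den (HH_coh A cM n) i)"
  unfolding HH_coh_def by (rule *; fact 1 2 3)
qed

lemma restr_acoch:
 assumes F: "lcoch n i F"
 shows "acoch n i (%ys al. corner A M (hd ys) (last ys) (F (unit_arrows ys al)))"
 unfolding acoch_def
proof (intro ballI conjI)
 fix ys assume ys: "ys \<in> obj_tuples A n"
 note hl = obj_tuples_hd_last[OF ys]
 have lys: "length ys = Suc n" using ys by (simp add: obj_tuples_def)
 let ?ps = "zip (butlast ys) (tl ys)"
 have ps: "?ps \<in> PL n"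
 proof -
  have "x \<in> Obj A \<times> Obj A" if "x \<in> set ?ps" for x
  proof -
   have "fst x \<in> set (butlast ys)" "snd x \<in> set (tl ys)"
    using that in_set_zipE[of "fst x" "snd x" "butlast ys" "tl ys"] by auto
   moreover have "set (tl ys) <= set ys" by (cases ys) auto
   ultimately show ?thesis using ys in_set_butlastD[of "fst x" ys] by (auto simp: obj_tuples_def mem_Times_iff)
  qed
  then show ?thesis using lys by (auto simp: PL_def)
 qed
 have "wmlin sM n (%w. fam F (hd ys) w (last ys))" using gfam_fam[OF F] hl by (simp add: gfam_def)
 then have "mlin (Scale A) sM n (slots ?ps) (%al. fam F (hd ys) (zip ?ps al) (last ys))"
  using ps by (simp add: wmlin_def)
 then show "mlin (Scale A) sM n (%k. Mor A (ys ! k) (ys ! Suc k)) (%al. corner A M (hd ys) (last ys) (F (unit_arrows ys al)))"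
 proof (rule mlin_cong)
  show "slots ?ps k = Mor A (ys ! k) (ys ! Suc k)" if "k < n" for k
   using that lys by (simp add: nth_butlast nth_tl)
  show "fam F (hd ys) (zip ?ps al) (last ys) = corner A M (hd ys) (last ys) (F (unit_arrows ys al))"
   if al: "length al = n" for al :: "(bit * 'a) list"
   using unit_arrows_wd[OF lys al] by (simp add: fam_def ul_def wd_def)
 qed
 fix al assume al: "al \<in> arrow_tuples A ys"
 show "corner A M (hd ys) (last ys) (F (unit_arrows ys al)) \<in> corner A M (hd ys) (last ys) ` BM (i + degsum al)"
  using F unit_arrows_Ltup[OF ys al] unfolding lcoch_def by (metis imageI)
qed

text \<open>All joints of a path are matched and its faces are again paths, so only values of
  \<open>F\<close> on composable words enter.\<close>

lemma restr_dL:
 assumes F: "lcoch m i F" and ys: "ys \<in> obj_tuples A (Suc m)" and al: "al \<in> arrow_tuples A ys"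
 shows "corner A M (hd ys) (last ys) (dL m i F (unit_arrows ys al)) =
  dA m i (%ys al. corner A M (hd ys) (last ys) (F (unit_arrows ys al))) ys al"
proof -
 have l: "length ys = Suc (Suc m)" "length al = Suc m" using ys al by (auto simp: obj_tuples_def arrow_tuples_def)
 note hl = obj_tuples_hd_last[OF ys]
 let ?G = "%ys al. corner A M (hd ys) (last ys) (F (unit_arrows ys al))"
 have ne: "wd ys al ~= []" using length_wd[OF l] by auto
 have "corner A M (hd ys) (last ys) (dL m i F (unit_arrows ys al)) = fam (dL m i F) (hd ys) (wd ys al) (last ys)"
  by (rule fam_wd[OF ys al])
 also have "... = wdiff A (lact i) ract (fam F) (hd ys) (wd ys al) (last ys)"
  by (rule fam_dL[OF F wd_arrows[OF ys al] length_wd[OF l] hl])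
 also have "... = wdiff A (lact i) ract (comp_fam ?G) (hd ys) (wd ys al) (last ys)"
 proof (unfold wdiff_def, rule sum.cong[OF refl])
  fix k assume "k \<in> {..length (wd ys al)}"
  then have k: "k <= Suc m" "k <= length (wd ys al)" using length_wd[OF l] by auto
  have al0: "al ~= []" using l by auto
  have l': "length (remove_nth k ys) = Suc m" "length (path_face A k ys al) = m"
   using k l al0 by (simp_all add: length_remove_nth length_path_face)
  have "fam F (fleft k (hd ys) (wd ys al)) (fword A k (wd ys al)) (fright k (wd ys al) (last ys)) =
   comp_fam ?G (fleft k (hd ys) (wd ys al)) (fword A k (wd ys al)) (fright k (wd ys al) (last ys))"
   unfolding face_wd[OF l k(1)] comp_fam_wd[OF l'] unit_arrows_wd[OF l'] by (simp add: fam_def ul_def)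
  then show "alt k (if matched (hd ys) (wd ys al) (last ys) k then wface A (lact i) ract k (fam F) (hd ys) (wd ys al) (last ys) else 0) =
   alt k (if matched (hd ys) (wd ys al) (last ys) k then wface A (lact i) ract k (comp_fam ?G) (hd ys) (wd ys al) (last ys) else 0)"
   by (simp add: wface_def)
 qed
 also have "... = dA m i ?G ys al" by (rule dA_wdiff[OF l, symmetric])
 finally show ?thesis .
qed

lemma remove_nth_obj_tuples: "ys \<in> obj_tuples A (Suc n) ==> k <= Suc n ==> remove_nth k ys \<in> obj_tuples A n"
 by (auto simp: obj_tuples_def remove_nth_def dest: in_set_takeD in_set_dropD)

lemma dA_cong:
 assumes "ys \<in> obj_tuples A (Suc n)" "al \<in> arrow_tuples A ys" "!!ys al. ys \<in> obj_tuples A n ==> G ys al = H ys al"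
 shows "dA n j G ys al = dA n j H ys al"
 unfolding dA_def using path_ends(1,3)[OF assms(1,2)] remove_nth_obj_tuples[OF assms(1)]
 by (intro arg_cong2[where f = "(+)"] sum.cong refl) (simp_all add: assms(3))

theorem HH_coh_iso: "induces_iso (HH_restr A M n) (HH_coh L M n) (HH_coh A cM n)"
proof -
 note vM = bim.vector_space
 interpret vM: vector_space sM by (rule vM)
 have sMc: "MScale cM = sM" by (simp add: cat_bimod_def)
 \<comment> \<open>On cochains with values in these components the corner projections are
   additive.\<close>
 let ?S = "%i. {\<phi>. \<forall>xs\<in>Ltup n. \<phi> (uls n) (basis xs) \<in> BM (i + degsum xs)}"
 have lin: "lin_map pscale sM (HH_restr A M n \<phi> ys)" if "ys \<in> obj_tuples A n" for \<phi> ys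
  using that linear_lext[OF vM] by (simp add: HH_restr_def)
 have out: "HH_restr A M n \<phi> ys = 0" if "ys \<notin> obj_tuples A n" for \<phi> ys
  using that by (simp add: HH_restr_def)
 \<comment> \<open>The coboundary of the zero cochain lies in the denominators but need not be
   literally zero on tuples that are not arrow tuples, so it is subtracted and added back.\<close>
 have denW: "x \<in> den (HH_coh A cM n) i" if "x \<in> den (hcochains A cM n) i" for x i
 proof (cases n)
  case 0
  then show ?thesis using that by (auto simp: HH_coh_def cohomology_def)
 next
  case (Suc m)
  have "0 \<in> num (hcochains A cM m) i"
   unfolding num_hcochains_A acoch_def using corner_image_closed[OF obj_tuples_hd_last]
   by (auto simp: mlin_zero[OF vM] linear_iff[OF vs_pscale vM])
  moreover have "hcoboundary A cM m i 0 \<in> den (hcochains A cM n) i"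
  proof -
   have "dA m i (%ys al. 0) ys al = 0" if ys: "ys \<in> obj_tuples A n" "al \<in> arrow_tuples A ys" for ys al
   proof -
    note p = path_ends[OF ys[unfolded Suc]]
    have "LA (munit (ys ! 0) (ys ! 1) (snd (hd al))) 0 = 0" "RA 0 (munit (ys ! m) (ys ! Suc m) (snd (last al))) = 0"
     using lin_on_0[OF vM vM LA_lin_right[OF p(5)], of 0 0] lin_on_0[OF vM vM RA_lin_left[OF p(6)], of 0 0] BM_closed by auto
    then show ?thesis by (simp add: dA_def)
   qed
   then show ?thesis
    unfolding den_hcochains_A Suc by (auto simp: hcoboundary_outside hcoboundary_A hcoboundary_linear sMc)
  qed
  moreover from calculation(2) that have "x - hcoboundary A cM m i 0 \<in> den (hcochains A cM n) i"
   unfolding den_hcochains_A by (auto intro: linear_diff)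
  ultimately have "hcoboundary A cM m i 0 + (x - hcoboundary A cM m i 0) \<in>
   hcoboundary A cM m i ` num (hcochains A cM m) i + den (hcochains A cM n) i"
   by (intro set_plus_intro imageI)
  then show ?thesis using Suc by (simp add: HH_coh_def cohomology_def)
 qed
 have eqW: "x - y \<in> den (HH_coh A cM n) i"
  if "!!ys. ys \<notin> obj_tuples A n ==> x ys = 0 & y ys = 0"
   "!!ys. ys \<in> obj_tuples A n ==> lin_map pscale sM (x ys) & lin_map pscale sM (y ys)"
   "!!ys al. ys \<in> obj_tuples A n ==> al \<in> arrow_tuples A ys ==> x ys (basis al) = y ys (basis al)" for x y i
  by (rule denW) (use that in \<open>auto simp: den_hcochains_A intro: linear_diff\<close>)
 have scl: "scl (HH_coh L M n) = hs" "scl (HH_coh A cM n) = hs"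
  by (simp_all add: HH_coh_def cohomology_def hcochains_def prod_sspace_def sMc)
 have valZ: "lcoch n i (%xs. \<phi> (uls n) (basis xs))" "!!xs. xs \<in> Ltup (Suc n) ==> dL n i (%xs. \<phi> (uls n) (basis xs)) xs = 0"
  if "\<phi> \<in> num (HH_coh L M n) i" for \<phi> i
 proof -
  have "\<phi> \<in> num (hcochains L M n) i" "hcoboundary L M n i \<phi> \<in> den (hcochains L M (Suc n)) i"
   using that by (auto simp: HH_coh_def cohomology_def)
  then show "lcoch n i (%xs. \<phi> (uls n) (basis xs))" "!!xs. xs \<in> Ltup (Suc n) ==> dL n i (%xs. \<phi> (uls n) (basis xs)) xs = 0"
   unfolding num_hcochains_L den_hcochains_L hcoboundary_L by blast+
 qed
 have valB: "case n of 0 => \<forall>xs\<in>Ltup n. \<phi> (uls n) (basis xs) = 0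
   | Suc m => \<exists>K. lcoch m i K & (\<forall>xs\<in>Ltup n. \<phi> (uls n) (basis xs) = dL m i K xs)"
  if phi: "\<phi> \<in> den (HH_coh L M n) i" for \<phi> i
 proof (cases n)
  case 0
  then have "\<phi> \<in> den (hcochains L M n) i" using phi by (simp add: HH_coh_def cohomology_def)
  then show ?thesis unfolding den_hcochains_L 0 by simp
 next
  case (Suc m)
  obtain g e where g: "g \<in> num (hcochains L M m) i" "e \<in> den (hcochains L M n) i" "\<phi> = hcoboundary L M m i g + e"
   using phi Suc by (auto simp: HH_coh_def cohomology_def set_plus_def)
  then have "lcoch m i (%xs. g (uls m) (basis xs))" unfolding num_hcochains_L by blast
  moreover have "\<phi> (uls n) (basis xs) = dL m i (%xs. g (uls m) (basis xs)) xs" if "xs \<in> Ltup n" for xs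
   using g(2,3) that hcoboundary_L[of m i g xs] unfolding den_hcochains_L Suc by (simp del: replicate_Suc)
  ultimately show ?thesis using Suc by auto
 qed
 show ?thesis
 proof (rule induces_isoI[where S = ?S])
  show "vector_space (scl (HH_coh L M n))" "vector_space (scl (HH_coh A cM n))"
   unfolding scl by (rule vector_space_fun[OF vector_space_fun[OF vM]])+
  show "subspc (scl (HH_coh L M n)) (num (HH_coh L M n) i)" for i unfolding scl by (rule hcochains_subspaces_L)
  show "subspc (scl (HH_coh L M n)) (den (HH_coh L M n) i)" for i unfolding scl by (rule hcochains_subspaces_L)
  show "subspc (scl (HH_coh A cM n)) (den (HH_coh A cM n) i)" for i unfolding scl by (rule hcochains_subspaces_A)
  show "num (HH_coh L M n) i <= ?S i" for i using valZ(1) by (auto simp: lcoch_def)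
  show "den (HH_coh L M n) i <= ?S i" for i
  proof clarify
   fix \<phi> xs assume phi: "\<phi> \<in> den (HH_coh L M n) i" and xs: "xs \<in> Ltup n"
   show "\<phi> (uls n) (basis xs) \<in> BM (i + degsum xs)"
   proof (cases n)
    case 0
    then show ?thesis using valB[OF phi] xs BM_closed by simp
   next
    case (Suc m)
    then show ?thesis using valB[OF phi] xs dL_degree[of m i] by (auto simp del: replicate_Suc)
   qed
  qed
  show "HH_restr A M n (x + y) - (HH_restr A M n x + HH_restr A M n y) \<in> den (HH_coh A cM n) i"
   if "x \<in> ?S i" "y \<in> ?S i" for i x y
  proof (rule eqW)
   fix ys assume ys: "ys \<in> obj_tuples A n"
   show "lin_map pscale sM (HH_restr A M n (x + y) ys) &
     lin_map pscale sM ((HH_restr A M n x + HH_restr A M n y) ys)"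
    using lin[OF ys] unfolding linear_iff[OF vs_pscale vM] by (simp add: vM.scale_right_distrib)
   fix al assume al: "al \<in> arrow_tuples A ys"
   show "HH_restr A M n (x + y) ys (basis al) = (HH_restr A M n x + HH_restr A M n y) ys (basis al)"
    using that unit_arrows_Ltup[OF ys al] corner_lin[OF obj_tuples_hd_last[OF ys], of "i + degsum al"] ys
    unfolding lin_on_def by (simp add: HH_restr_basis del: replicate_Suc) (metis (no_types, lifting))
  qed (simp add: out)
  show "HH_restr A M n (scl (HH_coh L M n) c x) - scl (HH_coh A cM n) c (HH_restr A M n x) \<in> den (HH_coh A cM n) i"
   if x: "x \<in> num (HH_coh L M n) i" for i c x
   unfolding scl
  proof (rule eqW)
   fix ys assume ys: "ys \<in> obj_tuples A n"
   show "lin_map pscale sM (HH_restr A M n (hs c x) ys) &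
     lin_map pscale sM (hs c (HH_restr A M n x) ys)"
    using lin[OF ys] unfolding linear_iff[OF vs_pscale vM]
    by (simp add: vM.scale_right_distrib mult.commute)
   fix al assume al: "al \<in> arrow_tuples A ys"
   show "HH_restr A M n (hs c x) ys (basis al) = hs c (HH_restr A M n x) ys (basis al)"
    using valZ(1)[OF x] unit_arrows_Ltup[OF ys al] corner_lin[OF obj_tuples_hd_last[OF ys], of "i + degsum al"] ys
    unfolding lin_on_def lcoch_def by (simp add: HH_restr_basis del: replicate_Suc) (metis (no_types, lifting))
  qed (auto simp: out)
  show "HH_restr A M n x \<in> num (HH_coh A cM n) i" if x: "x \<in> num (HH_coh L M n) i" for i x
  proof -
   let ?F = "%xs. x (uls n) (basis xs)"
   have "acoch n i (%ys al. HH_restr A M n x ys (basis al))"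
    using restr_acoch[OF valZ(1)[OF x]] unfolding acoch_def by (simp add: HH_restr_basis del: replicate_Suc)
   then have 1: "HH_restr A M n x \<in> num (hcochains A cM n) i"
    unfolding num_hcochains_A using lin out by blast
   have "dA n i (%ys al. HH_restr A M n x ys (basis al)) ys al = 0"
    if ys: "ys \<in> obj_tuples A (Suc n)" and al: "al \<in> arrow_tuples A ys" for ys al
   proof -
    have "dA n i (%ys al. HH_restr A M n x ys (basis al)) ys al =
      dA n i (%ys al. corner A M (hd ys) (last ys) (?F (unit_arrows ys al))) ys al"
     by (rule dA_cong[OF ys al HH_restr_basis])
    also have "... = corner A M (hd ys) (last ys) (dL n i ?F (unit_arrows ys al))"
     by (rule restr_dL[OF valZ(1)[OF x] ys al, symmetric])
    also have "... = 0"
     using valZ(2)[OF x unit_arrows_Ltup(1)[OF ys al]] corner_0[OF obj_tuples_hd_last[OF ys]] by simp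
    finally show ?thesis .
   qed
   then have "hcoboundary A cM n i (HH_restr A M n x) \<in> den (hcochains A cM (Suc n)) i"
    unfolding den_hcochains_A by (simp add: hcoboundary_outside hcoboundary_A hcoboundary_linear sMc)
   then show ?thesis using 1 by (simp add: HH_coh_def cohomology_def)
  qed
  show "HH_restr A M n x \<in> den (HH_coh A cM n) i" if x: "x \<in> den (HH_coh L M n) i" for i x
  proof (cases n)
   case 0
   have zl: "lin_map pscale sM 0" by (simp add: linear_iff[OF vs_pscale vM])
   have "HH_restr A M n x - 0 \<in> den (HH_coh A cM n) i"
   proof (rule eqW)
    fix ys al assume "ys \<in> obj_tuples A n" "al \<in> arrow_tuples A ys"
    then show "HH_restr A M n x ys (basis al) = 0 ys (basis al)"
     using valB[OF x] unit_arrows_Ltup[of ys n al] 0 by (simp add: HH_restr_basis corner_0 obj_tuples_hd_last)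
   qed (simp_all add: lin out zl)
   then show ?thesis by simp
  next
   case (Suc m)
   then obtain K where K: "lcoch m i K" "\<forall>xs\<in>Ltup n. x (uls n) (basis xs) = dL m i K xs"
    using valB[OF x] by auto
   \<comment> \<open>The restriction of the primitive \<open>K\<close>; by \<open>restr_dL\<close>
     its coboundary represents the restriction of \<open>x\<close>.\<close>
   define k where "k = (%ys. if ys \<in> obj_tuples A m then lext sM (%al. corner A M (hd ys) (last ys) (K (unit_arrows ys al))) else 0)"
   have kb: "k ys (basis al) = corner A M (hd ys) (last ys) (K (unit_arrows ys al))" if "ys \<in> obj_tuples A m" for ys al
    using that by (simp add: k_def lext_basis[OF vM])
   have kn: "k \<in> num (hcochains A cM m) i"
   proof -
    have "acoch m i (%ys al. corner A M (hd ys) (last ys) (K (unit_arrows ys al)))"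
     by (rule restr_acoch[OF K(1)])
    then have "acoch m i (%ys al. k ys (basis al))" unfolding acoch_def by (simp add: kb)
    then show ?thesis unfolding num_hcochains_A by (simp add: k_def linear_lext[OF vM])
   qed
   have "HH_restr A M n x - hcoboundary A cM m i k \<in> den (hcochains A cM n) i"
    unfolding den_hcochains_A
   proof (intro conjI allI impI ballI)
    fix ys assume ys: "ys \<in> obj_tuples A n"
    note ys' = ys[unfolded Suc]
    show "lin_map pscale sM ((HH_restr A M n x - hcoboundary A cM m i k) ys)"
     using linear_diff[OF lin[OF ys] hcoboundary_linear[OF sMc ys', of i k]] by simp
    fix al assume al: "al \<in> arrow_tuples A ys"
    have "HH_restr A M n x ys (basis al) = corner A M (hd ys) (last ys) (dL m i K (unit_arrows ys al))"
     using K(2) unit_arrows_Ltup(1)[OF ys al] by (simp add: HH_restr_basis[OF ys] del: replicate_Suc)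
    also have "... = dA m i (%ys al. corner A M (hd ys) (last ys) (K (unit_arrows ys al))) ys al"
     by (rule restr_dL[OF K(1) ys' al])
    also have "... = dA m i (%ys al. k ys (basis al)) ys al"
     by (rule dA_cong[OF ys' al kb[symmetric]])
    finally show "(HH_restr A M n x - hcoboundary A cM m i k) ys (basis al) = 0"
     by (simp add: hcoboundary_A[OF ys'])
   qed (use Suc out in \<open>simp add: hcoboundary_outside\<close>)
   then have "hcoboundary A cM m i k + (HH_restr A M n x - hcoboundary A cM m i k) \<in>
    hcoboundary A cM m i ` num (hcochains A cM m) i + den (hcochains A cM n) i"
    using kn by (intro set_plus_intro imageI)
   then show ?thesis using Suc by (simp add: HH_coh_def cohomology_def)
  qed
  show "x \<in> den (HH_coh L M n) i" if x: "x \<in> num (HH_coh L M n) i" and rx: "HH_restr A M n x \<in> den (HH_coh A cM n) i" for i x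
  proof -
   let ?F = "%xs. x (uls n) (basis xs)"
   have xn: "x \<in> num (hcochains L M n) i" using x by (simp add: HH_coh_def cohomology_def)
   note ex = cochain_exact[OF valZ(1)[OF x] valZ(2)[OF x]]
   show ?thesis
   proof (cases n)
    case 0
    have "HH_restr A M n x \<in> den (hcochains A cM n) i" using rx 0 by (simp add: HH_coh_def cohomology_def)
    then have "corner A M (hd ys) (last ys) (?F (unit_arrows ys al)) = 0"
     if "ys \<in> obj_tuples A n" "al \<in> arrow_tuples A ys" for ys al
     using that unfolding den_hcochains_A by (metis HH_restr_basis)
    then have "?F xs = 0" if "xs \<in> Ltup n" for xs
     using ex(1)[where G = "%_ _. 0"] that 0 by (simp del: replicate_Suc)
    then have "x \<in> den (hcochains L M n) i" using xn unfolding num_hcochains_L den_hcochains_L by blast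
    then show ?thesis using 0 by (simp add: HH_coh_def cohomology_def)
   next
    case (Suc m)
    obtain g e where g: "g \<in> num (hcochains A cM m) i" "e \<in> den (hcochains A cM n) i"
     "HH_restr A M n x = hcoboundary A cM m i g + e"
     using rx Suc by (auto simp: HH_coh_def cohomology_def set_plus_def)
    let ?G = "%ys al. g ys (basis al)"
    have G: "acoch m i ?G" using g(1) unfolding num_hcochains_A by blast
    have "corner A M (hd ys) (last ys) (?F (unit_arrows ys al)) = dA m i ?G ys al"
     if ys: "ys \<in> obj_tuples A n" and al: "al \<in> arrow_tuples A ys" for ys al
    proof -
     have "corner A M (hd ys) (last ys) (?F (unit_arrows ys al)) = HH_restr A M n x ys (basis al)"
      by (simp add: HH_restr_basis[OF ys] del: replicate_Suc)
     also have "... = dA m i ?G ys al"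
      unfolding g(3) using g(2) ys al Suc unfolding den_hcochains_A by (simp add: hcoboundary_A)
     finally show ?thesis .
    qed
    then obtain K where K: "lcoch m i K" "\<forall>xs\<in>Ltup n. ?F xs = dL m i K xs"
     using ex(2)[of m ?G] G Suc by auto
    define k where "k = (%us. if us = uls m then lext sM K else 0)"
    have kb: "k (uls m) (basis xs) = K xs" for xs by (simp add: k_def lext_basis[OF vM])
    have "k \<in> num (hcochains L M m) i"
     unfolding num_hcochains_L kb using K(1) by (simp add: k_def linear_lext[OF vM])
    moreover have "x - hcoboundary L M m i k \<in> den (hcochains L M n) i"
    proof -
     have "x (uls n) (basis xs) = hcoboundary L M m i k (uls n) (basis xs)" if "xs \<in> Ltup n" for xs
      using K(2) that unfolding Suc hcoboundary_L kb by simp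
     moreover have "lin_map pscale sM (x (uls n) - hcoboundary L M m i k (uls n))"
      using xn Suc unfolding num_hcochains_L
      by (intro linear_diff hcoboundary_linear) (auto simp: obj_tuples_L simp del: replicate_Suc)
     ultimately show ?thesis
      using xn Suc unfolding num_hcochains_L den_hcochains_L
      by (simp add: hcoboundary_outside obj_tuples_L del: replicate_Suc)
    qed
    ultimately have "hcoboundary L M m i k + (x - hcoboundary L M m i k) \<in>
     hcoboundary L M m i ` num (hcochains L M m) i + den (hcochains L M n) i"
     by (intro set_plus_intro imageI)
    then show ?thesis using Suc by (simp add: HH_coh_def cohomology_def)
   qed
  qed
  show "\<exists>v\<in>num (HH_coh L M n) i. HH_restr A M n v - w \<in> den (HH_coh A cM n) i" if w: "w \<in> num (HH_coh A cM n) i" for i w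
  proof -
   have wn: "w \<in> num (hcochains A cM n) i" "hcoboundary A cM n i w \<in> den (hcochains A cM (Suc n)) i"
    using w by (auto simp: HH_coh_def cohomology_def)
   let ?G = "%ys al. w ys (basis al)"
   have G: "acoch n i ?G" using wn(1) unfolding num_hcochains_A by blast
   have dG: "dA n i ?G ys al = 0" if "ys \<in> obj_tuples A (Suc n)" "al \<in> arrow_tuples A ys" for ys al
    using wn(2) that unfolding den_hcochains_A by (metis hcoboundary_A)
   obtain F where F: "lcoch n i F" "!!xs. xs \<in> Ltup (Suc n) ==> dL n i F xs = 0"
    "!!ys al. ys \<in> obj_tuples A n ==> al \<in> arrow_tuples A ys ==>
     corner A M (hd ys) (last ys) (F (unit_arrows ys al)) = ?G ys al"
    using cochain_lift[OF G dG] by blast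
   define v where "v = (%us. if us = uls n then lext sM F else 0)"
   have vb: "v (uls n) (basis xs) = F xs" for xs by (simp add: v_def lext_basis[OF vM])
   have "v \<in> num (hcochains L M n) i"
    unfolding num_hcochains_L vb using F(1) by (simp add: v_def linear_lext[OF vM])
   moreover have "hcoboundary L M n i v \<in> den (hcochains L M (Suc n)) i"
    unfolding den_hcochains_L hcoboundary_L vb using F(2)
    by (simp add: hcoboundary_outside hcoboundary_linear obj_tuples_L del: replicate_Suc)
   ultimately have "v \<in> num (HH_coh L M n) i" by (simp add: HH_coh_def cohomology_def)
   moreover have "HH_restr A M n v - w \<in> den (HH_coh A cM n) i"
   proof (rule eqW)
    fix ys assume ys: "ys \<in> obj_tuples A n"
    show "lin_map pscale sM (HH_restr A M n v ys) & lin_map pscale sM (w ys)"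
     using lin[OF ys] wn(1) ys unfolding num_hcochains_A by blast
    fix al assume al: "al \<in> arrow_tuples A ys"
    show "HH_restr A M n v ys (basis al) = w ys (basis al)"
     unfolding HH_restr_basis[OF ys] vb by (rule F(3)[OF ys al])
   qed (use out wn(1) in \<open>auto simp: num_hcochains_A\<close>)
   ultimately show ?thesis by blast
  qed
 qed
qed

end

section \<open>Functionals on Hochschild chains\<close>

lemma bit_cancel: "(a::bit) + (a + b) = b" "a + (b + a) = b"
 by (cases a; cases b; simp)+

lemma sum_fun_apply: "(\<Sum>i\<in>I. f i) x = (\<Sum>i\<in>I. f i x)"
 by (induction I rule: infinite_finite_induct) auto

lemma alt_fun_apply: "alt i f x = alt i (f x)"
 by (simp add: alt_def)

lemma whtpy_apply: "whtpy A f X w Z x = whtpy A (%X w Z. f X w Z x) X w Z"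
 by (simp add: whtpy_def alt_fun_apply Let_def)

text \<open>
 \<open>em X Y\<close> embeds \<open>N(X,Y)\<close> into the bimodule \<open>M\<close> over the superalgebra, with image \<open>1\<^sub>X M 1\<^sub>Y\<close>, and
 \<open>cp X Y\<close> is the corresponding projection. This covers \<open>cat_bimod A M\<close> as well as \<open>std_bimod A\<close>.
\<close>

locale chain_comparison = finite_superadditive_category A
 for A :: "('k::field, 'o, 'a::ab_group_add) scat" +
 fixes M :: "('k, unit, 'o => 'o => 'a, 'm::ab_group_add) sbimod"
  and N :: "('k, 'o, 'a, 'n::ab_group_add) sbimod"
  and em :: "'o => 'o => 'n => 'm" and cp :: "'o => 'o => 'm => 'n"
 assumes vM: "vector_space (MScale M)" and vN: "vector_space (MScale N)"
  and M_subspace: "subspc (MScale M) (Bim M () () d)"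
  and N_subspace: "X \<in> Obj A ==> Y \<in> Obj A ==> subspc (MScale N) (Bim N X Y d)"
  and LM_degree: "x \<in> Mor (superalgebra A) () () i ==> m \<in> Bim M () () j ==> LAct M () () () x m \<in> Bim M () () (i + j)"
  and RM_degree: "m \<in> Bim M () () i ==> x \<in> Mor (superalgebra A) () () j ==> RAct M () () () m x \<in> Bim M () () (i + j)"
  and LM_lin_left: "m \<in> Bim M () () j ==> lin_on (Scale (superalgebra A)) (MScale M) (Mor (superalgebra A) () () i) (%x. LAct M () () () x m)"
  and LM_lin_right: "x \<in> Mor (superalgebra A) () () i ==> lin_on (MScale M) (MScale M) (Bim M () () j) (%m. LAct M () () () x m)"
  and RM_lin_left: "x \<in> Mor (superalgebra A) () () i ==> lin_on (MScale M) (MScale M) (Bim M () () j) (%m. RAct M () () () m x)"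
  and RM_lin_right: "m \<in> Bim M () () j ==> lin_on (Scale (superalgebra A)) (MScale M) (Mor (superalgebra A) () () i) (%x. RAct M () () () m x)"
  and LN_degree: "u \<in> arrows A ==> Y \<in> Obj A ==> v \<in> Bim N (tgt u) Y j ==>
   LAct N (src u) (tgt u) Y (mor u) v \<in> Bim N (src u) Y (deg u + j)"
  and RN_degree: "u \<in> arrows A ==> X \<in> Obj A ==> v \<in> Bim N X (src u) i ==>
   RAct N X (src u) (tgt u) v (mor u) \<in> Bim N X (tgt u) (i + deg u)"
  and RN_unit: "X \<in> Obj A ==> Y \<in> Obj A ==> v \<in> Bim N X Y d ==> RAct N X Y Y v (Idn A Y) = v"
  and em_degree: "X \<in> Obj A ==> Y \<in> Obj A ==> v \<in> Bim N X Y d ==> em X Y v \<in> Bim M () () d"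
  and em_lin: "X \<in> Obj A ==> Y \<in> Obj A ==> lin_on (MScale N) (MScale M) (Bim N X Y d) (em X Y)"
  and cp_degree: "X \<in> Obj A ==> Y \<in> Obj A ==> m \<in> Bim M () () d ==> cp X Y m \<in> Bim N X Y d"
  and cp_lin: "X \<in> Obj A ==> Y \<in> Obj A ==> lin_on (MScale M) (MScale N) (Bim M () () d) (cp X Y)"
  and cp_em: "X \<in> Obj A ==> Y \<in> Obj A ==> X' \<in> Obj A ==> Y' \<in> Obj A ==> v \<in> Bim N X' Y' d ==>
   cp X Y (em X' Y' v) = (if X = X' & Y = Y' then v else 0)"
  and em_cp: "m \<in> Bim M () () d ==> (\<Sum>X\<in>Obj A. \<Sum>Y\<in>Obj A. em X Y (cp X Y m)) = m"
  and RM_em: "u \<in> arrows A ==> X \<in> Obj A ==> Y \<in> Obj A ==> v \<in> Bim N X Y d ==>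
   RAct M () () () (em X Y v) (munit (src u) (tgt u) (mor u)) =
   (if Y = src u then em X (tgt u) (RAct N X (src u) (tgt u) v (mor u)) else 0)"
  and LM_em: "u \<in> arrows A ==> X \<in> Obj A ==> Y \<in> Obj A ==> v \<in> Bim N X Y d ==>
   LAct M () () () (munit (src u) (tgt u) (mor u)) (em X Y v) =
   (if tgt u = X then em (src u) Y (LAct N (src u) (tgt u) Y (mor u) v) else 0)"
begin

abbreviation "sM \<equiv> MScale M"
abbreviation "sN \<equiv> MScale N"
abbreviation "BM \<equiv> Bim M () ()"
abbreviation "BN \<equiv> Bim N"
abbreviation "LA \<equiv> LAct M () () ()"
abbreviation "RA \<equiv> RAct M () () ()"

lemmas M_closed = M_subspace[unfolded subspace_iff[OF vM]]
lemmas N_closed = N_subspace[unfolded subspace_iff[OF vN]]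
lemmas vK = vector_space_mult

text \<open>A functional is evaluated as \<open>F (d, m) xs\<close>, where \<open>m\<close> has degree \<open>d\<close>; \<open>j\<close> is its own degree.\<close>

definition hml :: "nat => bit => (bit * 'm => (bit * ('o => 'o => 'a)) list => 'k) => bool" where
 "hml n j F \<longleftrightarrow> (\<forall>d. \<forall>m\<in>BM d. Lmlin (*) n (F (d, m))) &
   (\<forall>d. \<forall>xs\<in>Ltup n. lin_on sM (*) (BM d) (%m. F (d, m) xs)) &
   (\<forall>d. \<forall>m\<in>BM d. \<forall>xs\<in>Ltup n. d + degsum xs ~= j --> F (d, m) xs = 0)"

text \<open>The transposed differential from degree \<open>n\<close> to \<open>Suc n\<close>: that
  of b with the flag set, that of b' otherwise.\<close>

definition dF :: "bool => nat => (bit * 'm => (bit * ('o => 'o => 'a)) list => 'k)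
  => bit * 'm => (bit * ('o => 'o => 'a)) list => 'k" where
 "dF c n F dm xs =
   F (fst dm + fst (hd xs), RA (snd dm) (snd (hd xs))) (tl xs) +
   (\<Sum>i=1..n. (-1) ^ i * F dm (contract L [] i xs)) +
   (if c then (-1) ^ Suc n * (ksign (fst (last xs) * (fst dm + degsum (butlast xs))) *
    F (fst (last xs) + fst dm, LA (snd (last xs)) (snd dm)) (butlast xs)) else 0)"

text \<open>The coefficient runs from \<open>Z\<close> to \<open>X\<close> and closes the word to a
  cycle. The value 0 at other \<open>m\<close> allows families to be compared as functions.\<close>

definition famF :: "(bit * 'm => (bit * ('o => 'o => 'a)) list => 'k) => ('o, 'a, bit * 'n => 'k) wfam" where
 "famF F X w Z = (%(d, m). if m \<in> BN Z X d then F (d, em Z X m) (ul w) else 0)"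

text \<open>Face 0 multiplies the coefficient from the right; seen from the word, this happens at
  its left end.\<close>

definition lN :: "('o, 'a) arrow => 'o => (bit * 'n => 'k) => bit * 'n => 'k" where
 "lN x Z \<phi> = (%(d, m). \<phi> (d + deg x, RAct N Z (src x) (tgt x) m (mor x)))"

text \<open>The Koszul sign of the last face involves the degrees of all other factors. A functional
  of degree \<open>j\<close> sees only tuples of total degree \<open>j\<close>, where that sum is
  \<open>j + deg x\<close>; so the sign depends on \<open>x\<close> alone.\<close>

definition rN :: "bool => bit => 'o => ('o, 'a) arrow => (bit * 'n => 'k) => bit * 'n => 'k" where
 "rN c j X x \<phi> = (%(d, m). if c then
   ksign (deg x * (j + deg x)) * \<phi> (deg x + d, LAct N (src x) (tgt x) X (mor x) m) else 0)"

definition gfamF :: "nat => bit => ('o, 'a, bit * 'n => 'k) wfam => bool" where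
 "gfamF n j f \<longleftrightarrow> (\<forall>X\<in>Obj A. \<forall>Z\<in>Obj A.
   (\<forall>d. \<forall>m\<in>BN Z X d. wmlin (*) n (%w. f X w Z (d, m))) &
   (\<forall>w. set w <= arrows A --> length w = n -->
    (\<forall>d. lin_on sN (*) (BN Z X d) (%m. f X w Z (d, m))) &
    (\<forall>d m. d + sum_list (map deg w) ~= j | m \<notin> BN Z X d --> f X w Z (d, m) = 0)))"

definition exf :: "('o, 'a, bit * 'n => 'k) wfam => bit * 'm => (bit * ('o => 'o => 'a)) list => 'k" where
 "exf f dm xs = (\<Sum>X\<in>Obj A. \<Sum>Z\<in>Obj A. exw (%w. f X w Z (fst dm, cp Z X (snd dm))) xs)"

lemma lin_on_comp: "lin_on s t U f ==> (!!u. u \<in> U ==> f u \<in> V) ==> lin_on t r V g ==> lin_on s r U (%u. g (f u))"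
 by (simp add: lin_on_def)

lemma ul_parts:
 assumes "w ~= []"
 shows "hd (ul w) = (deg (hd w), um (hd w))" "tl (ul w) = ul (tl w)"
  "last (ul w) = (deg (last w), um (last w))" "butlast (ul w) = ul (butlast w)"
 using assms by (auto simp: ul_def hd_map map_tl last_map map_butlast)

lemma dF_hml:
 assumes F: "hml n j F"
 shows "hml (Suc n) j (dF c n F)"
 unfolding hml_def
proof (intro conjI allI ballI impI)
 have Fx: "Lmlin (*) n (F (d, m))" if "m \<in> BM d" for d m using F that by (simp add: hml_def)
 have Fm: "lin_on sM (*) (BM d) (%m. F (d, m) xs)" if "xs \<in> Ltup n" for d xs using F that by (simp add: hml_def)
 have F0: "F (d, m) xs = 0" if "m \<in> BM d" "xs \<in> Ltup n" "d + degsum xs ~= j" for d m xs using F that by (simp add: hml_def)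
 fix d
 show "Lmlin (*) (Suc n) (dF c n F (d, m))" if m: "m \<in> BM d" for m
 proof -
  have "Lmlin (*) (Suc n) (%xs. (%x xs. F (d + fst x, RA m (snd x)) xs) (hd xs) (tl xs))"
  proof (rule mlin_hd)
   show "Lmlin (*) n (%xs. F (d + fst x, RA m (snd x)) xs)" if "snd x \<in> LM (fst x)" for x
    by (rule Fx[OF RM_degree[OF m that]])
   show "lin_on (Scale L) (*) (LM i) (%x. F (d + fst (i, x), RA m (snd (i, x))) xs)" if "xs \<in> Ltup n" for i xs
    unfolding fst_conv snd_conv
    by (rule lin_on_comp[OF RM_lin_right[OF m] _ Fm[OF that]]) (rule RM_degree[OF m])
  qed
  moreover have "Lmlin (*) (Suc n) (%xs. \<Sum>i=1..n. (-1) ^ i * F (d, m) (contract L [] i xs))"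
   by (intro mlin_sum[OF vK] mlin_scale[OF vK] mlin_contract[OF vK Fx[OF m]]) auto
  moreover have "Lmlin (*) (Suc n) (%xs. (%x xs. (-1) ^ Suc n *
    (ksign (fst x * (d + degsum xs)) * F (fst x + d, LA (snd x) m) xs)) (last xs) (butlast xs))"
  proof (rule mlin_last)
   fix x :: "bit * ('o => 'o => 'a)" assume x: "snd x \<in> LM (fst x)"
   have "Lmlin (*) n (%xs. ksign (fst x * (d + degsum xs)) * F (fst x + d, LA (snd x) m) xs)"
   proof (rule mlinI)
    fix xs k assume xs: "xs \<in> Ltup n" and k: "k < n"
    then have "k < length xs" by (simp add: tup_def)
    then show "lin_on (Scale L) (*) (LM (fst (xs ! k))) (%u. ksign (fst x * (d + degsum (xs[k := (fst (xs ! k), u)]))) *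
      F (fst x + d, LA (snd x) m) (xs[k := (fst (xs ! k), u)]))"
     unfolding degsum_update[OF \<open>k < length xs\<close>]
     by (intro lin_on_scale[OF vK] mlinD[OF Fx[OF LM_degree[OF x m]] xs k refl])
   qed
   then show "Lmlin (*) n (%xs. (-1) ^ Suc n * (ksign (fst x * (d + degsum xs)) * F (fst x + d, LA (snd x) m) xs))"
    by (rule mlin_scale[OF vK])
  next
   fix i and xs :: "(bit * ('o => 'o => 'a)) list" assume xs: "xs \<in> Ltup n"
   show "lin_on (Scale L) (*) (LM i) (%x. (-1) ^ Suc n *
     (ksign (fst (i, x) * (d + degsum xs)) * F (fst (i, x) + d, LA (snd (i, x)) m) xs))"
    unfolding fst_conv snd_conv
    by (intro lin_on_scale[OF vK] lin_on_comp[OF LM_lin_left[OF m] _ Fm[OF xs]] LM_degree[OF _ m])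
  qed
  ultimately show ?thesis unfolding dF_def[abs_def] fst_conv snd_conv
   using mlin_zero[OF vK] by (cases c; simp only: if_True if_False; intro mlin_add[OF vK]) auto
 qed
 show "lin_on sM (*) (BM d) (%m. dF c n F (d, m) xs)" if xs: "xs \<in> Ltup (Suc n)" for xs
 proof -
  note h = Ltup_tl[OF xs] and l = Ltup_butlast[OF xs]
  have "lin_on sM (*) (BM d) (%m. F (d + fst (hd xs), RA m (snd (hd xs))) (tl xs))"
   using h by (intro lin_on_comp[OF RM_lin_left[of "snd (hd xs)"] RM_degree Fm]) auto
  moreover have "lin_on sM (*) (BM d) (%m. \<Sum>i=1..n. (-1) ^ i * F (d, m) (contract L [] i xs))"
   using contract_Ltup[OF xs] by (intro lin_on_sum[OF vK] lin_on_scale[OF vK] Fm) auto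
  moreover have "lin_on sM (*) (BM d) (%m. (-1) ^ Suc n * (ksign (fst (last xs) * (d + degsum (butlast xs))) *
    F (fst (last xs) + d, LA (snd (last xs)) m) (butlast xs)))"
   using l by (intro lin_on_scale[OF vK] lin_on_comp[OF LM_lin_right[of "snd (last xs)"] LM_degree Fm]) auto
  ultimately show ?thesis unfolding dF_def fst_conv snd_conv
   using lin_on_zero[OF vK] by (cases c; simp only: if_True if_False; intro lin_on_add[OF vK]) auto
 qed
 show "dF c n F (d, m) xs = 0" if m: "m \<in> BM d" and xs: "xs \<in> Ltup (Suc n)" and ne: "d + degsum xs ~= j" for m xs
 proof -
  note h = Ltup_tl[OF xs] and l = Ltup_butlast[OF xs]
  have "F (d + fst (hd xs), RA m (snd (hd xs))) (tl xs) = 0"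
   using h ne by (intro F0 RM_degree[OF m]) (auto simp: ac_simps)
  moreover have "F (d, m) (contract L [] i xs) = 0" if "i \<in> {1..n}" for i
  proof -
   have "i < length xs" using xs that by (auto simp: tup_def)
   then show ?thesis
    using degsum_contract[of i xs L "[]"] contract_Ltup[OF xs] ne that by (intro F0[OF m]) auto
  qed
  moreover have "F (fst (last xs) + d, LA (snd (last xs)) m) (butlast xs) = 0"
   using l ne by (intro F0 LM_degree[OF _ m]) (auto simp: ac_simps)
  ultimately show ?thesis by (simp add: dF_def)
 qed
qed

lemma famF_dF:
 assumes F: "hml n j F" and w: "set w <= arrows A" "length w = Suc n" and X: "X \<in> Obj A" and Z: "Z \<in> Obj A"
  and m: "m \<in> BN Z X d"
 shows "famF (dF c n F) X w Z (d, m) = wdiff A lN (rN c j) (famF F) X w Z (d, m)"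
proof -
 have ne: "w ~= []" using w by auto
 have hl: "hd w \<in> arrows A" "last w \<in> arrows A" using w ne by auto
 have lw: "w ! n = last w" using last_conv_nth[OF ne] w by simp
 have xs: "ul w \<in> Ltup (Suc n)" using ul_Ltup[OF w(1)] w(2) by simp
 have Fx: "Lmlin (*) n (F (d, m))" if "m \<in> BM d" for d m using F that by (simp add: hml_def)
 have F0: "F (d, m) xs = 0" if "m \<in> BM d" "xs \<in> Ltup n" "d + degsum xs ~= j" for d m xs using F that by (simp add: hml_def)
 have Fz: "F (d, 0) xs = 0" if "xs \<in> Ltup n" for d xs
  using F that M_closed lin_on_0[OF vM vK, of "BM d" "%m. F (d, m) xs" 0] by (simp add: hml_def)
 have eM: "em Z X m \<in> BM d" by (rule em_degree[OF Z X m])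
 define g where "g = (%i. if matched X w Z i then wface A lN (rN c j) i (famF F) X w Z (d, m) else 0)"
 have t: "ul (tl w) \<in> Ltup n" "ul (butlast w) \<in> Ltup n"
  using Ltup_tl[OF xs] Ltup_butlast[OF xs] ul_parts[OF ne] by auto
 have g0: "F (d + deg (hd w), RA (em Z X m) (um (hd w))) (ul (tl w)) = g 0"
 proof (cases "X = src (hd w)")
  case True
  have "RAct N Z (src (hd w)) (tgt (hd w)) m (mor (hd w)) \<in> BN Z (tgt (hd w)) (d + deg (hd w))"
   using RN_degree[OF hl(1) Z] m True by simp
  moreover have "RA (em Z X m) (um (hd w)) = em Z (tgt (hd w)) (RAct N Z (src (hd w)) (tgt (hd w)) m (mor (hd w)))"
   using RM_em[OF hl(1) Z X m] True by simp
  ultimately show ?thesis using True ne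
   by (simp add: g_def matched_def lo_def ro_def hd_conv_nth[symmetric] wface_def outer_def lN_def famF_def
     fleft_def fword_def fright_def w)
 next
  case False
  then show ?thesis using ne t
   by (simp add: g_def matched_def lo_def ro_def hd_conv_nth[symmetric] RM_em[OF hl(1) Z X m] Fz)
 qed
 have gi: "(-1) ^ i * F (d, em Z X m) (contract L [] i (ul w)) = alt i (g i)" if i: "i \<in> {1..n}" for i
 proof -
  have i': "0 < i" "i <= n" using i by auto
  have "F (d, em Z X m) (contract L [] i (ul w)) = g i"
  proof (cases "tgt (w ! (i - 1)) = src (w ! i)")
   case True
   then have "contract L [] i (ul w) = ul (wcontract A i w)" using contract_ul[OF w(1)] i' w by simp
   then show ?thesis using True i' w m
    by (simp add: g_def matched_def lo_def ro_def wface_def outer_def fleft_def fword_def fright_def famF_def)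
  next
   case False
   then have "F (d, em Z X m) (contract L [] i (ul w)) = 0"
    using contract_ul_zero[OF vK Fx[OF eM] w i'] by simp
   then show ?thesis using False i' w by (simp add: g_def matched_def lo_def ro_def)
  qed
  then show ?thesis by (simp add: alt_def)
 qed
 have gn: "(if c then (-1) ^ Suc n * (ksign (deg (last w) * (d + degsum (ul (butlast w)))) *
   F (deg (last w) + d, LA (um (last w)) (em Z X m)) (ul (butlast w))) else 0) = alt (Suc n) (g (Suc n))"
 proof (cases c)
  case True
  have "ksign (deg (last w) * (d + degsum (ul (butlast w)))) *
   F (deg (last w) + d, LA (um (last w)) (em Z X m)) (ul (butlast w)) = g (Suc n)"
  proof (cases "tgt (last w) = Z")
   case Zt: True
   let ?m = "LAct N (src (last w)) (tgt (last w)) X (mor (last w)) m"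
   have mm: "?m \<in> BN (src (last w)) X (deg (last w) + d)" using LN_degree[OF hl(2) X] m Zt by simp
   have so: "src (last w) \<in> Obj A" using hl by (simp add: arrows_def)
   \<comment> \<open>Either the total degree is \<open>j\<close> and the two signs agree, or both
     sides vanish.\<close>
   have "ksign (deg (last w) * (d + degsum (ul (butlast w)))) * F (deg (last w) + d, em (src (last w)) X ?m) (ul (butlast w)) =
    ksign (deg (last w) * (j + deg (last w))) * F (deg (last w) + d, em (src (last w)) X ?m) (ul (butlast w))"
   proof (cases "deg (last w) + d + degsum (ul (butlast w)) = j")
    case True
    then have "j + deg (last w) = d + degsum (ul (butlast w))"
     by (metis add.commute add.assoc bit_cancel(1))
    then show ?thesis by simp
   next
    case False
    then show ?thesis using F0[OF em_degree[OF so X mm] t(2)] by simp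
   qed
   then show ?thesis using Zt True ne w mm
    by (simp add: g_def matched_def lo_def ro_def lw wface_def outer_def rN_def famF_def
      fleft_def fword_def fright_def LM_em[OF hl(2) Z X m] LM_em[OF hl(2) Z X m, simplified Zt])
  next
   case False
   then show ?thesis using ne w t
    by (simp add: g_def matched_def lo_def ro_def lw LM_em[OF hl(2) Z X m] Fz)
  qed
  then show ?thesis using True by (simp add: alt_def)
 next
  case False
  then show ?thesis using w ne by (simp add: g_def wface_def outer_def rN_def alt_def)
 qed
 have "wdiff A lN (rN c j) (famF F) X w Z (d, m) = (\<Sum>i\<le>Suc n. alt i (g i))"
  unfolding wdiff_def sum_fun_apply alt_fun_apply w(2) g_def by (intro sum.cong refl) simp
 also have "... = dF c n F (d, em Z X m) (ul w)"
  unfolding alt_sums_split dF_def fst_conv snd_conv ul_parts[OF ne] g0 gn using gi by simp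
 finally show ?thesis using m by (simp add: famF_def)
qed

lemma exf_hml:
 assumes f: "gfamF n j f"
 shows "hml n j (exf f)"
 unfolding hml_def
proof (intro conjI allI ballI impI)
 fix d
 show "Lmlin (*) n (exf f (d, m))" if m: "m \<in> BM d" for m
  unfolding exf_def[abs_def] fst_conv snd_conv using f cp_degree m
  by (intro mlin_sum[OF vK] exw_mlin[OF vK]) (auto simp: gfamF_def)
 have l: "length xs = n" if "xs \<in> Ltup n" for xs using that by (simp add: tup_def)
 show "lin_on sM (*) (BM d) (%m. exf f (d, m) xs)" if xs: "xs \<in> Ltup n" for xs
  unfolding exf_def exw_def fst_conv snd_conv l[OF xs]
 proof (intro lin_on_sum[OF vK])
  fix X Z ps assume XZ: "X \<in> Obj A" "Z \<in> Obj A" and ps: "ps \<in> PL n"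
  have "lin_on sN (*) (BN Z X d) (%m. f X (zip ps (entries ps xs)) Z (d, m))"
   using f XZ zip_entries[OF ps xs] by (simp add: gfamF_def)
  from lin_on_comp[OF cp_lin[OF XZ(2,1)] cp_degree[OF XZ(2,1)] this]
  show "lin_on sM (*) (BM d) (%m. f X (zip ps (entries ps xs)) Z (d, cp Z X m))" by simp
 qed
 show "exf f (d, m) xs = 0" if "m \<in> BM d" and xs: "xs \<in> Ltup n" and ne: "d + degsum xs ~= j" for m xs
  unfolding exf_def exw_def fst_conv snd_conv l[OF xs]
 proof (intro sum.neutral ballI)
  fix X Z ps assume XZ: "X \<in> Obj A" "Z \<in> Obj A" and ps: "ps \<in> PL n"
  show "f X (zip ps (entries ps xs)) Z (d, cp Z X m) = 0"
   using f XZ zip_entries[OF ps xs] ne by (simp add: gfamF_def)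
 qed
qed

lemma famF_exf:
 assumes f: "gfamF n j f" and w: "set w <= arrows A" "length w = n" and X: "X \<in> Obj A" and Z: "Z \<in> Obj A"
 shows "famF (exf f) X w Z = f X w Z"
proof (rule ext, clarify)
 fix d m
 show "famF (exf f) X w Z (d, m) = f X w Z (d, m)"
 proof (cases "m \<in> BN Z X d")
  case True
  have z: "f X' w Z' (d, 0) = 0" if "X' \<in> Obj A" "Z' \<in> Obj A" for X' Z'
  proof -
   have "lin_on sN (*) (BN Z' X' d) (%m. f X' w Z' (d, m))" using f w that by (simp add: gfamF_def)
   moreover have "0 \<in> BN Z' X' d" using N_closed that by blast
   ultimately show ?thesis using lin_on_0[OF vN vK] by blast
  qed
  have "exf f (d, em Z X m) (ul w) = (\<Sum>X'\<in>Obj A. \<Sum>Z'\<in>Obj A. f X' w Z' (d, cp Z' X' (em Z X m)))"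
   unfolding exf_def fst_conv snd_conv
   using f w cp_degree em_degree[OF Z X True] by (intro sum.cong refl exw_ul[OF vK]) (auto simp: gfamF_def)
  also have "... = (\<Sum>X'\<in>Obj A. \<Sum>Z'\<in>Obj A. if X' = X then if Z' = Z then f X w Z (d, m) else 0 else 0)"
   using z by (intro sum.cong refl) (auto simp: cp_em[OF _ _ Z X True])
  also have "... = (\<Sum>X'\<in>Obj A. if X' = X then f X w Z (d, m) else 0)"
   using finite_Obj Z by (intro sum.cong refl) (simp add: sum.delta)
  also have "... = f X w Z (d, m)" using finite_Obj X by (simp add: sum.delta)
  finally show ?thesis using True by (simp add: famF_def)
 next
  case False
  then show ?thesis using f w X Z by (simp add: famF_def gfamF_def)
 qed
qed

lemma gfamF_famF:
 assumes F: "hml n j F"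
 shows "gfamF n j (famF F)"
 unfolding gfamF_def
proof (intro ballI conjI allI impI)
 fix X Z assume XZ: "X \<in> Obj A" "Z \<in> Obj A"
 show "wmlin (*) n (%w. famF F X w Z (d, m))" if m: "m \<in> BN Z X d" for d m
  using wmlin_ul[of "(*)" n "F (d, em Z X m)"] F em_degree[OF XZ(2,1) m] m by (simp add: famF_def hml_def)
 fix w assume w: "set w <= arrows A" "length w = n"
 have u: "ul w \<in> Ltup n" using ul_Ltup[OF w(1)] w(2) by simp
 show "lin_on sN (*) (BN Z X d) (%m. famF F X w Z (d, m))" for d
 proof -
  have Fl: "lin_on sM (*) (BM d) (%m. F (d, m) (ul w))" using F u by (simp add: hml_def)
  have "lin_on sN (*) (BN Z X d) (%m. F (d, em Z X m) (ul w))"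
   by (rule lin_on_comp[OF em_lin[OF XZ(2,1)] em_degree[OF XZ(2,1)] Fl])
  then show ?thesis using N_closed[OF XZ(2,1)] by (simp add: famF_def lin_on_def)
 qed
 show "famF F X w Z (d, m) = 0" if "d + sum_list (map deg w) ~= j | m \<notin> BN Z X d" for d m
  using that F u em_degree[OF XZ(2,1)] by (auto simp: famF_def hml_def degsum_ul)
qed

text \<open>The coefficient is split by \<open>em_cp\<close>, the other entries by matrix
  units.\<close>

lemma hml_eqI:
 assumes F: "hml n j F" and G: "hml n j' G"
  and eq: "!!X Z w d m. X \<in> Obj A ==> Z \<in> Obj A ==> set w <= arrows A ==> length w = n ==> m \<in> BN Z X d ==>
   famF F X w Z (d, m) = famF G X w Z (d, m)"
  and m: "m \<in> BM d" and xs: "xs \<in> Ltup n"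
 shows "F (d, m) xs = G (d, m) xs"
proof -
 have "(%xs. F (d, m) xs - G (d, m) xs) xs = 0"
 proof (rule Lmlin_eq_0[OF vK _ _ xs])
  show "Lmlin (*) n (%xs. F (d, m) xs - G (d, m) xs)"
   using F G m by (intro mlin_diff[OF vK]) (auto simp: hml_def)
  fix w assume w: "set w <= arrows A" "length w = n"
  have u: "ul w \<in> Ltup n" using ul_Ltup[OF w(1)] w(2) by simp
  have e: "H (d, m) (ul w) = (\<Sum>X\<in>Obj A. \<Sum>Y\<in>Obj A. H (d, em X Y (cp X Y m)) (ul w))" if H: "hml n i H" for H i
  proof -
   interpret M: vector_space sM by (rule vM)
   have lin: "lin_on sM (*) (BM d) (%m. H (d, m) (ul w))" using H u by (simp add: hml_def)
   have ec: "em X Y (cp X Y m) \<in> BM d" if "X \<in> Obj A" "Y \<in> Obj A" for X Y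
    using em_degree cp_degree m that by blast
   have "H (d, m) (ul w) = H (d, \<Sum>X\<in>Obj A. \<Sum>Y\<in>Obj A. em X Y (cp X Y m)) (ul w)" by (simp add: em_cp[OF m])
   also have "... = (\<Sum>X\<in>Obj A. H (d, \<Sum>Y\<in>Obj A. em X Y (cp X Y m)) (ul w))"
    by (rule lin_on_finite_sum[OF vM vK lin M_subspace finite_Obj])
     (rule M.subspace_sum[OF M_subspace], rule ec)
   also have "... = (\<Sum>X\<in>Obj A. \<Sum>Y\<in>Obj A. H (d, em X Y (cp X Y m)) (ul w))"
    by (intro sum.cong refl lin_on_finite_sum[OF vM vK lin M_subspace finite_Obj] ec)
   finally show ?thesis .
  qed
  have "F (d, em X Y (cp X Y m)) (ul w) = G (d, em X Y (cp X Y m)) (ul w)" if "X \<in> Obj A" "Y \<in> Obj A" for X Y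
   using eq[OF that(2,1) w cp_degree[OF that m]] cp_degree[OF that m] by (simp add: famF_def)
  then show "F (d, m) (ul w) - G (d, m) (ul w) = 0" unfolding e[OF F] e[OF G] by simp
 qed
 then show ?thesis by simp
qed

lemma gfamF_whtpy:
 assumes f: "gfamF (Suc n) j f"
 shows "gfamF n j (whtpy A f)"
 unfolding gfamF_def
proof (intro ballI conjI allI impI)
 fix X Z assume XZ: "X \<in> Obj A" "Z \<in> Obj A"
 show "wmlin (*) n (%w. whtpy A f X w Z (d, m))" if m: "m \<in> BN Z X d" for d m
  unfolding whtpy_apply using f XZ m by (intro wmlin_whtpy[OF vK]) (auto simp: gfamF_def)
 fix w assume w: "set w <= arrows A" "length w = n"
 have "(\<forall>d. lin_on sN (*) (BN Z X d) (%m. whtpy A f X w Z (d, m))) &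
  (\<forall>d m. d + sum_list (map deg w) ~= j | m \<notin> BN Z X d --> whtpy A f X w Z (d, m) = 0)"
 proof (cases "composable X w Z")
  case True
  then show ?thesis by (simp add: whtpy_def lin_on_zero[OF vK])
 next
  case False
  then obtain i where i: "first_mismatch X w Z i" using not_composable_iff[of X w Z] by blast
  then have i': "i <= length w" by (simp add: first_mismatch_def)
  have "length (ins A i X w) = Suc n" using i' w by simp
  then have *: "!!d. lin_on sN (*) (BN Z X d) (%m. f X (ins A i X w) Z (d, m))"
   "!!d m. d + sum_list (map deg w) ~= j | m \<notin> BN Z X d ==> f X (ins A i X w) Z (d, m) = 0"
   using f XZ ins_arrows[OF w(1) XZ(1) i'] by (auto simp: gfamF_def sum_deg_ins[OF i'])
  then show ?thesis unfolding whtpy_eq[OF i] alt_fun_apply alt_scale[OF vK] by (auto intro: lin_on_scale[OF vK])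
 qed
 then show "!!d. lin_on sN (*) (BN Z X d) (%m. whtpy A f X w Z (d, m))"
  "!!d m. d + sum_list (map deg w) ~= j | m \<notin> BN Z X d ==> whtpy A f X w Z (d, m) = 0" by blast+
qed

lemma outer_0: "outer lN (rN c j) i X w Z 0 = 0"
 by (auto simp: outer_def lN_def rN_def fun_eq_iff)

text \<open>The primitive is \<open>whtpy\<close>, which is 0 on composable words by definition.
  That it shares the vanishing of \<open>F\<close> there is what permits repeating the argument in
  the next column of the bicomplex.\<close>

lemma functional_exact:
 assumes F: "hml n j F" and dF0: "!!d m xs. m \<in> BM d ==> xs \<in> Ltup (Suc n) ==> dF c n F (d, m) xs = 0"
  and F0: "!!X Z w d m. X \<in> Obj A ==> Z \<in> Obj A ==> set w <= arrows A ==> length w = n ==> composable X w Z ==>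
   m \<in> BN Z X d ==> F (d, em Z X m) (ul w) = 0"
 shows "n = 0 ==> m \<in> BM d ==> xs \<in> Ltup n ==> F (d, m) xs = 0"
  and "n = Suc k ==> \<exists>K. hml k j K & (\<forall>d. \<forall>m\<in>BM d. \<forall>xs\<in>Ltup n. F (d, m) xs = dF c k K (d, m) xs) &
   (\<forall>X\<in>Obj A. \<forall>Z\<in>Obj A. \<forall>w. set w <= arrows A --> length w = k --> composable X w Z -->
    (\<forall>d. \<forall>m\<in>BN Z X d. K (d, em Z X m) (ul w) = 0))"
proof -
 \<comment> \<open>At the empty composable word \<open>wdiff\<close> would evaluate faces that do
   not exist, so that case is left out.\<close>
 have ht: "famF F X w Z (d, m) = wdiff A lN (rN c j) (whtpy A (famF F)) X w Z (d, m)"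
  if XZ: "X \<in> Obj A" "Z \<in> Obj A" and w: "set w <= arrows A" "length w = n" and m: "m \<in> BN Z X d"
   and nc: "w ~= [] | ~ composable X w Z" for X Z w d m
 proof (cases "composable X w Z")
  case True
  then have ne: "w ~= []" using nc by simp
  have "wdiff A lN (rN c j) (whtpy A (famF F)) X w Z = 0"
   unfolding wdiff_def
  proof (rule sum.neutral, clarify)
   fix i assume i: "i <= length w"
   have "composable (fleft i X w) (fword A i w) (fright i w Z)"
    unfolding composable_face[OF ne i] using True by (simp add: composable_def)
   then show "alt i (if matched X w Z i then wface A lN (rN c j) i (whtpy A (famF F)) X w Z else 0) = 0"
    by (simp add: wface_def whtpy_def outer_0)
  qed
  then show ?thesis using F0[OF XZ w True m] m by (simp add: famF_def)
 next
  case False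
  then obtain i where i: "first_mismatch X w Z i" using not_composable_iff[of X w Z] by blast
  then have i': "i <= length w" by (simp add: first_mismatch_def)
  have i2: "set (ins A i X w) <= arrows A" "length (ins A i X w) = Suc n"
   using ins_arrows[OF w(1) XZ(1) i'] i' w by auto
  have "whtpy A (wdiff A lN (rN c j) (famF F)) X w Z (d, m) = alt i (wdiff A lN (rN c j) (famF F) X (ins A i X w) Z (d, m))"
   unfolding whtpy_eq[OF i] alt_fun_apply ..
  also have "wdiff A lN (rN c j) (famF F) X (ins A i X w) Z (d, m) = famF (dF c n F) X (ins A i X w) Z (d, m)"
   by (rule famF_dF[OF F i2 XZ m, symmetric])
  also have "... = 0"
   using dF0[OF em_degree[OF XZ(2,1) m]] ul_Ltup[OF i2(1)] i2(2) m by (simp add: famF_def)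
  finally have h0: "whtpy A (wdiff A lN (rN c j) (famF F)) X w Z (d, m) = 0" by simp
  have "wdiff A lN (rN c j) (whtpy A (famF F)) X w Z + whtpy A (wdiff A lN (rN c j) (famF F)) X w Z =
   (if i = 0 then lN (idw A X) Z (famF F X w Z) else famF F X w Z)"
   by (rule whtpy_homotopy[OF w(1) XZ i, where f = "famF F" and C = UNIV]) (auto simp: lN_def rN_def fun_eq_iff)
  from fun_cong[OF this, of "(d, m)"]
  have "wdiff A lN (rN c j) (whtpy A (famF F)) X w Z (d, m) + whtpy A (wdiff A lN (rN c j) (famF F)) X w Z (d, m) =
   (if i = 0 then lN (idw A X) Z (famF F X w Z) else famF F X w Z) (d, m)"
   by (simp only: plus_fun_apply)
  \<comment> \<open>For \<open>i = 0\<close> the surviving face lets an identity act on the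
    coefficient.\<close>
  moreover have "lN (idw A X) Z (famF F X w Z) (d, m) = famF F X w Z (d, m)"
   using RN_unit[OF XZ(2,1) m] by (simp add: lN_def idw_def)
  ultimately show ?thesis using h0 by simp
 qed
 show "F (d, m) xs = 0" if n: "n = 0" and m: "m \<in> BM d" and xs: "xs \<in> Ltup n"
 proof (rule hml_eqI[OF F _ _ m xs])
  show "hml n j (%_ _. 0)" by (simp add: hml_def mlin_zero[OF vK] lin_on_zero[OF vK])
  fix X Z w d m assume *: "X \<in> Obj A" "Z \<in> Obj A" "set w <= arrows A" "length w = n" "m \<in> BN Z X d"
  have "famF F X w Z (d, m) = 0"
  proof (cases "composable X w Z")
   case True
   then show ?thesis using F0 * by (simp add: famF_def)
  next
   case False
   then have "~ matched X w Z 0" using * n by (simp add: composable_def)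
   then show ?thesis using ht[OF *] False * n by (simp add: wdiff_def)
  qed
  then show "famF F X w Z (d, m) = famF (%_ _. 0) X w Z (d, m)" by (simp add: famF_def)
 qed
 show "\<exists>K. hml k j K & (\<forall>d. \<forall>m\<in>BM d. \<forall>xs\<in>Ltup n. F (d, m) xs = dF c k K (d, m) xs) &
   (\<forall>X\<in>Obj A. \<forall>Z\<in>Obj A. \<forall>w. set w <= arrows A --> length w = k --> composable X w Z -->
    (\<forall>d. \<forall>m\<in>BN Z X d. K (d, em Z X m) (ul w) = 0))" if n: "n = Suc k"
 proof (intro exI conjI)
  let ?f = "whtpy A (famF F)"
  have g: "gfamF k j ?f" using gfamF_famF[OF F] n by (intro gfamF_whtpy) simp
  show K: "hml k j (exf ?f)" by (rule exf_hml[OF g])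
  note ex = famF_exf[OF g]
  show "\<forall>d. \<forall>m\<in>BM d. \<forall>xs\<in>Ltup n. F (d, m) xs = dF c k (exf ?f) (d, m) xs"
  proof (intro allI ballI)
   fix d m xs assume m: "m \<in> BM d" and xs: "xs \<in> Ltup n"
   have K': "hml n j (dF c k (exf ?f))" using dF_hml[OF K] n by simp
   show "F (d, m) xs = dF c k (exf ?f) (d, m) xs"
   proof (rule hml_eqI[OF F K' _ m xs])
    fix X Z w d m assume *: "X \<in> Obj A" "Z \<in> Obj A" "set w <= arrows A" "length w = n" "m \<in> BN Z X d"
    have w': "length w = Suc k" using * n by simp
    then have ne: "w ~= []" by auto
    have "wdiff A lN (rN c j) ?f X w Z = wdiff A lN (rN c j) (famF (exf ?f)) X w Z"
    proof (unfold wdiff_def, rule sum.cong[OF refl])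
     fix i assume "i \<in> {..length w}"
     then have i: "i <= length w" by simp
     have "famF (exf ?f) (fleft i X w) (fword A i w) (fright i w Z) = ?f (fleft i X w) (fword A i w) (fright i w Z)"
      if mi: "matched X w Z i"
      using ex[OF fword_arrows[OF *(3) ne i mi] _ fleft_Obj[OF *(3) ne *(1)] fright_Obj[OF *(3) ne *(2)]]
       length_fword[OF ne i, of A] w' by simp
     then show "alt i (if matched X w Z i then wface A lN (rN c j) i ?f X w Z else 0) =
      alt i (if matched X w Z i then wface A lN (rN c j) i (famF (exf ?f)) X w Z else 0)"
      by (simp add: wface_def)
    qed
    then show "famF F X w Z (d, m) = famF (dF c k (exf ?f)) X w Z (d, m)"
     using ne unfolding ht[OF * disjI1[OF ne]] famF_dF[OF K *(3) w' *(1,2,5)] by simp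
   qed
  qed
  show "\<forall>X\<in>Obj A. \<forall>Z\<in>Obj A. \<forall>w. set w <= arrows A --> length w = k --> composable X w Z -->
    (\<forall>d. \<forall>m\<in>BN Z X d. exf ?f (d, em Z X m) (ul w) = 0)"
  proof (intro ballI allI impI)
   fix X Z w d m assume *: "X \<in> Obj A" "Z \<in> Obj A" "set w <= arrows A" "length w = k" "composable X w Z" "m \<in> BN Z X d"
   have "famF (exf ?f) X w Z (d, m) = 0" using ex[OF *(3,4,1,2)] *(5) by (simp add: whtpy_def)
   then show "exf ?f (d, em Z X m) (ul w) = 0" using *(6) by (simp add: famF_def)
  qed
 qed
qed

end

lemma (in finite_superadditive_category) mlin_unit_arrows:
 assumes F: "Lmlin t n F" and ys: "ys \<in> obj_tuples A n"
 shows "mlin (Scale A) t n (%k. Mor A (ys ! k) (ys ! Suc k)) (%al. F (unit_arrows ys al))"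
proof -
 have lys: "length ys = Suc n" using ys by (simp add: obj_tuples_def)
 let ?ps = "zip (butlast ys) (tl ys)"
 have ps: "?ps \<in> PL n"
 proof -
  have "x \<in> Obj A \<times> Obj A" if "x \<in> set ?ps" for x
  proof -
   have "fst x \<in> set (butlast ys)" "snd x \<in> set (tl ys)"
    using that in_set_zipE[of "fst x" "snd x" "butlast ys" "tl ys"] by auto
   moreover have "set (tl ys) <= set ys" by (cases ys) auto
   ultimately show ?thesis using ys in_set_butlastD[of "fst x" ys] by (auto simp: obj_tuples_def mem_Times_iff)
  qed
  then show ?thesis using lys by (auto simp: PL_def)
 qed
 have "mlin (Scale A) t n (slots ?ps) (%al. F (ul (zip ?ps al)))"
  using ps wmlin_ul[OF F] by (simp add: wmlin_def)
 then show ?thesis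
 proof (rule mlin_cong)
  show "slots ?ps k = Mor A (ys ! k) (ys ! Suc k)" if "k < n" for k
   using that lys by (simp add: nth_butlast nth_tl)
  show "F (ul (zip ?ps al)) = F (unit_arrows ys al)" if al: "length al = n" for al :: "(bit * 'a) list"
   using unit_arrows_wd[OF lys al] by (simp add: ul_def wd_def)
 qed
qed

section \<open>Functionals on the chain quotients\<close>

lemma hgens_iff: "(ys, (d, m), al) \<in> hgens B N n i \<longleftrightarrow> ys \<in> obj_tuples B n & m \<in> Bim N (last ys) (hd ys) d &
  al \<in> arrow_tuples B ys & d + degsum al = i"
 by (auto simp: hgens_def)

text \<open>Universal property for the chain quotient. Since \<open>ground\<close> lives in degree
  0, a functional of degree \<open>j\<close> must vanish on generators of any other degree; on those
  of degree \<open>j\<close> there is no further condition.\<close>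

lemma hom_hchains_num_iff:
 fixes f :: "(('o, 'a::ab_group_add, 'n::ab_group_add) htuple \<Rightarrow>\<^sub>0 'k::field) => 'k"
 shows "f \<in> num (hom_sspace (hchains B N n) (*) ground) j \<longleftrightarrow>
  linfun f & (\<forall>ys\<in>obj_tuples B n.
   (\<forall>d. \<forall>m\<in>Bim N (last ys) (hd ys) d.
     mlin (Scale B) (*) n (%k. Mor B (ys ! k) (ys ! Suc k)) (%al. f (basis (ys, (d, m), al)))) &
   (\<forall>d. \<forall>al\<in>arrow_tuples B ys. lin_on (MScale N) (*) (Bim N (last ys) (hd ys) d) (%m. f (basis (ys, (d, m), al)))) &
   (\<forall>d. \<forall>m\<in>Bim N (last ys) (hd ys) d. \<forall>al\<in>arrow_tuples B ys. d + degsum al ~= j --> f (basis (ys, (d, m), al)) = 0))"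
  (is "?l \<longleftrightarrow> ?r")
proof -
 note P = vs_pscale and K = vector_space_mult
 define R where "R = (%i. \<Union>(ys, (d, m), xs)\<in>hgens B N n i.
      slot_relators (MScale N) (Bim N (last ys) (hd ys) d) (%u. (ys, (d, u), xs)) \<union>
      (\<Union>k<length xs.
        slot_relators (Scale B) (Mor B (ys ! k) (ys ! Suc k) (fst (xs ! k)))
         (%a. (ys, (d, m), xs[k := (fst (xs ! k), a)]))) :: (('o, 'a, 'n) htuple \<Rightarrow>\<^sub>0 'k) set)"
 have denR: "den (hchains B N n) i = module.span pscale (R i)" for i
  by (simp add: hchains_def R_def)
 have at: "arrow_tuples B ys = tup n (%k. Mor B (ys ! k) (ys ! Suc k))" if "ys \<in> obj_tuples B n" for ys
  using that by (intro tup_iff_arrow_tuples) (simp add: obj_tuples_def)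
 have dif: "f (a - b) = f a - f b" if "linfun f" for a b
  using that unfolding linear_iff[OF P K] by (metis add_diff_cancel diff_add_cancel)
 show ?thesis
 proof
  assume f: ?l
  then have lin: "linfun f" by (simp add: hom_sspace_def hchains_def)
  have R0: "f x = 0" if "x \<in> R i" for x i
  proof -
   have "x \<in> den (hchains B N n) i"
    unfolding denR using that by (rule module.span_base[OF P[unfolded module_iff_vector_space[symmetric]]])
   moreover have "f ` den (hchains B N n) i <= {0}" using f by (simp add: hom_sspace_def)
   ultimately show ?thesis by auto
  qed
  have rel: "lin_on s (*) U (%u. f (basis (h u)))"
   if "!!x. x \<in> slot_relators s U h ==> x \<in> R i" for s U h i
   unfolding lin_on_def
  proof (intro conjI ballI allI)
   fix u v c assume u: "u \<in> U"
   have "f (basis (h (s c u)) - pscale c (basis (h u))) = 0"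
    using u by (intro R0[OF that]) (auto simp: slot_relators_def)
   then show "f (basis (h (s c u))) = c * f (basis (h u))"
    using lin unfolding dif[OF lin] linear_iff[OF P K] by simp
   assume v: "v \<in> U"
   have "f (basis (h (u + v)) - basis (h u) - basis (h v)) = 0"
    using u v by (intro R0[OF that]) (auto simp: slot_relators_def)
   then show "f (basis (h (u + v))) = f (basis (h u)) + f (basis (h v))"
    unfolding dif[OF lin] by (simp add: algebra_simps)
  qed
  show ?r
  proof (intro conjI ballI allI impI lin)
   fix ys d assume ys: "ys \<in> obj_tuples B n"
   show "mlin (Scale B) (*) n (%k. Mor B (ys ! k) (ys ! Suc k)) (%al. f (basis (ys, (d, m), al)))"
    if m: "m \<in> Bim N (last ys) (hd ys) d" for m
   proof (rule mlinI, rule rel)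
    fix xs k x assume xs: "xs \<in> tup n (%k. Mor B (ys ! k) (ys ! Suc k))" and k: "k < n"
     and x: "x \<in> slot_relators (Scale B) (Mor B (ys ! k) (ys ! Suc k) (fst (xs ! k))) (%u. (ys, (d, m), xs[k := (fst (xs ! k), u)]))"
    have g: "(ys, (d, m), xs) \<in> hgens B N n (d + degsum xs)" using ys m xs at by (simp add: hgens_iff)
    have "k < length xs" using xs k by (simp add: tup_def)
    then show "x \<in> R (d + degsum xs)"
     unfolding R_def using x by (intro UN_I[OF g]) auto
   qed
   fix al assume al: "al \<in> arrow_tuples B ys"
   show "lin_on (MScale N) (*) (Bim N (last ys) (hd ys) d) (%m. f (basis (ys, (d, m), al)))"
   proof (cases "\<exists>m. m \<in> Bim N (last ys) (hd ys) d")
    case True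
    then obtain m where m: "m \<in> Bim N (last ys) (hd ys) d" by blast
    show ?thesis
    proof (rule rel)
     fix x assume x: "x \<in> slot_relators (MScale N) (Bim N (last ys) (hd ys) d) (%u. (ys, (d, u), al))"
     have g: "(ys, (d, m), al) \<in> hgens B N n (d + degsum al)" using ys m al by (simp add: hgens_iff)
     show "x \<in> R (d + degsum al)" unfolding R_def using x by (intro UN_I[OF g]) auto
    qed
   qed (simp add: lin_on_def)
   fix m assume m: "m \<in> Bim N (last ys) (hd ys) d" and ne: "d + degsum al ~= j"
   have "basis (ys, (d, m), al) \<in> hnum B N n (d + degsum al)"
    using ys m al by (simp add: hchains_def hgens_iff)
   moreover have "f ` hnum B N n (d + degsum al) <= ground (j + (d + degsum al))"
    using f by (simp add: hom_sspace_def)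
   moreover have "j + (d + degsum al) ~= 0"
    using ne by (metis bit_cancel(1) add.right_neutral)
   ultimately show "f (basis (ys, (d, m), al)) = 0" by (auto simp: ground_def)
  qed
 next
  assume r: ?r
  then have lin: "linfun f" by blast
  have "f x \<in> ground (j + i)" if x: "x \<in> hnum B N n i" for x i
  proof (cases "j + i = 0")
   case False
   then have "i ~= j" by (metis bit_cancel(1) add.right_neutral)
   have "f x = 0"
   proof (rule linear_zero_on_keys[OF K lin])
    fix g assume "g \<in> Poly_Mapping.keys x"
    then have g: "g \<in> hgens B N n i" using x by (auto simp: hchains_def)
    obtain ys d m al where e: "g = (ys, (d, m), al)" by (metis prod.collapse)
    show "f (basis g) = 0" using g r \<open>i ~= j\<close> unfolding e hgens_iff by blast
   qed
   then show ?thesis by (simp add: ground_def)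
  qed (simp add: ground_def)
  moreover have "f x = 0" if x: "x \<in> den (hchains B N n) i" for x i
  proof (rule linear_zero_on_span[OF P K lin _ x[unfolded denR]])
   fix y assume "y \<in> R i"
   then obtain ys d m xs where g: "(ys, (d, m), xs) \<in> hgens B N n i"
    and y: "y \<in> slot_relators (MScale N) (Bim N (last ys) (hd ys) d) (%u. (ys, (d, u), xs)) |
     (\<exists>k<length xs. y \<in> slot_relators (Scale B) (Mor B (ys ! k) (ys ! Suc k) (fst (xs ! k)))
         (%a. (ys, (d, m), xs[k := (fst (xs ! k), a)])))"
    unfolding R_def by (auto, blast)
   have h: "ys \<in> obj_tuples B n" "m \<in> Bim N (last ys) (hd ys) d" "xs \<in> arrow_tuples B ys" using g by (auto simp: hgens_iff)
   have rel: "f z = 0" if "z \<in> slot_relators s U h" "lin_on s (*) U (%u. f (basis (h u)))" for s U h z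
    using that lin unfolding slot_relators_def lin_on_def linear_iff[OF P K] by (auto simp: dif[OF lin])
   from y show "f y = 0"
   proof (elim disjE exE conjE)
    assume "y \<in> slot_relators (MScale N) (Bim N (last ys) (hd ys) d) (%u. (ys, (d, u), xs))"
    then show ?thesis by (rule rel) (use r h in blast)
   next
    fix k assume k: "k < length xs"
     and y: "y \<in> slot_relators (Scale B) (Mor B (ys ! k) (ys ! Suc k) (fst (xs ! k))) (%a. (ys, (d, m), xs[k := (fst (xs ! k), a)]))"
    have xs: "xs \<in> tup n (%k. Mor B (ys ! k) (ys ! Suc k))" using h at by simp
    have kn: "k < n" using k xs by (simp add: tup_def)
    have ml: "mlin (Scale B) (*) n (%k. Mor B (ys ! k) (ys ! Suc k)) (%al. f (basis (ys, (d, m), al)))" using r h by blast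
    show ?thesis by (rule rel[OF y]) (rule mlinD[OF ml xs kn refl])
   qed
  qed
  ultimately show ?l using lin by (auto simp: hom_sspace_def hchains_def)
 qed
qed

lemma hom_hchains_zero_iff:
 assumes "linfun f"
 shows "(\<forall>i. \<forall>x\<in>hnum B N n i. f x = (0::'k::field)) \<longleftrightarrow>
  (\<forall>ys\<in>obj_tuples B n. \<forall>d. \<forall>m\<in>Bim N (last ys) (hd ys) d. \<forall>al\<in>arrow_tuples B ys. f (basis (ys, (d, m), al)) = 0)"
  (is "?l \<longleftrightarrow> ?r")
proof
 assume l: ?l
 show ?r
 proof (intro ballI allI)
  fix ys d m al assume "ys \<in> obj_tuples B n" "m \<in> Bim N (last ys) (hd ys) d" "al \<in> arrow_tuples B ys"
  then have "basis (ys, (d, m), al) \<in> hnum B N n (d + degsum al)"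
   by (simp add: hchains_def hgens_iff)
  then show "f (basis (ys, (d, m), al)) = 0" using l by blast
 qed
next
 assume r: ?r
 show ?l
 proof (intro allI ballI)
  fix i x assume x: "x \<in> hnum B N n i"
  show "f x = 0"
  proof (rule linear_zero_on_keys[OF vector_space_mult assms])
   fix g assume "g \<in> Poly_Mapping.keys x"
   then have g: "g \<in> hgens B N n i" using x by (auto simp: hchains_def)
   obtain ys d m al where e: "g = (ys, (d, m), al)" by (metis prod.collapse)
   show "f (basis g) = 0" using g r unfolding e hgens_iff by blast
  qed
 qed
qed

text \<open>The flag \<open>c\<close> tells whether the last face is included, so this is \<open>b\<close> or \<open>b'\<close>.\<close>

definition gboundary :: "bool => ('k::field, 'o, 'a) scat => ('k, 'o, 'a, 'm) sbimod => nat
  => (('o, 'a, 'm) htuple \<Rightarrow>\<^sub>0 'k) => (('o, 'a, 'm) htuple \<Rightarrow>\<^sub>0 'k)" where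
 "gboundary c A M n = lext pscale (%g. (\<Sum>i<n. pscale ((-1) ^ i) (hface A M n i g)) +
   (if c then pscale ((-1) ^ n) (hface A M n n g) else 0))"

lemma hboundary_gboundary: "hboundary A M n = gboundary True A M n"
 by (simp add: hboundary_def gboundary_def lessThan_Suc_atMost[symmetric])

lemma bar_boundary_gboundary: "bar_boundary A n = gboundary False A (std_bimod A) n"
 by (simp add: bar_boundary_def gboundary_def)

lemma linear_gboundary: "linop (gboundary c A M n)"
 by (simp add: gboundary_def linear_lext[OF vs_pscale])

context chain_comparison
begin

text \<open>Common form of the two inclusions: \<open>HH_incl\<close> for \<open>em\<close> the
  identity on coefficients, \<open>cyc_incl\<close> for \<open>em = munit\<close>.\<close>

definition incl :: "(('o, 'a, 'n) htuple \<Rightarrow>\<^sub>0 'k) => ((unit, 'o => 'o => 'a, 'm) htuple \<Rightarrow>\<^sub>0 'k)" where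
 "incl = lext pscale (%(ys, (d, m), xs). basis (map (%_. ()) ys, (d, em (last ys) (hd ys) m), unit_arrows ys xs))"

section \<open>Functionals along the inclusion\<close>

abbreviation "uls n \<equiv> replicate (Suc n) ()"
abbreviation "homL n \<equiv> num (hom_sspace (hchains L M n) (*) ground)"
abbreviation "homA n \<equiv> num (hom_sspace (hchains A N n) (*) ground)"

lemma linear_incl: "linop incl"
 by (simp add: incl_def linear_lext[OF vs_pscale])

lemma incl_basis:
 assumes "ys \<in> obj_tuples A n"
 shows "incl (basis (ys, (d, m), al)) = basis (uls n, (d, em (last ys) (hd ys) m), unit_arrows ys al)"
proof -
 have "map (%_. ()) ys = uls n" using assms by (intro unit_list_eq) (simp add: obj_tuples_def)
 then show ?thesis by (simp add: incl_def lext_basis[OF vs_pscale] del: replicate_Suc)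
qed

lemma obj_tuples_L: "obj_tuples L n = {uls n}"
 using unit_list_eq by (auto simp: obj_tuples_def Obj_L)

lemma arrow_tuples_L: "arrow_tuples L (uls n) = Ltup n"
 by (simp add: tup_iff_arrow_tuples)

lemma homL_iff: "f \<in> homL n j \<longleftrightarrow> linfun f & hml n j (%dm xs. f (basis (uls n, dm, xs)))"
 unfolding hom_hchains_num_iff obj_tuples_L hml_def by (auto simp: arrow_tuples_L simp del: replicate_Suc)

lemma zeroL_iff:
 assumes "linfun f"
 shows "(\<forall>i. \<forall>x\<in>hnum L M n i. f x = (0::'k)) \<longleftrightarrow>
  (\<forall>d. \<forall>m\<in>BM d. \<forall>xs\<in>Ltup n. f (basis (uls n, (d, m), xs)) = 0)"
 unfolding hom_hchains_zero_iff[OF assms] obj_tuples_L by (auto simp: arrow_tuples_L simp del: replicate_Suc)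

text \<open>Normalisation of lifted functionals. Together with the values on composable words, which
  come from the category, it determines a functional (\<open>zero_unique\<close>), and the
  transposed differentials and rotations preserve it.\<close>

definition NV :: "nat => (((unit, 'o => 'o => 'a, 'm) htuple \<Rightarrow>\<^sub>0 'k) => 'k) => bool" where
 "NV n f \<longleftrightarrow> (\<forall>X\<in>Obj A. \<forall>Z\<in>Obj A. \<forall>w. set w <= arrows A --> length w = n --> ~ composable X w Z -->
   (\<forall>d. \<forall>m\<in>BN Z X d. f (basis (uls n, (d, em Z X m), ul w)) = 0))"

lemma unit_arrows_ul:
 assumes "ys \<in> obj_tuples A n" "al \<in> arrow_tuples A ys"
 shows "unit_arrows ys al = ul (wd ys al)" "unit_arrows ys al \<in> Ltup n" "degsum (unit_arrows ys al) = degsum al"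
proof -
 have l: "length ys = Suc n" "length al = n" using assms by (auto simp: obj_tuples_def arrow_tuples_def)
 show u: "unit_arrows ys al = ul (wd ys al)" by (simp add: unit_arrows_wd[OF l] ul_def)
 show "unit_arrows ys al \<in> Ltup n" unfolding u using ul_Ltup[OF wd_arrows[OF assms]] length_wd[OF l] by simp
 have "map fst (map snd (wd ys al)) = map fst al" unfolding map_snd_wd[OF l] ..
 then have "map deg (wd ys al) = map fst al" by (simp add: comp_def)
 then show "degsum (unit_arrows ys al) = degsum al" unfolding u degsum_ul by simp
qed

lemma pull_homA:
 assumes f: "f \<in> homL n j"
 shows "(%x. f (incl x)) \<in> homA n j"
proof -
 have lin: "linfun f" and F: "hml n j (%dm xs. f (basis (uls n, dm, xs)))"
  using f by (auto simp: homL_iff)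
 show ?thesis
  unfolding hom_hchains_num_iff
 proof (intro conjI ballI allI impI)
  show "linfun (%x. f (incl x))"
   by (rule linear_compose[OF vs_pscale vs_pscale vK linear_incl lin])
  fix ys d assume ys: "ys \<in> obj_tuples A n"
  note hl = obj_tuples_hd_last[OF ys]
  show "mlin (Scale A) (*) n (%k. Mor A (ys ! k) (ys ! Suc k)) (%al. f (incl (basis (ys, (d, m), al))))"
   if m: "m \<in> BN (last ys) (hd ys) d" for m
   unfolding incl_basis[OF ys] using F em_degree[OF hl(2,1) m]
   by (intro mlin_unit_arrows[OF _ ys]) (simp add: hml_def del: replicate_Suc)
  fix al assume al: "al \<in> arrow_tuples A ys"
  note u = unit_arrows_ul[OF ys al]
  show "lin_on sN (*) (BN (last ys) (hd ys) d) (%m. f (incl (basis (ys, (d, m), al))))"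
  proof -
   have "lin_on sM (*) (BM d) (%m. f (basis (uls n, (d, m), unit_arrows ys al)))"
    using F u(2) by (simp add: hml_def del: replicate_Suc)
   from lin_on_comp[OF em_lin[OF hl(2,1)] em_degree[OF hl(2,1)] this]
   show ?thesis unfolding incl_basis[OF ys] by simp
  qed
  fix m assume m: "m \<in> BN (last ys) (hd ys) d" and "d + degsum al ~= j"
  then show "f (incl (basis (ys, (d, m), al))) = 0"
   unfolding incl_basis[OF ys] using F u em_degree[OF hl(2,1) m] by (simp add: hml_def del: replicate_Suc)
 qed
qed

lemma zero_composable:
 assumes "!!ys d m al. ys \<in> obj_tuples A n ==> m \<in> BN (last ys) (hd ys) d ==> al \<in> arrow_tuples A ys ==>
   f (incl (basis (ys, (d, m), al))) = 0"
  and w: "set w <= arrows A" "length w = n" "composable X w Z" and X: "X \<in> Obj A" and m: "m \<in> BN Z X d"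
 shows "f (basis (uls n, (d, em Z X m), ul w)) = 0"
proof -
 note t = composable_tuples[OF w(3,1) X]
 note p = composable_path[OF w(3)]
 have "f (incl (basis (X # map tgt w, (d, m), map snd w))) = 0"
  using assms(1)[OF t(1)[unfolded w(2)] _ t(2), of m d] m p by simp
 then show ?thesis unfolding incl_basis[OF t(1)] unit_arrows_ul(1)[OF t] p w(2) .
qed

text \<open>The pullback along \<open>incl\<close> controls the composable words and
  \<open>NV\<close> the others; these exhaust all words.\<close>

lemma zero_unique:
 assumes f: "f \<in> homL n j" and nv: "NV n f" and z: "!!i x. x \<in> hnum A N n i ==> f (incl x) = 0"
  and x: "x \<in> hnum L M n i"
 shows "f x = 0"
proof -
 have lin: "linfun f" and F: "hml n j (%dm xs. f (basis (uls n, dm, xs)))"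
  using f by (auto simp: homL_iff)
 have lin': "linfun (%x. f (incl x))"
  by (rule linear_compose[OF vs_pscale vs_pscale vK linear_incl lin])
 have "f (basis (uls n, (d, m), xs)) = 0" if m: "m \<in> BM d" and xs: "xs \<in> Ltup n" for d m xs
 proof -
  have "(%dm xs. f (basis (uls n, dm, xs))) (d, m) xs = (%_ _. 0) (d, m) xs"
  proof (rule hml_eqI[OF F _ _ m xs])
   show "hml n j (%_ _. 0)" by (simp add: hml_def mlin_zero[OF vK] lin_on_zero[OF vK])
   fix X Z w d m assume *: "X \<in> Obj A" "Z \<in> Obj A" "set w <= arrows A" "length w = n" "m \<in> BN Z X d"
   have "f (basis (uls n, (d, em Z X m), ul w)) = 0"
   proof (cases "composable X w Z")
    case True
    show ?thesis
     by (rule zero_composable[where f = f, OF _ *(3,4) True *(1,5)])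
      (use z hom_hchains_zero_iff[OF lin', of A N n] in blast)
   next
    case False
    then show ?thesis using nv * by (simp add: NV_def del: replicate_Suc)
   qed
   then show "famF (%dm xs. f (basis (uls n, dm, xs))) X w Z (d, m) = famF (%_ _. 0) X w Z (d, m)"
    by (simp add: famF_def del: replicate_Suc)
  qed
  then show ?thesis by simp
 qed
 then show ?thesis using zeroL_iff[OF lin, of n] x by blast
qed

text \<open>Extension by zero to the non-composable words, then from words to arbitrary tuples by
  \<open>exf\<close>.\<close>

lemma lift_homL:
 assumes g: "g \<in> homA n j"
 obtains f where "f \<in> homL n j" "NV n f" "!!i x. x \<in> hnum A N n i ==> f (incl x) = g x"
proof -
 define G where "G = (%ys al (d, m). if m \<in> BN (last ys) (hd ys) d then g (basis (ys, (d, m), al)) else 0)"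
 have lin: "linfun g" using g by (simp add: hom_hchains_num_iff)
 note g' = g[unfolded hom_hchains_num_iff, THEN conjunct2, rule_format]
 let ?c = "comp_fam G"
 have app: "?c X w Z p = comp_fam (%ys al. G ys al p) X w Z" for X w Z p by (simp add: comp_fam_def)
 have gf: "gfamF n j ?c"
  unfolding gfamF_def
 proof (intro ballI conjI allI impI)
  fix X Z assume XZ: "X \<in> Obj A" "Z \<in> Obj A"
  show "wmlin (*) n (%w. ?c X w Z (d, m))" if "m \<in> BN Z X d" for d m
   unfolding app
  proof (rule wmlin_comp_fam[OF vK XZ(1)])
   fix ys assume ys: "ys \<in> obj_tuples A n"
   show "mlin (Scale A) (*) n (%k. Mor A (ys ! k) (ys ! Suc k)) (%al. G ys al (d, m))"
   proof (cases "m \<in> BN (last ys) (hd ys) d")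
    case True
    then show ?thesis using g'[OF ys] by (simp add: G_def)
   qed (simp add: G_def mlin_zero[OF vK])
  qed
  fix w assume w: "set w <= arrows A" "length w = n"
  have "(\<forall>d. lin_on sN (*) (BN Z X d) (%m. ?c X w Z (d, m))) &
   (\<forall>d m. d + sum_list (map deg w) ~= j | m \<notin> BN Z X d --> ?c X w Z (d, m) = 0)"
  proof (cases "composable X w Z")
   case True
   note t = composable_tuples[OF True w(1) XZ(1)]
   have t1: "X # map tgt w \<in> obj_tuples A n" using t(1) w(2) by simp
   note p = composable_path(2,3)[OF True]
   have e: "?c X w Z (d, m) = (if m \<in> BN Z X d then g (basis (X # map tgt w, (d, m), map snd w)) else 0)" for d m
    using True p by (simp add: comp_fam_def G_def)
   have "lin_on sN (*) (BN Z X d) (%m. g (basis (X # map tgt w, (d, m), map snd w)))" for d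
    using g'[OF t1] t(2) unfolding p by blast
   then have "lin_on sN (*) (BN Z X d) (%m. ?c X w Z (d, m))" for d
    using N_closed[OF XZ(2,1)] by (simp add: e lin_on_def)
   moreover have "?c X w Z (d, m) = 0" if "d + sum_list (map deg w) ~= j | m \<notin> BN Z X d" for d m
    using g'[OF t1] t(2) that unfolding e p by (auto simp: comp_def)
   ultimately show ?thesis by blast
  qed (simp add: comp_fam_def lin_on_zero[OF vK])
  then show "!!d. lin_on sN (*) (BN Z X d) (%m. ?c X w Z (d, m))"
   "!!d m. d + sum_list (map deg w) ~= j | m \<notin> BN Z X d ==> ?c X w Z (d, m) = 0" by blast+
 qed
 define f where "f = lext (*) (%(us :: unit list, dm, xs). exf ?c dm xs)"
 have fb: "f (basis (us, dm, xs)) = exf ?c dm xs" for us dm xs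
  by (simp add: f_def lext_basis[OF vK])
 have fl: "linfun f" by (simp add: f_def linear_lext[OF vK])
 show thesis
 proof
  show "f \<in> homL n j" unfolding homL_iff fb using fl exf_hml[OF gf] by simp
  show "NV n f"
   unfolding NV_def
  proof (intro ballI allI impI)
   fix X Z w d m assume *: "X \<in> Obj A" "Z \<in> Obj A" "set w <= arrows A" "length w = n" "~ composable X w Z" "m \<in> BN Z X d"
   have "famF (exf ?c) X w Z (d, m) = 0" unfolding famF_exf[OF gf *(3,4,1,2)] using *(5) by (simp add: comp_fam_def)
   then show "f (basis (uls n, (d, em Z X m), ul w)) = 0" unfolding fb using *(6) by (simp add: famF_def)
  qed
  have lin': "linfun (%x. f (incl x))"
   by (rule linear_compose[OF vs_pscale vs_pscale vK linear_incl fl])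
  fix i x assume x: "x \<in> hnum A N n i"
  show "f (incl x) = g x"
  proof (rule linear_eq_on_keys[OF vK lin' lin])
   fix b assume "b \<in> Poly_Mapping.keys x"
   then have b: "b \<in> hgens A N n i" using x by (auto simp: hchains_def)
   obtain ys d m al where e: "b = (ys, (d, m), al)" by (metis prod.collapse)
   have h: "ys \<in> obj_tuples A n" "m \<in> BN (last ys) (hd ys) d" "al \<in> arrow_tuples A ys"
    using b unfolding e hgens_iff by auto
   have l: "length ys = Suc n" "length al = n" using h by (auto simp: obj_tuples_def arrow_tuples_def)
   note hl = obj_tuples_hd_last[OF h(1)]
   have "f (incl (basis b)) = famF (exf ?c) (hd ys) (wd ys al) (last ys) (d, m)"
    unfolding e incl_basis[OF h(1)] fb unit_arrows_ul(1)[OF h(1,3)] using h(2) by (simp add: famF_def)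
   also have "... = ?c (hd ys) (wd ys al) (last ys) (d, m)"
    using famF_exf[OF gf wd_arrows[OF h(1,3)] length_wd[OF l] hl] by simp
   also have "... = g (basis b)" unfolding comp_fam_wd[OF l] using h(2) by (simp add: G_def e)
   finally show "f (incl (basis b)) = g (basis b)" .
  qed
 qed
qed

lemma gboundary_basis:
 assumes "linfun f"
 shows "f (gboundary c L M (Suc n) (basis (uls (Suc n), (d, m), xs))) = dF c n (%dm xs. f (basis (uls n, dm, xs))) (d, m) xs"
proof -
 interpret f: Vector_Spaces.linear pscale "(*)" f by fact
 have e: "tl (uls (Suc n)) = uls n" "butlast (uls (Suc n)) = uls n" "i <= Suc n ==> remove_nth i (uls (Suc n)) = uls n" for i
  by (rule unit_list_eq, simp add: length_remove_nth)+
 have c: "contract L (uls (Suc n)) i xs = contract L [] i xs" for i by (simp add: contract_L)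
 let ?g = "(uls (Suc n), (d, m), xs)"
 have "f (gboundary c L M (Suc n) (basis ?g)) =
  (\<Sum>i<Suc n. (-1) ^ i * f (hface L M (Suc n) i ?g)) + (if c then (-1) ^ Suc n * f (hface L M (Suc n) (Suc n) ?g) else 0)"
  unfolding gboundary_def lext_basis[OF vs_pscale] by (simp add: f.add f.sum f.scale f.zero del: replicate_Suc power_Suc)
 also have "(\<Sum>i<Suc n. (-1) ^ i * f (hface L M (Suc n) i ?g)) =
  f (hface L M (Suc n) 0 ?g) + (\<Sum>i=1..n. (-1) ^ i * f (hface L M (Suc n) i ?g))"
  using sum_split_at[of 0 n "%i. (-1) ^ i * f (hface L M (Suc n) i ?g)"] by (simp add: lessThan_Suc_atMost)
 also have "(\<Sum>i=1..n. (-1) ^ i * f (hface L M (Suc n) i ?g)) =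
  (\<Sum>i=1..n. (-1) ^ i * f (basis (uls n, (d, m), contract L [] i xs)))"
  by (intro sum.cong refl) (simp add: hface_def e c del: replicate_Suc)
 finally show ?thesis
  by (simp add: dF_def hface_def e f.scale del: replicate_Suc power_Suc)
qed

lemma gboundary_homL:
 assumes f: "f \<in> homL n j"
 shows "(%x. f (gboundary c L M (Suc n) x)) \<in> homL (Suc n) j"
proof -
 have lin: "linfun f" and F: "hml n j (%dm xs. f (basis (uls n, dm, xs)))"
  using f by (auto simp: homL_iff)
 have "f (gboundary c L M (Suc n) (basis (uls (Suc n), dm, xs))) = dF c n (%dm xs. f (basis (uls n, dm, xs))) dm xs" for dm xs
  by (cases dm) (simp only: gboundary_basis[OF lin])
 then show ?thesis
  unfolding homL_iff using linear_compose[OF vs_pscale vs_pscale vK linear_gboundary lin]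
   dF_hml[OF F, of c] by presburger
qed

lemma gboundary_NV:
 assumes f: "f \<in> homL n j" and nv: "NV n f"
 shows "NV (Suc n) (%x. f (gboundary c L M (Suc n) x))"
 unfolding NV_def
proof (intro ballI allI impI)
 have lin: "linfun f" and F: "hml n j (%dm xs. f (basis (uls n, dm, xs)))"
  using f by (auto simp: homL_iff)
 let ?F = "%dm xs. f (basis (uls n, dm, xs))"
 \<comment> \<open>Cut off outside genuine words of length \<open>n\<close>, because
   \<open>wdiff_not_composable\<close> asks for vanishing on every non-composable word
   whatsoever.\<close>
 let ?f = "%X w Z. if X \<in> Obj A & Z \<in> Obj A & set w <= arrows A & length w = n then famF ?F X w Z else 0"
 fix X Z w d m assume *: "X \<in> Obj A" "Z \<in> Obj A" "set w <= arrows A" "length w = Suc n" "~ composable X w Z" "m \<in> BN Z X d"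
 have ne: "w ~= []" using * by auto
 have "f (gboundary c L M (Suc n) (basis (uls (Suc n), (d, em Z X m), ul w))) = famF (dF c n ?F) X w Z (d, m)"
  unfolding gboundary_basis[OF lin] using *(6) by (simp add: famF_def)
 also have "... = wdiff A lN (rN c j) (famF ?F) X w Z (d, m)" by (rule famF_dF[OF F *(3,4,1,2,6)])
 also have "wdiff A lN (rN c j) (famF ?F) X w Z = wdiff A lN (rN c j) ?f X w Z"
 proof (unfold wdiff_def, rule sum.cong[OF refl])
  fix i assume "i \<in> {..length w}"
  then have i: "i <= length w" by simp
  have "famF ?F (fleft i X w) (fword A i w) (fright i w Z) = ?f (fleft i X w) (fword A i w) (fright i w Z)"
   if "matched X w Z i"
   using fword_arrows[OF *(3) ne i that] fleft_Obj[OF *(3) ne *(1)] fright_Obj[OF *(3) ne *(2)]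
    length_fword[OF ne i, of A] *(4) by simp
  then show "alt i (if matched X w Z i then wface A lN (rN c j) i (famF ?F) X w Z else 0) =
   alt i (if matched X w Z i then wface A lN (rN c j) i ?f X w Z else 0)" by (simp add: wface_def)
 qed
 also have "... = 0"
 proof (rule wdiff_not_composable[OF _ *(5,3,1,2)])
  fix X' Z' :: 'o and w' :: "('o, 'a) arrow list" assume nc: "~ composable X' w' Z'"
  show "?f X' w' Z' = 0"
  proof (rule ext, clarify)
   fix d m
   show "?f X' w' Z' (d, m) = 0 (d, m)"
    using nv nc by (auto simp: NV_def famF_def simp del: replicate_Suc)
  qed
 qed (auto simp: lN_def rN_def fun_eq_iff)
 finally show "f (gboundary c L M (Suc n) (basis (uls (Suc n), (d, em Z X m), ul w))) = 0" by simp
qed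

text \<open>Neighbouring arrows of a path share their middle object, so a product of matrix units is
  the matrix unit of the composite; the two outer faces are \<open>RM_em\<close> and
  \<open>LM_em\<close>.\<close>

lemma incl_hface:
 assumes g: "(ys, (d, m), al) \<in> hgens A N (Suc n) i" and k: "k <= Suc n"
 shows "incl (hface A N (Suc n) k (ys, (d, m), al)) =
  hface L M (Suc n) k (uls (Suc n), (d, em (last ys) (hd ys) m), unit_arrows ys al)"
proof -
 have h: "ys \<in> obj_tuples A (Suc n)" "m \<in> BN (last ys) (hd ys) d" "al \<in> arrow_tuples A ys"
  using g unfolding hgens_iff by auto
 have l: "length ys = Suc (Suc n)" "length al = Suc n" using h by (auto simp: obj_tuples_def arrow_tuples_def)
 note hl = obj_tuples_hd_last[OF h(1)]
 let ?w = "wd ys al"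
 have war: "set ?w <= arrows A" by (rule wd_arrows[OF h(1,3)])
 have lw: "length ?w = Suc n" by (rule length_wd[OF l])
 have ne: "?w ~= []" "ys ~= []" "al ~= []" using lw l by auto
 have ua: "unit_arrows ys al = ul ?w" by (rule unit_arrows_ul(1)[OF h(1,3)])
 have hdw: "hd ?w = ((ys ! 0, ys ! 1), hd al)" using nth_wd[OF l, of 0] ne by (simp add: hd_conv_nth)
 have law: "last ?w = ((ys ! n, ys ! Suc n), last al)" using nth_wd[OF l, of n] ne lw l by (simp add: last_conv_nth)
 have hla: "hd ?w \<in> arrows A" "last ?w \<in> arrows A" using war ne by auto
 have y: "ys ! 0 = hd ys" "ys ! Suc n = last ys" using ne l by (auto simp: hd_conv_nth last_conv_nth)
 have rn: "remove_nth k ys \<in> obj_tuples A n"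
  using h(1) k by (auto simp: obj_tuples_def remove_nth_def dest: in_set_takeD in_set_dropD)
 have l': "length (remove_nth k ys) = Suc n" "length (path_face A k ys al) = n"
  using k l ne by (simp_all add: length_remove_nth length_path_face)
 have fu: "unit_arrows (remove_nth k ys) (path_face A k ys al) = ul (fword A k ?w)"
  unfolding face_wd(1)[OF l k] by (simp add: unit_arrows_wd[OF l'] ul_def)
 have e: "tl (uls (Suc n)) = uls n" "butlast (uls (Suc n)) = uls n" "remove_nth k (uls (Suc n)) = uls n"
  using k by (auto intro!: unit_list_eq simp: length_remove_nth)
 have lin: "incl (pscale c x) = pscale c (incl x)" for c x
  using linear_incl unfolding linear_iff_pscale by blast
 note ends = face_wd(2,3)[OF l k]
 consider "k = 0" | "0 < k" "k < Suc n" | "k = Suc n" using k by linarith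
 then show ?thesis
 proof cases
  case 1
  have r: "RA (em (last ys) (hd ys) m) (um (hd ?w)) = em (last ys) (ys ! 1) (RAct N (last ys) (ys ! 0) (ys ! 1) m (snd (hd al)))"
   using RM_em[OF hla(1) hl(2,1) h(2)] hdw y by simp
  obtain y0 y1 zs where "ys = y0 # y1 # zs" using l(1) by (auto simp: length_Suc_conv)
  then have le: "last (tl ys) = last ys" "hd (tl ys) = ys ! 1" by simp_all
  have rt: "tl ys \<in> obj_tuples A n" using rn 1 by (simp add: remove_nth_0)
  have fu': "unit_arrows (tl ys) (tl al) = ul (tl ?w)"
   using fu 1 by (simp add: remove_nth_0 path_face_def fword_def)
  have "hface A N (Suc n) 0 (ys, (d, m), al) =
   basis (tl ys, (d + fst (hd al), RAct N (last ys) (ys ! 0) (ys ! 1) m (snd (hd al))), tl al)"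
   by (simp add: hface_def)
  moreover have "hface L M (Suc n) 0 (uls (Suc n), (d, em (last ys) (hd ys) m), ul ?w) =
   basis (uls n, (d + deg (hd ?w), RA (em (last ys) (hd ys) m) (um (hd ?w))), ul (tl ?w))"
   unfolding hface_def by (simp add: ul_parts(1,2)[OF ne(1)] e del: replicate_Suc)
  ultimately show ?thesis
   unfolding 1 ua by (simp only: incl_basis[OF rt] le fu' r[unfolded hdw fst_conv snd_conv] hdw fst_conv snd_conv)
 next
  case 2
  have m: "tgt (?w ! (k - 1)) = src (?w ! k)"
   using nth_wd[OF l, of "k - 1"] nth_wd[OF l, of k] 2 by simp
  have "contract L (uls (Suc n)) k (ul ?w) = ul (wcontract A k ?w)"
   using contract_ul[OF war] 2 lw m by simp
  moreover have "hd (remove_nth k ys) = hd ys" "last (remove_nth k ys) = last ys"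
   using ends 2 lw by (auto simp: fleft_def fright_def)
  moreover have "hface A N (Suc n) k (ys, (d, m), al) = basis (remove_nth k ys, (d, m), contract A ys k al)"
   using 2 by (simp add: hface_def)
  moreover have "hface L M (Suc n) k (uls (Suc n), (d, em (last ys) (hd ys) m), ul ?w) =
   basis (uls n, (d, em (last ys) (hd ys) m), contract L (uls (Suc n)) k (ul ?w))"
   using 2 by (simp add: hface_def e del: replicate_Suc)
  moreover have "unit_arrows (remove_nth k ys) (contract A ys k al) = ul (wcontract A k ?w)"
   using fu 2 lw l by (simp add: path_face_def fword_def)
  ultimately show ?thesis unfolding ua by (simp only: incl_basis[OF rn])
 next
  case 3
  have r: "LA (um (last ?w)) (em (last ys) (hd ys) m) = em (ys ! n) (hd ys) (LAct N (ys ! n) (ys ! Suc n) (hd ys) (snd (last al)) m)"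
   using LM_em[OF hla(2) hl(2,1) h(2)] law y by simp
  have le: "last (butlast ys) = ys ! n" "hd (butlast ys) = hd ys"
   using ends 3 lw law remove_nth_last[OF l(1)] by (auto simp: fleft_def fright_def)
  have dg: "degsum (butlast (ul ?w)) = degsum (butlast al)"
  proof -
   have "map fst (ul ?w) = map fst (map snd ?w)" by (simp add: ul_def comp_def)
   then have "map fst (ul ?w) = map fst al" unfolding map_snd_wd[OF l] .
   then show ?thesis by (metis map_butlast)
  qed
  have rb: "butlast ys \<in> obj_tuples A n" using rn 3 remove_nth_last[OF l(1)] by simp
  have fu': "unit_arrows (butlast ys) (butlast al) = ul (butlast ?w)"
   using fu 3 remove_nth_last[OF l(1)] l lw by (simp add: path_face_def fword_def)
  have "hface A N (Suc n) (Suc n) (ys, (d, m), al) = pscale (ksign (fst (last al) * (d + degsum (butlast al))))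
   (basis (butlast ys, (fst (last al) + d, LAct N (ys ! n) (ys ! Suc n) (ys ! 0) (snd (last al)) m), butlast al))"
   by (simp add: hface_def)
  moreover have "hface L M (Suc n) (Suc n) (uls (Suc n), (d, em (last ys) (hd ys) m), ul ?w) =
   pscale (ksign (deg (last ?w) * (d + degsum (butlast (ul ?w)))))
    (basis (uls n, (deg (last ?w) + d, LA (um (last ?w)) (em (last ys) (hd ys) m)), butlast (ul ?w)))"
   unfolding hface_def by (simp add: ul_parts(3)[OF ne(1)] e del: replicate_Suc)
  ultimately show ?thesis
   unfolding 3 ua ul_parts(4)[OF ne(1)] dg[unfolded ul_parts(4)[OF ne(1)]]
   by (simp only: lin incl_basis[OF rb] le fu' r[unfolded law fst_conv snd_conv y] law y fst_conv snd_conv)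
 qed
qed

lemma incl_gboundary:
 assumes x: "x \<in> hnum A N (Suc n) i"
 shows "incl (gboundary c A N (Suc n) x) = gboundary c L M (Suc n) (incl x)"
proof -
 note P = vs_pscale
 interpret I: Vector_Spaces.linear pscale pscale incl by (rule linear_incl)
 show ?thesis
 proof (rule linear_eq_on_keys[OF P, where f = "%x. incl (gboundary c A N (Suc n) x)" and
    f' = "%x. gboundary c L M (Suc n) (incl x)" and x = x])
  show "linop (%x. incl (gboundary c A N (Suc n) x))"
   by (rule linear_compose[OF P P P linear_gboundary linear_incl])
  show "linop (%x. gboundary c L M (Suc n) (incl x))"
   by (rule linear_compose[OF P P P linear_incl linear_gboundary])
  fix b assume "b \<in> Poly_Mapping.keys x"
  then have b: "b \<in> hgens A N (Suc n) i" using x by (auto simp: hchains_def)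
  obtain ys d m al where e: "b = (ys, (d, m), al)" by (metis prod.collapse)
  have ys: "ys \<in> obj_tuples A (Suc n)" using b unfolding e hgens_iff by blast
  have s: "(\<Sum>k<Suc n. pscale ((-1) ^ k) (incl (hface A N (Suc n) k b))) =
   (\<Sum>k<Suc n. pscale ((-1) ^ k) (hface L M (Suc n) k (uls (Suc n), (d, em (last ys) (hd ys) m), unit_arrows ys al)))"
   unfolding e by (intro sum.cong refl arg_cong[of _ _ "pscale _"] incl_hface[OF b[unfolded e]]) simp
  have l: "incl (hface A N (Suc n) (Suc n) b) = hface L M (Suc n) (Suc n) (uls (Suc n), (d, em (last ys) (hd ys) m), unit_arrows ys al)"
   unfolding e by (rule incl_hface[OF b[unfolded e]]) simp
  show "incl (gboundary c A N (Suc n) (basis b)) = gboundary c L M (Suc n) (incl (basis b))"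
   unfolding gboundary_def lext_basis[OF P] incl_basis[OF ys, folded e] e incl_basis[OF ys]
   using s l unfolding e by (simp add: I.add I.sum I.scale I.zero del: replicate_Suc sum.lessThan_Suc power_Suc)
 qed
qed

text \<open>\<open>functional_exact\<close> for functionals on the free spaces: the primitive
  \<open>h\<close> again vanishes on the image of \<open>incl\<close>.\<close>

lemma column_exact:
 assumes f: "f \<in> homL n j"
  and df: "!!i x. x \<in> hnum L M (Suc n) i ==> f (gboundary c L M (Suc n) x) = 0"
  and fA: "!!i x. x \<in> hnum A N n i ==> f (incl x) = 0"
 shows "n = 0 ==> x \<in> hnum L M n i ==> f x = 0"
  and "n = Suc k ==> \<exists>h\<in>homL k j. (\<forall>i. \<forall>x\<in>hnum L M n i. f x = h (gboundary c L M n x)) &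
   (\<forall>i. \<forall>x\<in>hnum A N k i. h (incl x) = 0)"
proof -
 note P = vs_pscale
 have lin: "linfun f" and F: "hml n j (%dm xs. f (basis (uls n, dm, xs)))"
  using f by (auto simp: homL_iff)
 let ?F = "%dm xs. f (basis (uls n, dm, xs))"
 have linA: "linfun (%x. f (incl x))" by (rule linear_compose[OF P P vK linear_incl lin])
 have lind: "linfun (%x. f (gboundary c L M (Suc n) x))" by (rule linear_compose[OF P P vK linear_gboundary lin])
 have dF0: "dF c n ?F (d, m) xs = 0" if "m \<in> BM d" "xs \<in> Ltup (Suc n)" for d m xs
  using df zeroL_iff[OF lind, of "Suc n"] that unfolding gboundary_basis[OF lin] by blast
 have F0: "?F (d, em Z X m) (ul w) = 0"
  if "X \<in> Obj A" "Z \<in> Obj A" "set w <= arrows A" "length w = n" "composable X w Z" "m \<in> BN Z X d" for X Z w d m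
  by (rule zero_composable[where f = f, OF _ that(3-5,1,6)])
   (use fA hom_hchains_zero_iff[OF linA, of A N n] in blast)
 show "f x = 0" if n: "n = 0" and x: "x \<in> hnum L M n i"
 proof -
  have "?F (d, m) xs = 0" if "m \<in> BM d" "xs \<in> Ltup n" for d m xs
   by (rule functional_exact(1)[OF F _ _ n that, of c]; (rule dF0 F0; assumption))
  then show ?thesis using zeroL_iff[OF lin, of n] x by blast
 qed
 show "\<exists>h\<in>homL k j. (\<forall>i. \<forall>x\<in>hnum L M n i. f x = h (gboundary c L M n x)) &
   (\<forall>i. \<forall>x\<in>hnum A N k i. h (incl x) = 0)" if n: "n = Suc k"
 proof -
  obtain K where K: "hml k j K" "!!d m xs. m \<in> BM d ==> xs \<in> Ltup n ==> ?F (d, m) xs = dF c k K (d, m) xs"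
   "!!X Z w d m. X \<in> Obj A ==> Z \<in> Obj A ==> set w <= arrows A ==> length w = k ==> composable X w Z ==>
    m \<in> BN Z X d ==> K (d, em Z X m) (ul w) = 0"
  proof -
   have "\<exists>K. hml k j K & (\<forall>d. \<forall>m\<in>BM d. \<forall>xs\<in>Ltup n. ?F (d, m) xs = dF c k K (d, m) xs) &
    (\<forall>X\<in>Obj A. \<forall>Z\<in>Obj A. \<forall>w. set w <= arrows A --> length w = k --> composable X w Z -->
     (\<forall>d. \<forall>m\<in>BN Z X d. K (d, em Z X m) (ul w) = 0))"
    by (rule functional_exact(2)[OF F _ _ n, of c]; (rule dF0 F0; assumption))
   then show thesis using that by blast
  qed
  define h where "h = lext (*) (%(us :: unit list, dm, xs). K dm xs)"
  have hb: "h (basis (us, dm, xs)) = K dm xs" for us dm xs by (simp add: h_def lext_basis[OF vK])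
  have hl: "linfun h" by (simp add: h_def linear_lext[OF vK])
  have hH: "h \<in> homL k j" unfolding homL_iff hb using hl K(1) by simp
  have linh: "linfun (%x. h (gboundary c L M n x))" by (rule linear_compose[OF P P vK linear_gboundary hl])
  have "f x = h (gboundary c L M n x)" if x: "x \<in> hnum L M n i" for i x
  proof (rule linear_eq_on_keys[OF vK lin linh])
   fix b assume "b \<in> Poly_Mapping.keys x"
   then have b: "b \<in> hgens L M n i" using x by (auto simp: hchains_def)
   obtain us d m xs where e: "b = (us, (d, m), xs)" by (metis prod.collapse)
   have us: "us = uls n" and m: "m \<in> BM d" and xs: "xs \<in> Ltup n"
    using b unfolding e hgens_iff obj_tuples_L by (auto simp: arrow_tuples_L simp del: replicate_Suc)
   show "f (basis b) = h (gboundary c L M n (basis b))"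
    using K(2)[OF m xs] gboundary_basis[OF hl, of c k d m xs] unfolding e us hb n by simp
  qed
  moreover have "h (incl x) = 0" if x: "x \<in> hnum A N k i" for i x
  proof -
   have linhA: "linfun (%x. h (incl x))" by (rule linear_compose[OF P P vK linear_incl hl])
   have "h (incl (basis (ys, (d, m), al))) = 0"
    if h: "ys \<in> obj_tuples A k" "m \<in> BN (last ys) (hd ys) d" "al \<in> arrow_tuples A ys" for ys d m al
   proof -
    have l: "length ys = Suc k" "length al = k" using h by (auto simp: obj_tuples_def arrow_tuples_def)
    show ?thesis
     unfolding incl_basis[OF h(1)] hb unit_arrows_ul(1)[OF h(1,3)]
     by (rule K(3)[OF obj_tuples_hd_last[OF h(1)] wd_arrows[OF h(1,3)] length_wd[OF l] composable_wd[OF l] h(2)])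
   qed
   then show ?thesis using hom_hchains_zero_iff[OF linhA, of A N k] x by blast
  qed
  ultimately show ?thesis using hH by blast
 qed
qed

end

section \<open>Hochschild homology\<close>

lemma keys_subspace: "subspc pscale {x :: 'z \<Rightarrow>\<^sub>0 'k::field. Poly_Mapping.keys x <= S}"
proof -
 have p: "Poly_Mapping.keys (pscale c x) <= S" if "Poly_Mapping.keys x <= S" for c :: 'k and x :: "'z \<Rightarrow>\<^sub>0 'k"
  using that by (auto simp: in_keys_iff)
 have a: "Poly_Mapping.keys (x + y) <= S" if "Poly_Mapping.keys x <= S" "Poly_Mapping.keys y <= S" for x y :: "'z \<Rightarrow>\<^sub>0 'k"
  by (rule order_trans[OF Poly_Mapping.keys_add Un_least[OF that]])
 show ?thesis unfolding subspace_iff[OF vs_pscale] by (simp add: a p)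
qed

lemma hchains_num_subspace: "subspc pscale (hnum B N n i)"
 by (simp add: hchains_def keys_subspace)

lemma hchains_den_subspace: "subspc pscale (den (hchains B N n) i)"
 unfolding hchains_def using module.subspace_span[OF vs_pscale[unfolded module_iff_vector_space[symmetric]]]
 by simp

text \<open>A relator only exchanges an entry for others of the same homogeneous component, so it
  combines generators of one degree.\<close>

lemma hchains_den_num:
 assumes vN: "vector_space (MScale N)" and vB: "vector_space (Scale B)"
  and N: "!!ys d. ys \<in> obj_tuples B n ==> subspc (MScale N) (Bim N (last ys) (hd ys) d)"
  and Bm: "!!ys k d. ys \<in> obj_tuples B n ==> k < n ==> subspc (Scale B) (Mor B (ys ! k) (ys ! Suc k) d)"
 shows "den (hchains B N n) i <= hnum B N n i"
proof -
 note N' = N[unfolded subspace_iff[OF vN]] and B' = Bm[unfolded subspace_iff[OF vB]]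
 note S = hchains_num_subspace[of B N n i]
 interpret P: vector_space pscale by (rule vs_pscale)
 have b: "basis g \<in> hnum B N n i" if "g \<in> hgens B N n i" for g using that by (simp add: hchains_def)
 have rel: "slot_relators s U h <= hnum B N n i"
  if "!!u. u \<in> U ==> h u \<in> hgens B N n i" "!!u v. u \<in> U ==> v \<in> U ==> u + v \<in> U" "!!c u. u \<in> U ==> s c u \<in> U" for s U h
  unfolding slot_relators_def using that by (auto intro!: P.subspace_diff[OF S] P.subspace_scale[OF S] b)
 show ?thesis
  unfolding hchains_def sspace.simps
 proof (rule P.span_minimal[OF _ S[unfolded hchains_def sspace.simps]], rule subsetI, elim UN_E)
  fix y g
  assume g0: "g \<in> hgens B N n i" and y0: "y \<in> (%(ys, (d, m), xs).
      slot_relators (MScale N) (Bim N (last ys) (hd ys) d) (%u. (ys, (d, u), xs)) \<union>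
      (\<Union>k<length xs. slot_relators (Scale B) (Mor B (ys ! k) (ys ! Suc k) (fst (xs ! k)))
        (%a. (ys, (d, m), xs[k := (fst (xs ! k), a)])))) g"
  obtain ys d m xs where e: "g = (ys, (d, m), xs)" by (metis prod.collapse)
  have g: "(ys, (d, m), xs) \<in> hgens B N n i" using g0 e by simp
  have y: "y \<in> slot_relators (MScale N) (Bim N (last ys) (hd ys) d) (%u. (ys, (d, u), xs)) \<union>
      (\<Union>k<length xs. slot_relators (Scale B) (Mor B (ys ! k) (ys ! Suc k) (fst (xs ! k)))
        (%a. (ys, (d, m), xs[k := (fst (xs ! k), a)])))"
   using y0 unfolding e prod.case .
  have h: "ys \<in> obj_tuples B n" "m \<in> Bim N (last ys) (hd ys) d" "xs \<in> arrow_tuples B ys" "d + degsum xs = i"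
   using g by (auto simp: hgens_iff)
  have at: "arrow_tuples B ys = tup n (%k. Mor B (ys ! k) (ys ! Suc k))"
   using h(1) by (intro tup_iff_arrow_tuples) (simp add: obj_tuples_def)
  from y have "y \<in> hnum B N n i"
  proof
   assume "y \<in> slot_relators (MScale N) (Bim N (last ys) (hd ys) d) (%u. (ys, (d, u), xs))"
   moreover have "slot_relators (MScale N) (Bim N (last ys) (hd ys) d) (%u. (ys, (d, u), xs)) <= hnum B N n i"
    by (rule rel) (use h N' in \<open>auto simp: hgens_iff\<close>)
   ultimately show ?thesis by blast
  next
   assume "y \<in> (\<Union>k<length xs. slot_relators (Scale B) (Mor B (ys ! k) (ys ! Suc k) (fst (xs ! k)))
        (%a. (ys, (d, m), xs[k := (fst (xs ! k), a)])))"
   then obtain k where k: "k < length xs" and y: "y \<in> slot_relators (Scale B) (Mor B (ys ! k) (ys ! Suc k) (fst (xs ! k)))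
        (%a. (ys, (d, m), xs[k := (fst (xs ! k), a)]))" by blast
   have kn: "k < n" using h(3) k at by (simp add: tup_def)
   have "slot_relators (Scale B) (Mor B (ys ! k) (ys ! Suc k) (fst (xs ! k)))
        (%a. (ys, (d, m), xs[k := (fst (xs ! k), a)])) <= hnum B N n i"
   proof (rule rel)
    fix u assume u: "u \<in> Mor B (ys ! k) (ys ! Suc k) (fst (xs ! k))"
    have "xs[k := (fst (xs ! k), u)] \<in> arrow_tuples B ys"
     using tup_update[of xs n "%k. Mor B (ys ! k) (ys ! Suc k)" u k] h(3) u unfolding at by blast
    then show "(ys, (d, m), xs[k := (fst (xs ! k), u)]) \<in> hgens B N n i"
     using h by (simp add: hgens_iff degsum_update[OF k])
   qed (use B'[OF h(1) kn] in auto)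
   then show ?thesis using y by blast
  qed
  then show "y \<in> {x. Poly_Mapping.keys x <= hgens B N n i}" by (simp add: hchains_def)
 qed
qed

text \<open>Homogenisation: keeping the values on generators of degree \<open>i\<close> and setting
  the others to 0 gives a functional of degree \<open>i\<close>. A generator records its degrees, so
  it belongs to only one total degree.\<close>

lemma restrict_hom:
 fixes f :: "(('o, 'a::ab_group_add, 'n::ab_group_add) htuple \<Rightarrow>\<^sub>0 'k::field) => 'k"
 assumes dn: "!!i. den (hchains B N n) i <= hnum B N n i"
  and lin: "linfun f" and f0: "!!x. x \<in> den (hchains B N n) i ==> f x = 0"
 obtains f' where "f' \<in> num (hom_sspace (hchains B N n) (*) ground) i" "!!x. x \<in> hnum B N n i ==> f' x = f x"
  "!!k x. x \<in> hnum B N n k ==> k ~= i ==> f' x = 0"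
proof
 note K = vector_space_mult
 define f' where "f' = lext (*) (%g. if g \<in> hgens B N n i then f (basis g) else 0)"
 have l': "linfun f'" by (simp add: f'_def linear_lext[OF K])
 have fb: "f' (basis g) = (if g \<in> hgens B N n i then f (basis g) else 0)" for g by (simp add: f'_def lext_basis[OF K])
 show eq: "f' x = f x" if "x \<in> hnum B N n i" for x
  by (rule linear_eq_on_keys[OF K l' lin]) (use that in \<open>auto simp: fb hchains_def\<close>)
 have dj: "hgens B N n i \<inter> hgens B N n k = {}" if "k ~= i" for k using that by (auto simp: hgens_def)
 show z: "f' x = 0" if "x \<in> hnum B N n k" "k ~= i" for k x
  by (rule linear_zero_on_keys[OF K l']) (use that dj[of k] in \<open>auto simp: fb hchains_def\<close>)
 show "f' \<in> num (hom_sspace (hchains B N n) (*) ground) i"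
  unfolding hom_sspace_def
 proof (simp, intro conjI allI)
  show "lin_map (scl (hchains B N n)) (*) f'" using l' by (simp add: hchains_def)
  fix k
  show "f' ` hnum B N n k <= ground (i + k)"
  proof (cases "k = i")
   case True
   then have "i + k = 0" by (cases i) auto
   then show ?thesis by (simp add: ground_def)
  qed (use z in \<open>auto simp: ground_def\<close>)
  show "f' ` den (hchains B N n) k <= {0}"
  proof (cases "k = i")
   case True
   have "f' x = 0" if "x \<in> den (hchains B N n) i" for x using eq[OF subsetD[OF dn that]] f0[OF that] by simp
   then show ?thesis using True by (simp add: image_subset_iff)
  next
   case False
   have "f' x = 0" if "x \<in> den (hchains B N n) k" for x using z[OF subsetD[OF dn that] False] .
   then show ?thesis by (simp add: image_subset_iff)
  qed
 qed
qed

lemma hom_degree_zero: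
 assumes "f \<in> num (hom_sspace (hchains B N n) (*) ground) i" "x \<in> hnum B N n k" "k ~= i"
 shows "f x = 0"
proof -
 have "f ` hnum B N n k <= ground (i + k)" using assms(1) by (simp add: hom_sspace_def)
 moreover have "i + k ~= 0" using assms(3) by (cases i; cases k) auto
 ultimately show ?thesis using assms(2) by (auto simp: ground_def)
qed

lemma hom_den_zero: "f \<in> num (hom_sspace (hchains B N n) (*) ground) i ==> x \<in> den (hchains B N n) k ==> f x = 0"
 unfolding hom_sspace_def by (simp add: image_subset_iff)

lemma hom_linear: "f \<in> num (hom_sspace (hchains B N n) (*) ground) i ==> linfun f"
 by (simp add: hom_sspace_def hchains_def)

lemma linear_num_closed:
 assumes T: "linop T" and S: "subspc pscale S"
  and b: "!!g. g \<in> Poly_Mapping.keys x ==> T (basis g) \<in> S"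
 shows "T x \<in> S"
proof -
 interpret P: vector_space pscale by (rule vs_pscale)
 show ?thesis unfolding linear_eq_lext[OF vs_pscale T, of x] lext_def
  by (intro P.subspace_sum[OF S] P.subspace_scale[OF S] b)
qed

lemma gboundary_num:
 assumes C: "!!X Y Z a b i j. X \<in> Obj B ==> Y \<in> Obj B ==> Z \<in> Obj B ==> a \<in> Mor B X Y i ==> b \<in> Mor B Y Z j ==>
   Comp B X Y Z a b \<in> Mor B X Z (i + j)"
  and la: "!!X Y Z a m i j. X \<in> Obj B ==> Y \<in> Obj B ==> Z \<in> Obj B ==> a \<in> Mor B Z X i ==> m \<in> Bim N X Y j ==>
   LAct N Z X Y a m \<in> Bim N Z Y (i + j)"
  and ra: "!!X Y Z a m i j. X \<in> Obj B ==> Y \<in> Obj B ==> Z \<in> Obj B ==> m \<in> Bim N X Y i ==> a \<in> Mor B Y Z j ==>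
   RAct N X Y Z m a \<in> Bim N X Z (i + j)"
  and x: "x \<in> hnum B N (Suc n) i"
 shows "gboundary c B N (Suc n) x \<in> hnum B N n i"
proof (rule linear_num_closed[OF linear_gboundary hchains_num_subspace])
 interpret P: vector_space pscale by (rule vs_pscale)
 note S = hchains_num_subspace[of B N n i]
 fix g assume "g \<in> Poly_Mapping.keys x"
 then have g: "g \<in> hgens B N (Suc n) i" using x by (auto simp: hchains_def)
 obtain ys d m al where e: "g = (ys, (d, m), al)" by (metis prod.collapse)
 have h: "ys \<in> obj_tuples B (Suc n)" "m \<in> Bim N (last ys) (hd ys) d" "al \<in> arrow_tuples B ys" "d + degsum al = i"
  using g unfolding e by (auto simp: hgens_iff)
 have l: "length ys = Suc (Suc n)" "length al = Suc n" using h by (auto simp: obj_tuples_def arrow_tuples_def)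
 have ob: "ys ! k \<in> Obj B" if "k <= Suc n" for k using h(1) that by (auto simp: obj_tuples_def)
 have ar: "snd (al ! k) \<in> Mor B (ys ! k) (ys ! Suc k) (fst (al ! k))" if "k <= n" for k
  using h(3) l that by (simp add: arrow_tuples_def)
 have ne: "ys ~= []" "al ~= []" using l by auto
 have y: "hd ys = ys ! 0" "last ys = ys ! Suc n" "hd al = al ! 0" "last al = al ! n"
  using ne l by (auto simp: hd_conv_nth last_conv_nth)
 have mm: "m \<in> Bim N (ys ! Suc n) (ys ! 0) d" using h(2) y by simp
 have dg: "degsum al = fst (al ! 0) + degsum (tl al)" "degsum al = degsum (butlast al) + fst (al ! n)"
 proof -
  show "degsum al = fst (al ! 0) + degsum (tl al)" using ne by (cases al) auto
  have "degsum al = degsum (butlast al @ [last al])" using ne by simp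
  then show "degsum al = degsum (butlast al) + fst (al ! n)" unfolding y by (simp del: append_butlast_last_id)
 qed
 have face: "hface B N (Suc n) k g \<in> hnum B N n i" if k: "k <= Suc n" for k
 proof -
  have rn: "remove_nth k ys \<in> obj_tuples B n"
   using h(1) k by (auto simp: obj_tuples_def remove_nth_def dest: in_set_takeD in_set_dropD)
  have rl: "length (remove_nth k ys) = Suc n" using rn by (simp add: obj_tuples_def)
  have rne: "remove_nth k ys ~= []" using rl by auto
  have rnth: "remove_nth k ys ! j = ys ! (if j < k then j else Suc j)" if "j <= n" for j
   using that k l by (subst nth_remove_nth) auto
  have rhl: "hd (remove_nth k ys) = ys ! (if 0 < k then 0 else 1)" "last (remove_nth k ys) = ys ! (if n < k then n else Suc n)"
   using rne rl rnth[of 0] rnth[of n] by (auto simp: hd_conv_nth last_conv_nth)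
  consider "k = 0" | "0 < k" "k < Suc n" | "k = Suc n" using k by linarith
  then show ?thesis
  proof cases
   case 1
   have "tl al \<in> arrow_tuples B (tl ys)" using l ar by (auto simp: arrow_tuples_def nth_tl)
   moreover have "RAct N (ys ! Suc n) (ys ! 0) (ys ! 1) m (snd (al ! 0)) \<in> Bim N (ys ! Suc n) (ys ! 1) (d + fst (al ! 0))"
    using ar[of 0] ob by (intro ra[OF _ _ _ mm]) auto
   moreover have "tl ys \<in> obj_tuples B n" "hd (tl ys) = ys ! 1" "last (tl ys) = ys ! Suc n"
    using rn rhl 1 by (auto simp: remove_nth_0)
   moreover have "(d + fst (al ! 0)) + degsum (tl al) = i" using h(4) dg(1) by (simp add: add.assoc)
   ultimately show ?thesis using 1 by (simp add: e hface_def hchains_def hgens_iff y)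
  next
   case 2
   have "contract B ys k al \<in> arrow_tuples B (remove_nth k ys)"
   proof -
    have "snd (contract B ys k al ! j) \<in> Mor B (remove_nth k ys ! j) (remove_nth k ys ! Suc j) (fst (contract B ys k al ! j))"
     if j: "j < n" for j
    proof -
     have n2: "contract B ys k al ! j = (if Suc j < k then al ! j else if Suc j = k then
       (fst (al ! (k - 1)) + fst (al ! k), Comp B (ys ! (k - 1)) (ys ! k) (ys ! (k + 1)) (snd (al ! (k - 1))) (snd (al ! k)))
       else al ! Suc j)"
      using 2 j l by (intro nth_contract) auto
     consider "Suc j < k" | "k = Suc j" | "k < Suc j" by linarith
     then show ?thesis
     proof cases
      case 2
      then show ?thesis unfolding n2 using j ob ar[of j] ar[of "Suc j"] rnth[of j] rnth[of "Suc j"]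
       by (simp, intro C) auto
     qed (use n2 j ar[of j] ar[of "Suc j"] rnth[of j] rnth[of "Suc j"] in auto)
    qed
    moreover have "length (contract B ys k al) = n" using 2 l by (simp add: contract_def)
    ultimately show ?thesis using rl by (simp add: arrow_tuples_def)
   qed
   moreover have "degsum (contract B ys k al) = degsum al" using 2 l by (intro degsum_contract) auto
   ultimately show ?thesis using 2 rn rhl mm h(4) by (simp add: e hface_def hchains_def hgens_iff)
  next
   case 3
   have "butlast al \<in> arrow_tuples B (butlast ys)" using l ar by (auto simp: arrow_tuples_def nth_butlast)
   moreover have "LAct N (ys ! n) (ys ! Suc n) (ys ! 0) (snd (al ! n)) m \<in> Bim N (ys ! n) (ys ! 0) (fst (al ! n) + d)"
    using ar[of n] ob by (intro la[OF _ _ _ _ mm]) auto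
   moreover have "butlast ys \<in> obj_tuples B n" "hd (butlast ys) = ys ! 0" "last (butlast ys) = ys ! n"
    using rn rhl 3 by (auto simp: remove_nth_last[OF l(1)])
   moreover have "(fst (al ! n) + d) + degsum (butlast al) = i" using h(4) dg(2) by (simp add: ac_simps)
   ultimately have "basis (butlast ys, (fst (al ! n) + d, LAct N (ys ! n) (ys ! Suc n) (ys ! 0) (snd (al ! n)) m), butlast al) \<in> hnum B N n i"
    by (simp add: hchains_def hgens_iff)
   then show ?thesis unfolding 3 using P.subspace_scale[OF S] by (simp add: e hface_def y)
  qed
 qed
 show "gboundary c B N (Suc n) (basis g) \<in> hnum B N n i"
  unfolding gboundary_def lext_basis[OF vs_pscale]
  using P.subspace_0[OF S]
  by (intro P.subspace_add[OF S] P.subspace_sum[OF S])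
   (auto simp del: power_Suc intro!: P.subspace_scale[OF S] face)
qed

context chain_comparison
begin

section \<open>Differential and inclusion on homogeneous chains\<close>

abbreviation "gbL c n \<equiv> gboundary c L M n"
abbreviation "gbA c n \<equiv> gboundary c A N n"

lemma gbA_num: "x \<in> hnum A N (Suc n) i ==> gbA c (Suc n) x \<in> hnum A N n i"
proof (rule gboundary_num)
 show "LAct N Z X Y a m \<in> BN Z Y (i + j)"
  if "X \<in> Obj A" "Y \<in> Obj A" "Z \<in> Obj A" "a \<in> Mor A Z X i" "m \<in> BN X Y j" for X Y Z a m i j
  using LN_degree[of "((Z, X), (i, a))" Y m j] that by (simp add: arrows_def)
 show "RAct N X Y Z m a \<in> BN X Z (i + j)"
  if "X \<in> Obj A" "Y \<in> Obj A" "Z \<in> Obj A" "m \<in> BN X Y i" "a \<in> Mor A Y Z j" for X Y Z a m i j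
  using RN_degree[of "((Y, Z), (j, a))" X m i] that by (simp add: arrows_def)
qed (auto intro: Comp_degree)

lemma gbL_num: "x \<in> hnum L M (Suc n) i ==> gbL c (Suc n) x \<in> hnum L M n i"
 by (rule gboundary_num) (auto intro: LC_degree LM_degree RM_degree)

lemma denA_num: "den (hchains A N n) i <= hnum A N n i"
proof (rule hchains_den_num[OF vN vector_space])
 show "subspc sN (BN (last ys) (hd ys) d)" if "ys \<in> obj_tuples A n" for ys d
  using N_subspace obj_tuples_hd_last[OF that] by blast
 show "subspc (Scale A) (Mor A (ys ! k) (ys ! Suc k) d)" if "ys \<in> obj_tuples A n" "k < n" for ys k d
  using that by (intro Mor_subspace) (auto simp: obj_tuples_def)
qed

lemma denL_num: "den (hchains L M n) i <= hnum L M n i"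
 by (rule hchains_den_num[OF vM vector_space_L]) (simp_all add: M_subspace LM_subspace)

lemma incl_num: "x \<in> hnum A N n i ==> incl x \<in> hnum L M n i"
proof (rule linear_num_closed[OF linear_incl hchains_num_subspace])
 fix g assume x: "x \<in> hnum A N n i" and "g \<in> Poly_Mapping.keys x"
 then have g: "g \<in> hgens A N n i" by (auto simp: hchains_def)
 obtain ys d m al where e: "g = (ys, (d, m), al)" by (metis prod.collapse)
 have h: "ys \<in> obj_tuples A n" "m \<in> BN (last ys) (hd ys) d" "al \<in> arrow_tuples A ys" "d + degsum al = i"
  using g unfolding e by (auto simp: hgens_iff)
 have "em (last ys) (hd ys) m \<in> BM d" using em_degree obj_tuples_hd_last[OF h(1)] h(2) by blast
 then show "incl (basis g) \<in> hnum L M n i"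
  using unit_arrows_ul(2,3)[OF h(1,3)] h(4) unfolding e incl_basis[OF h(1)]
  by (simp add: hchains_def hgens_iff obj_tuples_L arrow_tuples_L del: replicate_Suc)
qed

lemma restrict_homA:
 assumes "linfun f" "!!x. x \<in> den (hchains A N n) i ==> f x = 0"
 obtains f' where "f' \<in> homA n i" "!!x. x \<in> hnum A N n i ==> f' x = f x"
proof -
 obtain f' where "f' \<in> homA n i" "!!x. x \<in> hnum A N n i ==> f' x = f x"
  by (rule restrict_hom[where B = A and N = N, OF denA_num assms]) blast+
 then show thesis by (rule that)
qed

lemma restrict_homL:
 assumes "linfun f" "!!x. x \<in> den (hchains L M n) i ==> f x = 0"
 obtains f' where "f' \<in> homL n i" "!!x. x \<in> hnum L M n i ==> f' x = f x"
proof -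
 obtain f' where "f' \<in> homL n i" "!!x. x \<in> hnum L M n i ==> f' x = f x"
  by (rule restrict_hom[where B = L and N = M, OF denL_num assms]) blast+
 then show thesis by (rule that)
qed

text \<open>By duality: a functional separating \<open>incl x\<close> from the denominators would
  pull back to one that is nonzero at \<open>x\<close>, while pullbacks vanish on the
  denominators.\<close>

lemma incl_den:
 assumes x: "x \<in> den (hchains A N n) i"
 shows "incl x \<in> den (hchains L M n) i"
proof (rule ccontr)
 assume "incl x \<notin> den (hchains L M n) i"
 from functional_separation[OF vs_pscale hchains_den_subspace this]
 obtain f where f: "linfun f" "!!y. y \<in> den (hchains L M n) i ==> f y = (0::'k)" "f (incl x) ~= 0"
  by blast
 obtain f' where f': "f' \<in> homL n i" "!!x. x \<in> hnum L M n i ==> f' x = f x"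
  using restrict_homL[OF f(1,2)] by blast
 have "f' (incl x) = 0" by (rule hom_den_zero[OF pull_homA[OF f'(1)] x])
 moreover have "incl x \<in> hnum L M n i" using incl_num denA_num x by blast
 ultimately show False using f' f(3) by simp
qed

lemma homL_add: "f \<in> homL n j ==> g \<in> homL n j ==> (%x. f x + g x) \<in> homL n j"
 and homL_diff: "f \<in> homL n j ==> g \<in> homL n j ==> (%x. f x - g x) \<in> homL n j"
 and homL_uminus: "f \<in> homL n j ==> (%x. - f x) \<in> homL n j"
 and homL_zero: "(%_. 0) \<in> homL n j"
proof -
 have t: "vector_space (scl (hchains L M n))" by (simp add: hchains_def vs_pscale)
 have W: "subspc ((*) :: 'k => 'k => 'k) (ground i)" for i
  by (simp add: subspace_iff[OF vK] ground_def)
 have s: "subspc (%c f x. c * f x) (homL n j)" by (rule hom_subspaces(1)[OF t vK W])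
 interpret F: vector_space "%(c::'k) f x. c * f x" by (rule vector_space_fun[OF vK])
 show "f \<in> homL n j ==> g \<in> homL n j ==> (%x. f x + g x) \<in> homL n j"
  "f \<in> homL n j ==> g \<in> homL n j ==> (%x. f x - g x) \<in> homL n j"
  "f \<in> homL n j ==> (%x. - f x) \<in> homL n j" "(%_. 0) \<in> homL n j"
  using F.subspace_add[OF s, of f g] F.subspace_diff[OF s, of f g] F.subspace_neg[OF s, of f] F.subspace_0[OF s]
  by (simp_all add: plus_fun_def fun_diff_def zero_fun_def fun_Compl_def)
qed

lemma NV_diff: "NV n f ==> NV n g ==> NV n (%x. f x - g x)" by (simp add: NV_def)
lemma NV_add: "NV n f ==> NV n g ==> NV n (%x. f x + g x)" by (simp add: NV_def)

text \<open>A functional on homology is treated as a cocycle on all chains, first made homogeneous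
  of the degree under consideration. Lifts give one half of the duality criterion, exactness and
  \<open>functional_factor\<close> the other.\<close>

theorem HH_hom_iso: "induces_iso incl (HH_hom A N n) (HH_hom L M n)"
proof -
 note P = vs_pscale
 interpret P: vector_space pscale by (rule P)
 let ?dA = "gbA True" and ?dL = "gbL True"
 have linA: "linop (?dA n)" and linL: "linop (?dL n)" for n
  by (rule linear_gboundary)+
 have scl: "scl (HH_hom A N n) = pscale" "scl (HH_hom L M n) = pscale"
  by (simp_all add: HH_hom_def homology_def hchains_def)
 have numA: "num (HH_hom A N n) i = {z \<in> hnum A N n i. n = 0 | ?dA n z \<in> den (hchains A N (n - 1)) i}"
  and numL: "num (HH_hom L M n) i = {z \<in> hnum L M n i. n = 0 | ?dL n z \<in> den (hchains L M (n - 1)) i}"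
  and dnA: "den (HH_hom A N n) i = ?dA (Suc n) ` hnum A N (Suc n) i + den (hchains A N n) i"
  and dnL: "den (HH_hom L M n) i = ?dL (Suc n) ` hnum L M (Suc n) i + den (hchains L M n) i" for i
  by (simp_all add: HH_hom_def homology_def hboundary_gboundary)
 have dn0: "0 \<in> den (hchains B K n) i" "0 \<in> hnum B K n i" for B K n i
  using hchains_den_subspace[unfolded subspace_iff[OF P]] hchains_num_subspace[unfolded subspace_iff[OF P]] by blast+
 have T0: "T 0 = 0" if "linop T" for T :: "('x \<Rightarrow>\<^sub>0 'k) => ('y \<Rightarrow>\<^sub>0 'k)"
 proof -
  have "T (0 + 0) = T 0 + T 0" using that unfolding linear_iff[OF P P] by blast
  then show ?thesis by simp
 qed
 show ?thesis
 proof (rule induces_iso_dual, unfold scl)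
  show "vector_space (pscale :: 'k => (('o, 'a, 'n) htuple \<Rightarrow>\<^sub>0 'k) => _)"
   "vector_space (pscale :: 'k => ((unit, 'o => 'o => 'a, 'm) htuple \<Rightarrow>\<^sub>0 'k) => _)" by (rule P)+
  show "linop incl" by (rule linear_incl)
  show "subspc pscale (num (HH_hom A N n) i)" for i
  proof (cases n)
   case 0
   then show ?thesis using hchains_num_subspace[of A N n i] unfolding numA by simp
  next
   case (Suc k)
   have e: "num (HH_hom A N n) i = {z \<in> hnum A N n i. ?dA n z \<in> den (hchains A N k) i}"
    using Suc unfolding numA by simp
   show ?thesis
    using linA[of n] hchains_num_subspace[of A N n i] hchains_den_subspace[of A N k i] T0[OF linA[of n]]
    unfolding e subspace_iff[OF P] linear_iff[OF P P] by auto
  qed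
  show "subspc pscale (den (HH_hom A N n) i)" for i unfolding dnA
   by (intro subspace_plus[OF P] subspace_linear_image[OF linA] hchains_num_subspace hchains_den_subspace)
  show "subspc pscale (den (HH_hom L M n) i)" for i unfolding dnL
   by (intro subspace_plus[OF P] subspace_linear_image[OF linL] hchains_num_subspace hchains_den_subspace)
  show "incl x \<in> num (HH_hom L M n) i" if "x \<in> num (HH_hom A N n) i" for x i
  proof (cases n)
   case (Suc k)
   have x: "x \<in> hnum A N (Suc k) i" "?dA (Suc k) x \<in> den (hchains A N k) i" using that unfolding numA by (simp_all add: Suc)
   then have "?dL (Suc k) (incl x) \<in> den (hchains L M k) i"
    using incl_den[OF x(2)] unfolding incl_gboundary[OF x(1)] by simp
   then show ?thesis unfolding numL using incl_num[OF x(1)] by (simp add: Suc)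
  next
   case 0
   then show ?thesis using that incl_num[of x n i] unfolding numA numL by simp
  qed
  show "incl x \<in> den (HH_hom L M n) i" if x: "x \<in> den (HH_hom A N n) i" for x i
  proof -
   obtain y e where y: "y \<in> hnum A N (Suc n) i" "e \<in> den (hchains A N n) i" "x = ?dA (Suc n) y + e"
    using x unfolding dnA set_plus_def by blast
   have "incl x = ?dL (Suc n) (incl y) + incl e"
    using linear_incl unfolding y(3) linear_iff[OF P P] by (simp add: incl_gboundary[OF y(1)])
   then show ?thesis unfolding dnL using set_plus_intro[OF imageI[OF incl_num[OF y(1)]] incl_den[OF y(2)]] by simp
  qed
  show "\<exists>f'. linfun f' & (\<forall>x\<in>den (HH_hom L M n) i. f' x = 0) & (\<forall>x\<in>num (HH_hom A N n) i. f' (incl x) = f x)"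
   if f: "linfun f" and f0: "\<forall>x\<in>den (HH_hom A N n) i. f x = (0::'k)" for i f
  proof -
   have fd: "f (?dA (Suc n) y) = 0" if "y \<in> hnum A N (Suc n) i" for y
    using f0 that dn0(1)[of A N n i] unfolding dnA by (metis add.right_neutral image_eqI set_plus_intro)
   have fe: "f e = 0" if "e \<in> den (hchains A N n) i" for e
    using f0 that dn0(2)[of A N "Suc n" i] T0[OF linA[of "Suc n"]] unfolding dnA by (metis add_0 image_eqI set_plus_intro)
   obtain g where g: "g \<in> homA n i" "!!x. x \<in> hnum A N n i ==> g x = f x"
    using restrict_homA[OF f fe] by blast
   obtain f' where f': "f' \<in> homL n i" "NV n f'" "!!k x. x \<in> hnum A N n k ==> f' (incl x) = g x"
    using lift_homL[OF g(1)] by blast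
   \<comment> \<open>The lift is again a cocycle: its coboundary vanishes on the non-composable
     words and, since the inclusion is a chain map, on the image of the category.\<close>
   have "f' (?dL (Suc n) x) = 0" if "x \<in> hnum L M (Suc n) i" for x
   proof (rule zero_unique[OF gboundary_homL[OF f'(1)] gboundary_NV[OF f'(1,2)] _ that])
    fix k y assume y: "y \<in> hnum A N (Suc n) k"
    have "f' (?dL (Suc n) (incl y)) = g (?dA (Suc n) y)"
     unfolding incl_gboundary[OF y, symmetric] by (rule f'(3)[OF gbA_num[OF y]])
    also have "... = 0"
     using g(2)[OF gbA_num] fd hom_degree_zero[OF g(1) gbA_num[OF y]] y by (cases "k = i") auto
    finally show "f' (?dL (Suc n) (incl y)) = 0" .
   qed
   then have "f' x = 0" if "x \<in> den (HH_hom L M n) i" for x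
    using that hom_den_zero[OF f'(1)] hom_linear[OF f'(1)] unfolding dnL linear_iff[OF P vK]
    by (auto simp: set_plus_def)
   moreover have "f' (incl x) = f x" if "x \<in> num (HH_hom A N n) i" for x
    using that f'(3)[of x i] g(2)[of x] by (simp add: numA)
   ultimately show ?thesis using hom_linear[OF f'(1)] by blast
  qed
  show "f x = 0" if f: "linfun f" and f0: "\<forall>x\<in>den (HH_hom L M n) i. f x = (0::'k)"
    and fA: "\<forall>x\<in>num (HH_hom A N n) i. f (incl x) = 0" and x: "x \<in> num (HH_hom L M n) i" for i f x
  proof -
   have fd: "f (?dL (Suc n) y) = 0" if "y \<in> hnum L M (Suc n) i" for y
    using f0 that dn0(1)[of L M n i] unfolding dnL by (metis add.right_neutral image_eqI set_plus_intro)
   have fe: "f e = 0" if "e \<in> den (hchains L M n) i" for e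
    using f0 that dn0(2)[of L M "Suc n" i] T0[OF linL[of "Suc n"]] unfolding dnL by (metis add_0 image_eqI set_plus_intro)
   obtain g where g: "g \<in> homL n i" "!!x. x \<in> hnum L M n i ==> g x = f x"
    using restrict_homL[OF f fe] by blast
   have gd: "g (?dL (Suc n) y) = 0" if y: "y \<in> hnum L M (Suc n) k" for k y
    using g(2)[OF gbL_num] fd hom_degree_zero[OF g(1) gbL_num[OF y]] y by (cases "k = i") auto
   have gA: "(%x. g (incl x)) \<in> homA n i" by (rule pull_homA[OF g(1)])
   have xn: "x \<in> hnum L M n i" using x by (simp add: numL)
   have "g x = 0"
   proof (cases n)
    case 0
    have "g (incl y) = 0" if y: "y \<in> hnum A N n k" for k y
    proof (cases "k = i")
     case True
     have "y \<in> num (HH_hom A N n) i" unfolding numA using y True 0 by simp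
     then have "f (incl y) = 0" using fA by blast
     then show ?thesis using g(2)[OF incl_num[of y n i]] y True by simp
    next
     case False
     then show ?thesis using hom_degree_zero[OF gA y] by simp
    qed
    then show ?thesis by (intro column_exact(1)[where c = True and f = g, OF g(1) _ _ 0 xn]) (simp_all add: gd)
   next
    case (Suc m)
    have phi: "g (incl y) = 0" if y: "y \<in> hnum A N n i" "?dA n y \<in> den (hchains A N m) i" for y
    proof -
     have "y \<in> num (HH_hom A N n) i" unfolding numA using y Suc by simp
     then show ?thesis using fA g(2)[OF incl_num[OF y(1)]] by simp
    qed
    \<comment> \<open>The pullback of \<open>g\<close> vanishes on the cycles of the category, so it
      factors through the boundary there.\<close>
    obtain q where q: "linfun q" "!!y. y \<in> den (hchains A N m) i ==> q y = 0"
     "!!x. x \<in> hnum A N n i ==> q (?dA n x) = g (incl x)"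
     by (rule functional_factor[OF P P linA[of n] hchains_num_subspace hchains_den_subspace hom_linear[OF gA] phi]) auto
    obtain q' where q': "q' \<in> homA m i" "!!x. x \<in> hnum A N m i ==> q' x = q x"
     using restrict_homA[OF q(1,2)] by blast
    obtain k where k: "k \<in> homL m i" "NV m k" "!!l x. x \<in> hnum A N m l ==> k (incl x) = q' x"
     using lift_homL[OF q'(1)] by blast
    \<comment> \<open>\<open>p\<close> lifts the pullback of \<open>g\<close>, and \<open>k\<close>
      lifts \<open>q\<close>. By uniqueness of lifts \<open>p\<close> equals \<open>k\<close> after
      the boundary.\<close>
    obtain p where p: "p \<in> homL n i" "NV n p" "!!l x. x \<in> hnum A N n l ==> p (incl x) = g (incl x)"
     using lift_homL[OF gA] by blast
    have pd: "p (?dL (Suc n) y) = 0" if "y \<in> hnum L M (Suc n) l" for y l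
    proof (rule zero_unique[OF gboundary_homL[OF p(1)] gboundary_NV[OF p(1,2)] _ that])
     fix l z assume z: "z \<in> hnum A N (Suc n) l"
     show "p (?dL (Suc n) (incl z)) = 0"
      using gd[OF incl_num[OF z]] p(3)[OF gbA_num[OF z, of True]] unfolding incl_gboundary[OF z, symmetric] by simp
    qed
    have pk: "p y - k (?dL n y) = 0" if y: "y \<in> hnum L M n l" for y l
    proof (rule zero_unique[OF homL_diff[OF p(1)] NV_diff[OF p(2)] _ y])
     show "(%x. k (?dL n x)) \<in> homL n i" using gboundary_homL[OF k(1)] Suc by simp
     show "NV n (%x. k (?dL n x))" using gboundary_NV[OF k(1,2)] Suc by simp
     fix l z assume z: "z \<in> hnum A N n l"
     have z': "z \<in> hnum A N (Suc m) l" using z Suc by simp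
     have "k (?dL n (incl z)) = q' (?dA n z)"
      using k(3)[OF gbA_num[OF z', of True]] incl_gboundary[OF z', of True] Suc by simp
     also have "... = p (incl z)"
     proof (cases "l = i")
      case True
      then show ?thesis using q'(2)[OF gbA_num[OF z', of True, unfolded True]] q(3) z p(3)[OF z] Suc by simp
     next
      case False
      then show ?thesis using hom_degree_zero[OF q'(1) gbA_num[OF z', of True]] hom_degree_zero[OF gA z] p(3)[OF z] Suc by simp
     qed
     finally show "p (incl z) - k (?dL n (incl z)) = 0" by simp
    qed
    \<comment> \<open>The cocycle \<open>g - p\<close> vanishes on the image of the inclusion, hence
      is \<open>h\<close> after the boundary. Altogether \<open>g\<close> factors through the
      boundary and vanishes at the cycle \<open>x\<close>.\<close>
    have "\<exists>h\<in>homL m i. (\<forall>l. \<forall>x\<in>hnum L M n l. g x - p x = h (?dL n x)) &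
     (\<forall>l. \<forall>x\<in>hnum A N m l. h (incl x) = 0)"
     by (rule column_exact(2)[OF homL_diff[OF g(1) p(1)] _ _ Suc]) (simp_all add: gd pd p(3))
    then obtain h where h: "h \<in> homL m i" "!!l x. x \<in> hnum L M n l ==> g x - p x = h (?dL n x)" by blast
    have dx: "?dL n x \<in> den (hchains L M m) i" using x unfolding numL by (simp add: Suc)
    have "g x = h (?dL n x) + k (?dL n x)" using h(2)[OF xn] pk[OF xn] by (simp add: algebra_simps)
    then show ?thesis using hom_den_zero[OF h(1) dx] hom_den_zero[OF k(1) dx] by simp
   qed
   then show ?thesis using g(2)[OF xn] by simp
  qed
 qed
qed

end

section \<open>The cyclic bicomplex\<close>

lemma ksign_add: "ksign (a + b) = (ksign a * ksign b :: 'k::field)"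
 by (cases a; cases b) (simp_all add: ksign_def)

lemma linear_cyc: "linop (cyc n)"
 by (simp add: cyc_def linear_lext[OF vs_pscale])

text \<open>Modulo 2 a degree is its own square, so the exponent |a_n|(|a_0|+...+|a_(n-1)|) equals
  |a_n|(D+1) with D the total degree. As D is invariant under rotation, the exponents of iterated
  rotations simply add.\<close>

lemma cyc_basis: "cyc n (basis (ys, a, xs)) = pscale ((-1) ^ n * ksign (fst (last (a # xs)) * (degsum (a # xs) + 1)))
  (basis (last ys # butlast ys, last (a # xs), butlast (a # xs)))"
proof -
 let ?as = "a # xs"
 have "degsum ?as = degsum (butlast ?as) + fst (last ?as)"
  by (subst append_butlast_last_id[symmetric, of ?as]) (simp_all del: append_butlast_last_id)
 then have e: "fst (last ?as) * (degsum ?as + 1) = fst (last ?as) * degsum (butlast ?as)"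
  by (cases "fst (last ?as)"; cases "degsum (butlast ?as)") simp_all
 show ?thesis unfolding e by (simp add: cyc_def lext_basis[OF vs_pscale] Let_def del: last.simps butlast.simps)
qed

text \<open>For a single object, a Hochschild generator is a list of \<open>n + 1\<close> elements.\<close>

definition ub :: "(bit * 'b) list => (unit, 'b, 'b) htuple \<Rightarrow>\<^sub>0 'k::field" where
 "ub as = basis (replicate (length as) (), hd as, tl as)"

text \<open>The identities between rotation and faces hold already on the free space over all lists
  of length n + 1, before the multilinearity relations are divided out. The equation
  \<open>basis g = ub as\<close> says that the generator \<open>g\<close> is the list
  \<open>as\<close>.\<close>

definition uchains :: "nat => ((unit, 'b, 'b) htuple \<Rightarrow>\<^sub>0 'k::field) set" where
 "uchains n = {x. \<forall>g\<in>Poly_Mapping.keys x. \<exists>as. length as = Suc n & basis g = (ub as :: _ \<Rightarrow>\<^sub>0 'k)}"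

lemma uchains_eqI:
 fixes S T :: "((unit, 'b, 'b) htuple \<Rightarrow>\<^sub>0 'k::field) => ((unit, 'b, 'b) htuple \<Rightarrow>\<^sub>0 'k)"
 assumes "linop S" "linop T"
  and "!!as. length as = Suc n ==> S (ub as) = T (ub as)" and "x \<in> uchains n"
 shows "S x = T x"
proof (rule linear_eq_on_keys[OF vs_pscale assms(1,2)])
 fix g assume "g \<in> Poly_Mapping.keys x"
 then obtain as where "length as = Suc n" "basis g = (ub as :: _ \<Rightarrow>\<^sub>0 'k)" using assms(4) by (auto simp: uchains_def)
 then show "S (basis g) = T (basis g)" using assms(3) by simp
qed

lemma uchains_subspace: "subspc pscale (uchains n :: ((unit, 'b, 'b) htuple \<Rightarrow>\<^sub>0 'k::field) set)"
proof -
 have "(uchains n :: ((unit, 'b, 'b) htuple \<Rightarrow>\<^sub>0 'k) set) = {x. Poly_Mapping.keys x <= {g. \<exists>as. length as = Suc n & basis g = (ub as :: _ \<Rightarrow>\<^sub>0 'k)}}"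
  by (simp only: uchains_def subset_iff Ball_def mem_Collect_eq)
 then show ?thesis using keys_subspace[of "{g. \<exists>as. length as = Suc n & basis g = (ub as :: _ \<Rightarrow>\<^sub>0 'k)}", where 'k = 'k] by simp
qed

lemma ub_uchains: "length as = Suc n ==> ub as \<in> uchains n"
 by (auto simp: uchains_def ub_def)

lemma uchains_closed:
 assumes "linop T" "!!as. length as = Suc n ==> T (ub as) \<in> uchains m" "x \<in> uchains n"
 shows "T x \<in> uchains m"
proof (rule linear_num_closed[OF assms(1) uchains_subspace])
 fix g assume "g \<in> Poly_Mapping.keys x"
 then show "T (basis g) \<in> uchains m" using assms(2,3) unfolding uchains_def by auto
qed

text \<open>Positions count from \<open>a_0\<close>. For the standard bimodule over one object, face
  0 multiplies neighbours like any inner face, and the last face multiplies at position 0 after one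
  rotation.\<close>

definition mcon :: "('k::field, unit, 'b) scat => nat => (bit * 'b) list => (bit * 'b) list" where
 "mcon B i as = take i as @ (fst (as ! i) + fst (as ! Suc i), Comp B () () () (snd (as ! i)) (snd (as ! Suc i)))
   # drop (Suc (Suc i)) as"

text \<open>Includes the sign (-1)^i, so that the relations with \<open>cyc\<close> hold without
  further signs.\<close>

definition sface :: "('k::field, unit, 'b) scat => nat => nat
  => ((unit, 'b, 'b) htuple \<Rightarrow>\<^sub>0 'k) => ((unit, 'b, 'b) htuple \<Rightarrow>\<^sub>0 'k)" where
 "sface B n i = lext pscale (%g. pscale ((-1) ^ i) (hface B (std_bimod B) n i g))"

lemma linear_sface: "linop (sface B n i)"
 by (simp add: sface_def linear_lext[OF vs_pscale])

lemma pscale_pscale: "pscale a (pscale b x) = pscale (a * b) x"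
 using vector_space.vector_space_assms(3)[OF vs_pscale] by blast

lemma pscale_cong: "a = b ==> x = y ==> pscale a x = pscale b y" by simp

lemma cyc_ub:
 assumes "length as = Suc n"
 shows "cyc n (ub as) = pscale ((-1) ^ n * ksign (fst (last as) * (degsum as + 1))) (ub (last as # butlast as))"
proof -
 obtain a xs where e: "as = a # xs" using assms by (cases as) auto
 have u: "() # butlast (replicate (Suc n) ()) = replicate (Suc n) ()" by (rule unit_list_eq) simp
 show ?thesis using assms unfolding ub_def e list.sel cyc_basis
  by (simp add: u del: replicate_Suc last.simps butlast.simps)
qed

lemma sface_ub:
 assumes l: "length as = Suc (Suc m)"
 shows "i <= m ==> sface B (Suc m) i (ub as) = pscale ((-1) ^ i) (ub (mcon B i as))"
  "sface B (Suc m) (Suc m) (ub as) = pscale ((-1) ^ Suc m * ksign (fst (last as) * (degsum as + 1)))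
    (ub (mcon B 0 (last as # butlast as)))"
proof -
 obtain a b xs where e: "as = a # b # xs" using l by (auto simp: length_Suc_conv)
 have u: "us = (vs :: unit list)" if "length us = length vs" for us vs by (rule unit_list_eq[OF that])
 let ?us = "replicate (Suc (Suc m)) ()"
 have t: "tl ?us = replicate (Suc m) ()" "butlast ?us = replicate (Suc m) ()"
  "i <= Suc m ==> remove_nth i ?us = replicate (Suc m) ()" for i
  by (rule u, simp add: length_remove_nth)+
 have lm: "i <= m ==> length (mcon B i as) = Suc m" for i using l by (simp add: mcon_def)
 show "sface B (Suc m) i (ub as) = pscale ((-1) ^ i) (ub (mcon B i as))" if i: "i <= m"
 proof (cases i)
  case 0
  have "hface B (std_bimod B) (Suc m) 0 (?us, a, b # xs) = ub (mcon B 0 as)"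
   using lm[of 0] by (cases a) (simp add: hface_def ub_def t std_bimod_def e mcon_def del: replicate_Suc)
  then show ?thesis using 0 l by (simp add: sface_def ub_def lext_basis[OF vs_pscale] e del: replicate_Suc)
 next
  case (Suc k)
  have "hd (mcon B i as) = a" "tl (mcon B i as) = contract B ?us i (b # xs)"
   unfolding Suc by (simp_all add: mcon_def contract_def e del: replicate_Suc)
  then have "hface B (std_bimod B) (Suc m) i (?us, a, b # xs) = ub (mcon B i as)"
   using lm[of i] i Suc by (cases a) (simp add: hface_def ub_def t del: replicate_Suc)
  then show ?thesis using l by (simp add: sface_def ub_def lext_basis[OF vs_pscale] e del: replicate_Suc)
 qed
 have s: "fst (last as) * degsum (butlast as) = fst (last as) * (degsum as + 1)"
 proof -
  have "degsum as = degsum (butlast as) + fst (last as)"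
   using l by (subst append_butlast_last_id[symmetric, of as]) (auto simp del: append_butlast_last_id)
  then show ?thesis by (cases "fst (last as)"; cases "degsum (butlast as)") simp_all
 qed
 have bl: "butlast as = a # butlast (b # xs)" "last as = last (b # xs)" unfolding e by simp_all
 have lm': "length (mcon B 0 (last as # butlast as)) = Suc m" using l by (simp add: mcon_def)
 have hf: "hface B (std_bimod B) (Suc m) (Suc m) (?us, a, b # xs) =
   pscale (ksign (fst (last as) * degsum (butlast as))) (ub (mcon B 0 (last as # butlast as)))"
  using lm' unfolding bl
  by (cases a) (simp add: hface_def ub_def t std_bimod_def mcon_def del: replicate_Suc last.simps butlast.simps)
 have ua: "ub as = basis (?us, a, b # xs)" using l by (simp add: ub_def e)
 show "sface B (Suc m) (Suc m) (ub as) = pscale ((-1) ^ Suc m * ksign (fst (last as) * (degsum as + 1)))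
    (ub (mcon B 0 (last as # butlast as)))"
  unfolding sface_def by (simp only: ua lext_basis[OF vs_pscale] hf pscale_pscale s)
qed

lemma sface_cyc_0:
 assumes "length as = Suc (Suc m)"
 shows "sface B (Suc m) 0 (cyc (Suc m) (ub as)) = sface B (Suc m) (Suc m) (ub as)"
proof -
 interpret s: Vector_Spaces.linear pscale pscale "sface B (Suc m) 0" by (rule linear_sface)
 show ?thesis using assms by (simp add: cyc_ub s.scale sface_ub pscale_pscale del: power_Suc)
qed

lemma degsum_mcon:
 assumes "Suc i < length as"
 shows "degsum (mcon B i as) = degsum as"
proof -
 have "as = take i as @ as ! i # as ! Suc i # drop (Suc (Suc i)) as"
  using assms by (metis Cons_nth_drop_Suc Suc_lessD append_take_drop_id)
 then have "degsum as = degsum (take i as @ as ! i # as ! Suc i # drop (Suc (Suc i)) as)" by simp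
 then show ?thesis by (simp add: mcon_def add.assoc)
qed

text \<open>Rotation moves the pair to be multiplied one place to the right; only for
  \<open>i = m\<close> does it tear the pair apart.\<close>

lemma sface_cyc_Suc:
 fixes B :: "('k::field, unit, 'b) scat"
 assumes l: "length as = Suc (Suc m)" and i: "i <= m"
 shows "sface B (Suc m) (Suc i) (cyc (Suc m) (ub as)) = cyc m (sface B (Suc m) i (ub as))"
proof -
 interpret s: Vector_Spaces.linear pscale pscale "sface B (Suc m) (Suc i)" by (rule linear_sface)
 interpret t: Vector_Spaces.linear pscale pscale "cyc m" by (rule linear_cyc)
 obtain zs y z where e: "as = zs @ [y, z]" and lz: "length zs = m"
  using l by (cases as rule: rev_cases; cases "butlast as" rule: rev_cases) auto
 have lm: "length (mcon B i as) = Suc m" using l i by (simp add: mcon_def)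
 have R: "cyc m (sface B (Suc m) i (ub as)) = pscale ((-1) ^ i * ((-1) ^ m * ksign (fst (last (mcon B i as)) * (degsum as + 1))))
   (ub (last (mcon B i as) # butlast (mcon B i as)))"
  unfolding sface_ub(1)[OF l i] t.scale cyc_ub[OF lm] pscale_pscale using l i by (simp add: degsum_mcon)
 show ?thesis
 proof (cases "i = m")
  case False
  then have i': "Suc i <= m" using i by simp
  have "mcon B (Suc i) (z # zs @ [y]) = last (mcon B i as) # butlast (mcon B i as)" "last (mcon B i as) = z"
   using i' lz by (auto simp: mcon_def e nth_append nth_Cons' butlast_append)
  moreover have "last as = z" "butlast as = zs @ [y]" using e by (simp_all add: butlast_append)
  ultimately show ?thesis
   unfolding R cyc_ub[OF l] s.scale using i' l lz
   by (subst sface_ub(1)) (auto simp: pscale_pscale intro!: pscale_cong)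
 next
  \<comment> \<open>Here the last face joins \<open>y\<close> and \<open>z\<close> again by rotating
    once more. The two signs combine to the sign for rotating the product, whose degree is the
    sum.\<close>
  case True
  have mc: "mcon B i as = zs @ [(fst y + fst z, Comp B () () () (snd y) (snd z))]"
   using True lz by (simp add: mcon_def e nth_append)
  have lb: "last as = z" "butlast as = zs @ [y]" using e by (simp_all add: butlast_append)
  have sg: "ksign (fst z * (degsum as + 1)) * ksign (fst y * (degsum as + 1)) =
    (ksign ((fst y + fst z) * (degsum as + 1)) :: 'k)"
   by (simp add: ksign_add[symmetric] distrib_right add.commute)
  have ds: "degsum (z # zs @ [y]) = degsum as" by (simp add: e ac_simps)
  have "sface B (Suc m) (Suc i) (cyc (Suc m) (ub as)) =
   pscale ((-1) ^ Suc m * ksign (fst z * (degsum as + 1)) * ((-1) ^ Suc m * ksign (fst y * (degsum as + 1))))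
    (ub (mcon B 0 (y # z # zs)))"
   unfolding cyc_ub[OF l] s.scale[unfolded True] lb True using lz ds
   by (subst sface_ub(2)) (auto simp: pscale_pscale butlast_append simp del: power_Suc)
  moreover have "mcon B 0 (y # z # zs) = last (mcon B i as) # butlast (mcon B i as)" unfolding mc by (simp add: mcon_def)
  moreover have "(-1) ^ Suc m * ksign (fst z * (degsum as + 1)) * ((-1) ^ Suc m * ksign (fst y * (degsum as + 1))) =
   ((-1) ^ i * ((-1) ^ m * ksign (fst (last (mcon B i as)) * (degsum as + 1))) :: 'k)" (is "?l = ?r")
  proof -
   have s1: "(-1 :: 'k) ^ k * (-1) ^ k = 1" for k by (simp add: power_mult_distrib[symmetric])
   have "?l = ((-1) ^ Suc m * (-1) ^ Suc m) * (ksign (fst z * (degsum as + 1)) * ksign (fst y * (degsum as + 1)))"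
    by (simp only: mult_ac)
   also have "... = ((-1) ^ m * (-1) ^ m) * ksign ((fst y + fst z) * (degsum as + 1))" unfolding s1 sg by simp
   also have "... = ?r" unfolding True mc[unfolded True] by (simp add: mult.assoc)
   finally show ?thesis .
  qed
  ultimately show ?thesis unfolding R by simp
 qed
qed

text \<open>The block \<open>vs\<close> moves to the front one entry at a time. With D constant, the
  exponents |v|(D+1) add up.\<close>

lemma cyc_power_ub:
 assumes "length (us @ vs) = Suc n"
 shows "(cyc n ^^ length vs) (ub (us @ vs)) =
  (pscale (((-1) ^ n) ^ length vs * ksign (degsum vs * (degsum (us @ vs) + 1))) (ub (vs @ us)) :: _ \<Rightarrow>\<^sub>0 'k::field)"
 using assms
proof (induction vs arbitrary: us)
 case Nil
 interpret vector_space pscale by (rule vs_pscale)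
 show ?case by (simp add: ksign_def)
next
 case (Cons v vs)
 interpret t: Vector_Spaces.linear pscale pscale "cyc n" by (rule linear_cyc)
 have l: "length (vs @ us @ [v]) = Suc n" using Cons.prems by simp
 have d: "degsum (vs @ us @ [v]) = degsum (us @ v # vs)" by (simp add: ac_simps)
 have b: "last (vs @ us @ [v]) = v" "butlast (vs @ us @ [v]) = vs @ us" by (simp_all add: butlast_append)
 have "(cyc n ^^ length (v # vs)) (ub (us @ v # vs) :: _ \<Rightarrow>\<^sub>0 'k) = cyc n ((cyc n ^^ length vs) (ub ((us @ [v]) @ vs)))" by simp
 also have "... = pscale (((-1) ^ n) ^ length vs * ksign (degsum vs * (degsum (us @ v # vs) + 1)) *
   ((-1) ^ n * ksign (fst v * (degsum (us @ v # vs) + 1)))) (ub (v # vs @ us))"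
  using Cons.IH[of "us @ [v]"] Cons.prems by (simp add: t.scale pscale_pscale cyc_ub[OF l, unfolded b d] del: power_Suc)
 also have "((-1) ^ n) ^ length vs * ksign (degsum vs * (degsum (us @ v # vs) + 1)) *
   ((-1) ^ n * ksign (fst v * (degsum (us @ v # vs) + 1))) =
   ((-1) ^ n) ^ length (v # vs) * (ksign (degsum (v # vs) * (degsum (us @ v # vs) + 1)) :: 'k)"
  by (simp add: distrib_right ksign_add mult_ac)
 finally show ?case by simp
qed

lemma linear_cyc_power: "linop (cyc n ^^ k)"
proof (induction k)
 case 0
 then show ?case by (simp add: linear_iff_pscale)
next
 case (Suc k)
 then show ?case
  using linear_compose[OF vs_pscale vs_pscale vs_pscale Suc linear_cyc[of n]] by (simp add: comp_def)
qed

lemma linear_cyc_norm: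
 "linop (cyc_norm n :: (('o, 'a, 'a) htuple \<Rightarrow>\<^sub>0 'k::field) => _)"
proof -
 interpret vector_space pscale by (rule vs_pscale)
 have "(cyc n ^^ k) (x + y) = (cyc n ^^ k) x + (cyc n ^^ k) y" "(cyc n ^^ k) (pscale c x) = pscale c ((cyc n ^^ k) x)"
  for k and x y :: "('o, 'a, 'a) htuple \<Rightarrow>\<^sub>0 'k" and c
  using linear_cyc_power[of k n] unfolding linear_iff_pscale by blast+
 then show ?thesis unfolding linear_iff_pscale cyc_norm_def
  by (simp add: sum.distrib scale_sum_right)
qed

text \<open>Both signs of the full rotation are trivial: n(n+1) is even, and D(D+1) = 0 modulo
  2.\<close>

lemma cyc_power_id:
 assumes "x \<in> uchains n"
 shows "(cyc n ^^ Suc n) x = x"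
proof -
 interpret vector_space pscale by (rule vs_pscale)
 have i: "linop (%x. x)" by (simp add: linear_iff_pscale)
 show ?thesis
 proof (rule uchains_eqI[OF linear_cyc_power i _ assms])
  fix as :: "(bit * 'a) list" assume l: "length as = Suc n"
  have "((-1) ^ n) ^ Suc n = (-1 :: 'b) ^ (n * Suc n)" by (simp only: power_mult)
  then have "((-1) ^ n) ^ Suc n = (1 :: 'b)" by simp
  moreover have "ksign (degsum as * (degsum as + 1)) = (1 :: 'b)" by (cases "degsum as") (simp_all add: ksign_def)
  ultimately show "(cyc n ^^ Suc n) (ub as) = (ub as :: _ \<Rightarrow>\<^sub>0 'b)"
   using cyc_power_ub[of "[]" as n, where 'k = 'b] l by (simp del: power_Suc funpow.simps)
 qed
qed

lemma cyc_uchains: "x \<in> uchains n ==> cyc n x \<in> uchains n"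
proof (rule uchains_closed[OF linear_cyc])
 interpret vector_space pscale by (rule vs_pscale)
 fix as :: "(bit * 'a) list" assume "length as = Suc n"
 then show "cyc n (ub as) \<in> (uchains n :: (_ \<Rightarrow>\<^sub>0 'b) set)"
  by (simp add: cyc_ub subspace_scale[OF uchains_subspace] ub_uchains)
qed

lemma cyc_power_uchains: "x \<in> uchains n ==> (cyc n ^^ k) x \<in> uchains n"
 by (induction k) (simp_all add: cyc_uchains)

lemma sface_uchains:
 fixes B :: "('k::field, unit, 'b) scat"
 assumes "i <= Suc m" "x \<in> uchains (Suc m)"
 shows "sface B (Suc m) i x \<in> uchains m"
proof (rule uchains_closed[OF linear_sface _ assms(2)])
 interpret vector_space pscale by (rule vs_pscale)
 fix as :: "(bit * 'b) list" assume l: "length as = Suc (Suc m)"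
 have u: "ub (mcon B k bs) \<in> uchains m" if "length bs = Suc (Suc m)" "k <= m" for k bs
  by (rule ub_uchains) (use that in \<open>simp add: mcon_def\<close>)
 show "sface B (Suc m) i (ub as) \<in> uchains m"
 proof (cases "i <= m")
  case True
  then show ?thesis using l by (simp add: sface_ub subspace_scale[OF uchains_subspace] u)
 next
  case False
  then have "i = Suc m" using assms(1) by simp
  then show ?thesis using l
   by (simp add: sface_ub(2)[OF l] subspace_scale[OF uchains_subspace] u del: power_Suc)
 qed
qed

lemma gboundary_sface: "gboundary c B (std_bimod B) n x = (\<Sum>i<n. sface B n i x) + (if c then sface B n n x else 0)"
proof -
 interpret V: vector_space pscale by (rule vs_pscale)
 have l: "linop (%x. (\<Sum>i<n. sface B n i x) + (if c then sface B n n x else 0))"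
  using linear_sface[of B n] unfolding linear_iff_pscale
  by (simp add: sum.distrib V.scale_sum_right V.scale_right_distrib)
 show ?thesis
  by (rule linear_eq_on_keys[OF vs_pscale linear_gboundary l])
   (simp add: gboundary_def sface_def lext_basis[OF vs_pscale])
qed

lemma sface_cyc:
 assumes x: "x \<in> uchains (Suc m)"
 shows "sface B (Suc m) 0 (cyc (Suc m) x) = sface B (Suc m) (Suc m) x"
  "i <= m ==> sface B (Suc m) (Suc i) (cyc (Suc m) x) = cyc m (sface B (Suc m) i x)"
proof -
 note P = vs_pscale and C = linear_compose_pscale
 show "sface B (Suc m) 0 (cyc (Suc m) x) = sface B (Suc m) (Suc m) x"
  by (rule uchains_eqI[OF C[OF linear_cyc linear_sface] linear_sface sface_cyc_0 x])
 show "sface B (Suc m) (Suc i) (cyc (Suc m) x) = cyc m (sface B (Suc m) i x)" if "i <= m"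
  by (rule uchains_eqI[OF C[OF linear_cyc linear_sface] C[OF linear_sface linear_cyc] sface_cyc_Suc[OF _ that] x])
qed

text \<open>The classical identity b(1-t) = (1-t)b'. With signs inside the faces, d_0 t = d_n and
  d_(i+1) t = t d_i, hence bt = d_n + tb'.\<close>

lemma boundary_one_minus_cyc:
 assumes x: "x \<in> uchains (Suc m)"
 shows "gboundary True B (std_bimod B) (Suc m) (x - cyc (Suc m) x) =
  gboundary False B (std_bimod B) (Suc m) x - cyc m (gboundary False B (std_bimod B) (Suc m) x)"
proof -
 interpret b: Vector_Spaces.linear pscale pscale "gboundary True B (std_bimod B) (Suc m)" by (rule linear_gboundary)
 interpret t: Vector_Spaces.linear pscale pscale "cyc m" by (rule linear_cyc)
 let ?e = "sface B (Suc m)"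
 have "(\<Sum>i<Suc m. ?e (Suc i) (cyc (Suc m) x)) = (\<Sum>i<Suc m. cyc m (?e i x))"
  by (intro sum.cong refl sface_cyc(2)[OF x]) simp
 then have bt: "gboundary True B (std_bimod B) (Suc m) (cyc (Suc m) x) = ?e (Suc m) x + (\<Sum>i<Suc m. cyc m (?e i x))"
  using sum.lessThan_Suc_shift[of "%i. ?e i (cyc (Suc m) x)" "Suc m"]
  by (simp add: gboundary_sface sface_cyc(1)[OF x])
 show ?thesis unfolding b.diff bt by (simp add: gboundary_sface t.sum t.add)
qed

lemma cyc_norm_lessThan: "cyc_norm n x = (\<Sum>k<Suc n. (cyc n ^^ k) x)"
 by (simp add: cyc_norm_def lessThan_Suc_atMost)

text \<open>Multiplication by t permutes the summands of N cyclically, since a full rotation is the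
  identity.\<close>

lemma cyc_norm_cyc:
 assumes "x \<in> uchains n"
 shows "cyc_norm n (cyc n x) = cyc_norm n x" "cyc n (cyc_norm n x) = cyc_norm n x"
proof -
 interpret t: Vector_Spaces.linear pscale pscale "cyc n" by (rule linear_cyc)
 have "(\<Sum>k<Suc n. (cyc n ^^ Suc k) x) = cyc_norm n x"
  using sum.lessThan_Suc_shift[of "%k. (cyc n ^^ k) x" "Suc n"] cyc_power_id[OF assms]
  unfolding cyc_norm_lessThan sum.lessThan_Suc[of _ "Suc n"] by (simp del: funpow.simps(2) sum.lessThan_Suc)
 then show "cyc_norm n (cyc n x) = cyc_norm n x" "cyc n (cyc_norm n x) = cyc_norm n x"
  unfolding cyc_norm_lessThan t.sum by (simp_all add: funpow_swap1 del: sum.lessThan_Suc)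
qed

lemma cyc_norm_uchains: "x \<in> uchains n ==> cyc_norm n x \<in> uchains n"
proof -
 interpret vector_space pscale by (rule vs_pscale)
 show "x \<in> uchains n ==> cyc_norm n x \<in> uchains n"
  unfolding cyc_norm_def by (intro subspace_sum[OF uchains_subspace] cyc_power_uchains)
qed

text \<open>Both sides are \<open>N d\<^sub>0 N\<close>.\<close>

lemma boundary_cyc_norm:
 assumes x: "x \<in> uchains (Suc m)"
 shows "gboundary False B (std_bimod B) (Suc m) (cyc_norm (Suc m) x) =
  cyc_norm m (gboundary True B (std_bimod B) (Suc m) x)"
proof -
 interpret N: Vector_Spaces.linear pscale pscale "cyc_norm m" by (rule linear_cyc_norm)
 interpret e0: Vector_Spaces.linear pscale pscale "sface B (Suc m) 0" by (rule linear_sface)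
 let ?e = "sface B (Suc m)" and ?t = "cyc (Suc m)" and ?N = "cyc_norm (Suc m) x"
 note eS = sface_cyc(2)[where B = B]
 \<comment> \<open>Repeated use of d_(i+1) t = t d_i together with tN = N.\<close>
 have eN: "?e i ?N = (cyc m ^^ i) (?e 0 ?N)" if "i <= Suc m" for i
  using that
 proof (induction i)
  case (Suc i)
  then show ?case using eS[OF cyc_norm_uchains[OF x], of i] cyc_norm_cyc(2)[OF x] by simp
 qed simp
 have "(\<Sum>i<Suc m. ?e i ?N) = (\<Sum>i<Suc m. (cyc m ^^ i) (?e 0 ?N))"
  by (intro sum.cong refl eN) simp
 then have "gboundary False B (std_bimod B) (Suc m) ?N = (\<Sum>i<Suc m. (cyc m ^^ i) (?e 0 ?N))"
  by (simp only: gboundary_sface if_False add_0_right)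
 also have "... = cyc_norm m (?e 0 ?N)" by (simp add: cyc_norm_lessThan)
 finally have L: "gboundary False B (std_bimod B) (Suc m) ?N = cyc_norm m (?e 0 ?N)" .
 \<comment> \<open>On the other side the powers of t that leave the face are absorbed by Nt =
   N.\<close>
 have sh: "cyc_norm m (?e i ((?t ^^ i) y)) = cyc_norm m (?e 0 y)" if "i <= Suc m" "y \<in> uchains (Suc m)" for i y
  using that
 proof (induction i)
  case (Suc i)
  have ty: "(?t ^^ i) y \<in> uchains (Suc m)" by (rule cyc_power_uchains[OF Suc.prems(2)])
  then show ?case using Suc eS[OF ty, of i] cyc_norm_cyc(1)[OF sface_uchains[OF _ ty, of i]] by simp
 qed simp
 \<comment> \<open>Full rotation is the identity, so \<open>x\<close> is the \<open>i\<close>-th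
   rotation of the element on the right, and \<open>sh\<close> applies. As \<open>i\<close> varies,
   the right sides run through all rotations of \<open>x\<close> and sum up to the norm.\<close>
 have "cyc_norm m (?e i x) = cyc_norm m (?e 0 ((?t ^^ (Suc (Suc m) - i)) x))" if i: "i <= Suc m" for i
 proof -
  have "(?t ^^ i) ((?t ^^ (Suc (Suc m) - i)) x) = (?t ^^ Suc (Suc m)) x"
   using i by (simp add: funpow_add[symmetric, THEN fun_cong, unfolded comp_def] del: funpow.simps(2))
  then show ?thesis using sh[OF i cyc_power_uchains[OF x, of "Suc (Suc m) - i"]] cyc_power_id[OF x] by simp
 qed
 then have "cyc_norm m (gboundary True B (std_bimod B) (Suc m) x) =
   (\<Sum>i<Suc (Suc m). cyc_norm m (?e 0 ((?t ^^ (Suc (Suc m) - i)) x)))"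
  unfolding gboundary_sface by (simp add: N.add N.sum)
 also have "... = (\<Sum>k<Suc (Suc m). cyc_norm m (?e 0 ((?t ^^ Suc k) x)))"
  unfolding sum.nat_diff_reindex[of "%k. cyc_norm m (?e 0 ((?t ^^ Suc k) x))" "Suc (Suc m)", symmetric]
  by (intro sum.cong refl) (simp only: Suc_diff_Suc lessThan_iff)
 also have "... = cyc_norm m (?e 0 (cyc_norm (Suc m) (?t x)))"
  unfolding cyc_norm_lessThan[of "Suc m"] e0.sum N.sum by (simp add: funpow_swap1 del: sum.lessThan_Suc)
 finally show ?thesis using L cyc_norm_cyc(1)[OF x] by simp
qed

section \<open>The bicomplex operators on homogeneous chains\<close>

lemma std_bimod_sel: "Bim (std_bimod B) = Mor B" "MScale (std_bimod B) = Scale B"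
  "LAct (std_bimod B) = Comp B" "RAct (std_bimod B) = Comp B"
 by (simp_all add: std_bimod_def)

lemma split_last2:
 assumes "length ys = Suc (Suc n)"
 obtains us y z where "ys = us @ [y, z]" "length us = n"
 using assms by (cases ys rule: rev_cases; cases "butlast ys" rule: rev_cases) auto

lemma num_uminus: "x \<in> hnum B N n i ==> - x \<in> hnum B N n i"
proof -
 interpret P: vector_space pscale by (rule vs_pscale)
 show "x \<in> hnum B N n i ==> - x \<in> hnum B N n i"
  by (rule P.subspace_neg[OF hchains_num_subspace])
qed

lemma cyc_num:
 assumes "x \<in> cnum B n i"
 shows "cyc n x \<in> cnum B n i"
proof (rule linear_num_closed[OF linear_cyc hchains_num_subspace])
 interpret P: vector_space pscale by (rule vs_pscale)
 fix g assume "g \<in> Poly_Mapping.keys x"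
 then have g: "g \<in> hgens B (std_bimod B) n i" using assms by (auto simp: hchains_def)
 obtain ys d m al where e: "g = (ys, (d, m), al)" by (metis prod.collapse)
 have h: "ys \<in> obj_tuples B n" "m \<in> Mor B (last ys) (hd ys) d" "al \<in> arrow_tuples B ys" "d + degsum al = i"
  using g unfolding e hgens_iff std_bimod_sel by simp_all
 have "(last ys # butlast ys, last ((d, m) # al), butlast ((d, m) # al)) \<in> hgens B (std_bimod B) n i"
 proof (cases al rule: rev_cases)
  case Nil
  then have "length ys = Suc 0" using h(3) by (simp add: arrow_tuples_def)
  then obtain y where "ys = [y]" by (auto simp: length_Suc_conv)
  then show ?thesis using h Nil by (simp add: hgens_iff std_bimod_sel)
 next
  case (snoc bl c)
  have "length ys = Suc (Suc (length bl))" using h(3) snoc by (simp add: arrow_tuples_def)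
  then obtain us y z where ys: "ys = us @ [y, z]" "length us = length bl" by (rule split_last2)
  have at: "snd (al ! k) \<in> Mor B (ys ! k) (ys ! Suc k) (fst (al ! k))" if "k < Suc (length bl)" for k
   using h(3) that snoc by (simp add: arrow_tuples_def)
  have c: "snd c \<in> Mor B y z (fst c)" using at[of "length bl"] by (simp add: snoc ys nth_append)
  have "snd (((d, m) # bl) ! k) \<in> Mor B ((z # us @ [y]) ! k) ((z # us @ [y]) ! Suc k) (fst (((d, m) # bl) ! k))"
   if k: "k < Suc (length bl)" for k
  proof (cases k)
   case 0
   have "hd ys = (us @ [y]) ! 0" by (cases us) (simp_all add: ys)
   then show ?thesis using 0 h(2) ys by simp
  next
   case (Suc l)
   then show ?thesis using at[of l] k ys by (auto simp: snoc nth_append split: if_splits)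
  qed
  then have "(d, m) # bl \<in> arrow_tuples B (z # us @ [y])" using ys by (simp add: arrow_tuples_def)
  moreover have "fst c + (d + degsum bl) = i" using h(4) snoc by (simp add: ac_simps)
  moreover have "z # us @ [y] \<in> obj_tuples B n" using h(1) ys by (auto simp: obj_tuples_def)
  ultimately show ?thesis using c by (cases c) (simp add: hgens_iff std_bimod_sel snoc ys butlast_append)
 qed
 then show "cyc n (basis g) \<in> cnum B n i"
  unfolding e cyc_basis by (intro P.subspace_scale[OF hchains_num_subspace]) (simp add: hchains_def)
qed

lemma cyc_norm_num: "x \<in> cnum B n i ==> cyc_norm n x \<in> cnum B n i"
proof -
 interpret P: vector_space pscale by (rule vs_pscale)
 assume "x \<in> cnum B n i"
 then have "(cyc n ^^ k) x \<in> cnum B n i" for k by (induction k) (simp_all add: cyc_num)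
 then show ?thesis unfolding cyc_norm_def by (intro P.subspace_sum[OF hchains_num_subspace])
qed

lemma cc_vert_gboundary: "cc_vert B p q x =
  (if even p then gboundary True B (std_bimod B) q x else - gboundary False B (std_bimod B) q x)"
 by (simp add: cc_vert_def hboundary_gboundary bar_boundary_gboundary)

lemma linear_cc_vert: "linop (cc_vert B p q)"
proof -
 interpret P: vector_space pscale by (rule vs_pscale)
 show ?thesis
  using linear_gboundary[of True B "std_bimod B" q] linear_gboundary[of False B "std_bimod B" q]
  unfolding linear_iff_pscale cc_vert_gboundary by (simp add: P.scale_minus_right)
qed

lemma linear_cc_horiz:
 "linop (cc_horiz p q :: (('o, 'a, 'a) htuple \<Rightarrow>\<^sub>0 'k::field) => _)"
proof -
 interpret P: vector_space pscale by (rule vs_pscale)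
 interpret t: Vector_Spaces.linear pscale pscale "cyc q :: (('o, 'a, 'a) htuple \<Rightarrow>\<^sub>0 'k) => _" by (rule linear_cyc)
 interpret N: Vector_Spaces.linear pscale pscale "cyc_norm q :: (('o, 'a, 'a) htuple \<Rightarrow>\<^sub>0 'k) => _" by (rule linear_cyc_norm)
 show ?thesis
  unfolding linear_iff_pscale cc_horiz_def
  by (simp add: P.scale_right_diff_distrib t.add t.scale N.add N.scale)
qed

lemma cc_horiz_num: "x \<in> cnum B q i ==> cc_horiz p q x \<in> cnum B q i"
proof -
 interpret P: vector_space pscale by (rule vs_pscale)
 show "x \<in> cnum B q i ==> cc_horiz p q x \<in> cnum B q i"
  unfolding cc_horiz_def by (simp add: P.subspace_diff[OF hchains_num_subspace] cyc_num cyc_norm_num)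
qed

lemma num_uchains:
 fixes B :: "('k::field, unit, 'b::ab_group_add) scat"
 assumes "x \<in> cnum B n i"
 shows "x \<in> uchains n"
 unfolding uchains_def
proof (intro CollectI ballI)
 fix g assume "g \<in> Poly_Mapping.keys x"
 then have g: "g \<in> hgens B (std_bimod B) n i" using assms by (auto simp: hchains_def)
 obtain ys dm al where e: "g = (ys, dm, al)" by (metis prod.collapse)
 have "length ys = Suc n" "length al = n"
  using g e by (auto simp: hgens_def obj_tuples_def arrow_tuples_def)
 moreover from this have "ys = replicate (Suc n) ()" by (intro unit_list_eq) simp
 ultimately show "\<exists>as. length as = Suc n & basis g = (ub as :: _ \<Rightarrow>\<^sub>0 'k)"
  by (intro exI[of _ "dm # al"]) (simp add: ub_def e)
qed

text \<open>Even and odd \<open>k\<close> are b(1-t) = (1-t)b' and b'N = Nb; the minus sign in the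
  odd columns turns commuting squares into anticommuting ones.\<close>

lemma cc_anticommute:
 fixes B :: "('k::field, unit, 'b::ab_group_add) scat"
 assumes "x \<in> uchains (Suc q)"
 shows "cc_vert B k (Suc q) (cc_horiz (Suc k) (Suc q) x) + cc_horiz (Suc k) q (cc_vert B (Suc k) (Suc q) x) = 0"
proof -
 interpret t: Vector_Spaces.linear pscale pscale "cyc q" by (rule linear_cyc)
 show ?thesis
  using boundary_one_minus_cyc[OF assms, of B] boundary_cyc_norm[OF assms, of B]
  by (simp add: cc_vert_gboundary cc_horiz_def t.neg)
qed

lemma cc_horiz_horiz:
 fixes x :: "(unit, 'b, 'b) htuple \<Rightarrow>\<^sub>0 'k::field"
 assumes "x \<in> uchains q"
 shows "cc_horiz k q (cc_horiz (Suc k) q x) = 0"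
proof -
 interpret N: Vector_Spaces.linear pscale pscale "cyc_norm q" by (rule linear_cyc_norm)
 show ?thesis using cyc_norm_cyc[OF assms] by (simp add: cc_horiz_def N.diff)
qed

lemma composable_Cons: "composable X (x # w) Z \<longleftrightarrow> X = src x & composable (tgt x) w Z"
proof -
 have a: "(\<forall>k\<le>Suc n. P k) \<longleftrightarrow> P 0 & (\<forall>k\<le>n. P (Suc k))" for n P
  by (metis Suc_le_mono not0_implies_Suc le0)
 have "lo X (x # w) (Suc k) = lo (tgt x) w k" for k by (cases k) (simp_all add: lo_def)
 then show ?thesis by (simp add: composable_def matched_def a) (simp add: lo_def ro_def)
qed

lemma composable_Nil: "composable X [] Z \<longleftrightarrow> X = Z"
 by (simp add: composable_def matched_def lo_def ro_def)

lemma composable_snoc: "composable X (w @ [x]) Z \<longleftrightarrow> composable X w (src x) & tgt x = Z"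
 by (induction w arbitrary: X) (auto simp: composable_Cons composable_Nil)

lemma unit_arrows_Cons: "unit_arrows (z # ys) (p # al) = (fst p, munit z (ys ! 0) (snd p)) # unit_arrows ys al"
 by (simp add: unit_arrows_def upt_conv_Cons map_Suc_upt[symmetric] del: upt_Suc)

lemma unit_arrows_snoc: "length us = length bl ==>
  unit_arrows (us @ [y, z]) (bl @ [p]) = unit_arrows (us @ [y]) bl @ [(fst p, munit y z (snd p))]"
 by (auto simp: unit_arrows_def nth_append)

lemma degsum_unit_arrows: "degsum (unit_arrows ys al) = degsum al"
proof -
 have "map fst (unit_arrows ys al) = map fst al" by (intro nth_equalityI) (auto simp: unit_arrows_def)
 then show ?thesis by simp
qed

locale cyclic_comparison = chain_comparison A "std_bimod (superalgebra A)" "std_bimod A" munit "%X Y f. f X Y"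
 for A :: "('k::field, 'o, 'a::ab_group_add) scat"
begin

section \<open>Rotation and the inclusion\<close>

lemma incl_eq_cyc_incl: "incl = cyc_incl"
 by (simp add: incl_def cyc_incl_def)

lemma last_butlast_uls: "last (uls n) # butlast (uls n) = uls n"
 by (rule unit_list_eq) simp

lemma incl_cyc:
 assumes x: "x \<in> cnum A n i"
 shows "incl (cyc n x) = cyc n (incl x)"
proof -
 note C = linear_compose_pscale
 show ?thesis
 proof (rule linear_eq_on_keys[OF vs_pscale C[OF linear_cyc linear_incl] C[OF linear_incl linear_cyc]])
 interpret i: Vector_Spaces.linear pscale pscale incl by (rule linear_incl)
 fix g assume "g \<in> Poly_Mapping.keys x"
 then have g: "g \<in> hgens A (std_bimod A) n i" using x by (auto simp: hchains_def)
 obtain ys d m al where e: "g = (ys, (d, m), al)" by (metis prod.collapse)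
 have h: "ys \<in> obj_tuples A n" "al \<in> arrow_tuples A ys" using g unfolding e hgens_iff by simp_all
 have l: "length ys = Suc n" "length al = n" using h by (auto simp: obj_tuples_def arrow_tuples_def)
 show "incl (cyc n (basis g)) = cyc n (incl (basis g))"
 proof (cases al rule: rev_cases)
  case Nil
  then have n: "n = 0" using l by simp
  then obtain y where y: "ys = [y]" using l by (auto simp: length_Suc_conv)
  show ?thesis using h(1) incl_basis[OF h(1), of d m al]
   by (simp add: e Nil cyc_basis i.scale y n unit_arrows_def)
 next
  case (snoc bl c)
  obtain u cc where c: "c = (u, cc)" by (cases c)
  have "length ys = Suc (Suc (length bl))" using l snoc by simp
  then obtain us y z where ys: "ys = us @ [y, z]" "length us = length bl" by (rule split_last2)
  have o: "z # us @ [y] \<in> obj_tuples A n" using h(1) ys by (auto simp: obj_tuples_def)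
  have hd: "hd ys = (us @ [y]) ! 0" by (cases us) (simp_all add: ys)
  have la: "last ((d, m) # al) = (u, cc)" "butlast ((d, m) # al) = (d, m) # bl" "last ys # butlast ys = z # us @ [y]"
   by (simp_all add: snoc c ys butlast_append)
  have ua: "unit_arrows ys al = unit_arrows (us @ [y]) bl @ [(u, munit y z cc)]"
   unfolding ys(1) snoc c unit_arrows_snoc[OF ys(2)] by simp
  have lb: "last ((d, p) # unit_arrows ys al) = (u, munit y z cc)"
   "butlast ((d, p) # unit_arrows ys al) = (d, p) # unit_arrows (us @ [y]) bl" for p
   unfolding ua by simp_all
  have ds: "degsum ((d, p) # unit_arrows ys al) = degsum ((d, m) # al)" for p by (simp add: degsum_unit_arrows)
  have "incl (cyc n (basis g)) = pscale ((-1) ^ n * ksign (u * (degsum ((d, m) # al) + 1)))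
   (basis (uls n, (u, munit y z cc), (d, munit z (hd ys) m) # unit_arrows (us @ [y]) bl))"
   unfolding e cyc_basis la i.scale incl_basis[OF o] unit_arrows_Cons hd by simp
  also have "... = cyc n (incl (basis g))"
   unfolding e incl_basis[OF h(1)] cyc_basis lb ds last_butlast_uls using ys by simp
  finally show ?thesis .
 qed
 qed
qed

lemma cyc_homL_value:
 assumes "linfun f"
 shows "f (cyc n (basis (uls n, dm, xs))) =
  (-1) ^ n * ksign (fst (last (dm # xs)) * (degsum (dm # xs) + 1)) * f (basis (uls n, last (dm # xs), butlast (dm # xs)))"
proof -
 interpret f: Vector_Spaces.linear pscale "(*)" f by fact
 show ?thesis unfolding cyc_basis last_butlast_uls f.scale ..
qed

text \<open>Rotation turns the last entry into the coefficient and the coefficient into the first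
  entry. Linearity in one kind of slot is therefore obtained from linearity in the other.\<close>

lemma cyc_homL:
 assumes f: "f \<in> homL n j"
 shows "(%x. f (cyc n x)) \<in> homL n j"
proof -
 have lin: "linfun f" and F: "hml n j (%dm xs. f (basis (uls n, dm, xs)))"
  using f by (auto simp: homL_iff)
 let ?F = "%dm xs. f (basis (uls n, dm, xs))"
 have Fx: "Lmlin (*) n (?F (d, m))" if "m \<in> LM d" for d m using F that by (simp add: hml_def std_bimod_sel del: replicate_Suc)
 have Fm: "lin_on (Scale L) (*) (LM d) (%m. ?F (d, m) xs)" if "xs \<in> Ltup n" for d xs
  using F that by (simp add: hml_def std_bimod_sel del: replicate_Suc)
 have F0: "?F (d, m) xs = 0" if "m \<in> LM d" "xs \<in> Ltup n" "d + degsum xs ~= j" for d m xs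
  using F that by (simp add: hml_def std_bimod_sel del: replicate_Suc)
 have "hml n j (%dm xs. f (cyc n (basis (uls n, dm, xs))))"
 proof (cases n)
  case 0
  have k: "ksign (d * (d + 1)) = (1 :: 'k)" for d by (cases d) (simp_all add: ksign_def)
  have "f (cyc n (basis (uls n, (d, m), xs))) = ?F (d, m) xs" if "xs \<in> Ltup n" for d m xs
   using that 0 by (simp add: cyc_homL_value[OF lin] tup_def k del: replicate_Suc)
  then show ?thesis using F unfolding hml_def by (simp add: 0 mlin_def lin_on_def std_bimod_sel LM_closed del: replicate_Suc)
 next
  case (Suc k)
  have val: "f (cyc n (basis (uls n, (d, m), xs))) = (%x ys. (-1) ^ n *
    (ksign (fst x * (d + degsum ys + fst x + 1)) * ?F x ((d, m) # ys))) (last xs) (butlast xs)"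
   if len: "length xs = Suc k" for d m xs
  proof -
   obtain ys y where "xs = ys @ [y]" using len by (cases xs rule: rev_cases) auto
   then show ?thesis unfolding cyc_homL_value[OF lin] by (simp add: add.assoc butlast_append del: replicate_Suc)
  qed
  have lx: "length xs = Suc k" if "xs \<in> Ltup n" for xs :: "(bit * ('o => 'o => 'a)) list" using that Suc by (simp add: tup_def)
  have cons: "(d, m) # ys \<in> Ltup n" if "m \<in> LM d" "ys \<in> Ltup k" for d m ys
   using that Suc by (auto simp: tup_def nth_Cons')
  show ?thesis
   unfolding hml_def std_bimod_sel
  proof (intro conjI allI ballI impI)
   fix d
   show "Lmlin (*) n (%xs. f (cyc n (basis (uls n, (d, m), xs))))" if m: "m \<in> LM d" for m
    unfolding Suc
   proof (rule mlin_cong[OF _ refl val[unfolded Suc, symmetric]], rule mlin_last)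
    fix x :: "bit * ('o => 'o => 'a)" assume x: "snd x \<in> LM (fst x)"
    have Fc: "Lmlin (*) k (%ys. ?F x ((d, m) # ys))"
     using mlin_Cons[of "Scale L" "(*)" k "Mor L () ()" "?F x" "(d, m)"] Fx[OF x] m Suc by simp
    have "Lmlin (*) k (%ys. ksign (fst x * (d + degsum ys + fst x + 1)) * ?F x ((d, m) # ys))"
    proof (rule mlinI)
     fix xs l assume xs: "xs \<in> Ltup k" and l: "l < k"
     then have "l < length xs" by (simp add: tup_def)
     then show "lin_on (Scale L) (*) (LM (fst (xs ! l))) (%u. ksign (fst x * (d + degsum (xs[l := (fst (xs ! l), u)]) + fst x + 1)) *
       ?F x ((d, m) # xs[l := (fst (xs ! l), u)]))"
      unfolding degsum_update[OF \<open>l < length xs\<close>] by (intro lin_on_scale[OF vK] mlinD[OF Fc xs l refl])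
    qed
    then show "Lmlin (*) k (%ys. (-1) ^ Suc k * (ksign (fst x * (d + degsum ys + fst x + 1)) *
      f (basis (uls (Suc k), x, (d, m) # ys))))"
     unfolding Suc by (rule mlin_scale[OF vK])
   next
    fix i and ys :: "(bit * ('o => 'o => 'a)) list" assume ys: "ys \<in> Ltup k"
    show "lin_on (Scale L) (*) (LM i) (%x. (-1) ^ Suc k * (ksign (fst (i, x) * (d + degsum ys + fst (i, x) + 1)) *
      f (basis (uls (Suc k), (i, x), (d, m) # ys))))"
     unfolding fst_conv using Fm[OF cons[OF m ys], unfolded Suc] by (intro lin_on_scale[OF vK])
   qed
   fix xs assume xs: "xs \<in> Ltup n"
   note b = Ltup_butlast[OF xs[unfolded Suc]]
   have z: "0 \<in> LM d" using LM_closed by blast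
   have "Lmlin (*) (Suc k) (?F (last xs))" using Fx[of "snd (last xs)" "fst (last xs)"] b Suc by simp
   from mlin_head[OF this conjunct1[OF b] z]
   show "lin_on (Scale L) (*) (LM d) (%m. f (cyc n (basis (uls n, (d, m), xs))))"
    unfolding val[OF lx[OF xs]] by (intro lin_on_scale[OF vK])
   fix m assume m: "m \<in> LM d" and ne: "d + degsum xs ~= j"
   have "?F (fst (last xs), snd (last xs)) ((d, m) # butlast xs) = 0"
    using b m ne by (intro F0 cons) (auto simp: ac_simps)
   then show "f (cyc n (basis (uls n, (d, m), xs))) = 0" unfolding val[OF lx[OF xs]] by simp
  qed
 qed
 then show ?thesis
  unfolding homL_iff using linear_compose[OF vs_pscale vs_pscale vK linear_cyc lin] by blast
qed

text \<open>Coefficient and arrows form a closed cycle; a mismatch anywhere on it remains a mismatch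
  after rotation.\<close>

lemma cyc_NV:
 assumes f: "f \<in> homL n j" and nv: "NV n f"
 shows "NV n (%x. f (cyc n x))"
 unfolding NV_def
proof (intro ballI allI impI)
 note lin = hom_linear[OF f]
 fix X Z w d m assume *: "X \<in> Obj A" "Z \<in> Obj A" "set w <= arrows A" "length w = n" "~ composable X w Z" "m \<in> Bim (std_bimod A) Z X d"
 show "f (cyc n (basis (uls n, (d, munit Z X m), ul w))) = 0"
 proof (cases w rule: rev_cases)
  case Nil
  then have "f (basis (uls n, (d, munit Z X m), ul w)) = 0" using nv * by (simp add: NV_def del: replicate_Suc)
  then show ?thesis unfolding cyc_homL_value[OF lin] using Nil by (simp add: ul_def del: replicate_Suc)
 next
  case (snoc v x)
  \<comment> \<open>The rotated word: the old coefficient becomes its first arrow, and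
    \<open>x\<close>, the old last arrow, becomes the coefficient, so the new outer objects are
    \<open>tgt x\<close> and \<open>src x\<close>.\<close>
  let ?w = "((Z, X), (d, m)) # v"
  have x: "src x \<in> Obj A" "tgt x \<in> Obj A" "mor x \<in> Bim (std_bimod A) (src x) (tgt x) (deg x)"
   using *(3) snoc by (auto simp: arrows_def std_bimod_sel)
  have w: "set ?w <= arrows A" "length ?w = n" "~ composable (tgt x) ?w (src x)"
   using * snoc by (auto simp: arrows_def std_bimod_sel composable_Cons composable_snoc)
  have "f (basis (uls n, (deg x, um x), ul ?w)) = 0"
   using nv x w unfolding NV_def by blast
  then show ?thesis unfolding cyc_homL_value[OF lin] snoc by (simp add: ul_def butlast_append del: replicate_Suc)
 qed
qed

lemma cyc_norm_homL:
 assumes f: "f \<in> homL n j"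
 shows "(%x. f (cyc_norm n x)) \<in> homL n j" and "NV n f ==> NV n (%x. f (cyc_norm n x))"
proof -
 interpret f: Vector_Spaces.linear pscale "(*)" f by (rule hom_linear[OF f])
 have e: "(%x. f (cyc_norm n x)) = (%x. \<Sum>k\<le>n. f ((cyc n ^^ k) x))" by (simp add: cyc_norm_def f.sum)
 have p: "(%x. f ((cyc n ^^ k) x)) \<in> homL n j" for k
 proof (induction k)
  case (Suc k)
  from cyc_homL[OF this] show ?case by (simp add: funpow_swap1)
 qed (simp add: f)
 have "(%x. \<Sum>k\<le>l. f ((cyc n ^^ k) x)) \<in> homL n j" for l
 proof (induction l)
  case (Suc l)
  from homL_add[OF this p[of "Suc l"]] show ?case by simp
 qed (use f in simp)
 then show "(%x. f (cyc_norm n x)) \<in> homL n j" unfolding e .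
 assume nv: "NV n f"
 have q: "NV n (%x. f ((cyc n ^^ k) x))" for k
 proof (induction k)
  case (Suc k)
  from cyc_NV[OF p this] show ?case by (simp add: funpow_swap1)
 qed (simp add: nv)
 then show "NV n (%x. f (cyc_norm n x))" unfolding e by (simp add: NV_def del: replicate_Suc)
qed

lemma horiz_homL: "f \<in> homL q j ==> (%x. f (cc_horiz p q x)) \<in> homL q j"
 and horiz_NV: "f \<in> homL q j ==> NV q f ==> NV q (%x. f (cc_horiz p q x))"
proof -
 assume f: "f \<in> homL q j"
 interpret f: Vector_Spaces.linear pscale "(*)" f by (rule hom_linear[OF f])
 have e: "(%x. f (cc_horiz p q x)) = (if odd p then (%x. f x - f (cyc q x)) else (%x. f (cyc_norm q x)))"
  by (auto simp: cc_horiz_def f.diff)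
 show "(%x. f (cc_horiz p q x)) \<in> homL q j"
  unfolding e using homL_diff[OF f cyc_homL[OF f]] cyc_norm_homL(1)[OF f] by simp
 show "NV q f ==> NV q (%x. f (cc_horiz p q x))"
  unfolding e using NV_diff[OF _ cyc_NV[OF f]] cyc_norm_homL(2)[OF f] by simp
qed

lemma vert_homL: "f \<in> homL q j ==> (%x. f (cc_vert L p (Suc q) x)) \<in> homL (Suc q) j"
 and vert_NV: "f \<in> homL q j ==> NV q f ==> NV (Suc q) (%x. f (cc_vert L p (Suc q) x))"
proof -
 assume f: "f \<in> homL q j"
 interpret f: Vector_Spaces.linear pscale "(*)" f by (rule hom_linear[OF f])
 have e: "(%x. f (cc_vert L p (Suc q) x)) = (if even p then (%x. f (gbL True (Suc q) x)) else (%x. - f (gbL False (Suc q) x)))"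
  by (auto simp: cc_vert_gboundary f.neg)
 show "(%x. f (cc_vert L p (Suc q) x)) \<in> homL (Suc q) j"
  unfolding e using gboundary_homL[OF f] homL_uminus[OF gboundary_homL[OF f]] by simp
 show "NV q f ==> NV (Suc q) (%x. f (cc_vert L p (Suc q) x))"
  unfolding e using gboundary_NV[OF f] by (simp add: NV_def del: replicate_Suc)
qed

lemma vert_numL: "x \<in> cnum L (Suc q) i ==> cc_vert L p (Suc q) x \<in> cnum L q i"
 and vert_numA: "y \<in> cnum A (Suc q) i ==> cc_vert A p (Suc q) y \<in> cnum A q i"
proof -
 show "x \<in> cnum L (Suc q) i ==> cc_vert L p (Suc q) x \<in> cnum L q i"
  unfolding cc_vert_gboundary by (simp add: gbL_num num_uminus)
 show "y \<in> cnum A (Suc q) i ==> cc_vert A p (Suc q) y \<in> cnum A q i"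
  unfolding cc_vert_gboundary by (simp add: gbA_num num_uminus)
qed

lemma incl_vert: "x \<in> cnum A (Suc q) i ==> incl (cc_vert A p (Suc q) x) = cc_vert L p (Suc q) (incl x)"
proof -
 interpret i: Vector_Spaces.linear pscale pscale incl by (rule linear_incl)
 show "x \<in> cnum A (Suc q) i ==> incl (cc_vert A p (Suc q) x) = cc_vert L p (Suc q) (incl x)"
  unfolding cc_vert_gboundary by (simp add: i.neg incl_gboundary)
qed

lemma incl_horiz: assumes "x \<in> cnum A q i" shows "incl (cc_horiz p q x) = cc_horiz p q (incl x)"
proof -
 interpret i: Vector_Spaces.linear pscale pscale incl by (rule linear_incl)
 have "(cyc q ^^ k) x \<in> cnum A q i & incl ((cyc q ^^ k) x) = (cyc q ^^ k) (incl x)" for k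
 proof (induction k)
  case (Suc k)
  then show ?case using incl_cyc[of "(cyc q ^^ k) x" q i] by (simp add: cyc_num)
 qed (simp add: assms)
 then show ?thesis by (simp add: cc_horiz_def i.diff incl_cyc[OF assms] cyc_norm_def i.sum)
qed

lemma vert_exact:
 assumes f: "f \<in> homL n j"
  and df: "!!i x. x \<in> cnum L (Suc n) i ==> f (cc_vert L p (Suc n) x) = 0"
  and fA: "!!i x. x \<in> cnum A n i ==> f (incl x) = 0"
 shows "n = 0 ==> x \<in> cnum L n i ==> f x = 0"
  and "n = Suc k ==> \<exists>h\<in>homL k j. (\<forall>i. \<forall>x\<in>cnum L n i. f x = h (cc_vert L p n x)) &
   (\<forall>i. \<forall>x\<in>cnum A k i. h (incl x) = 0)"
proof -
 interpret f: Vector_Spaces.linear pscale "(*)" f by (rule hom_linear[OF f])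
 have d: "f (gbL (even p) (Suc n) x) = 0" if "x \<in> cnum L (Suc n) i" for i x
  using df[OF that] by (cases "even p") (simp_all add: cc_vert_gboundary f.neg)
 show "n = 0 ==> x \<in> cnum L n i ==> f x = 0"
  by (rule column_exact(1)[OF f d fA])
 assume n: "n = Suc k"
 have "\<exists>h\<in>homL k j. (\<forall>i. \<forall>x\<in>cnum L n i. f x = h (gbL (even p) n x)) &
   (\<forall>i. \<forall>x\<in>cnum A k i. h (incl x) = 0)"
  by (rule column_exact(2)[OF f _ _ n]) (erule d fA)+
 then obtain h where h: "h \<in> homL k j" "!!i x. x \<in> cnum L n i ==> f x = h (gbL (even p) n x)"
  "!!i x. x \<in> cnum A k i ==> h (incl x) = 0" by blast
 interpret h: Vector_Spaces.linear pscale "(*)" h by (rule hom_linear[OF h(1)])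
 \<comment> \<open>Absorbs the sign of the vertical differential in odd columns.\<close>
 let ?h = "if even p then h else (%x. - h x)"
 have "?h \<in> homL k j" using h(1) homL_uminus[OF h(1)] by simp
 moreover have "\<forall>i. \<forall>x\<in>cnum L n i. f x = ?h (cc_vert L p n x)"
  using h(2) by (simp add: cc_vert_gboundary h.neg)
 moreover have "\<forall>i. \<forall>x\<in>cnum A k i. ?h (incl x) = 0" using h(3) by simp
 ultimately show "\<exists>h\<in>homL k j. (\<forall>i. \<forall>x\<in>cnum L n i. f x = h (cc_vert L p n x)) &
   (\<forall>i. \<forall>x\<in>cnum A k i. h (incl x) = 0)" by blast
qed

end

section \<open>Cyclic cohomology\<close>

text \<open>The differential of \<open>K\<close> in degree \<open>n - 1\<close>, which is \<open>0\<close> for \<open>n = 0\<close>.\<close>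

definition tcob :: "('k::field, 'o, 'a::ab_group_add) scat => nat
  => (nat => (('o, 'a, 'a) htuple \<Rightarrow>\<^sub>0 'k) => 'k) => nat => (('o, 'a, 'a) htuple \<Rightarrow>\<^sub>0 'k) => 'k" where
 "tcob B n K p x = (if p < n then K p (cc_vert B p (n - p) x) else 0) +
   (if 0 < p then K (p - 1) (cc_horiz p (n - p) x) else 0)"

abbreviation "cfun B n j \<equiv> num (hom_sspace (cchains B n) (*) ground) j"

lemma tot_coboundary_tcob: "p <= Suc m ==> tot_coboundary B m K p x = tcob B (Suc m) K p x"
 by (auto simp: tot_coboundary_def tcob_def)

lemma tot_coboundary_outside: "p > Suc m ==> tot_coboundary B m K p = 0"
 by (simp add: tot_coboundary_def)

lemma tcob_linear:
 assumes "!!q. q < n ==> linfun (K q)" "p <= n"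
 shows "linfun (%x. tcob B n K p x)"
proof -
 note C = linear_compose[OF vs_pscale vs_pscale vector_space_mult]
 have z: "linfun (%x. 0)" by (simp add: linear_iff[OF vs_pscale vector_space_mult])
 have "linfun (%x. if p < n then K p (cc_vert B p (n - p) x) else 0)"
  using C[OF linear_cc_vert assms(1)[of p]] z by (cases "p < n") simp_all
 moreover have "linfun (%x. if 0 < p then K (p - 1) (cc_horiz p (n - p) x) else 0)"
  using C[OF linear_cc_horiz assms(1)[of "p - 1"]] z assms(2) by (cases "0 < p") simp_all
 ultimately show ?thesis
  unfolding tcob_def linear_iff[OF vs_pscale vector_space_mult] by (simp add: distrib_left)
qed

lemma num_tot_cochains: "f \<in> num (tot_cochains B n) j \<longleftrightarrow> (\<forall>p\<le>n. f p \<in> cfun B (n - p) j) & (\<forall>p>n. f p = 0)"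
 by (auto simp: tot_cochains_def prod_sspace_def)

lemma den_tot_cochains: "f \<in> den (tot_cochains B n) j \<longleftrightarrow> (\<forall>p\<le>n. linfun (f p) &
  (\<forall>i. \<forall>x\<in>cnum B (n - p) i. f p x = 0)) & (\<forall>p>n. f p = 0)"
proof -
 have "scl (cchains B q) = pscale" for q by (simp add: hchains_def)
 then show ?thesis by (auto simp: tot_cochains_def prod_sspace_def hom_sspace_def image_subset_iff)
qed

lemma num_HC_coh: "f \<in> num (HC_coh B n) j \<longleftrightarrow> f \<in> num (tot_cochains B n) j &
  (\<forall>p\<le>Suc n. \<forall>i. \<forall>x\<in>cnum B (Suc n - p) i. tcob B (Suc n) f p x = 0)"
proof -
 have "tot_coboundary B n f \<in> den (tot_cochains B (Suc n)) j \<longleftrightarrow>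
  (\<forall>p\<le>Suc n. \<forall>i. \<forall>x\<in>cnum B (Suc n - p) i. tcob B (Suc n) f p x = 0)"
  if "f \<in> num (tot_cochains B n) j"
 proof -
  have "linfun (%x. tcob B (Suc n) f p x)" if "p <= Suc n" for p
  proof (rule tcob_linear[OF _ that])
   fix q assume "q < Suc n"
   then show "linfun (f q)"
    using \<open>f \<in> _\<close> hom_linear[of "f q" B "std_bimod B" "n - q" j] by (simp add: num_tot_cochains)
  qed
  moreover have "tot_coboundary B n f p = (%x. tcob B (Suc n) f p x)" if "p <= Suc n" for p
   by (rule ext) (rule tot_coboundary_tcob[OF that])
  ultimately show ?thesis unfolding den_tot_cochains by (auto simp: tot_coboundary_outside)
 qed
 then show ?thesis by (auto simp: HC_coh_def cohomology_def)
qed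

text \<open>\<open>tcob\<close> looks at \<open>K\<close> only in the components
  \<open>p < n\<close>, so \<open>K\<close> can be cut off to a total cochain. For
  \<open>n = 0\<close> there are no such components and \<open>tcob\<close> is 0, which gives the
  same form in every degree.\<close>

lemma den_HC_coh: "f \<in> den (HC_coh B n) j \<longleftrightarrow> (\<forall>p\<le>n. linfun (f p)) & (\<forall>p>n. f p = 0) &
  (\<exists>K. (\<forall>p<n. K p \<in> cfun B (n - Suc p) j) &
   (\<forall>p\<le>n. \<forall>i. \<forall>x\<in>cnum B (n - p) i. f p x = tcob B n K p x))" (is "?l \<longleftrightarrow> ?r")
proof (cases n)
 case 0
 then show ?thesis by (simp add: HC_coh_def cohomology_def den_tot_cochains tcob_def) blast
next
 case (Suc m)
 have l: "?l \<longleftrightarrow> (\<exists>g\<in>num (tot_cochains B m) j. f - tot_coboundary B m g \<in> den (tot_cochains B n) j)"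
 proof
  assume ?l
  then obtain g e where "g \<in> num (tot_cochains B m) j" "e \<in> den (tot_cochains B n) j" "f = tot_coboundary B m g + e"
   by (auto simp: HC_coh_def cohomology_def Suc set_plus_def)
  then show "\<exists>g\<in>num (tot_cochains B m) j. f - tot_coboundary B m g \<in> den (tot_cochains B n) j"
   by (intro bexI[of _ g]) simp_all
 next
  assume "\<exists>g\<in>num (tot_cochains B m) j. f - tot_coboundary B m g \<in> den (tot_cochains B n) j"
  then obtain g where g: "g \<in> num (tot_cochains B m) j" "f - tot_coboundary B m g \<in> den (tot_cochains B n) j" by blast
  have "tot_coboundary B m g + (f - tot_coboundary B m g) \<in> tot_coboundary B m ` num (tot_cochains B m) j + den (tot_cochains B n) j"
   using g by (intro set_plus_intro imageI)
  then show ?l by (simp add: HC_coh_def cohomology_def Suc)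
 qed
 have lg: "linfun (tot_coboundary B m g p)" if "g \<in> num (tot_cochains B m) j" "p <= n" for g p
 proof -
  have "linfun (%x. tcob B (Suc m) g p x)"
  proof (rule tcob_linear)
   fix q assume "q < Suc m"
   then show "linfun (g q)"
    using that(1) hom_linear[of "g q" B "std_bimod B" "m - q" j] by (simp add: num_tot_cochains)
  qed (use that Suc in simp)
  moreover have "tot_coboundary B m g p = (%x. tcob B (Suc m) g p x)"
   using that Suc by (simp add: fun_eq_iff tot_coboundary_tcob)
  ultimately show ?thesis by simp
 qed
 have d: "f - tot_coboundary B m g \<in> den (tot_cochains B n) j \<longleftrightarrow> (\<forall>p\<le>n. linfun (f p)) &
   (\<forall>p>n. f p = 0) & (\<forall>p\<le>n. \<forall>i. \<forall>x\<in>cnum B (n - p) i. f p x = tcob B n g p x)"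
  if g: "g \<in> num (tot_cochains B m) j" for g
 proof -
  have a: "linfun (f p - tot_coboundary B m g p) \<longleftrightarrow> linfun (f p)"
   if "p <= n" for p
   using lg[OF g that] unfolding linear_iff[OF vs_pscale vector_space_mult]
   by (simp add: algebra_simps)
  have b: "tot_coboundary B m g p x = tcob B n g p x" if "p <= n" for p x
   using that Suc by (simp add: tot_coboundary_tcob)
  have c: "tot_coboundary B m g p = 0" if "p > n" for p using that Suc by (simp add: tot_coboundary_outside)
  show ?thesis unfolding den_tot_cochains by (auto simp: a b c)
 qed
 show ?thesis
 proof
  assume ?l
  then obtain g where g: "g \<in> num (tot_cochains B m) j" "f - tot_coboundary B m g \<in> den (tot_cochains B n) j" unfolding l by blast
  have "\<forall>p<n. g p \<in> cfun B (n - Suc p) j" using g(1) Suc by (simp add: num_tot_cochains)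
  then show ?r using g(2) unfolding d[OF g(1)] by blast
 next
  assume r: ?r
  then obtain K where K: "\<forall>p<n. K p \<in> cfun B (n - Suc p) j"
   "\<forall>p\<le>n. \<forall>i. \<forall>x\<in>cnum B (n - p) i. f p x = tcob B n K p x" by blast
  let ?g = "%p. if p < n then K p else 0"
  have g: "?g \<in> num (tot_cochains B m) j" using K(1) Suc by (simp add: num_tot_cochains)
  have "tcob B n ?g p x = tcob B n K p x" if "p <= n" for p x using that Suc by (auto simp: tcob_def)
  then have "f - tot_coboundary B m ?g \<in> den (tot_cochains B n) j" unfolding d[OF g] using r K(2) by simp
  then show ?l unfolding l using g by blast
 qed
qed

lemma HC_coh_subspaces:
 "subspc (%c f p x. c * f p x) (num (HC_coh B n) i)" "subspc (%c f p x. c * f p x) (den (HC_coh B n) i)"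
proof -
 have W: "subspc (*) (ground i)" for i by (simp add: subspace_iff[OF vector_space_mult] ground_def)
 have t: "vector_space (scl (cchains B q))" for q by (simp add: hchains_def vs_pscale)
 note vf = vector_space_fun[OF vector_space_mult]
 have N: "subspc (%c f p x. c * f p x) (num (tot_cochains B n) i)" for n i
  unfolding tot_cochains_def
  by (rule prod_subspaces(1)[OF vf]) (rule hom_subspaces[OF t vector_space_mult W])+
 have D: "subspc (%c f p x. c * f p x) (den (tot_cochains B n) i)" for n i
  unfolding tot_cochains_def
  by (rule prod_subspaces(2)[OF vf]) (rule hom_subspaces[OF t vector_space_mult W])+
 have z: "0 \<in> den (tot_cochains B n) i" for n i
  using D[of n i] unfolding subspace_iff[OF vector_space_fun[OF vf]] by blast
 have s: "scl (tot_cochains B n) = (%c f p x. c * f p x)" for n by (simp add: tot_cochains_def prod_sspace_def)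
 have 0: "tot_coboundary B n (f + g) - (tot_coboundary B n f + tot_coboundary B n g) = 0"
  "tot_coboundary B n (%p x. c * f p x) - (%p x. c * tot_coboundary B n f p x) = 0"
  "tot_coboundary B n 0 = 0" for n f g c
  by (auto simp: fun_eq_iff tot_coboundary_def algebra_simps)
 show "subspc (%c f p x. c * f p x) (num (HC_coh B n) i)" "subspc (%c f p x. c * f p x) (den (HC_coh B n) i)"
  unfolding HC_coh_def by (rule cohomology_subspaces[OF vector_space_fun[OF vf] s N D]; simp only: 0 z)+
qed

lemma scl_HC_coh: "scl (HC_coh B n) = (%c f p x. c * f p x)"
 by (simp add: HC_coh_def cohomology_def tot_cochains_def prod_sspace_def)

context cyclic_comparison
begin

section \<open>Exactness of the dual total complex\<close>

lemma tcob_homL: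
 assumes K: "!!q. q < n ==> K q \<in> homL (n - Suc q) j" and p: "p <= n"
 shows "(%x. tcob L n K p x) \<in> homL (n - p) j"
  and "(!!q. q < n ==> NV (n - Suc q) (K q)) ==> NV (n - p) (%x. tcob L n K p x)"
proof -
 have v: "n - p = Suc (n - Suc p)" if "p < n" using that by simp
 have h: "n - Suc (p - 1) = n - p" if "0 < p" using that by simp
 have 1: "(%x. if p < n then K p (cc_vert L p (n - p) x) else 0) \<in> homL (n - p) j"
 proof (cases "p < n")
  case True
  then show ?thesis using vert_homL[OF K[OF True], of p] unfolding v[OF True, symmetric] by simp
 qed (simp add: homL_zero)
 have 2: "(%x. if 0 < p then K (p - 1) (cc_horiz p (n - p) x) else 0) \<in> homL (n - p) j"
 proof (cases "0 < p")
  case True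
  then show ?thesis using horiz_homL[OF K[of "p - 1"], of p] p unfolding h[OF True] by simp
 qed (simp add: homL_zero)
 show "(%x. tcob L n K p x) \<in> homL (n - p) j" unfolding tcob_def by (rule homL_add[OF 1 2])
 assume nv: "!!q. q < n ==> NV (n - Suc q) (K q)"
 have "NV (n - p) (%x. if p < n then K p (cc_vert L p (n - p) x) else 0)"
 proof (cases "p < n")
  case True
  then show ?thesis using vert_NV[OF K[OF True] nv[OF True], of p] unfolding v[OF True, symmetric] by simp
 qed (simp add: NV_def)
 moreover have "NV (n - p) (%x. if 0 < p then K (p - 1) (cc_horiz p (n - p) x) else 0)"
 proof (cases "0 < p")
  case True
  then show ?thesis using horiz_NV[OF K[of "p - 1"] nv[of "p - 1"], of p] p unfolding h[OF True] by simp
 qed (simp add: NV_def)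
 ultimately show "NV (n - p) (%x. tcob L n K p x)" unfolding tcob_def by (rule NV_add)
qed

lemma tcob_incl:
 assumes x: "x \<in> cnum A (n - p) i" and p: "p <= n"
 shows "tcob L n K p (incl x) = tcob A n (%p x. K p (incl x)) p x"
proof -
 have v: "cc_vert L p (n - p) (incl x) = incl (cc_vert A p (n - p) x)" if "p < n"
  using incl_vert[of x "n - Suc p" i p] x that by (simp add: Suc_diff_Suc)
 show ?thesis
  unfolding tcob_def by (intro arg_cong2[where f = plus] if_cong refl) (simp_all only: v incl_horiz[OF x])
qed

lemma tcob_cong_num:
 assumes vn: "!!q p i x. x \<in> cnum B (Suc q) i ==> cc_vert B p (Suc q) x \<in> cnum B q i"
  and K: "!!q i x. q < n ==> x \<in> cnum B (n - Suc q) i ==> K q x = K' q x"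
  and p: "p <= n" and x: "x \<in> cnum B (n - p) i"
 shows "tcob B n K p x = tcob B n K' p x"
proof -
 have v: "K p (cc_vert B p (n - p) x) = K' p (cc_vert B p (n - p) x)" if "p < n"
  using K[OF that vn[of x "n - Suc p" i p]] x that by (simp add: Suc_diff_Suc)
 have h: "K (p - 1) (cc_horiz p (n - p) x) = K' (p - 1) (cc_horiz p (n - p) x)" if "0 < p"
  using K[of "p - 1", OF _ cc_horiz_num[of x]] x p that by simp
 show ?thesis
  unfolding tcob_def by (intro arg_cong2[where f = plus] if_cong refl) (simp_all only: v h)
qed

lemma NV_zero: "NV n (%_. 0)"
 by (simp add: NV_def)

text \<open>\<open>F\<close> vanishes on the image of the inclusion and in the columns before
  \<open>k\<close>. The induction runs downwards from \<open>k = Suc n\<close>, where nothing is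
  left. The part of \<open>F\<close> in column \<open>k\<close> is a cocycle of that column, and a
  vertical primitive moves the problem to the next column.\<close>

lemma tot_kernel:
 assumes "k <= Suc n"
  and "!!p. p <= n ==> F p \<in> homL (n - p) j"
  and "!!p i x. p <= Suc n ==> x \<in> cnum L (Suc n - p) i ==> tcob L (Suc n) F p x = 0"
  and "!!p i x. p <= n ==> x \<in> cnum A (n - p) i ==> F p (incl x) = 0"
  and "!!p i x. p < k ==> p <= n ==> x \<in> cnum L (n - p) i ==> F p x = 0"
 shows "\<exists>K. (\<forall>p<n. K p \<in> homL (n - Suc p) j) &
  (\<forall>p\<le>n. \<forall>i. \<forall>x\<in>cnum L (n - p) i. F p x = tcob L n K p x)"
 using assms
proof (induction k arbitrary: F rule: inc_induct)
 case base
 have "F p x = tcob L n (%_ _. 0) p x" if "p <= n" "x \<in> cnum L (n - p) i" for p i x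
  using base.prems(4)[of p x i] that by (simp add: tcob_def)
 then show ?case using homL_zero by (intro exI[of _ "%_ _. 0"]) blast
next
 case (step k)
 note hom = step.prems(1) and coc = step.prems(2) and inc = step.prems(3) and zero = step.prems(4)
 have kn: "k <= n" using step.hyps by simp
 interpret Fk: Vector_Spaces.linear pscale "(*)" "F k" by (rule hom_linear[OF hom[OF kn]])
 \<comment> \<open>Column \<open>k - 1\<close> of \<open>F\<close> vanishes, so only the vertical
   term is left in component \<open>k\<close> of the cocycle condition.\<close>
 have dv: "F k (cc_vert L k (Suc (n - k)) x) = 0" if x: "x \<in> num (cchains L (Suc (n - k))) i" for i x
 proof -
  have e: "Suc n - k = Suc (n - k)" using kn by simp
  have "F (k - 1) (cc_horiz k (Suc n - k) x) = 0" if "0 < k"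
  proof (rule zero)
   have "n - (k - 1) = Suc n - k" using that by simp
   then show "cc_horiz k (Suc n - k) x \<in> num (cchains L (n - (k - 1))) i"
    using cc_horiz_num[OF x] e by simp
  qed (use that kn in auto)
  moreover have "tcob L (Suc n) F k x = 0" using coc[of k x i] x kn e by simp
  ultimately show ?thesis using kn e by (simp add: tcob_def split: if_splits)
 qed
 note vex = vert_exact[OF hom[OF kn], of k, OF dv inc[OF kn]]
 show ?case
 proof (cases "n - k")
  \<comment> \<open>Row 0 of the bicomplex: exactness of the column gives vanishing of
    \<open>F k\<close> directly, without a primitive.\<close>
  case 0
  have "F k x = 0" if "x \<in> cnum L (n - k) i" for i x using vert_exact(1)[OF hom[OF kn] dv inc[OF kn] 0 that] .
  then have "F p x = 0" if "p < Suc k" "p <= n" "x \<in> cnum L (n - p) i" for p i x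
   using that zero[of p x i] by (cases "p = k") auto
  then show ?thesis by (intro step.IH hom coc inc) auto
 next
  case (Suc r)
  have "\<exists>h\<in>homL r j. (\<forall>i. \<forall>x\<in>cnum L (n - k) i. F k x = h (cc_vert L k (n - k) x)) &
   (\<forall>i. \<forall>x\<in>cnum A r i. h (incl x) = 0)"
   by (rule vert_exact(2)[OF hom[OF kn] _ _ Suc]) (erule dv inc[OF kn])+
  then obtain h where h: "h \<in> homL r j" "!!i x. x \<in> cnum L (n - k) i ==> F k x = h (cc_vert L k (Suc r) x)"
   "!!i x. x \<in> cnum A r i ==> h (incl x) = 0" unfolding Suc by blast
  interpret h: Vector_Spaces.linear pscale "(*)" h by (rule hom_linear[OF h(1)])
  have ar: "n - Suc k = r" "k < n" "Suc n - Suc k = Suc r" "Suc n - Suc (Suc k) = r" using Suc by auto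
  \<comment> \<open>Subtracts the total coboundary of \<open>h\<close> placed in column
    \<open>k\<close>, which has components in the columns \<open>k\<close> and \<open>Suc k\<close>.
    Since \<open>h\<close> vanishes on the image of the inclusion, so do both corrections.\<close>
  define F' where "F' = (%p. if p = k then (%x. F k x - h (cc_vert L k (Suc r) x))
   else if p = Suc k then (%x. F (Suc k) x - h (cc_horiz (Suc k) r x)) else F p)"
  have hom': "F' p \<in> homL (n - p) j" if "p <= n" for p
   using hom[OF that] homL_diff[OF hom[OF kn], of "%x. h (cc_vert L k (Suc r) x)"] vert_homL[OF h(1), of k]
    homL_diff[of "F (Suc k)" r j "%x. h (cc_horiz (Suc k) r x)"] horiz_homL[OF h(1), of "Suc k"] Suc ar
   by (auto simp: F'_def)
  have zero': "F' p x = 0" if "p < Suc k" "p <= n" "x \<in> cnum L (n - p) i" for p i x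
   using that zero[of p x i] h(2)[of x i] by (cases "p = k") (auto simp: F'_def)
  have inc': "F' p (incl x) = 0" if "p <= n" "x \<in> cnum A (n - p) i" for p i x
  proof -
   have "h (cc_vert L k (Suc r) (incl x)) = 0" if "p = k"
   proof -
    have x: "x \<in> cnum A (Suc r) i" using \<open>x \<in> _\<close> that Suc by simp
    show ?thesis unfolding incl_vert[OF x, symmetric] by (rule h(3)[OF vert_numA[OF x]])
   qed
   moreover have "h (cc_horiz (Suc k) r (incl x)) = 0" if "p = Suc k"
   proof -
    have x: "x \<in> cnum A r i" using \<open>x \<in> _\<close> that ar by simp
    show ?thesis unfolding incl_horiz[OF x, symmetric] by (rule h(3)[OF cc_horiz_num[OF x]])
   qed
   ultimately show ?thesis using inc[OF that] by (auto simp: F'_def)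
  qed
  have coc': "tcob L (Suc n) F' p x = 0" if p: "p <= Suc n" and x: "x \<in> cnum L (Suc n - p) i" for p i x
  proof -
   consider "p <= k" | "p = Suc k" | "p = Suc (Suc k)" | "Suc (Suc k) < p" by linarith
   then show ?thesis
   proof cases
    case 1
    have p1: "p - 1 <= k" using 1 by simp
    have "tcob L (Suc n) F' p x = tcob L (Suc n) (%q. if q <= k then (%_. 0) else F' q) p x"
     by (rule tcob_cong_num[OF vert_numL _ p x]) (auto intro: zero')
    also have "... = 0" unfolding tcob_def by (simp only: 1 p1 if_True) simp
    finally show ?thesis .
   next
    \<comment> \<open>The correction in column \<open>Suc k\<close> cancels because the squares of
      the bicomplex anticommute.\<close>
    case 2
    have x: "x \<in> cnum L (Suc r) i" using x 2 ar by simp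
    have v: "F' k (cc_horiz (Suc k) (Suc r) x) = 0"
     using zero'[of k "cc_horiz (Suc k) (Suc r) x" i] kn cc_horiz_num[OF x] Suc by simp
    have F: "F (Suc k) (cc_vert L (Suc k) (Suc r) x) + F k (cc_horiz (Suc k) (Suc r) x) = 0"
     using coc[of "Suc k" x i] x ar by (simp add: tcob_def)
    have "h (cc_vert L k (Suc r) (cc_horiz (Suc k) (Suc r) x)) + h (cc_horiz (Suc k) r (cc_vert L (Suc k) (Suc r) x)) = 0"
     unfolding h.add[symmetric] cc_anticommute[OF num_uchains[OF x]] by simp
    moreover have "F k (cc_horiz (Suc k) (Suc r) x) = h (cc_vert L k (Suc r) (cc_horiz (Suc k) (Suc r) x))"
     by (rule h(2)) (use cc_horiz_num[OF x] Suc in simp)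
    ultimately have "F (Suc k) (cc_vert L (Suc k) (Suc r) x) - h (cc_horiz (Suc k) r (cc_vert L (Suc k) (Suc r) x)) = 0"
     using F by (simp add: eq_neg_iff_add_eq_0[symmetric])
    then show ?thesis using v ar 2 by (simp add: tcob_def F'_def)
   next
    \<comment> \<open>The correction enters through two consecutive horizontal maps, whose composite
      is 0.\<close>
    case 3
    have x': "x \<in> cnum L r i" using x 3 ar by simp
    have "h (cc_horiz (Suc k) r (cc_horiz (Suc (Suc k)) r x)) = 0"
     unfolding cc_horiz_horiz[OF num_uchains[OF x']] by (rule h.zero)
    then have "tcob L (Suc n) F' p x = tcob L (Suc n) F p x" using 3 ar by (simp add: tcob_def F'_def)
    then show ?thesis using coc[OF p x] by simp
   next
    case 4
    then have "p ~= k" "p ~= Suc k" "p - Suc 0 ~= k" "p - Suc 0 ~= Suc k" by auto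
    then have "tcob L (Suc n) F' p x = tcob L (Suc n) F p x" by (simp add: tcob_def F'_def)
    then show ?thesis using coc[OF p x] by simp
   qed
  qed
  have "\<exists>K. (\<forall>p<n. K p \<in> homL (n - Suc p) j) &
   (\<forall>p\<le>n. \<forall>i. \<forall>x\<in>cnum L (n - p) i. F' p x = tcob L n K p x)"
   by (rule step.IH[of F', OF hom' coc' inc' zero']) assumption+
  then obtain K where K0: "\<forall>p<n. K p \<in> homL (n - Suc p) j"
   and K1: "\<forall>p\<le>n. \<forall>i. \<forall>x\<in>cnum L (n - p) i. F' p x = tcob L n K p x" by (elim exE conjE)
  note K = K0[rule_format] K1[rule_format]
  define K' where "K' = (%p. if p = k then (%x. K k x + h x) else K p)"
  have "\<forall>p<n. K' p \<in> homL (n - Suc p) j"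
   using K(1) homL_add[OF K(1)[OF ar(2)], of h] h(1) ar(1) by (simp add: K'_def)
  moreover have "F p x = tcob L n K' p x" if "p <= n" "x \<in> cnum L (n - p) i" for p i x
  proof -
   have "F p x = F' p x + (if p = k then h (cc_vert L k (Suc r) x) else if p = Suc k then h (cc_horiz (Suc k) r x) else 0)"
    by (simp add: F'_def)
   also have "... = tcob L n K' p x" unfolding K(2)[OF that] using ar Suc by (auto simp: tcob_def K'_def)
   finally show ?thesis .
  qed
  ultimately show ?thesis by blast
 qed
qed

lemma lift_family:
 assumes "!!p. p < n ==> G p \<in> homA (m p) j"
 obtains F where "!!p. p < n ==> F p \<in> homL (m p) j" "!!p. p < n ==> NV (m p) (F p)"
  "!!p i x. p < n ==> x \<in> cnum A (m p) i ==> F p (incl x) = G p x"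
proof -
 let ?P = "%p f. f \<in> homL (m p) j & NV (m p) f & (\<forall>i. \<forall>x\<in>cnum A (m p) i. f (incl x) = G p x)"
 define F where "F = (%p. SOME f. ?P p f)"
 have F: "?P p (F p)" if p: "p < n" for p
 proof -
  obtain f where "f \<in> homL (m p) j" "NV (m p) f" "!!i x. x \<in> cnum A (m p) i ==> f (incl x) = G p x"
   using lift_homL[OF assms[OF p]] by blast
  then have "?P p f" by blast
  then show ?thesis unfolding F_def by (rule someI[where P = "?P p"])
 qed
 show thesis by (rule that[of F]) (use F in blast)+
qed

text \<open>Both sides vanish on the non-composable words and agree on the image of the inclusion,
  so uniqueness of lifts applies.\<close>

lemma lift_coboundary:
 assumes F: "!!p. p < n ==> F p \<in> homL (n - Suc p) j" "!!p. p < n ==> NV (n - Suc p) (F p)"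
   "!!p i x. p < n ==> x \<in> cnum A (n - Suc p) i ==> F p (incl x) = G p x"
  and H: "H \<in> homL (n - p) j" "NV (n - p) H" and p: "p <= n"
  and eq: "!!i x. x \<in> cnum A (n - p) i ==> H (incl x) = tcob A n G p x"
  and x: "x \<in> cnum L (n - p) i"
 shows "H x = tcob L n F p x"
proof -
 have "H x - tcob L n F p x = 0"
 proof (rule zero_unique[OF homL_diff[OF H(1) tcob_homL(1)[OF F(1) p]] NV_diff[OF H(2) tcob_homL(2)[OF F(1) p F(2)]] _ x])
  fix i x assume x: "x \<in> cnum A (n - p) i"
  have "tcob L n F p (incl x) = tcob A n (%p x. F p (incl x)) p x" by (rule tcob_incl[OF x p])
  also have "... = tcob A n G p x" by (rule tcob_cong_num[OF vert_numA F(3) p x])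
  finally show "H (incl x) - tcob L n F p (incl x) = 0" using eq[OF x] by simp
 qed
 then show ?thesis by simp
qed

lemma lift_cocycle:
 assumes G: "!!p. p <= n ==> G p \<in> homA (n - p) j"
  and cG: "!!p i x. p <= Suc n ==> x \<in> cnum A (Suc n - p) i ==> tcob A (Suc n) G p x = 0"
 obtains F where "!!p. p <= n ==> F p \<in> homL (n - p) j" "!!p. p <= n ==> NV (n - p) (F p)"
  "!!p i x. p <= n ==> x \<in> cnum A (n - p) i ==> F p (incl x) = G p x"
  "!!p i x. p <= Suc n ==> x \<in> cnum L (Suc n - p) i ==> tcob L (Suc n) F p x = 0"
proof -
 have G': "G p \<in> homA (n - p) j" if "p < Suc n" for p using G[of p] that by simp
 obtain F where F: "!!p. p < Suc n ==> F p \<in> homL (n - p) j" "!!p. p < Suc n ==> NV (n - p) (F p)"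
  "!!p i x. p < Suc n ==> x \<in> cnum A (n - p) i ==> F p (incl x) = G p x"
  by (rule lift_family[where n = "Suc n" and m = "%p. n - p" and G = G and j = j, OF G']) (assumption | blast)+
 have "tcob L (Suc n) F p x = 0" if p: "p <= Suc n" and x: "x \<in> cnum L (Suc n - p) i" for p i x
  by (rule lift_coboundary[where H = "%_. 0" and n = "Suc n" and F = F and G = G and j = j, OF _ _ _ homL_zero NV_zero p _ x, symmetric])
   (simp_all add: F cG[OF p])
 then show thesis using that[of F] F by simp
qed

text \<open>\<open>F\<close> is split into the lift \<open>P\<close> of its restriction and a
  remainder. By uniqueness of lifts \<open>P\<close> is the coboundary of the lift of
  \<open>G\<close>; the remainder vanishes on the image of the inclusion, where
  \<open>tot_kernel\<close> applies.\<close>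

lemma tot_injective:
 assumes F: "!!p. p <= n ==> F p \<in> homL (n - p) j"
  and cF: "!!p i x. p <= Suc n ==> x \<in> cnum L (Suc n - p) i ==> tcob L (Suc n) F p x = 0"
  and G: "!!p. p < n ==> G p \<in> homA (n - Suc p) j"
  and eq: "!!p i x. p <= n ==> x \<in> cnum A (n - p) i ==> F p (incl x) = tcob A n G p x"
 obtains K where "!!p. p < n ==> K p \<in> homL (n - Suc p) j"
  "!!p i x. p <= n ==> x \<in> cnum L (n - p) i ==> F p x = tcob L n K p x"
proof -
 have cA: "tcob A (Suc n) (%p x. F p (incl x)) p x = 0" if "p <= Suc n" "x \<in> cnum A (Suc n - p) i" for p i x
  unfolding tcob_incl[OF that(2,1), symmetric] by (rule cF[OF that(1) incl_num[OF that(2)]])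
 obtain P where P: "!!p. p <= n ==> P p \<in> homL (n - p) j" "!!p. p <= n ==> NV (n - p) (P p)"
  "!!p i x. p <= n ==> x \<in> cnum A (n - p) i ==> P p (incl x) = F p (incl x)"
  "!!p i x. p <= Suc n ==> x \<in> cnum L (Suc n - p) i ==> tcob L (Suc n) P p x = 0"
  by (rule lift_cocycle[where G = "%p x. F p (incl x)" and n = n and j = j, OF pull_homA[OF F] cA]) (assumption | blast)+
 obtain g where g: "!!p. p < n ==> g p \<in> homL (n - Suc p) j" "!!p. p < n ==> NV (n - Suc p) (g p)"
  "!!p i x. p < n ==> x \<in> cnum A (n - Suc p) i ==> g p (incl x) = G p x"
  by (rule lift_family[where n = n and m = "%p. n - Suc p" and G = G and j = j, OF G]) (assumption | blast)+
 have Pg: "P p x = tcob L n g p x" if "p <= n" "x \<in> cnum L (n - p) i" for p i x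
  by (rule lift_coboundary[where G = G, OF g P(1,2)[OF that(1)] that(1) _ that(2)]) (simp_all add: P(3) eq that(1))
 have td: "tcob B m (%p x. F p x - P p x) p x = tcob B m F p x - tcob B m P p x" for B m p x by (simp add: tcob_def)
 have "\<exists>K. (\<forall>p<n. K p \<in> homL (n - Suc p) j) &
  (\<forall>p\<le>n. \<forall>i. \<forall>x\<in>cnum L (n - p) i. (%p x. F p x - P p x) p x = tcob L n K p x)"
  by (rule tot_kernel[of 0]) (simp_all add: homL_diff[OF F P(1)] td cF P(3,4))
 then obtain K where K0: "\<forall>p<n. K p \<in> homL (n - Suc p) j"
  and K1: "\<forall>p\<le>n. \<forall>i. \<forall>x\<in>cnum L (n - p) i. F p x - P p x = tcob L n K p x" by (elim exE conjE)
 note K = K0[rule_format] K1[rule_format]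
 show thesis
 proof (rule that[of "%p x. K p x + g p x"])
  show "(%x. K p x + g p x) \<in> homL (n - Suc p) j" if "p < n" for p by (rule homL_add[OF K(1) g(1)]) (rule that)+
  have "tcob L n (%p x. K p x + g p x) p x = tcob L n K p x + tcob L n g p x" for p x by (simp add: tcob_def)
  then show "F p x = tcob L n (%p x. K p x + g p x) p x" if "p <= n" "x \<in> cnum L (n - p) i" for p i x
   using K(2)[OF that] Pg[OF that] by (simp add: algebra_simps)
 qed
qed

theorem HC_coh_iso: "induces_iso HC_restr (HC_coh L n) (HC_coh A n)"
proof -
 have R: "HC_restr f = (%p x. f p (incl x))" for f by (simp add: HC_restr_def incl_eq_cyc_incl comp_def)
 have z: "0 \<in> den (HC_coh A n) i" for i
  using HC_coh_subspaces(2)[of A n i] unfolding subspace_iff[OF vector_space_fun[OF vector_space_fun[OF vK]]] by blast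
 note lc = linear_compose[OF vs_pscale vs_pscale vK linear_incl]
 show ?thesis
 proof (rule induces_isoI[where S = "%_. UNIV"], unfold scl_HC_coh)
  show "vector_space (%(c :: 'k) f p x. c * f p x)" "vector_space (%(c :: 'k) f p x. c * f p x)"
   by (rule vector_space_fun[OF vector_space_fun[OF vK]])+
  show "HC_restr (x + y) - (HC_restr x + HC_restr y) \<in> den (HC_coh A n) i" for i x y
  proof -
   have "HC_restr (x + y) - (HC_restr x + HC_restr y) = 0" by (simp add: R fun_eq_iff)
   then show ?thesis using z by simp
  qed
  show "HC_restr (%p y. c * x p y) - (%p y. c * HC_restr x p y) \<in> den (HC_coh A n) i" for i c x
  proof -
   have "HC_restr (%p y. c * x p y) - (%p y. c * HC_restr x p y) = 0" by (simp add: R fun_eq_iff)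
   then show ?thesis using z by simp
  qed
  fix i F assume F: "F \<in> num (HC_coh L n) i"
  then have Fh: "!!p. p <= n ==> F p \<in> homL (n - p) i" and F0: "!!p. p > n ==> F p = 0"
   and Fc: "!!p k x. p <= Suc n ==> x \<in> cnum L (Suc n - p) k ==> tcob L (Suc n) F p x = 0"
   unfolding num_HC_coh num_tot_cochains by blast+
  have c: "tcob A (Suc n) (%p x. F p (incl x)) p x = 0" if "p <= Suc n" "x \<in> cnum A (Suc n - p) k" for p k x
   unfolding tcob_incl[OF that(2,1), symmetric] by (rule Fc[OF that(1) incl_num[OF that(2)]])
  have h: "(%x. F p (incl x)) \<in> homA (n - p) i" if "p <= n" for p by (rule pull_homA[OF Fh[OF that]])
  have z: "(%x. F p (incl x)) = 0" if "p > n" for p using F0[OF that] by (simp add: fun_eq_iff)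
  show "HC_restr F \<in> num (HC_coh A n) i"
   unfolding num_HC_coh num_tot_cochains R using h z c by blast
  assume "HC_restr F \<in> den (HC_coh A n) i"
  note D = this[unfolded den_HC_coh R, THEN conjunct2, THEN conjunct2]
  then obtain G where G0: "\<forall>p<n. G p \<in> homA (n - Suc p) i"
   and G1: "\<forall>p\<le>n. \<forall>k. \<forall>x\<in>cnum A (n - p) k. F p (incl x) = tcob A n G p x" by (elim exE conjE)
  note G = G0[rule_format] G1[rule_format]
  obtain K where K: "!!p. p < n ==> K p \<in> homL (n - Suc p) i"
   "!!p i x. p <= n ==> x \<in> cnum L (n - p) i ==> F p x = tcob L n K p x"
   by (rule tot_injective[where F = F and G = G and n = n and j = i, OF Fh Fc G]) (assumption | blast)+
  have l: "linfun (F p)" if "p <= n" for p by (rule hom_linear[OF Fh[OF that]])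
  show "F \<in> den (HC_coh L n) i" unfolding den_HC_coh
   by (intro conjI allI impI ballI exI[of _ K]) (rule l F0 K; assumption)+
 next
  fix i F assume "F \<in> den (HC_coh L n) i"
  note D = this[unfolded den_HC_coh]
  note F = D[THEN conjunct1, rule_format] D[THEN conjunct2, THEN conjunct1, rule_format]
  from D[THEN conjunct2, THEN conjunct2] obtain K where K0: "\<forall>p<n. K p \<in> homL (n - Suc p) i"
   and K1: "\<forall>p\<le>n. \<forall>k. \<forall>x\<in>cnum L (n - p) k. F p x = tcob L n K p x" by (elim exE conjE)
  note K = K0[rule_format] K1[rule_format]
  have t: "F p (incl x) = tcob A n (%p x. K p (incl x)) p x" if "p <= n" "x \<in> cnum A (n - p) k" for p k x
   using K(2)[OF that(1) incl_num[OF that(2)]] tcob_incl[OF that(2,1)] by simp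
  have z: "(%x. F p (incl x)) = 0" if "p > n" for p using F(2)[OF that] by (simp add: fun_eq_iff)
  show "HC_restr F \<in> den (HC_coh A n) i"
   unfolding den_HC_coh R
   by (intro conjI allI impI ballI exI[of _ "%p x. K p (incl x)"]) (rule lc[OF F(1)] z pull_homA[OF K(1)] t; assumption)+
 next
  fix i G assume "G \<in> num (HC_coh A n) i"
  note D = this[unfolded num_HC_coh num_tot_cochains]
  note G = D[THEN conjunct1, THEN conjunct1, rule_format] D[THEN conjunct1, THEN conjunct2, rule_format] D[THEN conjunct2, rule_format]
  obtain F where F: "!!p. p <= n ==> F p \<in> homL (n - p) i"
   "!!p i x. p <= n ==> x \<in> cnum A (n - p) i ==> F p (incl x) = G p x"
   "!!p i x. p <= Suc n ==> x \<in> cnum L (Suc n - p) i ==> tcob L (Suc n) F p x = 0"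
   by (rule lift_cocycle[where G = G and n = n and j = i, OF G(1,3)]) (assumption | blast)+
  \<comment> \<open>Total cochains are required to be 0 in the columns beyond
    \<open>n\<close>.\<close>
  let ?F = "%p. if p <= n then F p else 0"
  have "tcob L (Suc n) ?F p x = tcob L (Suc n) F p x" if "p <= Suc n" for p x
   using that by (auto simp: tcob_def)
  then have "?F \<in> num (HC_coh L n) i" unfolding num_HC_coh num_tot_cochains using F(1,3) by simp
  moreover have "HC_restr ?F - G \<in> den (HC_coh A n) i"
  proof -
   have l: "linfun ((HC_restr ?F - G) p)" if "p <= n" for p
    using lc[OF hom_linear[OF F(1)[OF that]]] hom_linear[OF G(1)[OF that]] that
    unfolding R linear_iff[OF vs_pscale vK] by (simp add: algebra_simps)
   have z: "(HC_restr ?F - G) p = 0" if "p > n" for p using that G(2) by (simp add: R fun_eq_iff)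
   have t: "(HC_restr ?F - G) p x = tcob A n (%_ _. 0) p x" if "p <= n" "x \<in> cnum A (n - p) k" for p k x
    using F(2)[OF that] that(1) by (simp add: R tcob_def)
   have h: "(%_. 0) \<in> homA m i" for m using pull_homA[OF homL_zero] by simp
   show ?thesis unfolding den_HC_coh
    by (intro conjI allI impI ballI exI[of _ "%_ _. 0"]) ((rule l z t; assumption) | rule h)+
  qed
  ultimately show "\<exists>F\<in>num (HC_coh L n) i. HC_restr F - G \<in> den (HC_coh A n) i" by blast
 qed (rule HC_coh_subspaces | simp)+
qed

end

section \<open>Cyclic homology\<close>

definition sg :: "nat => 'c::zero => nat => 'c" where
 "sg q c p = (if p = q then c else 0)"

lemma sum_sg:
 assumes "!!p. f p 0 = (0 :: 'k::ab_group_add)" "q <= n"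
 shows "(\<Sum>p\<le>n. f p (sg q c p)) = f q c"
proof -
 have "(\<Sum>p\<le>n. f p (sg q c p)) = (\<Sum>p\<le>n. if p = q then f q c else 0)"
  by (rule sum.cong) (auto simp: sg_def assms(1))
 then show ?thesis using assms(2) by simp
qed

section \<open>Total chains and their functionals\<close>

lemma num_tot_chains: "x \<in> num (tot_chains B n) i \<longleftrightarrow> (\<forall>p\<le>n. x p \<in> cnum B (n - p) i) & (\<forall>p>n. x p = 0)"
 by (auto simp: tot_chains_def prod_sspace_def)

lemma den_tot_chains: "x \<in> den (tot_chains B n) i \<longleftrightarrow> (\<forall>p\<le>n. x p \<in> den (cchains B (n - p)) i) & (\<forall>p>n. x p = 0)"
 by (auto simp: tot_chains_def prod_sspace_def)

lemma zero_num: "0 \<in> hnum B N n i" and zero_den: "0 \<in> den (hchains B N n) i"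
 using hchains_num_subspace[of B N n i] hchains_den_subspace[of B N n i] unfolding subspace_iff[OF vs_pscale] by blast+

abbreviation "tscale \<equiv> %c x p. pscale c (x p)"

lemma vector_space_tscale: "vector_space tscale"
 by (rule vector_space_fun[OF vs_pscale])

lemma tot_chains_subspaces: "subspc tscale (num (tot_chains B n) i)" "subspc tscale (den (tot_chains B n) i)"
 unfolding tot_chains_def
 by (rule prod_subspaces[OF vs_pscale]; rule hchains_num_subspace hchains_den_subspace)+

lemma linear_tot_boundary: "lin_map tscale tscale (tot_boundary B n)"
proof -
 interpret P: vector_space pscale by (rule vs_pscale)
 have "cc_vert B p q (x + y) = cc_vert B p q x + cc_vert B p q y" "cc_vert B p q (pscale c x) = pscale c (cc_vert B p q x)" for p q x y c
  using linear_cc_vert[of B p q] unfolding linear_iff_pscale by blast+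
 moreover have "cc_horiz p q (x + y) = cc_horiz p q x + cc_horiz p q y" "cc_horiz p q (pscale c x) = pscale c (cc_horiz p q x)"
  for p q c and x y :: "('b, 'c, 'c) htuple \<Rightarrow>\<^sub>0 'a"
  using linear_cc_horiz[of p q, where 'k = 'a and 'o = 'b and 'a = 'c] unfolding linear_iff_pscale by blast+
 ultimately show ?thesis
  unfolding linear_iff[OF vector_space_tscale vector_space_tscale] tot_boundary_def
  by (auto simp: fun_eq_iff P.scale_right_distrib)
qed

text \<open>\<open>tcob\<close> is the transpose of \<open>tot_boundary\<close> under the pairing of
  total chains with families of functionals; the horizontal terms are reindexed from
  \<open>p\<close> to \<open>Suc p\<close>.\<close>

lemma pairing_adjoint:
 assumes lin: "!!p. p <= m ==> linfun (F p)"
 shows "(\<Sum>p\<le>m. F p (tot_boundary B (Suc m) y p)) = (\<Sum>p\<le>Suc m. tcob B (Suc m) F p (y p) :: 'k::field)"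
proof -
 have add: "F p (x + y) = F p x + F p y" if "p <= m" for p x y
  using lin[OF that] unfolding linear_iff[OF vs_pscale vector_space_mult] by blast
 have "(\<Sum>p\<le>m. F p (tot_boundary B (Suc m) y p)) =
  (\<Sum>p\<le>m. F p (cc_vert B p (Suc m - p) (y p))) + (\<Sum>p\<le>m. F p (cc_horiz (Suc p) (Suc m - Suc p) (y (Suc p))))"
  unfolding sum.distrib[symmetric] by (rule sum.cong) (auto simp: tot_boundary_def add)
 also have "(\<Sum>p\<le>m. F p (cc_vert B p (Suc m - p) (y p))) =
  (\<Sum>p\<le>Suc m. if p < Suc m then F p (cc_vert B p (Suc m - p) (y p)) else 0)"
  by (simp only: sum.atMost_Suc less_irrefl if_False add_0_right) (intro sum.cong; simp)
 also have "(\<Sum>p\<le>m. F p (cc_horiz (Suc p) (Suc m - Suc p) (y (Suc p)))) =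
  (\<Sum>p\<le>Suc m. if 0 < p then F (p - 1) (cc_horiz p (Suc m - p) (y p)) else 0)"
  unfolding sum.atMost_Suc_shift by simp
 finally show ?thesis unfolding tcob_def sum.distrib .
qed

lemma tcob_degree_zero:
 assumes vn: "!!q p i x. x \<in> cnum B (Suc q) i ==> cc_vert B p (Suc q) x \<in> cnum B q i"
  and G: "!!q. q < n ==> G q \<in> cfun B (n - Suc q) i"
  and p: "p <= n" and x: "x \<in> cnum B (n - p) k" and k: "k ~= i"
 shows "tcob B n G p x = 0"
proof -
 have v: "G p (cc_vert B p (n - p) x) = 0" if "p < n"
  using hom_degree_zero[OF G[OF that] vn[of x "n - Suc p" k p] k] x that by (simp add: Suc_diff_Suc)
 have h: "G (p - 1) (cc_horiz p (n - p) x) = 0" if "0 < p"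
  using hom_degree_zero[OF G[of "p - 1"] cc_horiz_num[of x] k] x p that by simp
 show ?thesis unfolding tcob_def
  by (cases "p < n"; cases "0 < p") (simp_all only: v h if_True if_False add_0)
qed

lemma functional_components:
 fixes f :: "(nat => ('o, 'a, 'a) htuple \<Rightarrow>\<^sub>0 'k::field) => 'k"
 assumes f: "lin_map tscale (*) f"
 shows "linfun (%c. f (sg q c))" "(!!p. p > n ==> x p = 0) ==> f x = (\<Sum>q\<le>n. f (sg q (x q)))"
proof -
 interpret f: Vector_Spaces.linear tscale "(*)" f by fact
 interpret P: vector_space pscale by (rule vs_pscale)
 have s: "sg q (c + d) = sg q c + sg q d" "sg q (pscale a c) = (%p. pscale a (sg q c p))" for q a and c d :: "('o, 'a, 'a) htuple \<Rightarrow>\<^sub>0 'k"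
  by (auto simp: sg_def fun_eq_iff)
 show "linfun (%c. f (sg q c))"
  unfolding linear_iff[OF vs_pscale vector_space_mult] s by (simp add: f.add f.scale)
 assume x: "!!p. p > n ==> x p = 0"
 have "x = (\<Sum>q\<le>n. sg q (x q))"
 proof
  fix p
  have "(\<Sum>q\<le>n. sg q (x q)) p = (\<Sum>q\<le>n. if q = p then x p else 0)"
   unfolding sum_fun_apply by (rule sum.cong) (auto simp: sg_def)
  then show "x p = (\<Sum>q\<le>n. sg q (x q)) p" using x[of p] by simp
 qed
 then show "f x = (\<Sum>q\<le>n. f (sg q (x q)))" by (metis (no_types, lifting) f.sum sum.cong)
qed

lemma linear_pairing:
 assumes "!!p. p <= n ==> linfun (F p)"
 shows "lin_map tscale (*) (%x. \<Sum>p\<le>n. F p (x p) :: 'k::field)"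
 using assms unfolding linear_iff[OF vector_space_tscale vector_space_mult] linear_iff[OF vs_pscale vector_space_mult]
 by (simp add: sum.distrib sum_distrib_left)

lemma num_HC_hom: "z \<in> num (HC_hom B n) i \<longleftrightarrow>
  z \<in> num (tot_chains B n) i & (n = 0 | tot_boundary B n z \<in> den (tot_chains B (n - 1)) i)"
 and den_HC_hom: "den (HC_hom B n) i = tot_boundary B (Suc n) ` num (tot_chains B (Suc n)) i + den (tot_chains B n) i"
 and scl_HC_hom: "scl (HC_hom B n) = tscale"
 by (simp_all add: HC_hom_def homology_def tot_chains_def[of _ n] prod_sspace_def)

lemma HC_hom_subspaces: "subspc tscale (num (HC_hom B n) i)" "subspc tscale (den (HC_hom B n) i)"
proof -
 note V = vector_space_tscale
 show "subspc tscale (den (HC_hom B n) i)" unfolding den_HC_hom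
  by (intro subspace_plus[OF V] subspace_linear_image[OF linear_tot_boundary] tot_chains_subspaces)
 show "subspc tscale (num (HC_hom B n) i)"
 proof (cases n)
  case 0
  then have "num (HC_hom B n) i = num (tot_chains B n) i" by (auto simp: num_HC_hom)
  then show ?thesis using tot_chains_subspaces(1) by metis
 next
  case (Suc m)
  have e: "num (HC_hom B n) i = {z \<in> num (tot_chains B n) i. tot_boundary B n z \<in> den (tot_chains B m) i}"
   using Suc num_HC_hom[of _ B n i] by auto
  interpret T: Vector_Spaces.linear tscale tscale "tot_boundary B n" by (rule linear_tot_boundary)
  show ?thesis
   using tot_chains_subspaces(1)[of B n i] tot_chains_subspaces(2)[of B m i]
   unfolding e subspace_iff[OF V] by (simp add: T.add T.scale T.zero)
 qed
qed

lemma den_HC_hom_boundary: "y \<in> num (tot_chains B (Suc n)) i ==> tot_boundary B (Suc n) y \<in> den (HC_hom B n) i"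
 and den_HC_hom_den: "e \<in> den (tot_chains B n) i ==> e \<in> den (HC_hom B n) i"
proof -
 have z: "0 \<in> den (tot_chains B n) i" "0 \<in> num (tot_chains B (Suc n)) i"
  using tot_chains_subspaces unfolding subspace_iff[OF vector_space_tscale] by blast+
 interpret T: Vector_Spaces.linear tscale tscale "tot_boundary B (Suc n)" by (rule linear_tot_boundary)
 show "tot_boundary B (Suc n) y \<in> den (HC_hom B n) i" if "y \<in> num (tot_chains B (Suc n)) i"
  unfolding den_HC_hom using set_plus_intro[OF imageI[where f = "tot_boundary B (Suc n)", OF that] z(1)] by simp
 show "e \<in> den (HC_hom B n) i" if "e \<in> den (tot_chains B n) i"
  unfolding den_HC_hom using set_plus_intro[OF imageI[where f = "tot_boundary B (Suc n)", OF z(2)] that] by (simp add: T.zero)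
qed

lemma sg_num: "q <= n ==> x \<in> cnum B (n - q) i ==> sg q x \<in> num (tot_chains B n) i"
 and sg_den: "q <= n ==> y \<in> den (cchains B (n - q)) i ==> sg q y \<in> den (tot_chains B n) i"
 by (auto simp: num_tot_chains den_tot_chains sg_def zero_num zero_den)

lemma tot_boundary_num:
 assumes vn: "!!q p i x. x \<in> cnum B (Suc q) i ==> cc_vert B p (Suc q) x \<in> cnum B q i"
  and y: "y \<in> num (tot_chains B n) i"
 shows "tot_boundary B n y \<in> num (tot_chains B (n - 1)) i"
proof -
 interpret P: vector_space pscale by (rule vs_pscale)
 have yq: "y r \<in> cnum B (n - r) i" if "r <= n" for r using y that by (simp add: num_tot_chains)
 have "tot_boundary B n y q \<in> cnum B (n - 1 - q) i" for q
 proof (cases "q < n")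
  case True
  have "cc_vert B q (n - q) (y q) \<in> cnum B (n - 1 - q) i"
   using vn[of "y q" "n - Suc q" i q] yq[of q] True by (simp add: Suc_diff_Suc)
  moreover have "cc_horiz (Suc q) (n - Suc q) (y (Suc q)) \<in> cnum B (n - 1 - q) i"
   using cc_horiz_num[OF yq[of "Suc q"]] True by simp
  ultimately show ?thesis using True P.subspace_add[OF hchains_num_subspace] by (simp add: tot_boundary_def)
 qed (simp add: tot_boundary_def zero_num)
 moreover have "tot_boundary B n y q = 0" if "q > n - 1" for q
 proof -
  have "~ q < n" using that by simp
  then show ?thesis by (simp add: tot_boundary_def)
 qed
 ultimately show ?thesis by (simp add: num_tot_chains)
qed

lemma sum_tcob_sg:
 assumes linF: "!!p. p < n ==> linfun (F p)" and p: "p <= n"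
 shows "(\<Sum>q\<le>n. tcob B n F q (sg p x q)) = (tcob B n F p x :: 'k::field)"
proof -
 have "(\<Sum>q\<le>n. tcob B n F q (sg p x q)) = (\<Sum>q\<le>n. (%q x. if q <= n then tcob B n F q x else 0) q (sg p x q))" by (rule sum.cong) auto
 also have "... = (if p <= n then tcob B n F p x else 0)"
 proof (rule sum_sg[OF _ p])
  fix q
  have "tcob B n F q 0 = 0" if "q <= n"
  proof -
   interpret T: Vector_Spaces.linear pscale "(*)" "%x. tcob B n F q x" by (rule tcob_linear[OF linF that])
   show ?thesis by (rule T.zero)
  qed
  then show "(if q <= n then tcob B n F q 0 else 0) = 0" by simp
 qed
 finally show ?thesis using p by simp
qed

text \<open>A functional on total chains amounts to its parts on the columns. Each part is replaced
  by its component of degree \<open>i\<close>, which gives a cochain of the dual bicomplex, and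
  vanishing on boundaries becomes the cocycle condition.\<close>

lemma functional_cocycle:
 fixes f :: "(nat => ('o, 'a::ab_group_add, 'a) htuple \<Rightarrow>\<^sub>0 'k::field) => 'k"
 assumes dn: "!!q i. den (cchains B q) i <= cnum B q i"
  and vn: "!!q p i x. x \<in> cnum B (Suc q) i ==> cc_vert B p (Suc q) x \<in> cnum B q i"
  and f: "lin_map tscale (*) f" and f0: "!!x. x \<in> den (tot_chains B n) i ==> f x = 0"
 obtains F where "!!p. p <= n ==> F p \<in> cfun B (n - p) i" "!!x. x \<in> num (tot_chains B n) i ==> f x = (\<Sum>p\<le>n. F p (x p))"
  "(!!y. y \<in> num (tot_chains B (Suc n)) i ==> f (tot_boundary B (Suc n) y) = 0) ==>
   (\<forall>p\<le>Suc n. \<forall>k. \<forall>x\<in>cnum B (Suc n - p) k. tcob B (Suc n) F p x = 0)"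
proof -
 let ?P = "%q g. g \<in> cfun B (n - q) i & (\<forall>x\<in>cnum B (n - q) i. g x = f (sg q x))"
 define F where "F = (%q. SOME g. ?P q g)"
 have FP: "?P q (F q)" if q: "q <= n" for q
 proof -
  have z: "f (sg q x) = 0" if "x \<in> den (cchains B (n - q)) i" for x by (rule f0[OF sg_den[OF q that]])
  obtain g where "g \<in> cfun B (n - q) i" "!!x. x \<in> cnum B (n - q) i ==> g x = f (sg q x)"
   by (rule restrict_hom[where B = B and N = "std_bimod B" and n = "n - q" and i = i and f = "%x. f (sg q x)",
      OF dn functional_components(1)[OF f] z]) (assumption | blast)+
  then have "?P q g" by blast
  then show ?thesis unfolding F_def by (rule someI[where P = "?P q"])
 qed
 have F: "F q \<in> cfun B (n - q) i" "x \<in> cnum B (n - q) i ==> F q x = f (sg q x)" if "q <= n" for q x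
  using FP[OF that] by blast+
 have fx: "f x = (\<Sum>p\<le>n. F p (x p))" if x: "x \<in> num (tot_chains B n) i" for x
 proof -
  have "f x = (\<Sum>q\<le>n. f (sg q (x q)))" using x by (intro functional_components(2)[OF f]) (simp add: num_tot_chains)
  also have "... = (\<Sum>q\<le>n. F q (x q))" using x F(2) by (intro sum.cong) (auto simp: num_tot_chains)
  finally show ?thesis .
 qed
 have linF: "linfun (F p)" if "p <= n" for p by (rule hom_linear[OF F(1)[OF that]])
 have co: "tcob B (Suc n) F p x = 0" if fb: "!!y. y \<in> num (tot_chains B (Suc n)) i ==> f (tot_boundary B (Suc n) y) = 0"
  and p: "p <= Suc n" and x: "x \<in> cnum B (Suc n - p) k" for p k x
 proof (cases "k = i")
  case True
  \<comment> \<open>Testing on chains concentrated in one column isolates component \<open>p\<close>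
    of the coboundary.\<close>
  let ?y = "sg p x"
  have y: "?y \<in> num (tot_chains B (Suc n)) i" by (rule sg_num[OF p]) (use x True in simp)
  have tb: "tot_boundary B (Suc n) ?y \<in> num (tot_chains B n) i" using tot_boundary_num[OF vn y] by simp
  have "0 = (\<Sum>q\<le>n. F q (tot_boundary B (Suc n) ?y q))" using fb[OF y] fx[OF tb] by simp
  also have "... = (\<Sum>q\<le>Suc n. tcob B (Suc n) F q (?y q))" by (rule pairing_adjoint[OF linF])
  also have "... = tcob B (Suc n) F p x" by (rule sum_tcob_sg[OF _ p]) (simp add: linF)
  finally show ?thesis by simp
 next
  case False
  show ?thesis by (rule tcob_degree_zero[OF vn _ p x False]) (use F(1) in simp_all)
 qed
 show thesis by (rule that[of F, OF F(1) fx]) (use co in blast)+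
qed

context cyclic_comparison
begin

section \<open>Comparison of total chains\<close>

lemma HC_incl_incl: "HC_incl x = (%p. incl (x p))"
 by (simp add: HC_incl_def incl_eq_cyc_incl)

lemma linear_HC_incl: "lin_map tscale tscale (HC_incl :: (nat => ('o, 'a, 'a) htuple \<Rightarrow>\<^sub>0 'k) => _)"
 using linear_incl unfolding linear_iff[OF vector_space_tscale vector_space_tscale] linear_iff_pscale
 by (simp add: HC_incl_incl fun_eq_iff)

lemma incl_0: "incl 0 = 0"
proof -
 interpret i: Vector_Spaces.linear pscale pscale incl by (rule linear_incl)
 show ?thesis by (rule i.zero)
qed

lemma HC_incl_num: "x \<in> num (tot_chains A n) i ==> HC_incl x \<in> num (tot_chains L n) i"
 and HC_incl_den: "y \<in> den (tot_chains A n) i ==> HC_incl y \<in> den (tot_chains L n) i"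
 by (auto simp: num_tot_chains den_tot_chains HC_incl_incl incl_0 intro: incl_num incl_den)

lemma HC_incl_boundary:
 assumes x: "x \<in> num (tot_chains A n) i"
 shows "HC_incl (tot_boundary A n x) = tot_boundary L n (HC_incl x)"
proof
 fix p
 interpret i: Vector_Spaces.linear pscale pscale incl by (rule linear_incl)
 have xp: "x q \<in> cnum A (n - q) i" if "q <= n" for q using x that by (simp add: num_tot_chains)
 show "HC_incl (tot_boundary A n x) p = tot_boundary L n (HC_incl x) p"
 proof (cases "p < n")
  case True
  then have "incl (cc_vert A p (n - p) (x p)) = cc_vert L p (n - p) (incl (x p))"
   using incl_vert[of "x p" "n - Suc p" i p] xp[of p] by (simp add: Suc_diff_Suc)
  moreover have "incl (cc_horiz (Suc p) (n - Suc p) (x (Suc p))) = cc_horiz (Suc p) (n - Suc p) (incl (x (Suc p)))"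
   by (rule incl_horiz[OF xp]) (use True in simp)
  ultimately show ?thesis using True by (simp add: HC_incl_incl tot_boundary_def i.add)
 qed (simp add: HC_incl_incl tot_boundary_def incl_0)
qed

text \<open>The argument of \<open>HH_hom_iso\<close>, with families over the columns in place of
  single functionals and \<open>tot_injective\<close> in place of exactness of one column.\<close>

theorem HC_hom_iso: "induces_iso HC_incl (HC_hom A n) (HC_hom L n)"
proof -
 have inclT: "HC_incl x \<in> num (HC_hom L n) i" if x: "x \<in> num (HC_hom A n) i" for x i
  using x HC_incl_num[of x n i] HC_incl_den[of "tot_boundary A n x" "n - 1" i] HC_incl_boundary[of x n i]
  unfolding num_HC_hom by auto
 have inclD: "HC_incl x \<in> den (HC_hom L n) i" if x: "x \<in> den (HC_hom A n) i" for x i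
 proof -
  interpret I: Vector_Spaces.linear tscale tscale "HC_incl :: (nat => ('o, 'a, 'a) htuple \<Rightarrow>\<^sub>0 'k) => _" by (rule linear_HC_incl)
  obtain y e where y: "y \<in> num (tot_chains A (Suc n)) i" "e \<in> den (tot_chains A n) i" "x = tot_boundary A (Suc n) y + e"
   using x unfolding den_HC_hom set_plus_def by blast
  show ?thesis unfolding den_HC_hom y(3) I.add HC_incl_boundary[OF y(1)]
   by (intro set_plus_intro imageI HC_incl_num HC_incl_den y)
 qed
 have lift: "\<exists>f'. lin_map tscale (*) f' & (\<forall>x\<in>den (HC_hom L n) i. f' x = 0) &
   (\<forall>x\<in>num (HC_hom A n) i. f' (HC_incl x) = f x)"
  if f: "lin_map tscale (*) f" and f0: "\<forall>x\<in>den (HC_hom A n) i. f x = (0::'k)" for i f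
 proof -
  obtain G where G: "!!p. p <= n ==> G p \<in> homA (n - p) i" "!!x. x \<in> num (tot_chains A n) i ==> f x = (\<Sum>p\<le>n. G p (x p))"
   "(!!y. y \<in> num (tot_chains A (Suc n)) i ==> f (tot_boundary A (Suc n) y) = 0) ==>
    (\<forall>p\<le>Suc n. \<forall>k. \<forall>x\<in>cnum A (Suc n - p) k. tcob A (Suc n) G p x = 0)"
   by (rule functional_cocycle[OF denA_num vert_numA f, of n i]) (use f0 den_HC_hom_den in blast)+
  have cG: "tcob A (Suc n) G p x = 0" if "p <= Suc n" "x \<in> cnum A (Suc n - p) k" for p k x
   using G(3) f0 den_HC_hom_boundary that by blast
  obtain F where F: "!!p. p <= n ==> F p \<in> homL (n - p) i"
   "!!p k x. p <= n ==> x \<in> cnum A (n - p) k ==> F p (incl x) = G p x"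
   "!!p k x. p <= Suc n ==> x \<in> cnum L (Suc n - p) k ==> tcob L (Suc n) F p x = 0"
   by (rule lift_cocycle[where G = G and n = n and j = i, OF G(1) cG]) (assumption | blast)+
  let ?f = "%x. \<Sum>p\<le>n. F p (x p)"
  have lF: "linfun (F p)" if "p <= n" for p by (rule hom_linear[OF F(1)[OF that]])
  have lf: "lin_map tscale (*) ?f" by (rule linear_pairing[OF lF])
  have "?f x = 0" if x: "x \<in> den (HC_hom L n) i" for x
  proof -
   interpret f: Vector_Spaces.linear tscale "(*)" ?f by (rule lf)
   obtain y e where y: "y \<in> num (tot_chains L (Suc n)) i" "e \<in> den (tot_chains L n) i" "x = tot_boundary L (Suc n) y + e"
    using x unfolding den_HC_hom set_plus_def by blast
   have "?f (tot_boundary L (Suc n) y) = (\<Sum>p\<le>Suc n. tcob L (Suc n) F p (y p))" by (rule pairing_adjoint[OF lF])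
   also have "... = 0" using y(1) F(3) by (intro sum.neutral) (auto simp: num_tot_chains)
   finally have 1: "?f (tot_boundary L (Suc n) y) = 0" .
   have "?f e = 0" using y(2) hom_den_zero[OF F(1)] by (intro sum.neutral) (auto simp: den_tot_chains)
   then show ?thesis unfolding y(3) f.add using 1 by simp
  qed
  moreover have "?f (HC_incl x) = f x" if "x \<in> num (HC_hom A n) i" for x
  proof -
   have x: "x \<in> num (tot_chains A n) i" using that by (simp add: num_HC_hom)
   then show ?thesis unfolding G(2)[OF x] HC_incl_incl using F(2) by (intro sum.cong) (auto simp: num_tot_chains)
  qed
  ultimately show ?thesis using lf by blast
 qed
 have van: "f x = 0" if f: "lin_map tscale (*) f" and f0: "\<forall>x\<in>den (HC_hom L n) i. f x = (0::'k)"
   and fA: "\<forall>x\<in>num (HC_hom A n) i. f (HC_incl x) = 0" and x: "x \<in> num (HC_hom L n) i" for i f x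
 proof -
  obtain F where F: "!!p. p <= n ==> F p \<in> homL (n - p) i" "!!x. x \<in> num (tot_chains L n) i ==> f x = (\<Sum>p\<le>n. F p (x p))"
   "(!!y. y \<in> num (tot_chains L (Suc n)) i ==> f (tot_boundary L (Suc n) y) = 0) ==>
    (\<forall>p\<le>Suc n. \<forall>k. \<forall>x\<in>cnum L (Suc n - p) k. tcob L (Suc n) F p x = 0)"
   by (rule functional_cocycle[OF denL_num vert_numL f, of n i]) (use f0 den_HC_hom_den in blast)+
  have cF: "tcob L (Suc n) F p x = 0" if "p <= Suc n" "x \<in> cnum L (Suc n - p) k" for p k x
   using F(3) f0 den_HC_hom_boundary that by blast
  let ?\<phi> = "%x. f (HC_incl x)"
  have lphi: "lin_map tscale (*) ?\<phi>"
   by (rule linear_compose[OF vector_space_tscale vector_space_tscale vK linear_HC_incl f])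
  have phi_sg: "?\<phi> (sg p y) = F p (incl y)" if p: "p <= n" and y: "y \<in> cnum A (n - p) i" for p y
  proof -
   have "HC_incl (sg p y) = sg p (incl y)" by (auto simp: HC_incl_incl sg_def incl_0 fun_eq_iff)
   moreover have s: "sg p (incl y) \<in> num (tot_chains L n) i" by (rule sg_num[OF p incl_num[OF y]])
   moreover have "(\<Sum>q\<le>n. F q (sg p (incl y) q)) = F p (incl y)"
   proof -
    have "(\<Sum>q\<le>n. F q (sg p (incl y) q)) = (\<Sum>q\<le>n. (%q x. if q <= n then F q x else 0) q (sg p (incl y) q))" by (rule sum.cong) auto
    also have "... = F p (incl y)"
    proof (subst sum_sg)
     fix q
     have "F q 0 = 0" if "q <= n"
     proof -
      interpret Fq: Vector_Spaces.linear pscale "(*)" "F q" by (rule hom_linear[OF F(1)[OF that]])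
      show ?thesis by (rule Fq.zero)
     qed
     then show "(if q <= n then F q 0 else 0) = 0" by simp
    qed (use p in auto)
    finally show ?thesis .
   qed
   ultimately show ?thesis using F(2)[OF s] by simp
  qed
  \<comment> \<open>The pullback of \<open>f\<close> vanishes on the cycles of the category, so it
    factors through the total boundary; in terms of families it is a coboundary.\<close>
  have "\<exists>G. (\<forall>p<n. G p \<in> homA (n - Suc p) i) &
   (\<forall>p\<le>n. \<forall>k. \<forall>y\<in>cnum A (n - p) k. F p (incl y) = tcob A n G p y)"
  proof (cases n)
   case 0
   have "F 0 (incl y) = 0" if y: "y \<in> cnum A 0 k" for k y
   proof (cases "k = i")
    case True
    have "sg 0 y \<in> num (HC_hom A n) i" using sg_num[of 0 n y A i] y True 0 unfolding num_HC_hom by simp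
    then show ?thesis using phi_sg[of 0 y] fA y True 0 by simp
   next
    case False
    then show ?thesis using hom_degree_zero[OF pull_homA[OF F(1)[of 0]], of y k] y 0 by simp
   qed
   then show ?thesis using 0 by (simp add: tcob_def)
  next
   case (Suc m)
   have phi0: "?\<phi> y = 0" if "y \<in> num (tot_chains A n) i" "tot_boundary A n y \<in> den (tot_chains A m) i" for y
   proof -
    have "y \<in> num (HC_hom A n) i" unfolding num_HC_hom using that Suc by simp
    then show ?thesis using fA by blast
   qed
   obtain q where q: "lin_map tscale (*) q" "!!y. y \<in> den (tot_chains A m) i ==> q y = 0"
    "!!x. x \<in> num (tot_chains A n) i ==> q (tot_boundary A n x) = ?\<phi> x"
    by (rule functional_factor[OF vector_space_tscale vector_space_tscale linear_tot_boundary tot_chains_subspaces(1)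
       tot_chains_subspaces(2) lphi phi0]) (assumption | blast)+
   obtain G where G: "!!p. p <= m ==> G p \<in> homA (m - p) i" "!!x. x \<in> num (tot_chains A m) i ==> q x = (\<Sum>p\<le>m. G p (x p))"
    by (rule functional_cocycle[OF denA_num vert_numA q(1), of m i]) (use q(2) in blast)+
   have Gh: "G p \<in> homA (n - Suc p) i" if "p < n" for p using G(1)[of p] that Suc by simp
   have linG: "linfun (G p)" if "p <= m" for p by (rule hom_linear[OF G(1)[OF that]])
   have "F p (incl y) = tcob A n G p y" if p: "p <= n" and y: "y \<in> cnum A (n - p) k" for p k y
   proof (cases "k = i")
    case True
    let ?y = "sg p y"
    have yi: "y \<in> cnum A (n - p) i" using y True by simp
    have yn: "?y \<in> num (tot_chains A n) i" by (rule sg_num[OF p yi])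
    have tb: "tot_boundary A n ?y \<in> num (tot_chains A m) i"
     using tot_boundary_num[OF vert_numA yn] Suc by simp
    have "F p (incl y) = (\<Sum>r\<le>m. G r (tot_boundary A n ?y r))"
     using phi_sg[OF p yi] q(3)[OF yn] G(2)[OF tb] by simp
    also have "... = (\<Sum>r\<le>n. tcob A n G r (?y r))" unfolding Suc by (rule pairing_adjoint[OF linG])
    also have "... = tcob A n G p y" by (rule sum_tcob_sg[OF _ p]) (use linG Suc in simp)
    finally show ?thesis .
   next
    case False
    have "tcob A n G p y = 0" by (rule tcob_degree_zero[OF vert_numA Gh p y False])
    then show ?thesis using hom_degree_zero[OF pull_homA[OF F(1)[OF p]] y False] by simp
   qed
   then show ?thesis using Gh by blast
  qed
  then obtain G where G0: "\<forall>p<n. G p \<in> homA (n - Suc p) i"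
   and G1: "\<forall>p\<le>n. \<forall>k. \<forall>y\<in>cnum A (n - p) k. F p (incl y) = tcob A n G p y" by (elim exE conjE)
  note G = G0[rule_format] G1[rule_format]
  obtain K where K: "!!p. p < n ==> K p \<in> homL (n - Suc p) i"
   "!!p k x. p <= n ==> x \<in> cnum L (n - p) k ==> F p x = tcob L n K p x"
   by (rule tot_injective[where F = F and G = G and n = n and j = i, OF F(1) cF G]) (assumption | blast)+
  have xn: "x \<in> num (tot_chains L n) i" using x by (simp add: num_HC_hom)
  \<comment> \<open>For \<open>n > 0\<close>, \<open>pairing_adjoint\<close> turns this into
    \<open>K\<close> evaluated on the boundary of the cycle \<open>x\<close>, which lies in the
    denominators.\<close>
  have fx: "f x = (\<Sum>p\<le>n. tcob L n K p (x p))"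
   unfolding F(2)[OF xn] using xn K(2) by (intro sum.cong) (auto simp: num_tot_chains)
  show ?thesis
  proof (cases n)
   case 0
   then show ?thesis using fx by (simp add: tcob_def)
  next
   case (Suc m)
   have lK: "linfun (K p)" if "p <= m" for p using hom_linear[OF K(1)[of p]] that Suc by simp
   have tx: "tot_boundary L n x \<in> den (tot_chains L m) i" using x Suc unfolding num_HC_hom by simp
   have "f x = (\<Sum>p\<le>m. K p (tot_boundary L n x p))"
    unfolding fx Suc by (rule pairing_adjoint[OF lK, symmetric])
   also have "... = 0"
   proof (intro sum.neutral ballI)
    fix p assume "p \<in> {..m}"
    then show "K p (tot_boundary L n x p) = 0"
     using hom_den_zero[OF K(1)[of p], of "tot_boundary L n x p" i] tx Suc by (simp add: den_tot_chains)
   qed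
   finally show ?thesis .
  qed
 qed
 show ?thesis
 proof (rule induces_iso_dual, unfold scl_HC_hom)
 qed ((rule vector_space_tscale linear_HC_incl HC_hom_subspaces) | (rule inclT inclD lift van; assumption))+
qed

end

section \<open>The comparison theorem\<close>

lemma cat_bimod_sel: "MScale (cat_bimod A M) = MScale M" "Bim (cat_bimod A M) X Y i = corner A M X Y ` Bim M () () i"
  "LAct (cat_bimod A M) Z X Y a m = LAct M () () () (munit Z X a) m"
  "RAct (cat_bimod A M) X Y Z m a = RAct M () () () m (munit Y Z a)"
 by (simp_all add: cat_bimod_def)

text \<open>The bimodule over the category consists of the corners of \<open>M\<close> themselves,
  so \<open>em\<close> is the inclusion of a corner.\<close>

lemma (in superalgebra_bimodule) cat_comparison:
 "chain_comparison A M (cat_bimod A M) (%_ _ m. m) (corner A M)"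
proof (intro chain_comparison.intro chain_comparison_axioms.intro finite_superadditive_category_axioms, unfold cat_bimod_sel)
 have c: "v \<in> BM d & corner A M X Y v = v" if "X \<in> Obj A" "Y \<in> Obj A" "v \<in> corner A M X Y ` BM d" for X Y v d
  using that corner_corner[OF that(1,2,1,2)] corner_degree[OF that(1,2)] by auto
 have ends: "src u \<in> Obj A" "tgt u \<in> Obj A" "um u \<in> LM (deg u)" if "u \<in> arrows A" for u
  using that um_LM[OF that] by (auto simp: arrows_def)
 show "vector_space sM" "vector_space sM" by (rule bim.vector_space)+
 show "subspc sM (BM d)" for d by (rule BM_subspace)
 show "subspc sM (corner A M X Y ` BM d)" if "X \<in> Obj A" "Y \<in> Obj A" for X Y d
  by (rule corner_image_subspace[OF that])
 show "LA (um u) v \<in> corner A M (src u) Y ` BM (deg u + j)"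
  if "u \<in> arrows A" "Y \<in> Obj A" "v \<in> corner A M (tgt u) Y ` BM j" for u Y v j
  using c[OF ends(2)[OF that(1)] that(2,3)] corner_LA[OF ends(1)[OF that(1)] that(2,1), of v j] LA_degree[OF ends(3)[OF that(1)], of v j]
  by (intro image_eqI[of _ _ "LA (um u) v"]) auto
 show "RA v (um u) \<in> corner A M X (tgt u) ` BM (i + deg u)"
  if "u \<in> arrows A" "X \<in> Obj A" "v \<in> corner A M X (src u) ` BM i" for u X v i
  using c[OF that(2) ends(1)[OF that(1)] that(3)] corner_RA[OF that(2) ends(2)[OF that(1)] that(1), of v i] RA_degree[OF _ ends(3)[OF that(1)], of v i]
  by (intro image_eqI[of _ _ "RA v (um u)"]) auto
 show "RA v (e Y) = v" if "X \<in> Obj A" "Y \<in> Obj A" "v \<in> corner A M X Y ` BM d" for X Y v d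
  using that(3) RA_e_corner[OF that(1,2)] by auto
 show "v \<in> BM d" if "X \<in> Obj A" "Y \<in> Obj A" "v \<in> corner A M X Y ` BM d" for X Y v d using c[OF that] by simp
 show "lin_on sM sM (corner A M X Y ` BM d) (%m. m)" for X Y d by (simp add: lin_on_def)
 show "corner A M X Y v = (if X = X' & Y = Y' then v else 0)"
  if "X \<in> Obj A" "Y \<in> Obj A" "X' \<in> Obj A" "Y' \<in> Obj A" "v \<in> corner A M X' Y' ` BM d" for X Y X' Y' v d
  using that(5) corner_corner[OF that(1-4)] by auto
 show "(\<Sum>X\<in>Obj A. \<Sum>Y\<in>Obj A. corner A M X Y m) = m" if "m \<in> BM d" for m d by (rule corner_sum[OF that, symmetric])
 show "RA v (um u) = (if Y = src u then RA v (um u) else 0)"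
  if "u \<in> arrows A" "X \<in> Obj A" "Y \<in> Obj A" "v \<in> corner A M X Y ` BM d" for u X Y v d
 proof -
  have v: "v \<in> BM d" using c[OF that(2-4)] by simp
  \<comment> \<open>\<open>e Y\<close> fixes \<open>v\<close> from the right; moved across by
    associativity it meets \<open>um u\<close>, and that product vanishes unless \<open>Y\<close> is
    the source of \<open>u\<close>.\<close>
  have "RA v (e Y) = v" using that(4) RA_e_corner[OF that(2,3)] by auto
  then have h: "RA v (um u) = RA v (LC (e Y) (um u))" using RA_RA[OF e_LM[OF that(3)] ends(3)[OF that(1)] v] by simp
  show ?thesis
  proof (cases "Y = src u")
   case False
   then have "LC (e Y) (um u) = 0" using e_um[OF that(3,1)] by simp
   then show ?thesis using False by (simp only: h RA_0[OF v] if_False)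
  qed simp
 qed
 show "LA (um u) v = (if tgt u = X then LA (um u) v else 0)"
  if "u \<in> arrows A" "X \<in> Obj A" "Y \<in> Obj A" "v \<in> corner A M X Y ` BM d" for u X Y v d
 proof -
  have v: "v \<in> BM d" using c[OF that(2-4)] by simp
  have "LA (e X) v = v" using that(4) LA_e_corner[OF that(2,3)] by auto
  then have h: "LA (um u) v = LA (LC (um u) (e X)) v" using LA_LA[OF ends(3)[OF that(1)] e_LM[OF that(2)] v] by simp
  show ?thesis
  proof (cases "tgt u = X")
   case False
   then have "LC (um u) (e X) = 0" using um_e[OF that(2,1)] by simp
   then show ?thesis using False by (simp only: h LA_0[OF v] if_False)
  qed simp
 qed
qed (simp_all add: LA_degree RA_degree LA_lin_left LA_lin_right RA_lin_left RA_lin_right corner_lin)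

text \<open>For the standard bimodule \<open>em\<close> turns a morphism into a matrix unit, as in
  \<open>cyc_incl\<close>, and \<open>cp\<close> reads off an entry.\<close>

lemma (in finite_superadditive_category) std_comparison:
 "chain_comparison A (std_bimod L) (std_bimod A) munit (%X Y f. f X Y)"
proof (intro chain_comparison.intro chain_comparison_axioms.intro finite_superadditive_category_axioms, unfold std_bimod_sel)
 show "vector_space (Scale L)" by (rule vector_space_L)
 show "vector_space (Scale A)" by (rule vector_space)
 show "Comp A (src u) (tgt u) Y (mor u) v \<in> Mor A (src u) Y (deg u + j)"
  if "u \<in> arrows A" "Y \<in> Obj A" "v \<in> Mor A (tgt u) Y j" for u Y v j
  using that by (auto simp: arrows_def intro!: Comp_degree)
 show "Comp A X (src u) (tgt u) v (mor u) \<in> Mor A X (tgt u) (i + deg u)"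
  if "u \<in> arrows A" "X \<in> Obj A" "v \<in> Mor A X (src u) i" for u X v i
  using that by (auto simp: arrows_def intro!: Comp_degree)
 show "Comp A X Y Y v (Idn A Y) = v" if "X \<in> Obj A" "Y \<in> Obj A" "v \<in> Mor A X Y d" for X Y v d
  using Idn_right[OF that(1,2) Mor_total[OF that]] .
 show "munit X Y v \<in> LM d" if "X \<in> Obj A" "Y \<in> Obj A" "v \<in> Mor A X Y d" for X Y v d by (rule munit_LM[OF that])
 show "f X Y \<in> Mor A X Y d" if "X \<in> Obj A" "Y \<in> Obj A" "f \<in> LM d" for X Y f d using that by (simp add: LM_iff2)
 show "lin_on (Scale L) (Scale A) (LM d) (%f. f X Y)" for X Y d by (simp add: lin_on_def Scale_L)
 show "munit X' Y' v X Y = (if X = X' & Y = Y' then v else 0)" for X Y X' Y' v by (simp add: munit_def)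
 show "(\<Sum>X\<in>Obj A. \<Sum>Y\<in>Obj A. munit X Y (m X Y)) = m" if "m \<in> LM d" for m d
  using munit_expansion[OF that] by (simp add: sum.cartesian_product case_prod_unfold)
 show "LC (munit X Y v) (um u) = (if Y = src u then munit X (tgt u) (Comp A X (src u) (tgt u) v (mor u)) else 0)"
  if "u \<in> arrows A" "X \<in> Obj A" "Y \<in> Obj A" "v \<in> Mor A X Y d" for u X Y v d
  using that LC_munit[of X Y "src u" "tgt u" v d "mor u" "deg u"] by (auto simp: arrows_def)
 show "LC (um u) (munit X Y v) = (if tgt u = X then munit (src u) Y (Comp A (src u) (tgt u) Y (mor u) v) else 0)"
  if "u \<in> arrows A" "X \<in> Obj A" "Y \<in> Obj A" "v \<in> Mor A X Y d" for u X Y v d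
  using that LC_munit[of "src u" "tgt u" X Y "mor u" "deg u" v d] by (auto simp: arrows_def)
qed (simp_all add: LM_subspace Mor_subspace LC_degree LC_lin_left LC_lin_right munit_lin)

theorem proposition3p13:
  fixes A :: "('k::field, 'o, 'a::ab_group_add) scat"
    and M :: "('k, unit, 'o \<Rightarrow> 'o \<Rightarrow> 'a, 'm::ab_group_add) sbimod"
  assumes "superadditive_category A"
    and "finite (Obj A)"
    and "graded_bimodule (superalgebra A) M"
  shows "(\<forall>n. induces_iso (HH_restr A M n) (HH_coh (superalgebra A) M n) (HH_coh A (cat_bimod A M) n)) \<and>
    (\<forall>n. induces_iso HH_incl (HH_hom A (cat_bimod A M) n) (HH_hom (superalgebra A) M n)) \<and>
    (\<forall>n. induces_iso HC_restr (HC_coh (superalgebra A) n) (HC_coh A n)) \<and>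
    (\<forall>n. induces_iso HC_incl (HC_hom A n) (HC_hom (superalgebra A) n))"
proof -
 have S: "finite_superadditive_category A"
  by (intro finite_superadditive_category.intro finite_superadditive_category_axioms.intro assms)
 have B: "superalgebra_bimodule A M" by (intro superalgebra_bimodule.intro S assms)
 note C = superalgebra_bimodule.cat_comparison[OF B]
 have Y: "cyclic_comparison A" by (rule cyclic_comparison.intro[OF finite_superadditive_category.std_comparison[OF S]])
 \<comment> \<open>\<open>HH_incl\<close> leaves the coefficient as it is, which is the case of
   \<open>em\<close> the identity.\<close>
 have "(chain_comparison.incl (%_ _ m. m) :: (('o, 'a, 'm) htuple \<Rightarrow>\<^sub>0 'k) => _) = HH_incl"
  unfolding chain_comparison.incl_def[OF C] HH_incl_def ..
 then show ?thesis
  using superalgebra_bimodule.HH_coh_iso[OF B] chain_comparison.HH_hom_iso[OF C]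
   cyclic_comparison.HC_coh_iso[OF Y] cyclic_comparison.HC_hom_iso[OF Y] by simp
qed

end
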